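(* Let $\Omega\subset\mathbb{R}^N$ be a bounded domain, let $2\le p<N$, and let $f\in L^m(\Omega)$ with $1<m<(p^* )'$. Suppose that $$0<\lambda<\frac{(m-1)N(N-mp)^{p-1}}{(p-1)^{p-1}m^{p}}.$$ Then the Dirichlet problem $$\begin{cases}-\operatorname{div}(|Du|^{p-2}Du)=\dfrac{\lambda}{|x|^p}|u|^{p-2}u+f & \text{in }\Omega,\\ u=0 & \text{on }\partial\Omega,\end{cases}$$ has a distributional solution $u\in W_0^{1,q}(\Omega)$, where $$q=\frac{pmN}{Np-m\,(N(p-2)+p)}.$$
   Context: $W_0^{1,q}(\Omega)$ is the closure of $C_0^\infty(\Omega)$ in the usual Sobolev space $W^{1,q}(\Omega)$. For $r>1$, $r'$ is the Hölder conjugate, $\frac1r+\frac1{r'}=1$; for $1\le r<N$, $r^*=\frac{rN}{N-r}$ is the Sobolev conjugate; thus $(p^* )'$ is the Hölder conjugate of $p^*=\frac{pN}{N-p}$. Standing assumption: $0<\lambda<\mathcal{H}^p$ with $\mathcal{H}=\frac{N-p}{p}$ (the Hardy constant). Distributional solution is meant in the usual sense: $|Du|^{p-1}$ and $\frac{|u|^{p-1}}{|x|^p}$ are integrable (at least locally) in $\Omega$, and for every $\varphi\in C_0^\infty(\Omega)$, $$\int_\Omega |Du|^{p-2}Du\cdot D\varphi=\int_\Omega\frac{\lambda}{|x|^p}|u|^{p-2}u\,\varphi+\int_\Omega f\varphi .$$ *)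

theory Defs
  imports "HOL-Analysis.Analysis"
begin

definition hoelder_conjugate :: "real \<Rightarrow> real" where
  "hoelder_conjugate r = r / (r - 1)"

lemma hoelder_conjugate: "r > 1 \<Longrightarrow> 1 / r + 1 / hoelder_conjugate r = 1"
  by (simp add: hoelder_conjugate_def field_simps)

definition sobolev_conjugate :: "real \<Rightarrow> real \<Rightarrow> real" where
  "sobolev_conjugate N r = r * N / (N - r)"

definition partial_deriv :: "'a::euclidean_space \<Rightarrow> ('a \<Rightarrow> real) \<Rightarrow> 'a \<Rightarrow> real" where
  "partial_deriv i g x = frechet_derivative g (at x) i"

definition grad :: "('a::euclidean_space \<Rightarrow> real) \<Rightarrow> 'a \<Rightarrow> 'a" where
  "grad g x = (\<Sum>i\<in>Basis. partial_deriv i g x *\<^sub>R i)"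

primrec C_k :: "nat \<Rightarrow> ('a::euclidean_space \<Rightarrow> real) \<Rightarrow> bool" where
  "C_k 0 g \<longleftrightarrow> continuous_on UNIV g"
| "C_k (Suc k) g \<longleftrightarrow> (\<forall>x. g differentiable (at x)) \<and> (\<forall>i\<in>Basis. C_k k (partial_deriv i g))"

(* C_0^infinity(Omega). A test function is a function on the whole space, i.e. it is
   identified with its extension by zero outside Omega. *)
definition test_functions :: "'a::euclidean_space set \<Rightarrow> ('a \<Rightarrow> real) set" where
  "test_functions \<Omega> =
     {\<phi>. (\<forall>k. C_k k \<phi>) \<and> compact (closure {x. \<phi> x \<noteq> 0}) \<and> closure {x. \<phi> x \<noteq> 0} \<subseteq> \<Omega>}"

(* Elements of Lebesgue and Sobolev spaces are represented by functions rather than by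
   classes modulo null sets; their values outside Omega are irrelevant. *)
definition Lp_space :: "real \<Rightarrow> 'a::euclidean_space set \<Rightarrow> ('a \<Rightarrow> 'b::euclidean_space) set" where
  "Lp_space r \<Omega> = {g. g \<in> borel_measurable (lebesgue_on \<Omega>) \<and>
                      integrable (lebesgue_on \<Omega>) (\<lambda>x. norm (g x) powr r)}"

definition locally_integrable ::
    "'a::euclidean_space set \<Rightarrow> ('a \<Rightarrow> 'b::euclidean_space) \<Rightarrow> bool" where
  "locally_integrable \<Omega> g \<longleftrightarrow> (\<forall>K. compact K \<and> K \<subseteq> \<Omega> \<longrightarrow> integrable (lebesgue_on K) g)"

(* A relation rather than a function, since Du is determined only up to null sets. *)
definition has_weak_gradient ::
    "'a::euclidean_space set \<Rightarrow> ('a \<Rightarrow> real) \<Rightarrow> ('a \<Rightarrow> 'a) \<Rightarrow> bool" where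
  "has_weak_gradient \<Omega> u Du \<longleftrightarrow>
     locally_integrable \<Omega> u \<and> locally_integrable \<Omega> Du \<and>
     (\<forall>\<phi>\<in>test_functions \<Omega>. \<forall>i\<in>Basis.
        (LINT x|lebesgue_on \<Omega>. u x * partial_deriv i \<phi> x) =
        - (LINT x|lebesgue_on \<Omega>. inner (Du x) i * \<phi> x))"

definition in_sobolev ::
    "real \<Rightarrow> 'a::euclidean_space set \<Rightarrow> ('a \<Rightarrow> real) \<Rightarrow> ('a \<Rightarrow> 'a) \<Rightarrow> bool" where
  "in_sobolev r \<Omega> u Du \<longleftrightarrow>
     u \<in> Lp_space r \<Omega> \<and> has_weak_gradient \<Omega> u Du \<and> Du \<in> Lp_space r \<Omega>"

(* The W^{1,r}(Omega) norm of u, where Du is a weak gradient of u. *)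
definition sobolev_norm ::
    "real \<Rightarrow> 'a::euclidean_space set \<Rightarrow> ('a \<Rightarrow> real) \<Rightarrow> ('a \<Rightarrow> 'a) \<Rightarrow> real" where
  "sobolev_norm r \<Omega> u Du =
     ((LINT x|lebesgue_on \<Omega>. \<bar>u x\<bar> powr r) + (LINT x|lebesgue_on \<Omega>. norm (Du x) powr r)) powr (1 / r)"

(* W_0^{1,r}(Omega): the closure of the test functions in W^{1,r}(Omega). The weak gradient of
   u - phi is Du - grad phi. *)
definition sobolev0_space :: "real \<Rightarrow> 'a::euclidean_space set \<Rightarrow> ('a \<Rightarrow> real) set" where
  "sobolev0_space r \<Omega> =
     {u. \<exists>Du. in_sobolev r \<Omega> u Du \<and>
           (\<forall>\<epsilon>>0. \<exists>\<phi>\<in>test_functions \<Omega>.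
              sobolev_norm r \<Omega> (\<lambda>x. u x - \<phi> x) (\<lambda>x. Du x - grad \<phi> x) < \<epsilon>)}"

(* Distributional solutions of  - div (|Du|^(p-2) Du) = lam / |x|^p |u|^(p-2) u + f  in Omega.
   For p = 2 the convention 0 powr 0 = 0 is harmless, as the power is always multiplied by Du or u
   itself; likewise the value of the potential at the single point x = 0 does not matter. *)
definition distributional_solution ::
    "'a::euclidean_space set \<Rightarrow> real \<Rightarrow> real \<Rightarrow> ('a \<Rightarrow> real) \<Rightarrow> ('a \<Rightarrow> real) \<Rightarrow> bool" where
  "distributional_solution \<Omega> p lam f u \<longleftrightarrow>
     (\<exists>Du. has_weak_gradient \<Omega> u Du \<and>
        locally_integrable \<Omega> (\<lambda>x. norm (Du x) powr (p - 1)) \<and>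
        locally_integrable \<Omega> (\<lambda>x. \<bar>u x\<bar> powr (p - 1) / norm x powr p) \<and>
        (\<forall>\<phi>\<in>test_functions \<Omega>.
           (LINT x|lebesgue_on \<Omega>. norm (Du x) powr (p - 2) * inner (Du x) (grad \<phi> x)) =
           (LINT x|lebesgue_on \<Omega>. lam / norm x powr p * \<bar>u x\<bar> powr (p - 2) * u x * \<phi> x) +
           (LINT x|lebesgue_on \<Omega>. f x * \<phi> x)))"

end

theory Submission
  imports Defs "HOL-Complex_Analysis.Great_Picard"
begin

text \<open>
  Truncate \<open>f\<close>, the potential and the nonlinearity at height \<open>n\<close>, and solve the truncated problems by
  minimising an energy. Put \<open>s = (p - 1) N (m - 1) / (N - m p)\<close> and \<open>\<beta> = (p - 1 + s) / p\<close>. Testing with a smooth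
  version of \<open>|u|\<^sup>s sgn u / s\<close> bounds \<open>|D (|u|\<^sup>\<beta>)|\<close> in \<open>L\<^sup>p\<close>: by Hardy's inequality the potential is absorbed
  exactly when \<open>\<lambda> < s ((N - p) / (p - 1 + s))\<^sup>p\<close>, which is the hypothesis on \<open>\<lambda>\<close>, and \<open>s\<close> is chosen such that the
  Sobolev inequality absorbs the term with \<open>f\<close>. Undoing the power bounds \<open>|u|\<^bsup>p - 1 + s\<^esup> / |x|\<^sup>p\<close> in \<open>L\<^sup>1\<close> and \<open>Du\<close>
  in \<open>L\<^sup>r\<close> for \<open>r = (p - 1) m N / (N - m)\<close>, where \<open>r > p - 1\<close> and, as \<open>p \<ge> 2\<close>, \<open>r \<ge> q\<close>. Testing
  the difference of two approximate equations with \<open>d arctan ((u\<^sub>i - u\<^sub>j) / d)\<close> makes the gradients Cauchy in \<open>L\<^sup>1\<close>,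
  so almost everywhere convergence and equi-integrability carry every term to the limit.
\<close>


subsection \<open>Smooth functions and test functions\<close>

text \<open>The range of m amounts to 0 < s < 1, so |u|^s is not differentiable at u = 0. The
  primitive of (1 + t^2)^a with -1/2 < a <= 0 replaces it: it is smooth with bounded derivative, so
  composition preserves test functions, and to leading order it grows like |t|^(1+2a) / (1+2a), with
  the exact constant. The errors are of lower order, and the strict bound on \<open>lam\<close>
  leaves room for them.

  The value of s solves s m' = \<beta> p^* with m' conjugate to m and p^* the Sobolev exponent. Thus
  Hoelder's inequality for f |u|^s meets the Sobolev norm of |u|^\<beta>, and the result is
  sublinear in the energy because m p < N.

  Two obstacles shape the rest. The lower order part of the truncated energy has the wrong sign for
  convexity, so the minimising sequence must be made to converge strongly. For p = 2 the exponents q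
  and r coincide, so a bound in L^r gives no equi-integrability in L^q; the limit is therefore
  placed in the Sobolev space through the functions k arctan(u / k), with k fixed first and sent to
  infinity afterwards.\<close>

lemma C_k_Suc_D: "C_k (Suc k) g \<Longrightarrow> C_k k g"
proof (induction k arbitrary: g)
  case 0
  then show ?case
    by (auto simp: continuous_on_eq_continuous_within intro!: differentiable_imp_continuous_within)
qed auto

lemma frechet_derivative_eqI:
  "(f has_derivative D) (at x) \<Longrightarrow> frechet_derivative f (at x) = D"
  using frechet_derivative_at by metis

lemma frechet_derivative_works': "f differentiable (at x) \<Longrightarrow> (f has_derivative frechet_derivative f (at x)) (at x)"
  using frechet_derivative_works by blast

lemma partial_deriv_add:
  assumes "f differentiable (at x)" "g differentiable (at x)"
  shows "partial_deriv i (\<lambda>x. f x + g x) x = partial_deriv i f x + partial_deriv i g x"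
  unfolding partial_deriv_def
  by (subst frechet_derivative_eqI[OF has_derivative_add[OF assms[THEN frechet_derivative_works']]]) simp

lemma partial_deriv_cmult:
  assumes "f differentiable (at x)"
  shows "partial_deriv i (\<lambda>x. c * f x) x = c * partial_deriv i f x"
  unfolding partial_deriv_def
  by (subst frechet_derivative_eqI[OF has_derivative_mult_right[OF assms[THEN frechet_derivative_works']]]) simp

lemma partial_deriv_mult:
  assumes "f differentiable (at x)" "g differentiable (at x)"
  shows "partial_deriv i (\<lambda>x. f x * g x) x = f x * partial_deriv i g x + partial_deriv i f x * g x"
  unfolding partial_deriv_def
  by (subst frechet_derivative_eqI[OF has_derivative_mult[OF assms[THEN frechet_derivative_works']]]) simp

lemma partial_deriv_compose:
  assumes "(P has_real_derivative d) (at (f x))" "f differentiable (at x)"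
  shows "partial_deriv i (\<lambda>x. P (f x)) x = d * partial_deriv i f x"
proof -
  have "((\<lambda>x. P (f x)) has_derivative (\<lambda>h. frechet_derivative f (at x) h * d)) (at x)"
    using has_derivative_compose[OF frechet_derivative_works'[OF assms(2)] assms(1)[unfolded has_field_derivative_def]]
    by (simp add: mult.commute)
  from frechet_derivative_eqI[OF this] show ?thesis
    unfolding partial_deriv_def by simp
qed

lemma C_k_add: "C_k k f \<Longrightarrow> C_k k g \<Longrightarrow> C_k k (\<lambda>x. f x + g x)"
proof (induction k arbitrary: f g)
  case (Suc k)
  have D: "partial_deriv i (\<lambda>x. f x + g x) = (\<lambda>x. partial_deriv i f x + partial_deriv i g x)" for i
    using Suc.prems by (intro ext partial_deriv_add) auto
  show ?case
    using Suc unfolding C_k.simps D by auto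
qed (auto intro: continuous_intros)

lemma C_k_cmult: "C_k k f \<Longrightarrow> C_k k (\<lambda>x. c * f x)"
proof (induction k arbitrary: f)
  case (Suc k)
  have D: "partial_deriv i (\<lambda>x. c * f x) = (\<lambda>x. c * partial_deriv i f x)" for i
    using Suc.prems by (intro ext partial_deriv_cmult) auto
  show ?case
    using Suc unfolding C_k.simps D by auto
qed (auto intro: continuous_intros)

lemma C_k_mult: "C_k k f \<Longrightarrow> C_k k g \<Longrightarrow> C_k k (\<lambda>x. f x * g x)"
proof (induction k arbitrary: f g)
  case (Suc k)
  note d = C_k_Suc_D[OF Suc.prems(1)] C_k_Suc_D[OF Suc.prems(2)]
  have D: "partial_deriv i (\<lambda>x. f x * g x) = (\<lambda>x. f x * partial_deriv i g x + partial_deriv i f x * g x)" for i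
    using Suc.prems by (intro ext partial_deriv_mult) auto
  have "C_k k (\<lambda>x. f x * partial_deriv i g x + partial_deriv i f x * g x)" if "i \<in> Basis" for i
    using Suc.prems d that by (intro C_k_add Suc.IH) auto
  then show ?case
    using Suc.prems unfolding C_k.simps D by (auto intro: differentiable_mult)
qed (auto intro: continuous_intros)

lemma real_derivative_iff_partial_deriv:
  fixes P :: "real \<Rightarrow> real"
  assumes "P differentiable (at t)"
  shows "(P has_real_derivative partial_deriv 1 P t) (at t)"
proof -
  obtain D where D: "(P has_real_derivative D) (at t)"
    using assms real_differentiable_def by blast
  then have "partial_deriv 1 P t = D"
    unfolding partial_deriv_def has_field_derivative_def by (simp add: frechet_derivative_eqI)
  with D show ?thesis by simp
qed

lemma partial_deriv_real_eq:
  fixes P :: "real \<Rightarrow> real"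
  assumes "(P has_real_derivative d) (at t)"
  shows "partial_deriv 1 P t = d"
  by (metis DERIV_unique assms real_derivative_iff_partial_deriv real_differentiable_def)

text \<open>By the chain rule each partial derivative is a composition with the derivative of P
  times a partial derivative of f. The induction therefore has to vary P together with f, and f is
  first lowered to order k by \<open>C_k_Suc_D\<close>.\<close>

lemma C_k_compose:
  fixes P :: "real \<Rightarrow> real"
  shows "C_k k P \<Longrightarrow> C_k k f \<Longrightarrow> C_k k (\<lambda>x. P (f x))"
proof (induction k arbitrary: P f)
  case 0
  then show ?case
    using continuous_on_compose2[of UNIV P UNIV f] by simp
next
  case (Suc k)
  have D: "partial_deriv i (\<lambda>x. P (f x)) = (\<lambda>x. partial_deriv 1 P (f x) * partial_deriv i f x)" for i
    using Suc.prems by (intro ext partial_deriv_compose[of P _ f] real_derivative_iff_partial_deriv) simp_all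
  have "C_k k (\<lambda>x. partial_deriv 1 P (f x))"
    by (rule Suc.IH[OF _ C_k_Suc_D[OF Suc.prems(2)]]) (use Suc.prems in simp)
  then have "C_k k (\<lambda>x. partial_deriv 1 P (f x) * partial_deriv i f x)" if "i \<in> Basis" for i
    by (rule C_k_mult) (use Suc.prems that in simp)
  moreover have "(\<lambda>x. P (f x)) differentiable at x" for x
    using Suc.prems by (intro differentiable_compose[of P f x UNIV]) simp_all
  ultimately show ?case
    unfolding C_k.simps D by simp
qed

lemma C_k_const [simp]: "C_k k (\<lambda>x. c)"
proof (induction k arbitrary: c)
  case (Suc k)
  have "partial_deriv i (\<lambda>x. c) = (\<lambda>x. 0)" for i :: 'a
    unfolding partial_deriv_def by (simp add: frechet_derivative_eqI[OF has_derivative_const])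
  then show ?case using Suc by simp
qed (auto intro: continuous_intros)

lemma C_k_realI:
  fixes P :: "real \<Rightarrow> real"
  assumes "\<And>t. (P has_real_derivative P' t) (at t)" "C_k k P'"
  shows "C_k (Suc k) P"
proof -
  have "partial_deriv 1 P = P'" by (rule ext) (rule partial_deriv_real_eq[OF assms(1)])
  then show ?thesis using assms by (auto simp: real_differentiable_def)
qed

lemma C_k_id [simp]: "C_k k (\<lambda>t::real. t)"
proof (cases k)
  case (Suc k)
  show ?thesis unfolding Suc by (rule C_k_realI[OF DERIV_ident C_k_const])
qed (auto intro: continuous_intros)

text \<open>Differentiation lowers the exponent by 1 and produces a factor t, so the family with all
  exponents a is closed up to factors that are already smooth. Hence the induction runs over all a
  at once.\<close>

lemma C_k_japanese: "C_k k (\<lambda>t::real. (1 + t\<^sup>2) powr a)"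
proof (induction k arbitrary: a)
  case 0
  have "1 + t\<^sup>2 \<noteq> 0" for t :: real
    using zero_le_power2[of t] by linarith
  then show ?case by (auto intro!: continuous_intros)
next
  case (Suc k)
  have pos: "1 + t\<^sup>2 > 0" for t :: real by (simp add: add_pos_nonneg)
  show ?case
  proof (rule C_k_realI)
    show "((\<lambda>t. (1 + t\<^sup>2) powr a) has_real_derivative 2 * a * (t * (1 + t\<^sup>2) powr (a - 1))) (at t)" for t
    proof -
      have "((\<lambda>t. 1 + t\<^sup>2) has_real_derivative 2 * t) (at t)"
        by (auto intro!: derivative_eq_intros)
      from DERIV_fun_powr[OF this pos, of a] show ?thesis by (simp add: mult_ac)
    qed
    show "C_k k (\<lambda>t. 2 * a * (t * (1 + t\<^sup>2) powr (a - 1)))"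
      by (intro C_k_cmult C_k_mult Suc.IH C_k_id)
  qed
qed

text \<open>A smooth substitute for the odd power \<open>|t|\<^bsup>2 a + 1\<^esup> sgn t / (2 a + 1)\<close> when \<open>a > - 1 / 2\<close>.\<close>

definition bracket_primitive :: "real \<Rightarrow> real \<Rightarrow> real" where
  "bracket_primitive a = (SOME P. (\<forall>t. (P has_real_derivative (1 + t\<^sup>2) powr a) (at t)) \<and> P 0 = 0)"

lemma continuous_antiderivative:
  fixes h :: "real \<Rightarrow> real"
  assumes "continuous_on UNIV h"
  obtains P where "\<And>t. (P has_real_derivative h t) (at t)" "P 0 = 0"
proof -
  have "isCont h x" for x
    using assms by (simp add: continuous_on_eq_continuous_at)
  then obtain F where F: "(F has_vector_derivative h x) (at x)" for x
    using einterval_antiderivative[of "-\<infinity>" "\<infinity>" h] by (simp add: less_ereal.simps) blast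
  show ?thesis
  proof
    show "((\<lambda>t. F t - F 0) has_real_derivative h t) (at t)" for t
      using DERIV_diff[OF F[of t, folded has_real_derivative_iff_has_vector_derivative] DERIV_const[of "F 0"]] by simp
  qed simp
qed

lemma bracket_primitive_props:
  "(\<forall>t. (bracket_primitive a has_real_derivative (1 + t\<^sup>2) powr a) (at t)) \<and> bracket_primitive a 0 = 0"
  unfolding bracket_primitive_def
proof (rule someI_ex[where P = "\<lambda>P. (\<forall>t. (P has_real_derivative (1 + t\<^sup>2) powr a) (at t)) \<and> P 0 = 0"])
  show "\<exists>P. (\<forall>t. (P has_real_derivative (1 + t\<^sup>2) powr a) (at t)) \<and> P 0 = 0"
    by (rule continuous_antiderivative[OF C_k_japanese[of 0 a, unfolded C_k.simps]]) blast
qed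

lemma bracket_primitive_deriv: "(bracket_primitive a has_real_derivative (1 + t\<^sup>2) powr a) (at t)"
  and bracket_primitive_0 [simp]: "bracket_primitive a 0 = 0"
  using bracket_primitive_props[of a] by simp_all

lemma C_k_bracket_primitive: "C_k k (bracket_primitive a)"
  by (rule C_k_Suc_D, rule C_k_realI[OF bracket_primitive_deriv C_k_japanese])

text \<open>The derivative of \<open>arctan\<close> is the member a = -1 of the family in
  \<open>C_k_japanese\<close>.\<close>

lemma C_k_arctan: "C_k k arctan"
proof (rule C_k_Suc_D, rule C_k_realI)
  show "(arctan has_real_derivative (1 + t\<^sup>2) powr (-1)) (at t)" for t
  proof -
    have "1 + t\<^sup>2 > 0" by (simp add: add_pos_nonneg)
    then show ?thesis using DERIV_arctan[of t] by (simp add: powr_minus)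
  qed
qed (rule C_k_japanese)

text \<open>Weaker than membership in \<open>test_functions\<close>, because Hardy's inequality
  needs functions built from |\<phi>|^p, which are in general only once differentiable. The gradient
  is an explicit argument, so that it can be given by a formula.\<close>

definition C1_compact :: "('a::euclidean_space \<Rightarrow> real) \<Rightarrow> ('a \<Rightarrow> 'a) \<Rightarrow> bool" where
  "C1_compact \<phi> G \<longleftrightarrow> (\<forall>x. (\<phi> has_derivative (\<lambda>v. G x \<bullet> v)) (at x)) \<and> continuous_on UNIV G \<and>
     (\<exists>R. \<forall>x. norm x > R \<longrightarrow> \<phi> x = 0)"

lemma frechet_derivative_eq_grad:
  assumes "f differentiable (at x)"
  shows "frechet_derivative f (at x) v = grad f x \<bullet> v"
proof -
  have bl: "linear (frechet_derivative f (at x))"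
    using assms frechet_derivative_works' has_derivative_linear by blast
  have "frechet_derivative f (at x) v = frechet_derivative f (at x) (\<Sum>i\<in>Basis. (v \<bullet> i) *\<^sub>R i)"
    by (simp add: euclidean_representation)
  also have "\<dots> = (\<Sum>i\<in>Basis. (v \<bullet> i) * partial_deriv i f x)"
    unfolding partial_deriv_def by (simp add: linear_sum[OF bl] linear_scale[OF bl])
  also have "\<dots> = grad f x \<bullet> v"
    unfolding grad_def inner_sum_left by (intro sum.cong) (auto simp: inner_commute)
  finally show ?thesis .
qed

lemma has_derivative_grad:
  assumes "f differentiable (at x)"
  shows "(f has_derivative (\<lambda>v. grad f x \<bullet> v)) (at x)"
proof -
  have "frechet_derivative f (at x) = (\<lambda>v. grad f x \<bullet> v)"
    by (rule ext) (rule frechet_derivative_eq_grad[OF assms])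
  with frechet_derivative_works'[OF assms] show ?thesis by simp
qed

lemma has_derivative_inner_unique:
  assumes "(f has_derivative (\<lambda>v. a \<bullet> v)) (at x)" "(f has_derivative (\<lambda>v. b \<bullet> v)) (at x)"
  shows "a = b"
  using has_derivative_unique[OF assms] by (simp add: fun_eq_iff vector_eq_rdot)

lemma grad_eqI: "(f has_derivative (\<lambda>v. a \<bullet> v)) (at x) \<Longrightarrow> grad f x = a"
  by (rule has_derivative_inner_unique[OF has_derivative_grad[OF differentiableI]])

lemma partial_deriv_eq_grad_inner: "f differentiable (at x) \<Longrightarrow> partial_deriv i f x = grad f x \<bullet> i"
  unfolding partial_deriv_def by (rule frechet_derivative_eq_grad)

lemma test_functionsD:
  assumes "\<phi> \<in> test_functions \<Omega>"
  shows test_functions_C_k: "C_k k \<phi>"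
    and test_functions_differentiable: "\<phi> differentiable (at x)"
    and test_functions_compact: "compact (closure {x. \<phi> x \<noteq> 0})" "closure {x. \<phi> x \<noteq> 0} \<subseteq> \<Omega>"
proof -
  show C: "C_k k \<phi>" for k using assms by (simp add: test_functions_def)
  show "\<phi> differentiable (at x)" using C[of "Suc 0"] by simp
qed (use assms in \<open>simp_all add: test_functions_def\<close>)

lemma test_functions_eq_0:
  assumes "\<phi> \<in> test_functions \<Omega>" "x \<notin> \<Omega>"
  shows "\<phi> x = 0"
  using test_functions_compact(2)[OF assms(1)] assms(2) closure_subset[of "{x. \<phi> x \<noteq> 0}"] by auto

lemma continuous_on_partial_deriv_test:
  assumes "\<phi> \<in> test_functions \<Omega>" "i \<in> Basis"
  shows "continuous_on UNIV (partial_deriv i \<phi>)"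
  using test_functions_C_k[OF assms(1), of "Suc 0"] assms(2) by simp

lemma C1_compact_test:
  assumes "\<phi> \<in> test_functions \<Omega>"
  shows "C1_compact \<phi> (grad \<phi>)"
  unfolding C1_compact_def
proof (intro conjI allI)
  show "(\<phi> has_derivative (\<lambda>v. grad \<phi> x \<bullet> v)) (at x)" for x
    by (rule has_derivative_grad[OF test_functions_differentiable[OF assms]])
  show "continuous_on UNIV (grad \<phi>)"
    unfolding grad_def[abs_def]
    by (intro continuous_on_sum continuous_on_scaleR continuous_on_const continuous_on_partial_deriv_test[OF assms])
  obtain R where "\<forall>x\<in>closure {x. \<phi> x \<noteq> 0}. norm x \<le> R"
    using compact_imp_bounded[OF test_functions_compact(1)[OF assms]] bounded_iff by blast
  then show "\<exists>R. \<forall>x. norm x > R \<longrightarrow> \<phi> x = 0"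
    using closure_subset[of "{x. \<phi> x \<noteq> 0}"] by (intro exI[of _ R]) (auto simp: subset_iff not_le[symmetric])
qed

lemma C1_compactD:
  assumes "C1_compact \<phi> G"
  shows C1_compact_deriv: "(\<phi> has_derivative (\<lambda>v. G x \<bullet> v)) (at x)"
    and C1_compact_cont_grad: "continuous_on UNIV G"
    and C1_compact_cont: "continuous_on UNIV \<phi>"
proof -
  show d: "(\<phi> has_derivative (\<lambda>v. G x \<bullet> v)) (at x)" for x
    using assms unfolding C1_compact_def by blast
  show "continuous_on UNIV G"
    using assms unfolding C1_compact_def by blast
  show "continuous_on UNIV \<phi>"
    using has_derivative_continuous[OF d] by (simp add: continuous_on_eq_continuous_at)
qed

text \<open>Outside a large ball \<phi> agrees with 0 on an open set, so uniqueness of derivatives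
  forces the gradient to vanish there as well.\<close>

lemma C1_compact_vanishing:
  assumes "C1_compact \<phi> G"
  obtains R where "R > 0" "\<And>x. norm x > R \<Longrightarrow> \<phi> x = 0 \<and> G x = 0"
proof -
  obtain R where R: "\<And>x. norm x > R \<Longrightarrow> \<phi> x = 0" using assms C1_compact_def by blast
  have "G x = 0" if "norm x > R" for x
  proof -
    have "open {y::'a. norm y > R}" by (intro open_Collect_less continuous_intros)
    moreover have d0: "((\<lambda>_. 0) has_derivative (\<lambda>v. 0 \<bullet> v)) (at x)" by simp
    ultimately have "(\<phi> has_derivative (\<lambda>v. 0 \<bullet> v)) (at x)"
      using has_derivative_transform_within_open[OF d0, of "{y. norm y > R}" \<phi>] that R by simp
    then show ?thesis
      using has_derivative_inner_unique[OF C1_compact_deriv[OF assms]] by blast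
  qed
  with R show ?thesis by (intro that[of "max R 1"]) auto
qed

lemma emeasure_lborel_cball_less_top: "emeasure lborel (cball c r :: 'a::euclidean_space set) < top"
  using emeasure_lborel_cball_finite[of c r] by simp

lemma continuous_bounded_support:
  fixes g :: "'a::euclidean_space \<Rightarrow> 'b::euclidean_space"
  assumes "continuous_on UNIV g" "\<And>x. norm x > R \<Longrightarrow> g x = 0"
  shows "integrable lborel g" and "\<exists>B>0. \<forall>x. norm (g x) \<le> B"
proof -
  have "compact (g ` cball 0 R)"
    by (intro compact_continuous_image continuous_on_subset[OF assms(1)]) auto
  then obtain B where B: "\<forall>y\<in>g ` cball 0 R. norm y \<le> B"
    using compact_imp_bounded bounded_iff by blast
  have B': "norm (g x) \<le> max B 1" for x
    using B assms(2)[of x] by (cases "norm x \<le> R") (auto intro: order_trans[OF _ max.cobounded1])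
  then show "\<exists>B>0. \<forall>x. norm (g x) \<le> B" by (intro exI[of _ "max B 1"]) auto
  have m: "g \<in> borel_measurable lborel"
    using assms(1) borel_measurable_continuous_onI by simp
  show "integrable lborel g"
  proof (rule Bochner_Integration.integrable_bound)
    show "integrable lborel (\<lambda>x. max B 1 * indicator (cball 0 R) x)"
      by (intro integrable_mult_right integrable_real_indicator) (auto simp: emeasure_lborel_cball_less_top)
    show "AE x in lborel. norm (g x) \<le> norm (max B 1 * indicator (cball 0 R) x)"
      using B' assms(2) by (auto simp: indicator_def not_le)
  qed (rule m)
qed

text \<open>The divergence theorem for compact support. By translation invariance of Lebesgue
  measure every difference quotient in direction b has integral 0. The quotients are bounded by the
  Lipschitz constant times \<open>norm b\<close> on a ball enlarged by \<open>norm b\<close>, the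
  steps being at most 1, so dominated convergence applies.\<close>

lemma integral_C1_compact_grad_eq_0:
  assumes "C1_compact \<phi> G"
  shows "integrable lborel (\<lambda>x. G x \<bullet> b)" "(LINT x|lborel. G x \<bullet> b) = 0"
proof -
  obtain R where R: "R > 0" "\<And>x. norm x > R \<Longrightarrow> \<phi> x = 0 \<and> G x = 0"
    using C1_compact_vanishing[OF assms] by blast
  note cG = C1_compact_cont_grad[OF assms] and c\<phi> = C1_compact_cont[OF assms]
  show "integrable lborel (\<lambda>x. G x \<bullet> b)"
    by (rule continuous_bounded_support(1)[where R=R]) (use R cG in \<open>auto intro!: continuous_intros\<close>)
  have i\<phi>: "integrable lborel \<phi>"
    by (rule continuous_bounded_support(1)[where R=R]) (use R c\<phi> in auto)
  obtain B where B: "B > 0" "\<And>x. norm (G x) \<le> B"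
    using continuous_bounded_support(2)[OF cG, of R] R by auto
  define h where "h n = 1 / real (Suc n)" for n
  have h: "0 < h n" "h n \<le> 1" for n by (auto simp: h_def)
  have h0: "h \<longlonglongrightarrow> 0" unfolding h_def by (rule LIMSEQ_Suc[OF lim_1_over_n])
  define D where "D n x = (\<phi> (x + h n *\<^sub>R b) - \<phi> x) / h n" for n x
  have lip: "norm (\<phi> x - \<phi> y) \<le> B * norm (x - y)" for x y
  proof (rule differentiable_bound[of UNIV \<phi> "\<lambda>x v. G x \<bullet> v"])
    show "onorm (\<lambda>v. G x \<bullet> v) \<le> B" for x
    proof (rule onorm_le)
      show "norm (G x \<bullet> v) \<le> B * norm v" for v
        using Cauchy_Schwarz_ineq2[of "G x" v] mult_right_mono[OF B(2)[of x] norm_ge_zero[of v]] by simp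
    qed
  qed (use C1_compact_deriv[OF assms] in auto)
  have i\<phi>': "integrable lborel (\<lambda>x. \<phi> (x + h n *\<^sub>R b))" and
    e: "(LINT x|lborel. \<phi> (x + h n *\<^sub>R b)) = (LINT x|lborel. \<phi> x)" for n
  proof -
    have L: "(lborel::'a measure) = distr lborel borel ((+) (h n *\<^sub>R b))" by (rule lborel_distr_plus[symmetric])
    have m: "\<phi> \<in> borel_measurable borel" using c\<phi> borel_measurable_continuous_onI by blast
    show "integrable lborel (\<lambda>x. \<phi> (x + h n *\<^sub>R b))"
      using i\<phi> integrable_distr_eq[of "(+) (h n *\<^sub>R b)" lborel borel \<phi>] m
      by (subst (asm) L) (simp add: add.commute)
    show "(LINT x|lborel. \<phi> (x + h n *\<^sub>R b)) = (LINT x|lborel. \<phi> x)"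
      using integral_distr[of "(+) (h n *\<^sub>R b)" lborel borel \<phi>] m
      by (subst (2) L) (simp add: add.commute)
  qed
  have D0: "(LINT x|lborel. D n x) = 0" for n
    unfolding D_def using i\<phi> i\<phi>' e by simp
  have "(\<lambda>n. LINT x|lborel. D n x) \<longlonglongrightarrow> (LINT x|lborel. G x \<bullet> b)"
  proof (rule integral_dominated_convergence)
    show "integrable lborel (\<lambda>x. B * norm b * indicator (cball 0 (R + norm b)) x)"
      by (intro integrable_mult_right integrable_real_indicator) (auto simp: emeasure_lborel_cball_less_top)
    have "(\<lambda>n. D n x) \<longlonglongrightarrow> G x \<bullet> b" for x
    proof -
      have "((\<lambda>t. x + t *\<^sub>R b) has_derivative (\<lambda>t. t *\<^sub>R b)) (at 0)"
        by (auto intro!: derivative_eq_intros)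
      moreover have "(\<phi> has_derivative (\<lambda>v. G x \<bullet> v)) (at (x + 0 *\<^sub>R b))"
        using C1_compact_deriv[OF assms, of x] by simp
      ultimately have "((\<lambda>t. \<phi> (x + t *\<^sub>R b)) has_derivative (\<lambda>t. G x \<bullet> (t *\<^sub>R b))) (at 0)"
        by (rule has_derivative_compose)
      moreover have "(\<lambda>t. G x \<bullet> (t *\<^sub>R b)) = (*) (G x \<bullet> b)" by auto
      ultimately have "DERIV (\<lambda>t. \<phi> (x + t *\<^sub>R b)) 0 :> G x \<bullet> b"
        by (simp add: has_field_derivative_def)
      then have "((\<lambda>t. (\<phi> (x + (0 + t) *\<^sub>R b) - \<phi> (x + 0 *\<^sub>R b)) / t) \<longlongrightarrow> G x \<bullet> b) (at 0)"
        unfolding DERIV_def by simp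
      moreover have "filterlim h (at 0) sequentially"
        unfolding filterlim_at using h0 h(1) by (simp add: less_imp_neq[symmetric])
      ultimately have "(\<lambda>n. (\<phi> (x + (0 + h n) *\<^sub>R b) - \<phi> (x + 0 *\<^sub>R b)) / h n) \<longlonglongrightarrow> G x \<bullet> b"
        by (rule filterlim_compose)
      then show ?thesis unfolding D_def by simp
    qed
    then show "AE x in lborel. (\<lambda>n. D n x) \<longlonglongrightarrow> G x \<bullet> b" by simp
    have "norm (D n x) \<le> B * norm b * indicator (cball 0 (R + norm b)) x" for n x
    proof (cases "norm x \<le> R + norm b")
      case True
      have "norm (D n x) = norm (\<phi> (x + h n *\<^sub>R b) - \<phi> x) / h n" using h[of n] by (simp add: D_def)
      also have "\<dots> \<le> B * norm (h n *\<^sub>R b) / h n"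
        using lip[of "x + h n *\<^sub>R b" x] h[of n] by (intro divide_right_mono) auto
      also have "\<dots> = B * norm b" using h[of n] by simp
      finally show ?thesis using True by simp
    next
      case False
      have "norm (h n *\<^sub>R b) \<le> norm b" using h[of n] by (simp add: mult_left_le_one_le)
      then have "norm (x + h n *\<^sub>R b) > R"
        using False norm_triangle_ineq4[of "x + h n *\<^sub>R b" "h n *\<^sub>R b"] by simp
      moreover have "norm x > R" using False by (smt (verit) norm_ge_zero)
      ultimately have "D n x = 0" using R(2) by (simp add: D_def)
      then show ?thesis using False by simp
    qed
    then show "AE x in lborel. norm (D n x) \<le> B * norm b * indicator (cball 0 (R + norm b)) x" for n by simp
    show "D n \<in> borel_measurable lborel" for n
      unfolding D_def[abs_def] using i\<phi> i\<phi>' by (auto intro!: borel_measurable_divide borel_measurable_diff)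
    show "(\<lambda>x. G x \<bullet> b) \<in> borel_measurable lborel"
      using \<open>integrable lborel (\<lambda>x. G x \<bullet> b)\<close> by simp
  qed
  then show "(LINT x|lborel. G x \<bullet> b) = 0"
    unfolding D0 by (rule LIMSEQ_unique[OF _ tendsto_const])
qed

subsection \<open>Hardy's inequality\<close>

text \<open>Written so that equality holds at x = y: this is the tangent inequality y^p >= x^p + p
  x^(p-1) (y - x) of a convex function. It serves Hardy's inequality with its sharp constant and
  also the convexity statements further on.\<close>

lemma Young_powr:
  assumes "x \<ge> 0" "y \<ge> 0" "(p::real) > 1"
  shows "p * x powr (p - 1) * y \<le> (p - 1) * x powr p + y powr p"
proof -
  have "x powr (p - 1) * y \<le> (x powr (p - 1)) powr (p / (p - 1)) / (p / (p - 1)) + y powr p / p"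
    by (rule Youngs_inequality) (use assms in \<open>auto simp: field_simps\<close>)
  also have "(x powr (p - 1)) powr (p / (p - 1)) = x powr p"
    using assms by (simp add: powr_powr)
  finally have "p * (x powr (p - 1) * y) \<le> p * (x powr p / (p / (p - 1)) + y powr p / p)"
    using assms by (intro mult_left_mono) auto
  also have "\<dots> = (p - 1) * x powr p + y powr p"
    using assms by (simp add: field_simps)
  finally show ?thesis by (simp add: mult.assoc)
qed

lemma has_real_derivative_abs_powr:
  assumes "(p::real) > 1"
  shows "((\<lambda>t. \<bar>t\<bar> powr p) has_real_derivative p * \<bar>t\<bar> powr (p - 1) * sgn t) (at t)"
proof -
  consider "t > 0" | "t < 0" | "t = 0" by linarith
  then show ?thesis
  proof cases
    case 1
    have "((\<lambda>t. t powr p) has_real_derivative p * t powr (p - 1)) (at t)"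
      using 1 by (rule has_real_derivative_powr)
    then have "((\<lambda>t. \<bar>t\<bar> powr p) has_real_derivative p * t powr (p - 1)) (at t)"
      by (rule has_field_derivative_transform_within_open[where S="{0<..}"]) (use 1 in auto)
    then show ?thesis using 1 by simp
  next
    case 2
    have "((\<lambda>t. (-t) powr p) has_real_derivative p * (-t) powr (p - 1) * (-1)) (at t)"
      using DERIV_fun_powr[of uminus "-1" t p] 2 by (auto intro!: derivative_eq_intros)
    then have "((\<lambda>t. \<bar>t\<bar> powr p) has_real_derivative p * (-t) powr (p - 1) * (-1)) (at t)"
      by (rule has_field_derivative_transform_within_open[where S="{..<0}"]) (use 2 in auto)
    then show ?thesis using 2 by simp
  next
    case 3
    have "((\<lambda>h::real. \<bar>h\<bar> powr (p - 1)) \<longlongrightarrow> \<bar>0\<bar> powr (p - 1)) (at 0)"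
      using assms by (intro tendsto_powr' tendsto_intros) auto
    then have "((\<lambda>h::real. \<bar>h\<bar> powr (p - 1)) \<longlongrightarrow> 0) (at 0)" using assms by simp
    then have "((\<lambda>h::real. \<bar>h\<bar> powr p / h) \<longlongrightarrow> 0) (at 0)"
    proof (rule tendsto_0_le[where K=1])
      have "norm (\<bar>h\<bar> powr p / h) \<le> norm (\<bar>h\<bar> powr (p - 1)) * 1" for h :: real
        by (cases "h = 0") (auto simp: powr_diff)
      then show "\<forall>\<^sub>F h::real in at 0. norm (\<bar>h\<bar> powr p / h) \<le> norm (\<bar>h\<bar> powr (p - 1)) * 1" by simp
    qed
    then show ?thesis unfolding 3 DERIV_def by simp
  qed
qed

lemma continuous_on_abs_powr [continuous_intros]:
  fixes g :: "'a::topological_space \<Rightarrow> real"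
  shows "continuous_on S g \<Longrightarrow> a > 0 \<Longrightarrow> continuous_on S (\<lambda>x. \<bar>g x\<bar> powr a)"
  by (intro continuous_on_powr' continuous_intros) auto

text \<open>The odd power is the difference of the powers of the positive and the negative part, and
  this form is continuous without a case distinction at 0.\<close>

lemma continuous_on_sgn_powr:
  assumes "a > 0"
  shows "continuous_on S (\<lambda>t::real. \<bar>t\<bar> powr a * sgn t)"
proof -
  have e: "(\<lambda>t::real. \<bar>t\<bar> powr a * sgn t) = (\<lambda>t. max t 0 powr a - max (-t) 0 powr a)"
    using assms by (auto simp: fun_eq_iff max_def sgn_if)
  have c: "continuous_on S (\<lambda>t::real. max t 0 powr a - max (-t) 0 powr a)"
    by (intro continuous_on_diff continuous_on_powr' continuous_on_max continuous_on_id continuous_on_const continuous_on_minus)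
      (use assms in auto)
  show ?thesis unfolding e by (rule c)
qed

text \<open>The functions are the components in direction b of the field |\<phi>|^p x / (|x|^2 +
  e)^(p/2). The parameter e > 0 removes the singularity at the origin, and p > 1 makes |\<phi>|^p
  differentiable at the zeros of \<phi>.\<close>

lemma hardy_field:
  fixes \<phi> :: "'a::euclidean_space \<Rightarrow> real"
  assumes \<phi>: "C1_compact \<phi> G" and p: "p > 1" and e: "e > 0"
  defines "w \<equiv> \<lambda>a x::'a. (x \<bullet> x + e) powr (- a / 2)"
  shows "C1_compact (\<lambda>x. \<bar>\<phi> x\<bar> powr p * (x \<bullet> b) * w p x)
    (\<lambda>x. ((x \<bullet> b) * w p x * p * (\<bar>\<phi> x\<bar> powr (p - 1) * sgn (\<phi> x))) *\<^sub>R G x + (\<bar>\<phi> x\<bar> powr p * w p x) *\<^sub>R b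
       - (p * \<bar>\<phi> x\<bar> powr p * (x \<bullet> b) * w (p + 2) x) *\<^sub>R x)"
  unfolding C1_compact_def
proof (intro conjI allI)
  fix x :: 'a
  have pos: "x \<bullet> x + e > 0" for x :: 'a using e by (simp add: add_nonneg_pos)
  have 1: "((\<lambda>x. \<bar>\<phi> x\<bar> powr p) has_derivative (\<lambda>v. (p * \<bar>\<phi> x\<bar> powr (p - 1) * sgn (\<phi> x)) * (G x \<bullet> v))) (at x)"
    using has_derivative_compose[OF C1_compact_deriv[OF \<phi>, of x] has_real_derivative_abs_powr[OF p, unfolded has_field_derivative_def]] .
  have "((\<lambda>x. x \<bullet> x + e) has_derivative (\<lambda>v. 2 * (x \<bullet> v))) (at x)"
    by (auto intro!: derivative_eq_intros simp: inner_commute)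
  moreover have "((\<lambda>t. t powr (- p / 2)) has_real_derivative (- p / 2) * (x \<bullet> x + e) powr (- p / 2 - 1)) (at (x \<bullet> x + e))"
    using pos by (rule has_real_derivative_powr)
  ultimately have 2: "(w p has_derivative (\<lambda>v. (- p / 2) * (x \<bullet> x + e) powr (- p / 2 - 1) * (2 * (x \<bullet> v)))) (at x)"
    unfolding w_def has_field_derivative_def by (rule has_derivative_compose)
  have w2: "(x \<bullet> x + e) powr (- p / 2 - 1) = w (p + 2) x"
    unfolding w_def by (intro arg_cong2[of _ _ _ _ "(powr)"]) (auto simp: field_simps)
  note 2 = 2[unfolded w2]
  have 3: "((\<lambda>x. x \<bullet> b) has_derivative (\<lambda>v. v \<bullet> b)) (at x)" by (auto intro!: derivative_eq_intros)
  show "((\<lambda>x. \<bar>\<phi> x\<bar> powr p * (x \<bullet> b) * w p x) has_derivative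
         (\<lambda>v. (((x \<bullet> b) * w p x * p * (\<bar>\<phi> x\<bar> powr (p - 1) * sgn (\<phi> x))) *\<^sub>R G x + (\<bar>\<phi> x\<bar> powr p * w p x) *\<^sub>R b
       - (p * \<bar>\<phi> x\<bar> powr p * (x \<bullet> b) * w (p + 2) x) *\<^sub>R x) \<bullet> v)) (at x)"
    by (rule has_derivative_eq_rhs[OF has_derivative_mult[OF has_derivative_mult[OF 1 3] 2]])
      (simp add: fun_eq_iff inner_add_left inner_diff_left inner_commute[of _ b] algebra_simps)
next
  have pos: "x \<bullet> x + e \<noteq> 0" for x :: 'a using e by (metis add_nonneg_pos inner_ge_zero less_irrefl)
  have cw: "continuous_on UNIV (w a)" for a
    unfolding w_def using pos by (auto intro!: continuous_intros)
  note c = C1_compact_cont[OF \<phi>] C1_compact_cont_grad[OF \<phi>]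
  have s: "continuous_on UNIV (\<lambda>x. \<bar>\<phi> x\<bar> powr (p - 1) * sgn (\<phi> x))"
    using continuous_on_compose2[OF continuous_on_sgn_powr[of "p - 1" UNIV] c(1)] p by simp
  show "continuous_on UNIV (\<lambda>x. ((x \<bullet> b) * w p x * p * (\<bar>\<phi> x\<bar> powr (p - 1) * sgn (\<phi> x))) *\<^sub>R G x + (\<bar>\<phi> x\<bar> powr p * w p x) *\<^sub>R b
       - (p * \<bar>\<phi> x\<bar> powr p * (x \<bullet> b) * w (p + 2) x) *\<^sub>R x)"
    using p by (intro continuous_intros cw c s) auto
  obtain R where R: "\<And>x. norm x > R \<Longrightarrow> \<phi> x = 0" using \<phi> C1_compact_def by blast
  show "\<exists>R. \<forall>x. norm x > R \<longrightarrow> \<bar>\<phi> x\<bar> powr p * (x \<bullet> b) * w p x = 0"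
    by (rule exI[of _ R]) (simp add: R)
qed

text \<open>The divergence of the field in \<open>hardy_field\<close> has integral 0. Put s = (|x|^2
  + e)^(-1/2). Since s |x| <= 1, the divergence is at least (N - p) (|\<phi>| s)^p - p (|\<phi>|
  s)^(p-1) |G|, exactly as without regularisation, and Young's inequality removes the mixed
  term.\<close>

lemma hardy_regularized:
  fixes \<phi> :: "'a::euclidean_space \<Rightarrow> real" and p :: real
  assumes \<phi>: "C1_compact \<phi> G" and p: "1 < p" "p < DIM('a)" and e: "e > 0"
  defines "H \<equiv> (DIM('a) - p) / p"
  shows "ennreal (H powr p) * (\<integral>\<^sup>+x. ennreal (\<bar>\<phi> x\<bar> powr p * (x \<bullet> x + e) powr (- p / 2)) \<partial>lborel)
      \<le> (\<integral>\<^sup>+x. ennreal (norm (G x) powr p) \<partial>lborel)"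
proof -
  define w where "w a x = (x \<bullet> x + e) powr (- a / 2)" for a and x :: 'a
  have H: "H > 0" using p by (simp add: H_def)
  have pos: "x \<bullet> x + e > 0" for x :: 'a using e by (simp add: add_nonneg_pos)
  obtain R where R: "R > 0" "\<And>x. norm x > R \<Longrightarrow> \<phi> x = 0 \<and> G x = 0"
    using C1_compact_vanishing[OF \<phi>] by blast
  note c = C1_compact_cont[OF \<phi>] C1_compact_cont_grad[OF \<phi>]
  define F where "F b x = ((x \<bullet> b) * w p x * p * (\<bar>\<phi> x\<bar> powr (p - 1) * sgn (\<phi> x))) *\<^sub>R G x + (\<bar>\<phi> x\<bar> powr p * w p x) *\<^sub>R b
       - (p * \<bar>\<phi> x\<bar> powr p * (x \<bullet> b) * w (p + 2) x) *\<^sub>R x" for b x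
  have C: "C1_compact (\<lambda>x. \<bar>\<phi> x\<bar> powr p * (x \<bullet> b) * w p x) (F b)" for b
    using hardy_field[OF \<phi> p(1) e, of b] unfolding F_def w_def .
  have I: "(LINT x|lborel. (\<Sum>b\<in>Basis. F b x \<bullet> b)) = 0"
    using integral_C1_compact_grad_eq_0[OF C] by (subst Bochner_Integration.integral_sum) auto
  have Ii: "integrable lborel (\<lambda>x. (\<Sum>b\<in>Basis. F b x \<bullet> b))"
    using integral_C1_compact_grad_eq_0[OF C] by auto
  have S: "(\<Sum>b\<in>Basis. F b x \<bullet> b) = p * (\<bar>\<phi> x\<bar> powr (p - 1) * sgn (\<phi> x)) * w p x * (x \<bullet> G x)
      + \<bar>\<phi> x\<bar> powr p * w p x * DIM('a) - p * \<bar>\<phi> x\<bar> powr p * w (p + 2) x * (x \<bullet> x)" for x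
  proof -
    have "(\<Sum>b\<in>Basis. F b x \<bullet> b) = (\<Sum>b\<in>Basis. p * (\<bar>\<phi> x\<bar> powr (p - 1) * sgn (\<phi> x)) * w p x * ((x \<bullet> b) * (G x \<bullet> b))
      + \<bar>\<phi> x\<bar> powr p * w p x - p * \<bar>\<phi> x\<bar> powr p * w (p + 2) x * ((x \<bullet> b) * (x \<bullet> b)))"
      unfolding F_def by (intro sum.cong) (auto simp: inner_add_left inner_diff_left inner_Basis algebra_simps)
    also have "\<dots> = p * (\<bar>\<phi> x\<bar> powr (p - 1) * sgn (\<phi> x)) * w p x * (\<Sum>b\<in>Basis. (x \<bullet> b) * (G x \<bullet> b))
      + \<bar>\<phi> x\<bar> powr p * w p x * DIM('a) - p * \<bar>\<phi> x\<bar> powr p * w (p + 2) x * (\<Sum>b\<in>Basis. (x \<bullet> b) * (x \<bullet> b))"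
      by (simp add: sum.distrib sum_subtractf flip: sum_distrib_left)
    also have "\<dots> = p * (\<bar>\<phi> x\<bar> powr (p - 1) * sgn (\<phi> x)) * w p x * (x \<bullet> G x)
      + \<bar>\<phi> x\<bar> powr p * w p x * DIM('a) - p * \<bar>\<phi> x\<bar> powr p * w (p + 2) x * (x \<bullet> x)"
      by (simp only: euclidean_inner[of x "G x", symmetric] euclidean_inner[of x x, symmetric])
    finally show ?thesis .
  qed
  \<comment> \<open>The factor \<open>H powr (p - 1)\<close> balances Young's inequality for
    \<open>H * (a * s)\<close> and \<open>norm (G x)\<close>. As H^(p-1) (N - p) = p H^p and Young's
    inequality consumes (p - 1) H^p, exactly the sharp constant H^p remains.\<close>
  have P: "H powr p * (\<bar>\<phi> x\<bar> powr p * w p x) - norm (G x) powr p \<le> H powr (p - 1) * (\<Sum>b\<in>Basis. F b x \<bullet> b)" for x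
  proof -
    define s where "s = (x \<bullet> x + e) powr (- 1 / 2)"
    have s: "s > 0" unfolding s_def using pos[of x] by simp
    have ws: "w a x = s powr a" for a unfolding w_def s_def by (simp add: powr_powr)
    have s2: "s powr 2 * (x \<bullet> x) \<le> 1"
    proof -
      have "s powr 2 = (x \<bullet> x + e) powr (-1)" unfolding s_def by (simp only: powr_powr) simp
      also have "\<dots> = 1 / (x \<bullet> x + e)" using pos[of x] by (simp add: powr_minus_divide)
      finally have "s powr 2 * (x \<bullet> x) = x \<bullet> x / (x \<bullet> x + e)" by simp
      also have "\<dots> \<le> 1" using pos[of x] e by simp
      finally show ?thesis .
    qed
    have s1: "s * norm x \<le> 1"
    proof -
      have "(s * norm x)\<^sup>2 \<le> 1\<^sup>2" using s2 s by (simp add: power_mult_distrib power2_norm_eq_inner powr_numeral)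
      then show ?thesis by (rule power2_le_imp_le) simp
    qed
    define a where "a = \<bar>\<phi> x\<bar>"
    have a: "a \<ge> 0" by (simp add: a_def)
    have t2: "p * a powr p * w (p + 2) x * (x \<bullet> x) \<le> p * a powr p * w p x"
    proof -
      have "p * a powr p * w (p + 2) x * (x \<bullet> x) = (p * a powr p * w p x) * (s powr 2 * (x \<bullet> x))"
        unfolding ws by (simp add: powr_add)
      also have "\<dots> \<le> (p * a powr p * w p x) * 1"
        using s2 p ws by (intro mult_left_mono) auto
      finally show ?thesis by simp
    qed
    have t1: "- (p * (a powr (p - 1) * sgn (\<phi> x)) * w p x * (x \<bullet> G x)) \<le> p * (a * s) powr (p - 1) * norm (G x)"
    proof -
      have "\<bar>p * (a powr (p - 1) * sgn (\<phi> x)) * w p x * (x \<bullet> G x)\<bar> \<le> p * a powr (p - 1) * s powr p * (norm x * norm (G x))"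
        unfolding ws abs_mult using p Cauchy_Schwarz_ineq2[of x "G x"]
        by (intro mult_mono) (auto simp: abs_mult abs_sgn_eq)
      also have "\<dots> = p * a powr (p - 1) * s powr (p - 1) * norm (G x) * (s * norm x)"
        using s by (simp add: powr_diff)
      also have "\<dots> \<le> p * a powr (p - 1) * s powr (p - 1) * norm (G x) * 1"
        using s1 p by (intro mult_left_mono) auto
      also have "\<dots> = p * (a * s) powr (p - 1) * norm (G x)" by (simp add: powr_mult)
      finally show ?thesis by linarith
    qed
    have "(DIM('a) - p) * (a * s) powr p - p * (a * s) powr (p - 1) * norm (G x) \<le> (\<Sum>b\<in>Basis. F b x \<bullet> b)"
      unfolding S a_def[symmetric] using t1 t2 by (simp add: ws powr_mult algebra_simps)
    then have "H powr (p - 1) * ((DIM('a) - p) * (a * s) powr p - p * (a * s) powr (p - 1) * norm (G x))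
       \<le> H powr (p - 1) * (\<Sum>b\<in>Basis. F b x \<bullet> b)"
      by (intro mult_left_mono) auto
    moreover have E: "H powr (p - 1) * (DIM('a) - p) = p * H powr p"
    proof -
      have "real DIM('a) - p = p * H" using p by (simp add: H_def)
      then show ?thesis using H by (simp add: powr_diff)
    qed
    ultimately have "p * H powr p * (a * s) powr p - p * (H powr (p - 1) * (a * s) powr (p - 1)) * norm (G x) \<le> H powr (p - 1) * (\<Sum>b\<in>Basis. F b x \<bullet> b)"
    proof -
      have "H powr (p - 1) * ((DIM('a) - p) * (a * s) powr p) = p * H powr p * (a * s) powr p"
        using E by (metis mult.assoc)
      moreover have "H powr (p - 1) * (p * (a * s) powr (p - 1) * norm (G x)) = p * (H powr (p - 1) * (a * s) powr (p - 1)) * norm (G x)"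
        by simp
      ultimately show ?thesis
        using \<open>H powr (p - 1) * (_ - _) \<le> _\<close> by (simp only: right_diff_distrib)
    qed
    moreover have "p * (H * (a * s)) powr (p - 1) * norm (G x) \<le> (p - 1) * (H * (a * s)) powr p + norm (G x) powr p"
      using H s a p by (intro Young_powr) auto
    ultimately show ?thesis
      unfolding a_def[symmetric] ws by (simp add: powr_mult algebra_simps)
  qed
  have i1: "integrable lborel (\<lambda>x. \<bar>\<phi> x\<bar> powr p * w p x)"
    unfolding w_def by (rule continuous_bounded_support(1)[where R=R])
      (use c R p pos in \<open>auto intro!: continuous_intros simp: less_imp_neq[symmetric]\<close>)
  have i2: "integrable lborel (\<lambda>x. norm (G x) powr p)"
    by (rule continuous_bounded_support(1)[where R=R])
      (use c R p in \<open>auto intro!: continuous_intros continuous_on_powr'\<close>)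
  have "(LINT x|lborel. H powr p * (\<bar>\<phi> x\<bar> powr p * w p x) - norm (G x) powr p) \<le> (LINT x|lborel. H powr (p - 1) * (\<Sum>b\<in>Basis. F b x \<bullet> b))"
    by (rule integral_mono) (use i1 i2 Ii P in auto)
  also have "\<dots> = 0" using I by simp
  finally have "H powr p * (LINT x|lborel. \<bar>\<phi> x\<bar> powr p * w p x) \<le> (LINT x|lborel. norm (G x) powr p)"
    using i1 i2 by simp
  then have "ennreal (H powr p * (LINT x|lborel. \<bar>\<phi> x\<bar> powr p * w p x)) \<le> ennreal (LINT x|lborel. norm (G x) powr p)"
    by (rule ennreal_leI)
  moreover have "(\<integral>\<^sup>+x. ennreal (\<bar>\<phi> x\<bar> powr p * w p x) \<partial>lborel) = ennreal (LINT x|lborel. \<bar>\<phi> x\<bar> powr p * w p x)"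
    using i1 by (rule nn_integral_eq_integral) (simp add: w_def)
  moreover have "(\<integral>\<^sup>+x. ennreal (norm (G x) powr p) \<partial>lborel) = ennreal (LINT x|lborel. norm (G x) powr p)"
    using i2 by (rule nn_integral_eq_integral) simp
  ultimately show ?thesis
    unfolding w_def by (simp only: ennreal_mult'[OF powr_ge_zero])
qed

lemma nn_integral_ennreal_cmult:
  assumes "c \<ge> 0" "g \<in> borel_measurable M"
  shows "(\<integral>\<^sup>+x. ennreal (c * g x) \<partial>M) = ennreal c * (\<integral>\<^sup>+x. ennreal (g x) \<partial>M)"
  unfolding ennreal_mult'[OF assms(1)] using assms(2) by (intro nn_integral_cmult) measurable

text \<open>Fatou's lemma as the regularisation 1/(n+1) tends to 0. In extended nonnegative reals,
  finiteness of the weighted integral is part of the conclusion and not an assumption.\<close>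

lemma hardy_inequality:
  fixes \<phi> :: "'a::euclidean_space \<Rightarrow> real" and p :: real
  assumes \<phi>: "C1_compact \<phi> G" and p: "1 < p" "p < DIM('a)"
  shows "ennreal (((DIM('a) - p) / p) powr p) * (\<integral>\<^sup>+x. ennreal (\<bar>\<phi> x\<bar> powr p / norm x powr p) \<partial>lborel)
      \<le> (\<integral>\<^sup>+x. ennreal (norm (G x) powr p) \<partial>lborel)"
proof -
  define h where "h n = 1 / real (Suc n)" for n
  have h: "0 < h n" for n by (auto simp: h_def)
  have h0: "h \<longlonglongrightarrow> 0" unfolding h_def by (rule LIMSEQ_Suc[OF lim_1_over_n])
  let ?c = "((DIM('a) - p) / p) powr p"
  let ?f = "\<lambda>n x. ennreal (?c * (\<bar>\<phi> x\<bar> powr p * (x \<bullet> x + h n) powr (- p / 2)))"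
  have m [measurable]: "\<phi> \<in> borel_measurable borel"
    using C1_compact_cont[OF \<phi>] borel_measurable_continuous_onI by blast
  have le: "ennreal (?c * (\<bar>\<phi> x\<bar> powr p / norm x powr p)) \<le> liminf (\<lambda>n. ?f n x)" for x
  \<comment> \<open>At the origin division by zero gives the left side the value 0.\<close>
  proof (cases "x = 0")
    case False
    have "(\<lambda>n. ?c * (\<bar>\<phi> x\<bar> powr p * (x \<bullet> x + h n) powr (- p / 2))) \<longlonglongrightarrow> ?c * (\<bar>\<phi> x\<bar> powr p * (x \<bullet> x + 0) powr (- p / 2))"
      using False by (intro tendsto_intros h0) auto
    also have "(x \<bullet> x + 0) powr (- p / 2) = 1 / norm x powr p"
    proof -
      have "x \<bullet> x + 0 = norm x powr 2" using False by (simp add: dot_square_norm)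
      then show ?thesis by (simp only: powr_powr) (simp add: powr_minus_divide)
    qed
    finally have "(\<lambda>n. ?f n x) \<longlonglongrightarrow> ennreal (?c * (\<bar>\<phi> x\<bar> powr p / norm x powr p))"
      by (intro tendsto_ennrealI) simp
    then show ?thesis by (intro eq_refl lim_imp_Liminf[symmetric]) auto
  qed (use p in simp)
  have "ennreal ?c * (\<integral>\<^sup>+x. ennreal (\<bar>\<phi> x\<bar> powr p / norm x powr p) \<partial>lborel)
      = (\<integral>\<^sup>+x. ennreal (?c * (\<bar>\<phi> x\<bar> powr p / norm x powr p)) \<partial>lborel)"
    by (rule nn_integral_ennreal_cmult[symmetric]) auto
  also have "\<dots> \<le> (\<integral>\<^sup>+x. liminf (\<lambda>n. ?f n x) \<partial>lborel)"
    by (intro nn_integral_mono le)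
  also have "\<dots> \<le> liminf (\<lambda>n. (\<integral>\<^sup>+x. ?f n x \<partial>lborel))"
    by (rule nn_integral_liminf) measurable
  also have "\<dots> \<le> liminf (\<lambda>n::nat. (\<integral>\<^sup>+x. ennreal (norm (G x) powr p) \<partial>lborel))"
  proof (intro Liminf_mono always_eventually allI)
    fix n
    have "(\<integral>\<^sup>+x. ?f n x \<partial>lborel) = ennreal ?c * (\<integral>\<^sup>+x. ennreal (\<bar>\<phi> x\<bar> powr p * (x \<bullet> x + h n) powr (- p / 2)) \<partial>lborel)"
      by (rule nn_integral_ennreal_cmult) auto
    then show "(\<integral>\<^sup>+x. ?f n x \<partial>lborel) \<le> (\<integral>\<^sup>+x. ennreal (norm (G x) powr p) \<partial>lborel)"
      using hardy_regularized[OF \<phi> p h] by simp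
  qed
  also have "\<dots> = (\<integral>\<^sup>+x. ennreal (norm (G x) powr p) \<partial>lborel)" by (simp add: Liminf_const)
  finally show ?thesis .
qed

subsection \<open>The Gagliardo--Nirenberg--Sobolev inequality\<close>

lemma ennreal_power_le_imp_le:
  fixes a :: ennreal
  assumes "a ^ k \<le> ennreal (b ^ k)" "k > 0" "b \<ge> 0"
  shows "a \<le> ennreal b"
proof (cases a)
  case (real r)
  then have "r ^ k \<le> b ^ k" using assms by (simp add: ennreal_power ennreal_le_iff)
  then have "r \<le> b" using assms by (metis power_le_imp_le_base gr0_conv_Suc)
  then show ?thesis using real by (simp add: ennreal_leI)
next
  case top
  then show ?thesis using assms by (simp add: top_unique)
qed

lemma prod_le_mean_power:
  fixes f :: "'i \<Rightarrow> real"
  assumes I: "finite I" "card I = k" "k > 0" and nn: "\<And>i. i \<in> I \<Longrightarrow> f i \<ge> 0"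
  shows "(\<Prod>i\<in>I. f i) \<le> ((\<Sum>i\<in>I. f i) / k) ^ k"
proof -
  have "(\<Prod>i\<in>I. f i) powr (1 / card I) \<le> (\<Sum>i\<in>I. f i / card I)"
    by (rule arith_geom_mean) (use I nn in auto)
  then have "((\<Prod>i\<in>I. f i) powr (1 / k)) ^ k \<le> ((\<Sum>i\<in>I. f i) / k) ^ k"
    unfolding I(2) sum_divide_distrib[symmetric] by (intro power_mono) auto
  moreover have "((\<Prod>i\<in>I. f i) powr (1 / k)) ^ k = (\<Prod>i\<in>I. f i)"
  proof (cases "(\<Prod>i\<in>I. f i) = 0")
    case False
    then have "(\<Prod>i\<in>I. f i) > 0" using nn prod_nonneg[of I f] by simp
    then show ?thesis using I(3) by (simp add: powr_powr flip: powr_realpow)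
  qed (use I(3) in simp)
  ultimately show ?thesis by simp
qed

text \<open>Scale the factors so that all have the same integral, bound \<Psi> pointwise by the sum
  of the scaled factors through the inequality of arithmetic and geometric means, and integrate. The
  factor c stands for the part of a product that is constant in the variable of integration.\<close>

lemma nn_integral_Hoelder_prod:
  fixes F :: "'i \<Rightarrow> 'x \<Rightarrow> ennreal"
  assumes I: "finite I" "card I = k" "k > 0"
    and F[measurable]: "\<And>i. i \<in> I \<Longrightarrow> F i \<in> borel_measurable M"
    and \<Psi>[measurable]: "\<Psi> \<in> borel_measurable M"
    and le: "\<And>x. \<Psi> x ^ k \<le> c * (\<Prod>i\<in>I. F i x)"
  shows "(\<integral>\<^sup>+x. \<Psi> x \<partial>M) ^ k \<le> c * (\<Prod>i\<in>I. \<integral>\<^sup>+x. F i x \<partial>M)"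
proof -
  define A where "A i = (\<integral>\<^sup>+x. F i x \<partial>M)" for i
  \<comment> \<open>Since 0 times infinity is 0, vanishing factors have to be dealt with before
    infinite ones.\<close>
  consider "c = 0" | i where "i \<in> I" "A i = 0" | "c \<noteq> 0" "\<And>i. i \<in> I \<Longrightarrow> A i \<noteq> 0" "c = \<infinity> \<or> (\<exists>i\<in>I. A i = \<infinity>)"
    | "c \<noteq> 0" "\<And>i. i \<in> I \<Longrightarrow> A i \<noteq> 0" "c < \<infinity>" "\<And>i. i \<in> I \<Longrightarrow> A i < \<infinity>"
    by (metis infinity_ennreal_def less_top)
  then show ?thesis
  proof cases
    case 1
    then have "\<Psi> x = 0" for x using le[of x] I(3) by simp
    then show ?thesis by (simp add: zero_power[OF I(3)])
  next
    case 2
    then have "AE x in M. F i x = 0"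
      unfolding A_def by (subst (asm) nn_integral_0_iff_AE) auto
    then have "AE x in M. \<Psi> x = 0"
    proof eventually_elim
      case (elim x)
      then have 0: "(\<Prod>i\<in>I. F i x) = 0" using 2 I by (auto intro: prod_zero)
      have "\<Psi> x ^ k \<le> ennreal (0 ^ k)" using le[of x] unfolding 0 by (simp add: zero_power[OF I(3)])
      from ennreal_power_le_imp_le[OF this I(3)] show ?case by simp
    qed
    then have "(\<integral>\<^sup>+x. \<Psi> x \<partial>M) = 0" by (subst nn_integral_0_iff_AE) auto
    then show ?thesis by (simp add: zero_power[OF I(3)])
  next
    case 3
    have "(\<Prod>i\<in>I. A i) \<noteq> 0" using 3 I by simp
    moreover have "(\<exists>i\<in>I. A i = \<infinity>) \<Longrightarrow> (\<Prod>i\<in>I. A i) = \<infinity>"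
      using 3(2) I(1) by (auto simp: ennreal_prod_eq_top)
    ultimately have "c * (\<Prod>i\<in>I. A i) = \<infinity>"
      using 3(1,3) by (auto simp: ennreal_mult_eq_top_iff)
    then show ?thesis unfolding A_def by simp
  next
    case 4
    define a where "a i = enn2real (A i)" for i
    have a: "A i = ennreal (a i)" "a i > 0" if "i \<in> I" for i
      using 4(2,4)[OF that] by (auto simp: a_def enn2real_positive_iff less_top zero_less_iff_neq_zero)
    obtain c' where c': "c = ennreal c'" "c' > 0"
      using 4(1,3) by (cases c) (auto simp: zero_less_iff_neq_zero[symmetric] less_le)
    have pa: "(\<Prod>i\<in>I. a i) > 0" using a by (intro prod_pos) auto
    \<comment> \<open>B is the bound to be reached, the k-th root of the right-hand side. The
      weights \<open>d i\<close> are chosen such that each of the k weighted integrals equals B /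
      k.\<close>
    define B where "B = root k (c' * (\<Prod>i\<in>I. a i))"
    have B: "B > 0" "B ^ k = c' * (\<Prod>i\<in>I. a i)"
      using I(3) pa c'(2) by (auto simp: B_def less_imp_le)
    define d where "d i = B / (k * a i)" for i
    have d: "d i > 0" if "i \<in> I" for i using a[OF that] B I(3) by (simp add: d_def)
    have pt: "\<Psi> x \<le> (\<Sum>i\<in>I. ennreal (d i) * F i x)" for x
    proof (cases "\<exists>i\<in>I. F i x = \<infinity>")
      case True
      then obtain i where i: "i \<in> I" "F i x = top" by auto
      then have "ennreal (d i) * F i x = top"
        using d[OF i(1)] by (simp add: ennreal_mult_eq_top_iff)
      then have "(\<Sum>i\<in>I. ennreal (d i) * F i x) = \<infinity>"
        using I(1) i(1) by auto
      then show ?thesis by simp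
    next
      case False
      define f where "f i = enn2real (F i x)" for i
      have f: "F i x = ennreal (f i)" "f i \<ge> 0" if "i \<in> I" for i
        using False that by (auto simp: f_def less_top)
      have nn: "f i / a i \<ge> 0" if "i \<in> I" for i using f(2)[OF that] a(2)[OF that] by simp
      have "\<Psi> x ^ k \<le> ennreal c' * (\<Prod>i\<in>I. ennreal (f i))"
        using le[of x] c' f(1) by (simp cong: prod.cong)
      also have "\<dots> = ennreal (c' * (\<Prod>i\<in>I. f i))"
        using f(2) c' by (simp add: prod_ennreal ennreal_mult' )
      also have "c' * (\<Prod>i\<in>I. f i) = B ^ k * (\<Prod>i\<in>I. f i / a i)"
        unfolding B(2) using pa by (simp add: prod_dividef)
      also have "ennreal (B ^ k * (\<Prod>i\<in>I. f i / a i)) \<le> ennreal (B ^ k * ((\<Sum>i\<in>I. f i / a i) / k) ^ k)"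
        using B(1) nn I by (intro ennreal_leI mult_left_mono prod_le_mean_power) auto
      also have "\<dots> = ennreal ((B * ((\<Sum>i\<in>I. f i / a i) / k)) ^ k)"
        by (simp only: power_mult_distrib)
      finally have "\<Psi> x \<le> ennreal (B * ((\<Sum>i\<in>I. f i / a i) / k))"
        using I(3) by (rule ennreal_power_le_imp_le) (intro mult_nonneg_nonneg divide_nonneg_nonneg sum_nonneg less_imp_le[OF B(1)] nn, auto)
      also have "B * ((\<Sum>i\<in>I. f i / a i) / k) = (\<Sum>i\<in>I. d i * f i)"
        by (simp add: sum_distrib_left sum_divide_distrib d_def mult.commute)
      also have "ennreal (\<Sum>i\<in>I. d i * f i) = (\<Sum>i\<in>I. ennreal (d i * f i))"
        using d f(2) by (intro sum_ennreal[symmetric] mult_nonneg_nonneg) (auto intro: less_imp_le)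
      also have "\<dots> = (\<Sum>i\<in>I. ennreal (d i) * F i x)"
        using f d by (intro sum.cong refl) (simp add: ennreal_mult' less_imp_le)
      finally show ?thesis .
    qed
    have "(\<integral>\<^sup>+x. \<Psi> x \<partial>M) \<le> (\<integral>\<^sup>+x. (\<Sum>i\<in>I. ennreal (d i) * F i x) \<partial>M)"
      by (intro nn_integral_mono pt)
    also have "\<dots> = (\<Sum>i\<in>I. ennreal (d i) * A i)"
      unfolding A_def by (subst nn_integral_sum) (auto intro!: sum.cong nn_integral_cmult)
    also have "\<dots> = (\<Sum>i\<in>I. ennreal (B / k))"
    proof (intro sum.cong refl)
      fix i assume i: "i \<in> I"
      have "ennreal (d i) * A i = ennreal (d i * a i)"
        using a[OF i] d[OF i] by (simp add: ennreal_mult' less_imp_le)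
      also have "d i * a i = B / k" using a(2)[OF i] by (simp add: d_def)
      finally show "ennreal (d i) * A i = ennreal (B / k)" .
    qed
    also have "\<dots> = ennreal (\<Sum>i\<in>I. B / k)" using B(1) by (intro sum_ennreal) simp
    also have "(\<Sum>i\<in>I. B / k) = B" using I by simp
    finally have "(\<integral>\<^sup>+x. \<Psi> x \<partial>M) ^ k \<le> ennreal B ^ k" by (intro power_mono) auto
    also have "\<dots> = ennreal (c' * (\<Prod>i\<in>I. a i))" using B by (simp add: ennreal_power)
    also have "\<dots> = c * (\<Prod>i\<in>I. A i)"
      using c' a by (simp add: ennreal_mult' prod_ennreal[symmetric] less_imp_le cong: prod.cong)
    finally show ?thesis unfolding A_def .
  qed
qed

text \<open>Kept as a function on the whole space that is constant along b, instead of a function of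
  the remaining N - 1 coordinates. In this way no splitting of the space into a product is needed
  during the induction.\<close>

definition line_integral :: "'a::euclidean_space \<Rightarrow> ('a \<Rightarrow> ennreal) \<Rightarrow> 'a \<Rightarrow> ennreal" where
  "line_integral b g x = (\<integral>\<^sup>+t. g (x + t *\<^sub>R b) \<partial>lborel)"

lemma line_integral_measurable [measurable]:
  assumes [measurable]: "g \<in> borel_measurable borel"
  shows "line_integral b g \<in> borel_measurable borel"
  unfolding line_integral_def[abs_def] by measurable

lemma line_integral_shift:
  assumes [measurable]: "g \<in> borel_measurable borel"
  shows "line_integral b g (x + s *\<^sub>R b) = line_integral b g x"
proof -
  have "line_integral b g x = (\<integral>\<^sup>+t. g (x + t *\<^sub>R b) \<partial>distr lborel borel ((+) s))"
    unfolding line_integral_def lborel_distr_plus ..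
  also have "\<dots> = (\<integral>\<^sup>+t. g (x + (s + t) *\<^sub>R b) \<partial>lborel)"
    by (rule nn_integral_distr) measurable
  finally show ?thesis unfolding line_integral_def by (simp add: algebra_simps)
qed

lemma line_integral_commute:
  assumes [measurable]: "g \<in> borel_measurable borel"
  shows "line_integral b (line_integral c g) x = line_integral c (line_integral b g) x"
proof -
  have "line_integral b (line_integral c g) x = (\<integral>\<^sup>+t. (\<integral>\<^sup>+s. g (x + t *\<^sub>R b + s *\<^sub>R c) \<partial>lborel) \<partial>lborel)"
    unfolding line_integral_def ..
  also have "\<dots> = (\<integral>\<^sup>+s. (\<integral>\<^sup>+t. g (x + t *\<^sub>R b + s *\<^sub>R c) \<partial>lborel) \<partial>lborel)"
    by (rule lborel_pair.Fubini') measurable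
  also have "\<dots> = line_integral c (line_integral b g) x"
    unfolding line_integral_def by (simp add: algebra_simps)
  finally show ?thesis .
qed

primrec iterated_integral :: "'a::euclidean_space list \<Rightarrow> ('a \<Rightarrow> ennreal) \<Rightarrow> 'a \<Rightarrow> ennreal" where
  "iterated_integral [] g = g"
| "iterated_integral (b # bs) g = line_integral b (iterated_integral bs g)"

lemma iterated_integral_measurable [measurable]:
  assumes [measurable]: "g \<in> borel_measurable borel"
  shows "iterated_integral bs g \<in> borel_measurable borel"
  by (induction bs) simp_all

lemma iterated_line_integral_commute:
  assumes [measurable]: "g \<in> borel_measurable borel"
  shows "iterated_integral bs (line_integral c g) = line_integral c (iterated_integral bs g)"
proof (induction bs)
  case (Cons b bs)
  have "line_integral b (line_integral c (iterated_integral bs g)) = line_integral c (line_integral b (iterated_integral bs g))"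
    by (rule ext) (rule line_integral_commute, measurable)
  with Cons show ?case by simp
qed simp

text \<open>Integrate along one direction after the other. In the step for j, the factor with index
  j is already constant along j by \<open>line_integral_shift\<close> and leaves the integral;
  exactly k = N - 1 factors remain, which is the number that Hoelder's inequality for the k-th power
  can take. Once all directions are used up, every factor is the full integral of g.\<close>

lemma gagliardo_iterated:
  fixes g \<Phi> :: "'a::euclidean_space \<Rightarrow> ennreal"
  assumes [measurable]: "g \<in> borel_measurable borel" "\<Phi> \<in> borel_measurable borel"
    and n: "DIM('a) = Suc k" "k > 0"
    and le: "\<And>x. \<Phi> x ^ k \<le> (\<Prod>b\<in>Basis. line_integral b g x)"
  shows "distinct bs \<Longrightarrow> set bs \<subseteq> Basis \<Longrightarrow> iterated_integral bs \<Phi> x ^ k \<le>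
    (\<Prod>b\<in>Basis. if b \<in> set bs then iterated_integral bs g x else iterated_integral bs (line_integral b g) x)"
proof (induction bs arbitrary: x)
  case Nil
  then show ?case using le by simp
next
  case (Cons j bs)
  define F where "F b x = (if b \<in> set bs then iterated_integral bs g x else iterated_integral bs (line_integral b g) x)" for b x
  have [measurable]: "F b \<in> borel_measurable borel" for b
    unfolding F_def by measurable
  have j: "j \<in> Basis" "j \<notin> set bs" using Cons.prems by auto
  have "(\<integral>\<^sup>+t. iterated_integral bs \<Phi> (x + t *\<^sub>R j) \<partial>lborel) ^ k \<le>
      line_integral j (iterated_integral bs g) x * (\<Prod>b\<in>Basis - {j}. \<integral>\<^sup>+t. F b (x + t *\<^sub>R j) \<partial>lborel)"
  proof (rule nn_integral_Hoelder_prod)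
    fix t
    have "iterated_integral bs \<Phi> (x + t *\<^sub>R j) ^ k \<le> (\<Prod>b\<in>Basis. F b (x + t *\<^sub>R j))"
      using Cons unfolding F_def by simp
    also have "\<dots> = F j (x + t *\<^sub>R j) * (\<Prod>b\<in>Basis - {j}. F b (x + t *\<^sub>R j))"
      using j by (intro prod.remove) auto
    also have "F j (x + t *\<^sub>R j) = line_integral j (iterated_integral bs g) x"
      using j by (simp add: F_def iterated_line_integral_commute line_integral_shift)
    finally show "iterated_integral bs \<Phi> (x + t *\<^sub>R j) ^ k \<le> line_integral j (iterated_integral bs g) x * (\<Prod>b\<in>Basis - {j}. F b (x + t *\<^sub>R j))" .
  qed (use n j in auto)
  also have "\<dots> = (\<Prod>b\<in>Basis. if b \<in> set (j # bs) then iterated_integral (j # bs) g x else iterated_integral (j # bs) (line_integral b g) x)"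
  proof -
    have "(\<Prod>b\<in>Basis. if b \<in> set (j # bs) then iterated_integral (j # bs) g x else iterated_integral (j # bs) (line_integral b g) x)
      = iterated_integral (j # bs) g x * (\<Prod>b\<in>Basis - {j}. if b \<in> set (j # bs) then iterated_integral (j # bs) g x else iterated_integral (j # bs) (line_integral b g) x)"
      using j by (subst prod.remove[of _ j]) auto
    also have "(\<Prod>b\<in>Basis - {j}. if b \<in> set (j # bs) then iterated_integral (j # bs) g x else iterated_integral (j # bs) (line_integral b g) x)
       = (\<Prod>b\<in>Basis - {j}. \<integral>\<^sup>+t. F b (x + t *\<^sub>R j) \<partial>lborel)"
      by (intro prod.cong refl) (auto simp: F_def line_integral_def)
    finally show ?thesis by simp
  qed
  finally show ?case by (simp add: line_integral_def)
qed

text \<open>The link from iterated line integrals to Lebesgue measure: for a list enumerating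
  \<open>Basis\<close> and x = 0, the right side is the image-measure description of
  \<open>lborel\<close>.\<close>

lemma iterated_integral_eq_PiM:
  fixes g :: "'a::euclidean_space \<Rightarrow> ennreal"
  assumes [measurable]: "g \<in> borel_measurable borel"
  shows "distinct bs \<Longrightarrow> iterated_integral bs g x = integral\<^sup>N (PiM (set bs) (\<lambda>_. lborel)) (\<lambda>\<omega>. g (x + (\<Sum>b\<in>set bs. \<omega> b *\<^sub>R b)))"
proof (induction bs arbitrary: x)
  case Nil
  interpret product_sigma_finite "\<lambda>_::'a. lborel :: real measure" ..
  have "integral\<^sup>N (PiM {} (\<lambda>_::'a. lborel :: real measure)) (\<lambda>\<omega>. g x) = g x"
    by (rule nn_integral_empty) simp
  then show ?case by simp
next
  case (Cons b bs)
  interpret product_sigma_finite "\<lambda>_::'a. lborel :: real measure" ..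
  have b: "b \<notin> set bs" using Cons.prems by simp
  have e: "(\<Sum>c\<in>insert b (set bs). (fun_upd \<omega> b t) c *\<^sub>R c) = t *\<^sub>R b + (\<Sum>c\<in>set bs. \<omega> c *\<^sub>R c)" for t and \<omega> :: "'a \<Rightarrow> real"
    using b by (subst sum.insert) (auto intro!: sum.cong)
  have "integral\<^sup>N (PiM (set (b # bs)) (\<lambda>_. lborel)) (\<lambda>\<omega>. g (x + (\<Sum>b\<in>set (b # bs). \<omega> b *\<^sub>R b)))
     = (\<integral>\<^sup>+t. integral\<^sup>N (PiM (set bs) (\<lambda>_. lborel)) (\<lambda>\<omega>. g (x + (\<Sum>c\<in>insert b (set bs). (fun_upd \<omega> b t) c *\<^sub>R c))) \<partial>lborel)"
    unfolding list.set using b by (intro product_nn_integral_insert_rev) auto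
  also have "\<dots> = (\<integral>\<^sup>+t. integral\<^sup>N (PiM (set bs) (\<lambda>_. lborel)) (\<lambda>\<omega>. g (x + t *\<^sub>R b + (\<Sum>c\<in>set bs. \<omega> c *\<^sub>R c))) \<partial>lborel)"
    unfolding e by (simp only: add.assoc)
  also have "\<dots> = iterated_integral (b # bs) g x"
    using Cons by (simp add: line_integral_def)
  finally show ?case ..
qed

text \<open>Both sides are raised to the power \<open>N - 1\<close>, so that no roots of extended reals are needed.\<close>

lemma gagliardo:
  fixes g \<Phi> :: "'a::euclidean_space \<Rightarrow> ennreal"
  assumes [measurable]: "g \<in> borel_measurable borel" "\<Phi> \<in> borel_measurable borel"
    and n: "DIM('a) = Suc k" "k > 0"
    and le: "\<And>x. \<Phi> x ^ k \<le> (\<Prod>b\<in>Basis. line_integral b g x)"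
  shows "(\<integral>\<^sup>+x. \<Phi> x \<partial>lborel) ^ k \<le> (\<integral>\<^sup>+x. g x \<partial>lborel) ^ Suc k"
proof -
  obtain bs :: "'a list" where bs: "distinct bs" "set bs = Basis"
    using finite_distinct_list[OF finite_Basis] by blast
  have L: "(\<integral>\<^sup>+x. h x \<partial>lborel) = iterated_integral bs h 0" if [measurable]: "h \<in> borel_measurable borel" for h :: "'a \<Rightarrow> ennreal"
    unfolding iterated_integral_eq_PiM[OF that bs(1)] bs(2)
    by (subst lborel_eq, subst nn_integral_distr) simp_all
  show ?thesis
    unfolding L[OF assms(1)] L[OF assms(2)]
    using gagliardo_iterated[OF assms bs(1), of 0] bs(2) n by simp
qed

section \<open>From the first power of the gradient to the exponent p\<close>

lemma integral_Hoelder: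
  fixes f g :: "'x \<Rightarrow> real"
  assumes pq: "p > 1" "q > 1" "1 / p + 1 / q = 1"
    and [measurable]: "f \<in> borel_measurable M" "g \<in> borel_measurable M"
    and i: "integrable M (\<lambda>x. \<bar>f x\<bar> powr p)" "integrable M (\<lambda>x. \<bar>g x\<bar> powr q)"
  shows "integrable M (\<lambda>x. \<bar>f x\<bar> * \<bar>g x\<bar>)"
    and "(LINT x|M. \<bar>f x\<bar> * \<bar>g x\<bar>) \<le> (LINT x|M. \<bar>f x\<bar> powr p) powr (1 / p) * (LINT x|M. \<bar>g x\<bar> powr q) powr (1 / q)"
proof -
  show ifg: "integrable M (\<lambda>x. \<bar>f x\<bar> * \<bar>g x\<bar>)"
  proof (rule Bochner_Integration.integrable_bound)
    show "integrable M (\<lambda>x. \<bar>f x\<bar> powr p / p + \<bar>g x\<bar> powr q / q)" using i by simp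
    show "AE x in M. norm (\<bar>f x\<bar> * \<bar>g x\<bar>) \<le> norm (\<bar>f x\<bar> powr p / p + \<bar>g x\<bar> powr q / q)"
      using Youngs_inequality[OF pq abs_ge_zero abs_ge_zero] pq by (auto simp: abs_mult)
  qed measurable
  define A where "A = (LINT x|M. \<bar>f x\<bar> powr p)"
  define B where "B = (LINT x|M. \<bar>g x\<bar> powr q)"
  have AB: "A \<ge> 0" "B \<ge> 0" by (auto simp: A_def B_def)
  have zero: "(LINT x|M. \<bar>f x\<bar> * \<bar>g x\<bar>) = 0" if "A = 0 \<or> B = 0"
  proof -
    have "(AE x in M. \<bar>f x\<bar> powr p = 0) \<or> (AE x in M. \<bar>g x\<bar> powr q = 0)"
      using that i unfolding A_def B_def by (auto simp: integral_nonneg_eq_0_iff_AE)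
    then have "AE x in M. \<bar>f x\<bar> * \<bar>g x\<bar> = 0" by (auto elim: eventually_mono)
    then show ?thesis by (rule integral_eq_zero_AE)
  qed
  show "(LINT x|M. \<bar>f x\<bar> * \<bar>g x\<bar>) \<le> (LINT x|M. \<bar>f x\<bar> powr p) powr (1 / p) * (LINT x|M. \<bar>g x\<bar> powr q) powr (1 / q)"
  proof (cases "A = 0 \<or> B = 0")
    case False
    then have AB: "A > 0" "B > 0" using AB by auto
    define a b where "a = A powr (1 / p)" and "b = B powr (1 / q)"
    have ab: "a > 0" "b > 0" "a powr p = A" "b powr q = B" using AB pq by (auto simp: a_def b_def powr_powr)
    have "(\<bar>f x\<bar> / a) * (\<bar>g x\<bar> / b) \<le> \<bar>f x\<bar> powr p / A / p + \<bar>g x\<bar> powr q / B / q" for x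
      using Youngs_inequality[OF pq, of "\<bar>f x\<bar> / a" "\<bar>g x\<bar> / b"] ab by (simp add: powr_divide)
    then have "(LINT x|M. (\<bar>f x\<bar> / a) * (\<bar>g x\<bar> / b)) \<le> (LINT x|M. \<bar>f x\<bar> powr p / A / p + \<bar>g x\<bar> powr q / B / q)"
      using ifg i by (intro integral_mono) auto
    also have "\<dots> = 1" using i AB pq by (simp add: A_def[symmetric] B_def[symmetric])
    finally have "(LINT x|M. \<bar>f x\<bar> * \<bar>g x\<bar>) / (a * b) \<le> 1" by simp
    then have "(LINT x|M. \<bar>f x\<bar> * \<bar>g x\<bar>) \<le> a * b" using ab by (simp add: divide_le_eq)
    then show ?thesis by (simp add: a_def b_def A_def B_def)
  qed (use zero in auto)
qed

text \<open>The fundamental theorem of calculus on the segment that ends at x and starts, in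
  direction -b, at a point beyond the support. The power r > 1 is kept because the geometric
  inequality is applied to |\<phi>|^r rather than to \<phi>.\<close>

lemma line_integral_ge_abs_powr:
  fixes \<phi> :: "'a::euclidean_space \<Rightarrow> real"
  assumes \<phi>: "C1_compact \<phi> G" and r: "r > 1" and b: "norm b = 1"
  shows "ennreal (\<bar>\<phi> x\<bar> powr r) \<le> line_integral b (\<lambda>x. ennreal (r * \<bar>\<phi> x\<bar> powr (r - 1) * norm (G x))) x"
proof -
  obtain R where R: "R > 0" "\<And>x. norm x > R \<Longrightarrow> \<phi> x = 0 \<and> G x = 0"
    using C1_compact_vanishing[OF \<phi>] by blast
  define T where "T = R + norm x + 1"
  have T: "T > 0" using R by (simp add: T_def add_pos_nonneg)
  have "norm (x + (- T) *\<^sub>R b) \<ge> T - norm x"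
    using norm_triangle_ineq2[of "T *\<^sub>R b" x] b T by (simp add: norm_minus_commute)
  then have "norm (x + (- T) *\<^sub>R b) > R" by (simp add: T_def)
  then have F0: "\<phi> (x + (- T) *\<^sub>R b) = 0" using R(2) by blast
  define F where "F t = \<bar>\<phi> (x + t *\<^sub>R b)\<bar> powr r" for t
  define f where "f t = r * \<bar>\<phi> (x + t *\<^sub>R b)\<bar> powr (r - 1) * sgn (\<phi> (x + t *\<^sub>R b)) * (G (x + t *\<^sub>R b) \<bullet> b)" for t
  have dF: "(F has_vector_derivative f t) (at t within S)" for t S
  proof -
    have "((\<lambda>t. x + t *\<^sub>R b) has_derivative (\<lambda>t. t *\<^sub>R b)) (at t)"
      by (auto intro!: derivative_eq_intros)
    from has_derivative_compose[OF this C1_compact_deriv[OF \<phi>]]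
    have "((\<lambda>t. \<phi> (x + t *\<^sub>R b)) has_derivative (\<lambda>s. G (x + t *\<^sub>R b) \<bullet> s *\<^sub>R b)) (at t)" .
    moreover have "(\<lambda>s. G (x + t *\<^sub>R b) \<bullet> s *\<^sub>R b) = (*) (G (x + t *\<^sub>R b) \<bullet> b)" by auto
    ultimately have "((\<lambda>t. \<phi> (x + t *\<^sub>R b)) has_real_derivative (G (x + t *\<^sub>R b) \<bullet> b)) (at t)"
      by (simp add: has_field_derivative_def)
    from DERIV_chain2[OF has_real_derivative_abs_powr[OF r] this]
    have "(F has_real_derivative f t) (at t)" unfolding F_def f_def by (simp add: mult_ac)
    then show ?thesis
      by (metis has_field_derivative_at_within has_real_derivative_iff_has_vector_derivative)
  qed
  note c = C1_compact_cont[OF \<phi>] C1_compact_cont_grad[OF \<phi>]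
  have cl: "continuous_on UNIV (\<lambda>t. x + t *\<^sub>R b)" by (intro continuous_intros)
  have c\<phi>: "continuous_on UNIV (\<lambda>t. \<phi> (x + t *\<^sub>R b))" and cG: "continuous_on UNIV (\<lambda>t. G (x + t *\<^sub>R b))"
    using continuous_on_compose2[OF c(1) cl] continuous_on_compose2[OF c(2) cl] by auto
  have cs: "continuous_on UNIV (\<lambda>t. \<bar>\<phi> (x + t *\<^sub>R b)\<bar> powr (r - 1) * sgn (\<phi> (x + t *\<^sub>R b)))"
    using continuous_on_compose2[OF continuous_on_sgn_powr[of "r - 1" UNIV] c\<phi>] r by simp
  have cf: "continuous_on UNIV f"
  proof -
    have e: "f = (\<lambda>t. r * ((\<bar>\<phi> (x + t *\<^sub>R b)\<bar> powr (r - 1) * sgn (\<phi> (x + t *\<^sub>R b))) * (G (x + t *\<^sub>R b) \<bullet> b)))"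
      unfolding f_def[abs_def] by (simp add: mult.assoc)
    show ?thesis unfolding e
      by (intro continuous_on_mult[OF continuous_on_const] continuous_on_mult[OF cs] continuous_on_inner cG continuous_on_const)
  qed
  have "has_bochner_integral lborel (\<lambda>t. indicator {-T..0} t *\<^sub>R f t) (F 0 - F (-T))"
    by (rule has_bochner_integral_FTC_Icc) (use T dF continuous_on_subset[OF cf] in auto)
  then have I: "integrable lborel (\<lambda>t. indicator {-T..0} t *\<^sub>R f t)" "F 0 - F (-T) = (LINT t|lborel. indicator {-T..0} t *\<^sub>R f t)"
    by (auto simp: has_bochner_integral_iff)
  have "ennreal (F 0 - F (-T)) \<le> ennreal (LINT t|lborel. norm (indicator {-T..0} t *\<^sub>R f t))"
    unfolding I(2) using I(1) by (intro ennreal_leI integral_mono) auto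
  also have "\<dots> = (\<integral>\<^sup>+t. ennreal (norm (indicator {-T..0} t *\<^sub>R f t)) \<partial>lborel)"
    using I(1) by (intro nn_integral_eq_integral[symmetric]) auto
  also have "\<dots> \<le> (\<integral>\<^sup>+t. ennreal (r * \<bar>\<phi> (x + t *\<^sub>R b)\<bar> powr (r - 1) * norm (G (x + t *\<^sub>R b))) \<partial>lborel)"
  proof (intro nn_integral_mono ennreal_leI)
    fix t
    have "norm (f t) \<le> r * \<bar>\<phi> (x + t *\<^sub>R b)\<bar> powr (r - 1) * 1 * (norm (G (x + t *\<^sub>R b)) * norm b)"
      unfolding f_def real_norm_def abs_mult
      using r by (intro mult_mono Cauchy_Schwarz_ineq2) (auto simp: abs_sgn_eq)
    moreover have "norm (indicator {-T..0} t *\<^sub>R f t) \<le> norm (f t)"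
      by (auto simp: indicator_def)
    ultimately show "norm (indicator {-T..0} t *\<^sub>R f t) \<le> r * \<bar>\<phi> (x + t *\<^sub>R b)\<bar> powr (r - 1) * norm (G (x + t *\<^sub>R b))"
      using b by simp
  qed
  finally show ?thesis unfolding line_integral_def using F0 by (simp add: F_def)
qed

lemma prod_mono_ennreal:
  fixes f g :: "'i \<Rightarrow> ennreal"
  assumes "\<And>i. i \<in> A \<Longrightarrow> f i \<le> g i"
  shows "prod f A \<le> prod g A"
  using assms by (induction A rule: infinite_finite_induct) (auto intro!: mult_mono)

text \<open>The exponent r is forced by two requirements that it meets at once: r N / (N - 1) is the
  Sobolev exponent, and so is (r - 1) p / (p - 1). Hoelder's inequality applied to |\<phi>|^(r-1)
  |G| thus brings back the same integral X with a smaller power, which is absorbed.\<close>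

lemma sobolev_inequality:
  fixes \<phi> :: "'a::euclidean_space \<Rightarrow> real"
  assumes \<phi>: "C1_compact \<phi> G" and p: "1 < p" "p < N" and N: "N = real DIM('a)"
  shows "(LINT x|lborel. \<bar>\<phi> x\<bar> powr (p * N / (N - p))) \<le>
     ((p * (N - 1) / (N - p)) powr p * (LINT x|lborel. norm (G x) powr p)) powr (N / (N - p))"
proof -
  define r where "r = p * (N - 1) / (N - p)"
  define s where "s = p * N / (N - p)"
  obtain k where k: "DIM('a) = Suc k" "k > 0" using p N by (cases "DIM('a)") (auto intro: gr0I)
  have Nk: "N = real (Suc k)" using k N by simp
  have r1: "r - 1 = N * (p - 1) / (N - p)" using p by (simp add: r_def field_simps)
  have r: "r > 1"
  proof -
    have "r - 1 > 0" unfolding r1 using p by simp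
    then show ?thesis by simp
  qed
  have s: "s > 0" using p by (simp add: s_def)
  obtain R where R: "R > 0" "\<And>x. norm x > R \<Longrightarrow> \<phi> x = 0 \<and> G x = 0"
    using C1_compact_vanishing[OF \<phi>] by blast
  note c = C1_compact_cont[OF \<phi>] C1_compact_cont_grad[OF \<phi>]
  have [measurable]: "\<phi> \<in> borel_measurable borel" "G \<in> borel_measurable borel"
    using c borel_measurable_continuous_onI by blast+
  have iX: "integrable lborel (\<lambda>x. \<bar>\<phi> x\<bar> powr s)"
    by (rule continuous_bounded_support(1)[where R=R]) (use c R s in \<open>auto intro!: continuous_intros\<close>)
  have iY: "integrable lborel (\<lambda>x. norm (G x) powr p)"
    by (rule continuous_bounded_support(1)[where R=R]) (use c R p in \<open>auto intro!: continuous_intros continuous_on_powr'\<close>)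
  have iZ: "integrable lborel (\<lambda>x. r * \<bar>\<phi> x\<bar> powr (r - 1) * norm (G x))"
    by (rule continuous_bounded_support(1)[where R=R]) (use c R r in \<open>auto intro!: continuous_intros\<close>)
  define X where "X = (LINT x|lborel. \<bar>\<phi> x\<bar> powr s)"
  define Y where "Y = (LINT x|lborel. norm (G x) powr p)"
  define Z where "Z = (LINT x|lborel. r * \<bar>\<phi> x\<bar> powr (r - 1) * norm (G x))"
  have nn: "X \<ge> 0" "Y \<ge> 0" "Z \<ge> 0" using r by (auto simp: X_def Y_def Z_def)
  have "(\<integral>\<^sup>+x. ennreal (\<bar>\<phi> x\<bar> powr s) \<partial>lborel) ^ k \<le> (\<integral>\<^sup>+x. ennreal (r * \<bar>\<phi> x\<bar> powr (r - 1) * norm (G x)) \<partial>lborel) ^ Suc k"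
  proof (rule gagliardo[OF _ _ k])
    fix x
    have "ennreal (\<bar>\<phi> x\<bar> powr s) ^ k = ennreal ((\<bar>\<phi> x\<bar> powr s) ^ k)" by (simp add: ennreal_power)
    also have "(\<bar>\<phi> x\<bar> powr s) ^ k = (\<bar>\<phi> x\<bar> powr r) ^ Suc k"
    proof (cases "\<phi> x = 0")
      case False
      have "s * k = r * Suc k" using p Nk by (simp add: s_def r_def)
      then show ?thesis using False by (simp add: powr_powr flip: powr_realpow del: power_Suc)
    qed (use k in simp)
    also have "ennreal ((\<bar>\<phi> x\<bar> powr r) ^ Suc k) = (\<Prod>b\<in>(Basis::'a set). ennreal (\<bar>\<phi> x\<bar> powr r))"
      using k(1) by (simp add: ennreal_power del: power_Suc)
    also have "\<dots> \<le> (\<Prod>b\<in>Basis. line_integral b (\<lambda>x. ennreal (r * \<bar>\<phi> x\<bar> powr (r - 1) * norm (G x))) x)"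
      by (intro prod_mono_ennreal line_integral_ge_abs_powr[OF \<phi> r]) auto
    finally show "ennreal (\<bar>\<phi> x\<bar> powr s) ^ k \<le> (\<Prod>b\<in>Basis. line_integral b (\<lambda>x. ennreal (r * \<bar>\<phi> x\<bar> powr (r - 1) * norm (G x))) x)" .
  qed measurable
  also have "(\<integral>\<^sup>+x. ennreal (\<bar>\<phi> x\<bar> powr s) \<partial>lborel) = ennreal X"
    unfolding X_def by (rule nn_integral_eq_integral[OF iX]) simp
  also have "(\<integral>\<^sup>+x. ennreal (r * \<bar>\<phi> x\<bar> powr (r - 1) * norm (G x)) \<partial>lborel) = ennreal Z"
    unfolding Z_def by (rule nn_integral_eq_integral[OF iZ]) (use r in simp)
  finally have XZ: "X ^ k \<le> Z ^ Suc k"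
    using nn by (simp add: ennreal_power del: power_Suc)
  have "Z = r * (LINT x|lborel. \<bar>\<bar>\<phi> x\<bar> powr (r - 1)\<bar> * \<bar>norm (G x)\<bar>)"
    unfolding Z_def by (simp add: mult.assoc)
  also have "\<dots> \<le> r * ((LINT x|lborel. \<bar>\<bar>\<phi> x\<bar> powr (r - 1)\<bar> powr (p / (p - 1))) powr (1 / (p / (p - 1))) * (LINT x|lborel. \<bar>norm (G x)\<bar> powr p) powr (1 / p))"
  proof (intro mult_left_mono integral_Hoelder(2))
    show "integrable lborel (\<lambda>x. \<bar>\<bar>\<phi> x\<bar> powr (r - 1)\<bar> powr (p / (p - 1)))"
      using iX p by (simp add: powr_powr r1 s_def mult.commute)
  qed (use p r iY in \<open>auto simp: field_simps\<close>)
  also have "(\<lambda>x. \<bar>\<bar>\<phi> x\<bar> powr (r - 1)\<bar> powr (p / (p - 1))) = (\<lambda>x. \<bar>\<phi> x\<bar> powr s)"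
    using p by (simp add: powr_powr r1 s_def mult.commute)
  finally have Z: "Z \<le> r * (X powr ((p - 1) / p) * Y powr (1 / p))"
    by (simp add: X_def Y_def)
  have "X \<le> (r powr p * Y) powr (N / (N - p))"
  proof (cases "X = 0")
    case False
    then have X: "X > 0" using nn by simp
    have "X powr k = X ^ k" using X by (simp add: powr_realpow)
    also have "X ^ k \<le> (r * (X powr ((p - 1) / p) * Y powr (1 / p))) ^ Suc k"
      using XZ power_mono[OF Z nn(3), of "Suc k"] by linarith
    also have "\<dots> = r ^ Suc k * ((X powr ((p - 1) / p)) ^ Suc k * (Y powr (1 / p)) ^ Suc k)"
      by (simp only: power_mult_distrib)
    also have "(X powr ((p - 1) / p)) ^ Suc k = X powr (N * (p - 1) / p)"
      using X Nk by (simp add: powr_powr mult.commute flip: powr_realpow del: power_Suc)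
    \<comment> \<open>X is finite because \<phi> has compact support, so its power may be moved to
      the left. The exponent remaining there is (N - p) / p, positive because p < N.\<close>
    finally have "X powr k / X powr (N * (p - 1) / p) \<le> r ^ Suc k * (Y powr (1 / p)) ^ Suc k"
      using X by (simp add: divide_le_eq mult_ac del: power_Suc)
    also have "X powr k / X powr (N * (p - 1) / p) = X powr ((N - p) / p)"
    proof -
      have "real k - N * (p - 1) / p = (N - p) / p" using Nk p by (simp add: field_simps)
      then show ?thesis by (simp add: powr_diff[symmetric])
    qed
    finally have "(X powr ((N - p) / p)) powr (p / (N - p)) \<le> (r ^ Suc k * (Y powr (1 / p)) ^ Suc k) powr (p / (N - p))"
      using p by (intro powr_mono2) auto
    also have "(X powr ((N - p) / p)) powr (p / (N - p)) = X" using X p by (simp add: powr_powr)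
    also have "(r ^ Suc k * (Y powr (1 / p)) ^ Suc k) powr (p / (N - p)) = (r powr p * Y) powr (N / (N - p))"
    proof (cases "Y = 0")
      case False
      then have Y: "Y > 0" using nn by simp
      have "r ^ Suc k = r powr N" "(Y powr (1 / p)) ^ Suc k = Y powr (N / p)"
        using r Y Nk by (simp_all add: powr_powr flip: powr_realpow del: power_Suc)
      then show ?thesis using r Y p by (simp add: powr_mult powr_powr mult.commute)
    qed simp
    finally show ?thesis .
  qed simp
  then show ?thesis unfolding X_def Y_def r_def s_def .
qed

subsection \<open>Compactness in the first-power norm\<close>

lemma nn_integral_translate:
  fixes g :: "'a::euclidean_space \<Rightarrow> ennreal"
  assumes [measurable]: "g \<in> borel_measurable borel"
  shows "(\<integral>\<^sup>+x. g (x + h) \<partial>lborel) = (\<integral>\<^sup>+x. g x \<partial>lborel)"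
proof -
  have "(\<integral>\<^sup>+x. g x \<partial>lborel) = (\<integral>\<^sup>+x. g x \<partial>distr lborel borel ((+) h))"
    unfolding lborel_distr_plus ..
  also have "\<dots> = (\<integral>\<^sup>+x. g (h + x) \<partial>lborel)" by (rule nn_integral_distr) measurable
  finally show ?thesis by (simp add: add.commute)
qed

lemma C1_compact_line_deriv:
  assumes "C1_compact \<phi> G"
  shows "((\<lambda>t. \<phi> (x + t *\<^sub>R h)) has_real_derivative (G (x + t *\<^sub>R h) \<bullet> h)) (at t)"
proof -
  have "((\<lambda>t. x + t *\<^sub>R h) has_derivative (\<lambda>t. t *\<^sub>R h)) (at t)"
    by (auto intro!: derivative_eq_intros)
  from has_derivative_compose[OF this C1_compact_deriv[OF assms]]
  have "((\<lambda>t. \<phi> (x + t *\<^sub>R h)) has_derivative (\<lambda>s. G (x + t *\<^sub>R h) \<bullet> s *\<^sub>R h)) (at t)" .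
  moreover have "(\<lambda>s. G (x + t *\<^sub>R h) \<bullet> s *\<^sub>R h) = (*) (G (x + t *\<^sub>R h) \<bullet> h)" by auto
  ultimately show ?thesis by (simp add: has_field_derivative_def)
qed

lemma C1_compact_borel:
  assumes "C1_compact \<phi> G"
  shows "\<phi> \<in> borel_measurable borel" "G \<in> borel_measurable borel"
  using C1_compact_cont[OF assms] C1_compact_cont_grad[OF assms] borel_measurable_continuous_onI by blast+

text \<open>The difference is the integral of the derivative along the segment from x to x + h.
  Tonelli's theorem exchanges the integrals, and the inner one does not depend on the position along
  the segment by translation invariance.\<close>

lemma C1_compact_translation_estimate:
  fixes \<phi> :: "'a::euclidean_space \<Rightarrow> real"
  assumes \<phi>: "C1_compact \<phi> G"
  shows "(\<integral>\<^sup>+x. ennreal \<bar>\<phi> (x + h) - \<phi> x\<bar> \<partial>lborel) \<le> ennreal (norm h) * (\<integral>\<^sup>+x. ennreal (norm (G x)) \<partial>lborel)"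
proof -
  note [measurable] = C1_compact_borel[OF \<phi>]
  have cG: "continuous_on UNIV (\<lambda>t. G (x + t *\<^sub>R h))" for x
    by (rule continuous_on_compose2[OF C1_compact_cont_grad[OF \<phi>]]) (auto intro!: continuous_intros)
  have pt: "ennreal \<bar>\<phi> (x + h) - \<phi> x\<bar> \<le> (\<integral>\<^sup>+t. indicator {0..1} t * (ennreal (norm h) * ennreal (norm (G (x + t *\<^sub>R h)))) \<partial>lborel)" for x
  proof -
    define f where "f t = G (x + t *\<^sub>R h) \<bullet> h" for t
    have cf: "continuous_on UNIV f" unfolding f_def by (intro continuous_intros cG)
    have "has_bochner_integral lborel (\<lambda>t. indicator {0..1} t *\<^sub>R f t) (\<phi> (x + 1 *\<^sub>R h) - \<phi> (x + 0 *\<^sub>R h))"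
    proof (rule has_bochner_integral_FTC_Icc)
      show "((\<lambda>t. \<phi> (x + t *\<^sub>R h)) has_vector_derivative f t) (at t within {0..1})" for t
        using C1_compact_line_deriv[OF \<phi>, of x h t] unfolding f_def
        by (metis has_field_derivative_at_within has_real_derivative_iff_has_vector_derivative)
    qed (use continuous_on_subset[OF cf] in auto)
    then have I: "integrable lborel (\<lambda>t. indicator {0..1} t *\<^sub>R f t)" "\<phi> (x + h) - \<phi> x = (LINT t|lborel. indicator {0..1} t *\<^sub>R f t)"
      by (auto simp: has_bochner_integral_iff)
    have "ennreal \<bar>\<phi> (x + h) - \<phi> x\<bar> \<le> ennreal (LINT t|lborel. norm (indicator {0..1} t *\<^sub>R f t))"
      unfolding I(2) using integral_norm_bound[of lborel "\<lambda>t. indicator {0..1} t *\<^sub>R f t"] by (intro ennreal_leI) simp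
    also have "\<dots> = (\<integral>\<^sup>+t. ennreal (norm (indicator {0..1} t *\<^sub>R f t)) \<partial>lborel)"
      using I(1) by (intro nn_integral_eq_integral[symmetric]) auto
    also have "\<dots> \<le> (\<integral>\<^sup>+t. indicator {0..1} t * (ennreal (norm h) * ennreal (norm (G (x + t *\<^sub>R h)))) \<partial>lborel)"
    proof (intro nn_integral_mono)
      fix t
      have "\<bar>f t\<bar> \<le> norm h * norm (G (x + t *\<^sub>R h))"
        unfolding f_def using Cauchy_Schwarz_ineq2 by (metis mult.commute)
      then show "ennreal (norm (indicator {0..1} t *\<^sub>R f t)) \<le> indicator {0..1} t * (ennreal (norm h) * ennreal (norm (G (x + t *\<^sub>R h))))"
        by (auto simp: indicator_def ennreal_mult'[symmetric] intro!: ennreal_leI)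
    qed
    finally show ?thesis .
  qed
  have "(\<integral>\<^sup>+x. ennreal \<bar>\<phi> (x + h) - \<phi> x\<bar> \<partial>lborel)
    \<le> (\<integral>\<^sup>+x. (\<integral>\<^sup>+t. indicator {0..1} t * (ennreal (norm h) * ennreal (norm (G (x + t *\<^sub>R h)))) \<partial>lborel) \<partial>lborel)"
    by (intro nn_integral_mono pt)
  also have "\<dots> = (\<integral>\<^sup>+t. (\<integral>\<^sup>+x. indicator {0..1} t * (ennreal (norm h) * ennreal (norm (G (x + t *\<^sub>R h)))) \<partial>lborel) \<partial>lborel)"
    by (rule lborel_pair.Fubini'[symmetric]) measurable
  also have "\<dots> = (\<integral>\<^sup>+t. indicator {0..1} (t::real) * (ennreal (norm h) * (\<integral>\<^sup>+x. ennreal (norm (G x)) \<partial>lborel)) \<partial>lborel)"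
  proof (rule nn_integral_cong)
    fix t :: real
    have "(\<integral>\<^sup>+x. ennreal (norm (G (x + t *\<^sub>R h))) \<partial>lborel) = (\<integral>\<^sup>+x. ennreal (norm (G x)) \<partial>lborel)"
      by (rule nn_integral_translate) measurable
    then show "(\<integral>\<^sup>+x. indicator {0..1} t * (ennreal (norm h) * ennreal (norm (G (x + t *\<^sub>R h)))) \<partial>lborel)
       = indicator {0..1} t * (ennreal (norm h) * (\<integral>\<^sup>+x. ennreal (norm (G x)) \<partial>lborel))"
      by (simp add: nn_integral_cmult)
  qed
  also have "\<dots> = ennreal (norm h) * (\<integral>\<^sup>+x. ennreal (norm (G x)) \<partial>lborel)"
    by (simp add: nn_integral_multc)
  finally show ?thesis .
qed

text \<open>Not divided by the volume of the ball: in this form the bound and the Lipschitz constant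
  below do not depend on d. The normalisation is made where the averages are compared with the
  function.\<close>

definition ball_average :: "real \<Rightarrow> ('a::euclidean_space \<Rightarrow> real) \<Rightarrow> 'a \<Rightarrow> real" where
  "ball_average d g x = (LINT y|lborel. indicator (ball 0 d) y * g (x + y))"

lemma C1_compact_integrable:
  assumes "C1_compact \<phi> G"
  shows "integrable lborel \<phi>" "integrable lborel G"
proof -
  obtain R where R: "R > 0" "\<And>x. norm x > R \<Longrightarrow> \<phi> x = 0 \<and> G x = 0"
    using C1_compact_vanishing[OF assms] by blast
  show "integrable lborel \<phi>"
    by (rule continuous_bounded_support(1)[where R=R]) (use R C1_compact_cont[OF assms] in auto)
  show "integrable lborel G"
    by (rule continuous_bounded_support(1)[where R=R]) (use R C1_compact_cont_grad[OF assms] in auto)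
qed

lemma integrable_translate:
  fixes \<phi> :: "'a::euclidean_space \<Rightarrow> real"
  assumes "integrable lborel \<phi>"
  shows "integrable lborel (\<lambda>y. \<phi> (x + y))"
proof -
  have L: "(lborel::'a measure) = distr lborel borel ((+) x)" by (rule lborel_distr_plus[symmetric])
  have "\<phi> \<in> borel_measurable borel" using assms by auto
  then show ?thesis
    using assms integrable_distr_eq[of "(+) x" lborel borel \<phi>] by (subst (asm) L) simp
qed

lemma ball_average_integrable:
  fixes \<phi> :: "'a::euclidean_space \<Rightarrow> real"
  assumes "integrable lborel \<phi>"
  shows "integrable lborel (\<lambda>y. indicator (ball 0 d) y * \<phi> (x + y))"
  using integrable_mult_indicator[OF _ integrable_translate[OF assms], of "ball 0 d" x] by simp

text \<open>The averages at x and z differ at most by the L^1 distance between \<phi> and its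
  translate by x - z, so an L^1 bound for the gradient makes averages Lipschitz.\<close>

lemma ball_average_diff_le:
  fixes \<phi> :: "'a::euclidean_space \<Rightarrow> real"
  assumes \<phi>: "C1_compact \<phi> G" and C: "(\<integral>\<^sup>+x. ennreal (norm (G x)) \<partial>lborel) \<le> ennreal C" "C \<ge> 0"
  shows "\<bar>ball_average d \<phi> x - ball_average d \<phi> z\<bar> \<le> norm (x - z) * C"
proof -
  note i = C1_compact_integrable(1)[OF \<phi>]
  note [measurable] = C1_compact_borel[OF \<phi>]
  have "ball_average d \<phi> x - ball_average d \<phi> z = (LINT y|lborel. indicator (ball 0 d) y * \<phi> (x + y) - indicator (ball 0 d) y * \<phi> (z + y))"
    unfolding ball_average_def using ball_average_integrable[OF i] by simp
  then have "ennreal \<bar>ball_average d \<phi> x - ball_average d \<phi> z\<bar> \<le> (\<integral>\<^sup>+y. ennreal (norm (indicator (ball 0 d) y * \<phi> (x + y) - indicator (ball 0 d) y * \<phi> (z + y))) \<partial>lborel)"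
    using integral_norm_bound_ennreal[OF Bochner_Integration.integrable_diff[OF ball_average_integrable[OF i] ball_average_integrable[OF i]]] by simp
  also have "\<dots> \<le> (\<integral>\<^sup>+y. ennreal \<bar>\<phi> (y + z + (x - z)) - \<phi> (y + z)\<bar> \<partial>lborel)"
    by (intro nn_integral_mono ennreal_leI) (auto simp: indicator_def algebra_simps)
  also have "\<dots> = (\<integral>\<^sup>+y. ennreal \<bar>\<phi> (y + (x - z)) - \<phi> y\<bar> \<partial>lborel)"
    by (rule nn_integral_translate) measurable
  also have "\<dots> \<le> ennreal (norm (x - z)) * (\<integral>\<^sup>+x. ennreal (norm (G x)) \<partial>lborel)"
    by (rule C1_compact_translation_estimate[OF \<phi>])
  also have "\<dots> \<le> ennreal (norm (x - z)) * ennreal C" using C by (intro mult_left_mono) auto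
  also have "\<dots> = ennreal (norm (x - z) * C)" using C by (simp add: ennreal_mult)
  finally show ?thesis using C(2) by (subst (asm) ennreal_le_iff) auto
qed

lemma ball_average_le:
  fixes \<phi> :: "'a::euclidean_space \<Rightarrow> real"
  assumes i: "integrable lborel \<phi>" and C: "(\<integral>\<^sup>+x. ennreal \<bar>\<phi> x\<bar> \<partial>lborel) \<le> ennreal C" "C \<ge> 0"
  shows "\<bar>ball_average d \<phi> x\<bar> \<le> C"
proof -
  have [measurable]: "\<phi> \<in> borel_measurable borel" using i by auto
  have "ennreal \<bar>ball_average d \<phi> x\<bar> \<le> (\<integral>\<^sup>+y. ennreal (norm (indicator (ball 0 d) y * \<phi> (x + y))) \<partial>lborel)"
    unfolding ball_average_def using integral_norm_bound_ennreal[OF ball_average_integrable[OF i]] by simp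
  also have "\<dots> \<le> (\<integral>\<^sup>+y. ennreal \<bar>\<phi> (y + x)\<bar> \<partial>lborel)"
    by (intro nn_integral_mono ennreal_leI) (auto simp: indicator_def algebra_simps)
  also have "\<dots> = (\<integral>\<^sup>+y. ennreal \<bar>\<phi> y\<bar> \<partial>lborel)"
    by (rule nn_integral_translate) measurable
  also note C(1)
  finally show ?thesis using C(2) by simp
qed

text \<open>The function minus its mean over the ball is the mean of the differences under
  translations of length less than d, each of which is small in L^1 by the translation
  estimate.\<close>

lemma ball_average_L1:
  fixes \<phi> :: "'a::euclidean_space \<Rightarrow> real"
  assumes \<phi>: "C1_compact \<phi> G" and C: "(\<integral>\<^sup>+x. ennreal (norm (G x)) \<partial>lborel) \<le> ennreal C" "C \<ge> 0" and d: "d > 0"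
  shows "(\<integral>\<^sup>+x. ennreal \<bar>\<phi> x - ball_average d \<phi> x / measure lborel (ball 0 d :: 'a set)\<bar> \<partial>lborel) \<le> ennreal (d * C)"
proof -
  note i = C1_compact_integrable(1)[OF \<phi>]
  note [measurable] = C1_compact_borel[OF \<phi>]
  have [measurable]: "ball (0::'a) d \<in> sets borel" by simp
  define V where "V = measure lborel (ball 0 d :: 'a set)"
  have fin: "emeasure lborel (ball 0 d :: 'a set) < \<infinity>" by (rule emeasure_lborel_ball_finite)
  have eV: "emeasure lborel (ball 0 d :: 'a set) = ennreal V"
    unfolding V_def using fin by (intro emeasure_eq_ennreal_measure) auto
  have V: "V > 0"
    unfolding V_def using d by (simp add: content_ball_pos)
  have iV: "integrable lborel (indicator (ball 0 d) :: 'a \<Rightarrow> real)" using fin by (intro integrable_real_indicator) auto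
  have pt: "ennreal \<bar>\<phi> x - ball_average d \<phi> x / V\<bar> \<le> ennreal (1 / V) * (\<integral>\<^sup>+y. indicator (ball 0 d) y * ennreal \<bar>\<phi> (x + y) - \<phi> x\<bar> \<partial>lborel)" for x
  proof -
    have "V * \<phi> x = (LINT y|lborel. indicator (ball 0 d) (y::'a) * \<phi> x)"
      using iV by (simp add: V_def)
    then have "V * \<phi> x - ball_average d \<phi> x = (LINT y|lborel. indicator (ball 0 d) y * \<phi> x - indicator (ball 0 d) y * \<phi> (x + y))"
      unfolding ball_average_def using ball_average_integrable[OF i] iV by simp
    then have "ennreal \<bar>V * \<phi> x - ball_average d \<phi> x\<bar> \<le> (\<integral>\<^sup>+y. ennreal (norm (indicator (ball 0 d) y * \<phi> x - indicator (ball 0 d) y * \<phi> (x + y))) \<partial>lborel)"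
      using integral_norm_bound_ennreal[OF Bochner_Integration.integrable_diff[OF integrable_mult_left[OF iV] ball_average_integrable[OF i]], of "\<phi> x" d x] by simp
    also have "\<dots> = (\<integral>\<^sup>+y. indicator (ball 0 d) y * ennreal \<bar>\<phi> (x + y) - \<phi> x\<bar> \<partial>lborel)"
      by (intro nn_integral_cong) (auto simp: indicator_def abs_minus_commute)
    finally have "ennreal (1 / V) * ennreal \<bar>V * \<phi> x - ball_average d \<phi> x\<bar> \<le> ennreal (1 / V) * (\<integral>\<^sup>+y. indicator (ball 0 d) y * ennreal \<bar>\<phi> (x + y) - \<phi> x\<bar> \<partial>lborel)"
      by (intro mult_left_mono) auto
    moreover have "1 / V * \<bar>V * \<phi> x - ball_average d \<phi> x\<bar> = \<bar>\<phi> x - ball_average d \<phi> x / V\<bar>"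
    proof -
      have "\<phi> x - ball_average d \<phi> x / V = 1 / V * (V * \<phi> x - ball_average d \<phi> x)" using V by (simp add: field_simps)
      then show ?thesis using V by (simp only: abs_mult) simp
    qed
    ultimately show ?thesis using V by (simp add: ennreal_mult'[symmetric])
  qed
  have "(\<integral>\<^sup>+x. (\<integral>\<^sup>+y. indicator (ball 0 d) y * ennreal \<bar>\<phi> (x + y) - \<phi> x\<bar> \<partial>lborel) \<partial>lborel)
     = (\<integral>\<^sup>+y. (\<integral>\<^sup>+x. indicator (ball 0 d) y * ennreal \<bar>\<phi> (x + y) - \<phi> x\<bar> \<partial>lborel) \<partial>lborel)"
    by (rule lborel_pair.Fubini'[symmetric]) measurable
  also have "\<dots> \<le> (\<integral>\<^sup>+y. ennreal (d * C) * indicator (ball 0 d) (y::'a) \<partial>lborel)"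
  proof (intro nn_integral_mono)
    fix y :: 'a
    have "(\<integral>\<^sup>+x. indicator (ball 0 d) y * ennreal \<bar>\<phi> (x + y) - \<phi> x\<bar> \<partial>lborel) = indicator (ball 0 d) y * (\<integral>\<^sup>+x. ennreal \<bar>\<phi> (x + y) - \<phi> x\<bar> \<partial>lborel)"
      by (rule nn_integral_cmult) measurable
    also have "\<dots> \<le> indicator (ball 0 d) y * (ennreal (norm y) * (\<integral>\<^sup>+x. ennreal (norm (G x)) \<partial>lborel))"
      by (intro mult_left_mono C1_compact_translation_estimate[OF \<phi>]) auto
    also have "\<dots> \<le> indicator (ball 0 d) y * (ennreal (norm y) * ennreal C)"
      using C by (intro mult_left_mono) auto
    also have "\<dots> \<le> ennreal (d * C) * indicator (ball 0 d) y"
      using C by (auto simp: indicator_def ennreal_mult'[symmetric] intro!: ennreal_leI mult_right_mono)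
    finally show "(\<integral>\<^sup>+x. indicator (ball 0 d) y * ennreal \<bar>\<phi> (x + y) - \<phi> x\<bar> \<partial>lborel) \<le> ennreal (d * C) * indicator (ball 0 d) y" .
  qed
  also have "(\<integral>\<^sup>+y. ennreal (d * C) * indicator (ball 0 d) (y::'a) \<partial>lborel) = ennreal (d * C) * ennreal V"
    by (subst nn_integral_cmult_indicator) (auto simp: eV)
  finally have dbl: "(\<integral>\<^sup>+x. (\<integral>\<^sup>+y. indicator (ball 0 d) y * ennreal \<bar>\<phi> (x + y) - \<phi> x\<bar> \<partial>lborel) \<partial>lborel) \<le> ennreal (d * C) * ennreal V" .
  have "(\<integral>\<^sup>+x. ennreal \<bar>\<phi> x - ball_average d \<phi> x / V\<bar> \<partial>lborel)
      \<le> (\<integral>\<^sup>+x. ennreal (1 / V) * (\<integral>\<^sup>+y. indicator (ball 0 d) y * ennreal \<bar>\<phi> (x + y) - \<phi> x\<bar> \<partial>lborel) \<partial>lborel)"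
    by (intro nn_integral_mono pt)
  also have "\<dots> = ennreal (1 / V) * (\<integral>\<^sup>+x. (\<integral>\<^sup>+y. indicator (ball 0 d) y * ennreal \<bar>\<phi> (x + y) - \<phi> x\<bar> \<partial>lborel) \<partial>lborel)"
    by (rule nn_integral_cmult) measurable
  also have "\<dots> \<le> ennreal (1 / V) * (ennreal (d * C) * ennreal V)"
    by (intro mult_left_mono dbl) auto
  also have "\<dots> = ennreal (d * C)"
    using V d C by (simp add: ennreal_mult[symmetric])
  finally show ?thesis unfolding V_def .
qed

text \<open>For each of the radii 1/(k+1) the averages are uniformly bounded and have a common
  Lipschitz constant. A diagonal subsequence converges for all k at the points of a countable dense
  set, hence everywhere. Dominated convergence makes the averages Cauchy in L^1, and by
  \<open>ball_average_L1\<close> the functions stay within a multiple of the radius of them.\<close>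

lemma rellich_L1:
  fixes \<phi> :: "nat \<Rightarrow> 'a::euclidean_space \<Rightarrow> real"
  assumes \<phi>: "\<And>j. C1_compact (\<phi> j) (G j)" and R: "\<And>j x. norm x > R \<Longrightarrow> \<phi> j x = 0"
    and C1: "\<And>j. (\<integral>\<^sup>+x. ennreal \<bar>\<phi> j x\<bar> \<partial>lborel) \<le> ennreal C"
    and C2: "\<And>j. (\<integral>\<^sup>+x. ennreal (norm (G j x)) \<partial>lborel) \<le> ennreal C" and C: "C > 0"
  obtains r where "strict_mono (r::nat \<Rightarrow> nat)"
    "\<And>e. e > 0 \<Longrightarrow> \<exists>n0. \<forall>i\<ge>n0. \<forall>j\<ge>n0. (\<integral>\<^sup>+x. ennreal \<bar>\<phi> (r i) x - \<phi> (r j) x\<bar> \<partial>lborel) \<le> ennreal e"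
proof -
  note [measurable] = C1_compact_borel[OF \<phi>]
  define d where "d k = 1 / real (Suc k)" for k
  have d: "d k > 0" for k by (simp add: d_def)
  define I where "I j k x = ball_average (d k) (\<phi> j) x" for j k x
  have Ib: "\<bar>I j k x\<bar> \<le> C" for j k x
    unfolding I_def by (rule ball_average_le[OF C1_compact_integrable(1)[OF \<phi>] C1]) (use C in simp)
  have Il: "\<bar>I j k x - I j k z\<bar> \<le> norm (x - z) * C" for j k x z
    unfolding I_def by (rule ball_average_diff_le[OF \<phi> C2]) (use C in simp)
  obtain D :: "'a set" where D: "countable D" "\<And>X. open X \<Longrightarrow> X \<noteq> {} \<Longrightarrow> \<exists>y\<in>D. y \<in> X"
    using countable_dense_setE by metis
  have "countable ((UNIV::nat set) \<times> D)" using D(1) by simp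
  then obtain r where r: "strict_mono (r::nat \<Rightarrow> nat)"
    and conv: "\<And>kx. kx \<in> UNIV \<times> D \<Longrightarrow> \<exists>l. (\<lambda>n. I (r n) (fst kx) (snd kx)) \<longlonglongrightarrow> l"
    using function_convergent_subsequence[of "(UNIV::nat set) \<times> D" "\<lambda>n kx. I n (fst kx) (snd kx)" C] Ib by auto
  have "\<exists>l. (\<lambda>n. I (r n) k x) \<longlonglongrightarrow> l" for k x
  proof -
    have "Cauchy (\<lambda>n. I (r n) k x)"
    proof (rule metric_CauchyI)
      fix e :: real assume e: "e > 0"
      have "x \<in> ball x (e / (3 * C))" using e C by simp
      then have "ball x (e / (3 * C)) \<noteq> {}" by blast
      then obtain z where z: "z \<in> D" "z \<in> ball x (e / (3 * C))"
        using D(2)[OF open_ball, of x "e / (3 * C)"] by blast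
      then have zC: "norm (x - z) * C < e / 3" using C by (simp add: dist_norm field_simps)
      have "Cauchy (\<lambda>n. I (r n) k z)" using conv[of "(k, z)"] z(1) by (auto intro: LIMSEQ_imp_Cauchy)
      then obtain n0 where n0: "\<And>m n. m \<ge> n0 \<Longrightarrow> n \<ge> n0 \<Longrightarrow> dist (I (r m) k z) (I (r n) k z) < e / 3"
        using e unfolding Cauchy_def by (metis zero_less_divide_iff zero_less_numeral)
      show "\<exists>M. \<forall>m\<ge>M. \<forall>n\<ge>M. dist (I (r m) k x) (I (r n) k x) < e"
      proof (intro exI[of _ n0] allI impI)
        fix m n assume "m \<ge> n0" "n \<ge> n0"
        from n0[OF this] show "dist (I (r m) k x) (I (r n) k x) < e"
          using Il[of "r m" k x z] Il[of "r n" k x z] zC unfolding dist_real_def by linarith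
      qed
    qed
    then show ?thesis by (simp add: convergent_def Cauchy_convergent_iff flip: convergent_def)
  qed
  then obtain L where L: "(\<lambda>n. I (r n) k x) \<longlonglongrightarrow> L k x" for k x by metis
  have Im [measurable]: "I j k \<in> borel_measurable borel" for j k
  proof -
    have "C-lipschitz_on UNIV (I j k)"
      using Il C by (intro lipschitz_onI) (auto simp: dist_norm mult.commute)
    then show ?thesis using lipschitz_on_continuous_on borel_measurable_continuous_onI by blast
  qed
  have Lm [measurable]: "L k \<in> borel_measurable borel" for k
    by (rule borel_measurable_LIMSEQ_real[OF L]) measurable
  let ?B = "cball (0::'a) R"
  have Bm [measurable]: "?B \<in> sets borel" by simp
  have fB: "emeasure lborel ?B < \<infinity>" by (rule emeasure_lborel_cball_finite)
  \<comment> \<open>The averages need not vanish outside the ball of radius R, but the functions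
    themselves do, so convergence on that ball is enough.\<close>
  have dc: "(\<lambda>n. (\<integral>\<^sup>+x. ennreal (\<bar>I (r n) k x - L k x\<bar> * indicator ?B x) \<partial>lborel)) \<longlonglongrightarrow> (\<integral>\<^sup>+x. 0 \<partial>(lborel::'a measure))" for k
  proof (rule nn_integral_dominated_convergence)
    show "(\<integral>\<^sup>+x. ennreal (2 * C) * indicator ?B x \<partial>lborel) < \<infinity>"
      using fB by (subst nn_integral_cmult_indicator) (auto simp: ennreal_mult_less_top)
    have "\<bar>L k x\<bar> \<le> C" for x
      by (rule LIMSEQ_le_const2[OF tendsto_rabs[OF L]]) (use Ib in auto)
    then have "\<bar>I (r n) k x - L k x\<bar> \<le> 2 * C" for n x
      using Ib[of "r n" k x] by (smt (verit))
    then show "AE x in lborel. ennreal (\<bar>I (r n) k x - L k x\<bar> * indicator ?B x) \<le> ennreal (2 * C) * indicator ?B x" for n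
      by (auto simp: indicator_def intro!: ennreal_leI)
    have "(\<lambda>n. \<bar>I (r n) k x - L k x\<bar> * indicator ?B x) \<longlonglongrightarrow> \<bar>L k x - L k x\<bar> * indicator ?B x" for x
      by (intro tendsto_intros L)
    then have "(\<lambda>n. ennreal (\<bar>I (r n) k x - L k x\<bar> * indicator ?B x)) \<longlonglongrightarrow> ennreal 0" for x
      by (intro tendsto_ennrealI) simp
    then show "AE x in lborel. (\<lambda>n. ennreal (\<bar>I (r n) k x - L k x\<bar> * indicator ?B x)) \<longlonglongrightarrow> 0" by simp
  qed measurable
  define V where "V k = measure lborel (ball 0 (d k) :: 'a set)" for k
  have V: "V k > 0" for k unfolding V_def using d by (simp add: content_ball_pos)
  show ?thesis
  proof (rule that[OF r])
    fix e :: real assume e: "e > 0"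
    obtain k where k: "1 / real (Suc k) < e / (4 * C)"
      using reals_Archimedean[of "e / (4 * C)"] e C by (auto simp: inverse_eq_divide)
    then have dk: "d k * C \<le> e / 4" using C by (simp add: d_def field_simps)
    have "\<forall>\<^sub>F n in sequentially. (\<integral>\<^sup>+x. ennreal (\<bar>I (r n) k x - L k x\<bar> * indicator ?B x) \<partial>lborel) < ennreal (e * V k / 4)"
      by (rule order_tendstoD(2)[OF dc]) (use e V[of k] in simp)
    then obtain n0 where n0: "\<And>n. n \<ge> n0 \<Longrightarrow> (\<integral>\<^sup>+x. ennreal (\<bar>I (r n) k x - L k x\<bar> * indicator ?B x) \<partial>lborel) < ennreal (e * V k / 4)"
      unfolding eventually_sequentially by blast
    have half: "(\<integral>\<^sup>+x. ennreal (\<bar>\<phi> (r i) x - L k x / V k\<bar> * indicator ?B x) \<partial>lborel) \<le> ennreal (e / 2)" if "i \<ge> n0" for i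
    proof -
      have "(\<integral>\<^sup>+x. ennreal (\<bar>\<phi> (r i) x - L k x / V k\<bar> * indicator ?B x) \<partial>lborel)
        \<le> (\<integral>\<^sup>+x. ennreal \<bar>\<phi> (r i) x - I (r i) k x / V k\<bar> + ennreal (1 / V k) * ennreal (\<bar>I (r i) k x - L k x\<bar> * indicator ?B x) \<partial>lborel)"
      proof (intro nn_integral_mono)
        fix x
        have "\<bar>\<phi> (r i) x - L k x / V k\<bar> \<le> \<bar>\<phi> (r i) x - I (r i) k x / V k\<bar> + \<bar>I (r i) k x / V k - L k x / V k\<bar>" by simp
        also have "\<bar>I (r i) k x / V k - L k x / V k\<bar> = 1 / V k * \<bar>I (r i) k x - L k x\<bar>"
          using V[of k] by (simp add: diff_divide_distrib[symmetric] abs_divide)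
        finally have "\<bar>\<phi> (r i) x - L k x / V k\<bar> * indicator ?B x \<le> \<bar>\<phi> (r i) x - I (r i) k x / V k\<bar> + 1 / V k * (\<bar>I (r i) k x - L k x\<bar> * indicator ?B x)"
          by (auto simp: indicator_def)
        then have "ennreal (\<bar>\<phi> (r i) x - L k x / V k\<bar> * indicator ?B x) \<le> ennreal (\<bar>\<phi> (r i) x - I (r i) k x / V k\<bar> + 1 / V k * (\<bar>I (r i) k x - L k x\<bar> * indicator ?B x))"
          by (rule ennreal_leI)
        also have "\<dots> = ennreal \<bar>\<phi> (r i) x - I (r i) k x / V k\<bar> + ennreal (1 / V k) * ennreal (\<bar>I (r i) k x - L k x\<bar> * indicator ?B x)"
          using V[of k] by (subst ennreal_plus) (auto simp: ennreal_mult'[symmetric])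
        finally show "ennreal (\<bar>\<phi> (r i) x - L k x / V k\<bar> * indicator ?B x) \<le> ennreal \<bar>\<phi> (r i) x - I (r i) k x / V k\<bar> + ennreal (1 / V k) * ennreal (\<bar>I (r i) k x - L k x\<bar> * indicator ?B x)" .
      qed
      also have "\<dots> = (\<integral>\<^sup>+x. ennreal \<bar>\<phi> (r i) x - I (r i) k x / V k\<bar> \<partial>lborel) + ennreal (1 / V k) * (\<integral>\<^sup>+x. ennreal (\<bar>I (r i) k x - L k x\<bar> * indicator ?B x) \<partial>lborel)"
        by (subst nn_integral_add) (auto intro!: nn_integral_cmult)
      also have "\<dots> \<le> ennreal (e / 4) + ennreal (1 / V k) * ennreal (e * V k / 4)"
      proof (intro add_mono mult_left_mono)
        have "(\<integral>\<^sup>+x. ennreal \<bar>\<phi> (r i) x - I (r i) k x / V k\<bar> \<partial>lborel) \<le> ennreal (d k * C)"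
          unfolding I_def V_def by (rule ball_average_L1[OF \<phi> C2 _ d]) (use C in simp)
        also have "\<dots> \<le> ennreal (e / 4)" using dk by (rule ennreal_leI)
        finally show "(\<integral>\<^sup>+x. ennreal \<bar>\<phi> (r i) x - I (r i) k x / V k\<bar> \<partial>lborel) \<le> ennreal (e / 4)" .
      qed (use n0[OF that] in auto)
      also have "\<dots> = ennreal (e / 2)"
        using V[of k] e by (simp add: ennreal_mult'[symmetric] ennreal_plus[symmetric] del: ennreal_plus)
      finally show ?thesis .
    qed
    show "\<exists>n0. \<forall>i\<ge>n0. \<forall>j\<ge>n0. (\<integral>\<^sup>+x. ennreal \<bar>\<phi> (r i) x - \<phi> (r j) x\<bar> \<partial>lborel) \<le> ennreal e"
    proof (intro exI[of _ n0] allI impI)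
      fix i j assume ij: "i \<ge> n0" "j \<ge> n0"
      have "(\<integral>\<^sup>+x. ennreal \<bar>\<phi> (r i) x - \<phi> (r j) x\<bar> \<partial>lborel)
        \<le> (\<integral>\<^sup>+x. ennreal (\<bar>\<phi> (r i) x - L k x / V k\<bar> * indicator ?B x) + ennreal (\<bar>\<phi> (r j) x - L k x / V k\<bar> * indicator ?B x) \<partial>lborel)"
      proof (intro nn_integral_mono)
        fix x
        have "\<bar>\<phi> (r i) x - \<phi> (r j) x\<bar> \<le> \<bar>\<phi> (r i) x - L k x / V k\<bar> * indicator ?B x + \<bar>\<phi> (r j) x - L k x / V k\<bar> * indicator ?B x"
          using R[of x] by (auto simp: indicator_def not_le)
        then show "ennreal \<bar>\<phi> (r i) x - \<phi> (r j) x\<bar> \<le> ennreal (\<bar>\<phi> (r i) x - L k x / V k\<bar> * indicator ?B x) + ennreal (\<bar>\<phi> (r j) x - L k x / V k\<bar> * indicator ?B x)"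
          by (simp add: ennreal_plus[symmetric] ennreal_leI del: ennreal_plus)
      qed
      also have "\<dots> = (\<integral>\<^sup>+x. ennreal (\<bar>\<phi> (r i) x - L k x / V k\<bar> * indicator ?B x) \<partial>lborel) + (\<integral>\<^sup>+x. ennreal (\<bar>\<phi> (r j) x - L k x / V k\<bar> * indicator ?B x) \<partial>lborel)"
        by (rule nn_integral_add) measurable
      also have "\<dots> \<le> ennreal (e / 2) + ennreal (e / 2)"
        by (intro add_mono half ij)
      also have "\<dots> = ennreal e" using e by (simp add: ennreal_plus[symmetric] del: ennreal_plus)
      finally show "(\<integral>\<^sup>+x. ennreal \<bar>\<phi> (r i) x - \<phi> (r j) x\<bar> \<partial>lborel) \<le> ennreal e" .
    qed
  qed
qed

subsection \<open>Integrals of powers and convergence\<close>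

text \<open>The power of the L^r norm without the root, as an extended real: finiteness is then a
  property of the value and not a side condition. The triangle inequality holds up to a factor
  \<open>2 powr r\<close>, which is harmless for convergence to 0.\<close>

definition powr_integral :: "'x measure \<Rightarrow> real \<Rightarrow> ('x \<Rightarrow> 'b::euclidean_space) \<Rightarrow> ennreal" where
  "powr_integral M r g = (\<integral>\<^sup>+x. ennreal (norm (g x) powr r) \<partial>M)"

lemma ennreal_pos_dense_real:
  assumes "0 < (e::ennreal)"
  shows "\<exists>e'. ennreal e' < e \<and> e' > 0"
proof -
  obtain c where c: "0 < c" "c < e" using dense[OF assms] by blast
  then have "c < top" using less_trans less_top top_greatest by (metis not_less order_le_less)
  with c show ?thesis by (intro exI[of _ "enn2real c"]) (simp add: enn2real_positive_iff)
qed

lemma powr_add_le: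
  assumes "a \<ge> 0" "b \<ge> 0" "r \<ge> (0::real)"
  shows "(a + b) powr r \<le> 2 powr r * (a powr r + b powr r)"
proof -
  have "(a + b) powr r \<le> (2 * max a b) powr r" using assms by (intro powr_mono2) auto
  also have "\<dots> = 2 powr r * max a b powr r" using assms by (simp add: powr_mult)
  also have "\<dots> \<le> 2 powr r * (a powr r + b powr r)" by (intro mult_left_mono) (auto simp: max_def)
  finally show ?thesis .
qed

lemma powr_integral_add_le:
  fixes g h :: "'x \<Rightarrow> 'b::euclidean_space"
  assumes [measurable]: "g \<in> borel_measurable M" "h \<in> borel_measurable M" and r: "r \<ge> 0"
  shows "powr_integral M r (\<lambda>x. g x + h x) \<le> ennreal (2 powr r) * (powr_integral M r g + powr_integral M r h)"
proof -
  have "powr_integral M r (\<lambda>x. g x + h x) \<le> (\<integral>\<^sup>+x. ennreal (2 powr r) * (ennreal (norm (g x) powr r) + ennreal (norm (h x) powr r)) \<partial>M)"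
    unfolding powr_integral_def
  proof (intro nn_integral_mono)
    fix x
    have "norm (g x + h x) powr r \<le> (norm (g x) + norm (h x)) powr r"
      using r by (intro powr_mono2 norm_triangle_ineq) auto
    also have "\<dots> \<le> 2 powr r * (norm (g x) powr r + norm (h x) powr r)" using r by (intro powr_add_le) auto
    finally have "ennreal (norm (g x + h x) powr r) \<le> ennreal (2 powr r * (norm (g x) powr r + norm (h x) powr r))"
      by (rule ennreal_leI)
    then show "ennreal (norm (g x + h x) powr r) \<le> ennreal (2 powr r) * (ennreal (norm (g x) powr r) + ennreal (norm (h x) powr r))"
      by (simp add: ennreal_mult)
  qed
  also have "\<dots> = ennreal (2 powr r) * (powr_integral M r g + powr_integral M r h)"
    unfolding powr_integral_def by (simp add: nn_integral_cmult nn_integral_add)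
  finally show ?thesis .
qed

lemma powr_integral_minus: "powr_integral M r (\<lambda>x. - g x) = powr_integral M r g"
  by (simp add: powr_integral_def)

lemma powr_integral_diff_le:
  fixes g h :: "'x \<Rightarrow> 'b::euclidean_space"
  assumes "g \<in> borel_measurable M" "h \<in> borel_measurable M" "r \<ge> 0"
  shows "powr_integral M r (\<lambda>x. g x - h x) \<le> ennreal (2 powr r) * (powr_integral M r g + powr_integral M r h)"
  using powr_integral_add_le[of g M "\<lambda>x. - h x" r] assms by (simp add: powr_integral_minus)

lemma powr_integral_scaleR:
  assumes [measurable]: "g \<in> borel_measurable M"
  shows "powr_integral M r (\<lambda>x. c *\<^sub>R g x) = ennreal (\<bar>c\<bar> powr r) * powr_integral M r g"
  unfolding powr_integral_def by (simp add: powr_mult ennreal_mult nn_integral_cmult)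

lemma powr_integral_mono:
  assumes "\<And>x. x \<in> space M \<Longrightarrow> norm (g x) \<le> norm (h x)" "r \<ge> 0"
  shows "powr_integral M r g \<le> powr_integral M r h"
  unfolding powr_integral_def using assms by (intro nn_integral_mono ennreal_leI powr_mono2) auto

text \<open>Below the height K nothing is lost; above it the lower power is at most K^(b-a) times
  the higher one. With K small this compares exponents on a finite measure space, with K large it
  yields equi-integrability.\<close>

lemma powr_le_split:
  assumes "t \<ge> 0" "K > (0::real)" "0 < b" "b \<le> a"
  shows "t powr b \<le> min t K powr b + K powr (b - a) * t powr a"
proof (cases "t \<le> K")
  case False
  then have "t powr b = t powr (b - a) * t powr a" using assms by (simp add: powr_add[symmetric])
  also have "\<dots> \<le> K powr (b - a) * t powr a"
    using False assms by (intro mult_right_mono powr_mono2') auto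
  finally show ?thesis by (simp add: add_increasing)
qed simp

lemma powr_integral_le_split:
  fixes g :: "'x \<Rightarrow> 'b::euclidean_space"
  assumes [measurable]: "g \<in> borel_measurable M" and K: "K > 0" "0 < b" "b \<le> a"
  shows "powr_integral M b g \<le> (\<integral>\<^sup>+x. ennreal (min (norm (g x)) K powr b) \<partial>M) + ennreal (K powr (b - a)) * powr_integral M a g"
proof -
  have "powr_integral M b g \<le> (\<integral>\<^sup>+x. ennreal (min (norm (g x)) K powr b) + ennreal (K powr (b - a)) * ennreal (norm (g x) powr a) \<partial>M)"
    unfolding powr_integral_def using powr_le_split[OF norm_ge_zero K]
    by (intro nn_integral_mono) (simp add: ennreal_mult[symmetric] ennreal_plus[symmetric] ennreal_leI del: ennreal_plus)
  also have "\<dots> = (\<integral>\<^sup>+x. ennreal (min (norm (g x)) K powr b) \<partial>M) + ennreal (K powr (b - a)) * powr_integral M a g"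
    unfolding powr_integral_def by (simp add: nn_integral_cmult nn_integral_add)
  finally show ?thesis .
qed

lemma powr_integral_le_lower_exponent:
  fixes g :: "'x \<Rightarrow> 'b::euclidean_space"
  assumes [measurable]: "g \<in> borel_measurable M" and K: "K > 0" "0 < b" "b \<le> a"
  shows "powr_integral M b g \<le> ennreal (K powr b) * emeasure M (space M) + ennreal (K powr (b - a)) * powr_integral M a g"
proof -
  have "(\<integral>\<^sup>+x. ennreal (min (norm (g x)) K powr b) \<partial>M) \<le> (\<integral>\<^sup>+x. ennreal (K powr b) \<partial>M)"
    using K by (intro nn_integral_mono ennreal_leI powr_mono2) auto
  then have "(\<integral>\<^sup>+x. ennreal (min (norm (g x)) K powr b) \<partial>M) \<le> ennreal (K powr b) * emeasure M (space M)" by simp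
  then show ?thesis using powr_integral_le_split[OF assms] by (meson add_right_mono order_trans)
qed

text \<open>Here K is taken small: the part below K contributes at most K^b times the total mass,
  and for this fixed K the other part tends to 0 by assumption.\<close>

lemma powr_integral_tendsto_lower_exponent:
  fixes F :: "nat \<Rightarrow> 'x \<Rightarrow> 'b::euclidean_space"
  assumes "finite_measure M" and [measurable]: "\<And>n. F n \<in> borel_measurable M" and b: "0 < b" "b \<le> a"
    and lim: "(\<lambda>n. powr_integral M a (F n)) \<longlonglongrightarrow> 0"
  shows "(\<lambda>n. powr_integral M b (F n)) \<longlonglongrightarrow> 0"
proof (rule order_tendstoI)
  fix e :: ennreal assume e: "0 < e"
  interpret finite_measure M by fact
  obtain e' where e': "ennreal e' < e" "e' > 0"
  using ennreal_pos_dense_real[OF e] by blast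
  define m where "m = measure M (space M)"
  have em: "emeasure M (space M) = ennreal m" by (simp add: m_def emeasure_eq_measure)
  have m0: "m \<ge> 0" by (simp add: m_def)
  define K where "K = (e' / (2 * (m + 1))) powr (1 / b)"
  have K: "K > 0" using e' m0 by (simp add: K_def)
  have Kb: "K powr b * m \<le> e' / 2"
  proof -
    have "K powr b = e' / (2 * (m + 1))" using b e' m0 by (simp add: K_def powr_powr)
    then have "K powr b * m = (e' / 2) * (m / (m + 1))" by simp
    also have "\<dots> \<le> (e' / 2) * 1" using m0 e' by (intro mult_left_mono) auto
    finally show ?thesis by simp
  qed
  have "(\<lambda>n. ennreal (K powr (b - a)) * powr_integral M a (F n)) \<longlonglongrightarrow> ennreal (K powr (b - a)) * 0"
    by (intro ennreal_tendsto_cmult lim) simp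
  then have "(\<lambda>n. ennreal (K powr (b - a)) * powr_integral M a (F n)) \<longlonglongrightarrow> 0" by simp
  then have "\<forall>\<^sub>F n in sequentially. ennreal (K powr (b - a)) * powr_integral M a (F n) < ennreal (e' / 2)"
    by (rule order_tendstoD(2)) (use e' in simp)
  then show "\<forall>\<^sub>F n in sequentially. powr_integral M b (F n) < e"
  proof eventually_elim
    case (elim n)
    have "powr_integral M b (F n) \<le> ennreal (K powr b) * ennreal m + ennreal (K powr (b - a)) * powr_integral M a (F n)"
      using powr_integral_le_lower_exponent[OF _ K b, of "F n" M] em by simp
    also have "\<dots> \<le> ennreal (e' / 2) + ennreal (e' / 2)"
      using elim Kb m0 by (intro add_mono) (auto simp: ennreal_mult[symmetric] intro!: ennreal_leI)
    also have "\<dots> = ennreal e'" using e' by (simp add: ennreal_plus[symmetric] del: ennreal_plus)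
    finally show ?case using e' by simp
  qed
qed simp

lemma powr_integral_AE_subseq:
  fixes F :: "nat \<Rightarrow> 'x \<Rightarrow> 'b::euclidean_space"
  assumes [measurable]: "\<And>n. F n \<in> borel_measurable M" and r: "r > 0"
    and lim: "(\<lambda>n. powr_integral M r (F n)) \<longlonglongrightarrow> 0"
  obtains s where "strict_mono (s::nat\<Rightarrow>nat)" "AE x in M. (\<lambda>n. F (s n) x) \<longlonglongrightarrow> 0"
proof -
  have "\<forall>\<^sub>F n in sequentially. powr_integral M r (F n) < 1" by (rule order_tendstoD(2)[OF lim]) simp
  then obtain n0 where n0: "\<And>n. n \<ge> n0 \<Longrightarrow> powr_integral M r (F n) < 1" unfolding eventually_sequentially by blast
  \<comment> \<open>The shift by n0 discards the terms whose integral might be infinite.\<close>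
  define u where "u n x = norm (F (n + n0) x) powr r" for n x
  have i: "integrable M (u n)" for n
    unfolding u_def using n0[of "n + n0"] less_trans[OF _ ennreal_one_less_top]
    by (intro integrableI_nonneg) (auto simp: powr_integral_def)
  have e: "ennreal (LINT x|M. norm (u n x)) = powr_integral M r (F (n + n0))" for n
    unfolding powr_integral_def using nn_integral_eq_integral[OF i[of n]] by (simp add: u_def[abs_def])
  have "(\<lambda>n. ennreal (LINT x|M. norm (u n x))) \<longlonglongrightarrow> ennreal 0"
    unfolding e using LIMSEQ_ignore_initial_segment[OF lim] by simp
  then have "(\<lambda>n. LINT x|M. norm (u n x)) \<longlonglongrightarrow> 0"
    by (subst (asm) tendsto_ennreal_iff) auto
  from tendsto_L1_AE_subseq[OF i this]
  obtain s where s: "strict_mono s" "AE x in M. (\<lambda>n. u (s n) x) \<longlonglongrightarrow> 0" by blast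
  have "AE x in M. (\<lambda>n. F (s n + n0) x) \<longlonglongrightarrow> 0"
    using s(2)
  proof eventually_elim
    case (elim x)
    have "(\<lambda>n. u (s n) x powr (1 / r)) \<longlonglongrightarrow> 0 powr (1 / r)"
      using r by (intro tendsto_powr' elim tendsto_const) (auto simp: u_def)
    then have "(\<lambda>n. norm (F (s n + n0) x)) \<longlonglongrightarrow> 0" using r by (simp add: u_def powr_powr)
    then show ?case by (rule tendsto_norm_zero_cancel)
  qed
  then show ?thesis
    using s(1) by (intro that[of "\<lambda>n. s n + n0"]) (auto simp: strict_mono_def)
qed

lemma powr_integral_Fatou:
  fixes F :: "nat \<Rightarrow> 'x \<Rightarrow> 'b::euclidean_space"
  assumes [measurable]: "\<And>n. F n \<in> borel_measurable M" and r: "r > 0"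
    and lim: "AE x in M. (\<lambda>n. F n x) \<longlonglongrightarrow> g x" and le: "\<forall>\<^sub>F n in sequentially. powr_integral M r (F n) \<le> C"
  shows "powr_integral M r g \<le> C"
proof -
  have "powr_integral M r g = (\<integral>\<^sup>+x. liminf (\<lambda>n. ennreal (norm (F n x) powr r)) \<partial>M)"
    unfolding powr_integral_def
  proof (rule nn_integral_cong_AE, use lim in eventually_elim)
    case (elim x)
    have "(\<lambda>n. norm (F n x) powr r) \<longlonglongrightarrow> norm (g x) powr r"
      using r by (intro tendsto_powr' tendsto_intros elim) auto
    then have "(\<lambda>n. ennreal (norm (F n x) powr r)) \<longlonglongrightarrow> ennreal (norm (g x) powr r)" by (rule tendsto_ennrealI)
    then show ?case by (intro lim_imp_Liminf[symmetric]) auto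
  qed
  also have "\<dots> \<le> liminf (\<lambda>n. powr_integral M r (F n))"
    unfolding powr_integral_def by (rule nn_integral_liminf) measurable
  also have "\<dots> \<le> liminf (\<lambda>n::nat. C)" by (rule Liminf_mono) (rule le)
  also have "\<dots> = C" by (simp add: Liminf_const)
  finally show ?thesis .
qed

text \<open>A uniform bound for a higher exponent takes the place of equi-integrability. Here K is
  large: the part above K is uniformly small, and the part cut at K converges by dominated
  convergence.\<close>

lemma powr_integral_vitali:
  fixes F :: "nat \<Rightarrow> 'x \<Rightarrow> 'b::euclidean_space"
  assumes "finite_measure M" and [measurable]: "\<And>n. F n \<in> borel_measurable M" "g \<in> borel_measurable M"
    and ab: "0 < b" "b < a"
    and lim: "AE x in M. (\<lambda>n. F n x) \<longlonglongrightarrow> g x" and le: "\<And>n. powr_integral M a (F n) \<le> ennreal C"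
  shows "(\<lambda>n. powr_integral M b (\<lambda>x. F n x - g x)) \<longlonglongrightarrow> 0"
proof (rule order_tendstoI)
  fix e :: ennreal assume e: "0 < e"
  interpret finite_measure M by fact
  obtain e' where e': "ennreal e' < e" "e' > 0"
  using ennreal_pos_dense_real[OF e] by blast
  \<comment> \<open>\<open>ennreal\<close> sends negative reals to 0, so C may be replaced by its
    positive part.\<close>
  define C' where "C' = max C 0"
  have C': "ennreal C = ennreal C'" "C' \<ge> 0" by (auto simp: C'_def max_def ennreal_neg)
  have g: "powr_integral M a g \<le> ennreal C'"
    using le ab lim C' by (intro powr_integral_Fatou[of F]) auto
  define D where "D = 2 powr a * (2 * C')"
  have D0: "D \<ge> 0" using C' by (simp add: D_def)
  have D: "powr_integral M a (\<lambda>x. F n x - g x) \<le> ennreal D" for n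
  proof -
    have "powr_integral M a (\<lambda>x. F n x - g x) \<le> ennreal (2 powr a) * (powr_integral M a (F n) + powr_integral M a g)"
      using ab by (intro powr_integral_diff_le) auto
    also have "\<dots> \<le> ennreal (2 powr a) * (ennreal C' + ennreal C')"
      using le C' g by (intro mult_left_mono add_mono) auto
    also have "\<dots> = ennreal D" using C' by (simp add: D_def ennreal_mult[symmetric] ennreal_plus[symmetric] del: ennreal_plus)
    finally show ?thesis .
  qed
  define K where "K = ((e' / (2 * (D + 1)))) powr (1 / (b - a))"
  have K: "K > 0" using e' D0 by (simp add: K_def)
  have KD: "K powr (b - a) * D \<le> e' / 2"
  proof -
    have "K powr (b - a) = e' / (2 * (D + 1))" using ab e' D0 by (simp add: K_def powr_powr)
    then have "K powr (b - a) * D = (e' / 2) * (D / (D + 1))" by simp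
    also have "\<dots> \<le> (e' / 2) * 1" using D0 e' by (intro mult_left_mono) auto
    finally show ?thesis by simp
  qed
  have "(\<lambda>n. (\<integral>\<^sup>+x. ennreal (min (norm (F n x - g x)) K powr b) \<partial>M)) \<longlonglongrightarrow> (\<integral>\<^sup>+x. 0 \<partial>M)"
  proof (rule nn_integral_dominated_convergence)
    show "(\<integral>\<^sup>+x. ennreal (K powr b) \<partial>M) < \<infinity>"
      using emeasure_finite[of "space M"] by (simp add: ennreal_mult_less_top ennreal_mult_eq_top_iff less_top[symmetric])
    show "AE x in M. ennreal (min (norm (F n x - g x)) K powr b) \<le> ennreal (K powr b)" for n
      using K ab by (auto intro!: ennreal_leI powr_mono2)
    show "AE x in M. (\<lambda>n. ennreal (min (norm (F n x - g x)) K powr b)) \<longlonglongrightarrow> 0"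
      using lim
    proof eventually_elim
      case (elim x)
      have "(\<lambda>n. norm (F n x - g x)) \<longlonglongrightarrow> 0" using elim LIM_zero tendsto_norm_zero by blast
      then have "(\<lambda>n. min (norm (F n x - g x)) K) \<longlonglongrightarrow> min 0 K" by (intro tendsto_min tendsto_const)
      then have "(\<lambda>n. min (norm (F n x - g x)) K) \<longlonglongrightarrow> 0" using K by simp
      then have "(\<lambda>n. min (norm (F n x - g x)) K powr b) \<longlonglongrightarrow> 0 powr b"
        using ab K by (intro tendsto_powr' tendsto_const) auto
      then have "(\<lambda>n. ennreal (min (norm (F n x - g x)) K powr b)) \<longlonglongrightarrow> ennreal 0"
        using ab by (intro tendsto_ennrealI) simp
      then show ?case by simp
    qed
  qed measurable
  then have "\<forall>\<^sub>F n in sequentially. (\<integral>\<^sup>+x. ennreal (min (norm (F n x - g x)) K powr b) \<partial>M) < ennreal (e' / 2)"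
    by (intro order_tendstoD(2)) (use e' in auto)
  then show "\<forall>\<^sub>F n in sequentially. powr_integral M b (\<lambda>x. F n x - g x) < e"
  proof eventually_elim
    case (elim n)
    have "powr_integral M b (\<lambda>x. F n x - g x) \<le> (\<integral>\<^sup>+x. ennreal (min (norm (F n x - g x)) K powr b) \<partial>M) + ennreal (K powr (b - a)) * powr_integral M a (\<lambda>x. F n x - g x)"
      using K ab by (intro powr_integral_le_split) auto
    also have "\<dots> \<le> ennreal (e' / 2) + ennreal (K powr (b - a)) * ennreal D"
      using elim D by (intro add_mono mult_left_mono) auto
    also have "\<dots> = ennreal (e' / 2 + K powr (b - a) * D)"
      using D0 e' by (simp add: ennreal_mult)
    also have "\<dots> \<le> ennreal e'" using KD by (intro ennreal_leI) simp
    finally show ?case using e' by simp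
  qed
qed simp

lemma powr_integral_1_tendsto_integral:
  fixes F :: "nat \<Rightarrow> 'x \<Rightarrow> 'b::euclidean_space"
  assumes "\<And>n. integrable M (F n)" "integrable M g"
    and "(\<lambda>n. powr_integral M 1 (\<lambda>x. F n x - g x)) \<longlonglongrightarrow> 0"
  shows "(\<lambda>n. LINT x|M. F n x) \<longlonglongrightarrow> (LINT x|M. g x)"
  using assms by (intro tendsto_L1_int) (auto simp: powr_integral_def)

lemma integrable_of_powr_integral:
  fixes g :: "'x \<Rightarrow> 'b::euclidean_space"
  assumes "finite_measure M" and [measurable]: "g \<in> borel_measurable M" and "a \<ge> 1" "powr_integral M a g < \<infinity>"
  shows "integrable M g"
proof -
  interpret finite_measure M by fact
  have "powr_integral M 1 g \<le> ennreal (1 powr 1) * emeasure M (space M) + ennreal (1 powr (1 - a)) * powr_integral M a g"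
    using assms by (intro powr_integral_le_lower_exponent) auto
  also have "\<dots> < \<infinity>" using assms(4) by (simp add: less_top[symmetric])
  finally have "(\<integral>\<^sup>+x. ennreal (norm (g x)) \<partial>M) < \<infinity>" by (simp add: powr_integral_def)
  then show ?thesis by (intro integrableI_bounded) auto
qed

lemma integral_vitali:
  fixes F :: "nat \<Rightarrow> 'x \<Rightarrow> 'b::euclidean_space"
  assumes M: "finite_measure M" and m: "\<And>n. F n \<in> borel_measurable M" "g \<in> borel_measurable M" and a: "a > 1"
    and lim: "AE x in M. (\<lambda>n. F n x) \<longlonglongrightarrow> g x" and le: "\<And>n. powr_integral M a (F n) \<le> ennreal C"
  shows "integrable M g" "(\<lambda>n. LINT x|M. F n x) \<longlonglongrightarrow> (LINT x|M. g x)"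
proof -
  have "powr_integral M a g \<le> ennreal C"
    using le a lim m by (intro powr_integral_Fatou[of F]) auto
  then have f: "powr_integral M a g < \<infinity>" "powr_integral M a (F n) < \<infinity>" for n
    using le[of n] by (auto simp: less_top[symmetric] top_unique)
  show i: "integrable M g"
    by (rule integrable_of_powr_integral[OF M m(2) _ f(1)]) (use a in simp)
  have "integrable M (F n)" for n
    by (rule integrable_of_powr_integral[OF M m(1) _ f(2)]) (use a in simp)
  then show "(\<lambda>n. LINT x|M. F n x) \<longlonglongrightarrow> (LINT x|M. g x)"
    by (intro powr_integral_1_tendsto_integral i powr_integral_vitali[OF M m _ a lim le]) auto
qed

text \<open>The Cauchy property descends to exponent 1, where an almost everywhere convergent
  subsequence is available. Fatou's lemma, applied to F n minus that subsequence with n fixed,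
  transfers the Cauchy bound in exponent r to the distance between F n and the limit.\<close>

lemma powr_integral_complete:
  fixes F :: "nat \<Rightarrow> 'x \<Rightarrow> 'b::euclidean_space"
  assumes M: "finite_measure M" and i: "\<And>n. integrable M (F n)" and r: "r \<ge> 1"
    and cauchy: "\<And>e. e > 0 \<Longrightarrow> \<exists>n0. \<forall>i\<ge>n0. \<forall>j\<ge>n0. powr_integral M r (\<lambda>x. F i x - F j x) \<le> ennreal e"
  obtains g s where "g \<in> borel_measurable M" "strict_mono (s::nat\<Rightarrow>nat)" "AE x in M. (\<lambda>n. F (s n) x) \<longlonglongrightarrow> g x"
    "(\<lambda>n. powr_integral M r (\<lambda>x. F n x - g x)) \<longlonglongrightarrow> 0"
proof -
  interpret finite_measure M by fact
  have [measurable]: "F n \<in> borel_measurable M" for n using i by auto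
  have "\<exists>n0. \<forall>i\<ge>n0. \<forall>j\<ge>n0. (LINT x|M. norm (F i x - F j x)) < e" if e: "e > 0" for e
  proof -
    define m where "m = measure M (space M)"
    have em: "emeasure M (space M) = ennreal m" by (simp add: m_def emeasure_eq_measure)
    have m0: "m \<ge> 0" by (simp add: m_def)
    define K where "K = e / (4 * (m + 1))"
    have K: "K > 0" using e m0 by (simp add: K_def)
    have Km: "K * m \<le> e / 4"
    proof -
      have "K * m = (e / 4) * (m / (m + 1))" by (simp add: K_def)
      also have "\<dots> \<le> (e / 4) * 1" using m0 e by (intro mult_left_mono) auto
      finally show ?thesis by simp
    qed
    obtain n0 where n0: "\<And>i j. i \<ge> n0 \<Longrightarrow> j \<ge> n0 \<Longrightarrow> powr_integral M r (\<lambda>x. F i x - F j x) \<le> ennreal (e / 4 * K powr (r - 1))"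
      using cauchy[of "e / 4 * K powr (r - 1)"] e K by auto
    have "(LINT x|M. norm (F i x - F j x)) < e" if "i \<ge> n0" "j \<ge> n0" for i j
    proof -
      have "ennreal (LINT x|M. norm (F i x - F j x)) = powr_integral M 1 (\<lambda>x. F i x - F j x)"
        unfolding powr_integral_def using i by (subst nn_integral_eq_integral[symmetric]) auto
      also have "\<dots> \<le> ennreal (K powr 1) * emeasure M (space M) + ennreal (K powr (1 - r)) * powr_integral M r (\<lambda>x. F i x - F j x)"
        using K r by (intro powr_integral_le_lower_exponent) auto
      also have "\<dots> \<le> ennreal K * ennreal m + ennreal (K powr (1 - r)) * ennreal (e / 4 * K powr (r - 1))"
        using n0[OF that] K unfolding em by (intro add_mono mult_left_mono) auto
      also have "\<dots> = ennreal (K * m + K powr (1 - r) * (e / 4 * K powr (r - 1)))"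
        using K m0 e by (subst ennreal_plus) (auto simp: ennreal_mult[symmetric] simp del: ennreal_plus)
      also have "K powr (1 - r) * (e / 4 * K powr (r - 1)) = e / 4"
        using K by (simp add: mult.left_commute powr_add[symmetric])
      finally have "(LINT x|M. norm (F i x - F j x)) \<le> K * m + e / 4"
        using K m0 e by (subst (asm) ennreal_le_iff) auto
      then show ?thesis using Km e by simp
    qed
    then show ?thesis by blast
  qed
  then obtain s where s: "strict_mono s" "AE x in M. Cauchy (\<lambda>n. F (s n) x)"
    using cauchy_L1_AE_cauchy_subseq[of M F] i by blast
  define g where "g x = lim (\<lambda>n. F (s n) x)" for x
  have gm [measurable]: "g \<in> borel_measurable M"
    unfolding g_def by (rule borel_measurable_lim_metric) measurable
  have lim: "AE x in M. (\<lambda>n. F (s n) x) \<longlonglongrightarrow> g x"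
    using s(2) by eventually_elim (simp add: g_def Cauchy_convergent_iff convergent_LIMSEQ_iff)
  have "(\<lambda>n. powr_integral M r (\<lambda>x. F n x - g x)) \<longlonglongrightarrow> 0"
  proof (rule order_tendstoI)
    fix e :: ennreal assume e: "0 < e"
    obtain e' where e': "ennreal e' < e" "e' > 0"
    using ennreal_pos_dense_real[OF e] by blast
    obtain n0 where n0: "\<And>i j. i \<ge> n0 \<Longrightarrow> j \<ge> n0 \<Longrightarrow> powr_integral M r (\<lambda>x. F i x - F j x) \<le> ennreal e'"
      using cauchy[OF e'(2)] by blast
    show "\<forall>\<^sub>F n in sequentially. powr_integral M r (\<lambda>x. F n x - g x) < e"
      unfolding eventually_sequentially
    proof (intro exI[of _ n0] allI impI)
      fix n assume n: "n \<ge> n0"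
      have "powr_integral M r (\<lambda>x. F n x - g x) \<le> ennreal e'"
      proof (rule powr_integral_Fatou[of "\<lambda>k x. F n x - F (s k) x"])
        show "AE x in M. (\<lambda>k. F n x - F (s k) x) \<longlonglongrightarrow> F n x - g x"
          using lim by eventually_elim (intro tendsto_intros)
        show "\<forall>\<^sub>F k in sequentially. powr_integral M r (\<lambda>x. F n x - F (s k) x) \<le> ennreal e'"
          unfolding eventually_sequentially
        proof (intro exI[of _ n0] allI impI)
          fix k assume "k \<ge> n0"
          then have "s k \<ge> n0" using seq_suble[OF s(1), of k] by simp
          then show "powr_integral M r (\<lambda>x. F n x - F (s k) x) \<le> ennreal e'" using n0 n by blast
        qed
      qed (use r in auto)
      then show "powr_integral M r (\<lambda>x. F n x - g x) < e" using e' by simp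
    qed
  qed simp
  with gm s(1) lim show ?thesis using that by blast
qed

subsection \<open>Closure of the test functions\<close>

lemma grad_add:
  assumes "f differentiable (at x)" "g differentiable (at x)"
  shows "grad (\<lambda>x. f x + g x) x = grad f x + grad g x"
  by (rule grad_eqI) (use has_derivative_add[OF assms[THEN has_derivative_grad]] in \<open>simp add: inner_add_left\<close>)

lemma grad_cmult:
  assumes "f differentiable (at x)"
  shows "grad (\<lambda>x. c * f x) x = c *\<^sub>R grad f x"
  by (rule grad_eqI) (use has_derivative_mult_right[OF assms[THEN has_derivative_grad]] in simp)

lemma grad_compose:
  assumes "(P has_real_derivative d) (at (f x))" "f differentiable (at x)"
  shows "grad (\<lambda>x. P (f x)) x = d *\<^sub>R grad f x"
proof (rule grad_eqI)
  show "((\<lambda>x. P (f x)) has_derivative (\<lambda>v. (d *\<^sub>R grad f x) \<bullet> v)) (at x)"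
    using has_derivative_compose[OF has_derivative_grad[OF assms(2)] assms(1)[unfolded has_field_derivative_def]]
    by simp
qed

lemma compact_subset_closed: "compact A \<Longrightarrow> closed B \<Longrightarrow> B \<subseteq> A \<Longrightarrow> compact B"
  using compact_Int_closed[of A B] by (simp add: Int_absorb1)

lemma test_functionsI:
  assumes "\<And>k. C_k k g" "\<phi> \<in> test_functions \<Omega>" "\<And>x. \<phi> x = 0 \<Longrightarrow> g x = 0"
  shows "g \<in> test_functions \<Omega>"
proof -
  have sub: "closure {x. g x \<noteq> 0} \<subseteq> closure {x. \<phi> x \<noteq> 0}"
    using assms(3) by (intro closure_mono) auto
  then have "compact (closure {x. g x \<noteq> 0})"
    by (rule compact_subset_closed[OF test_functions_compact(1)[OF assms(2)] closed_closure])
  then show ?thesis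
    using sub test_functions_compact(2)[OF assms(2)] assms(1) unfolding test_functions_def by auto
qed

lemma test_functions_zero [simp]: "(\<lambda>x. 0) \<in> test_functions \<Omega>"
  unfolding test_functions_def by simp

lemma test_functions_cmult: "\<phi> \<in> test_functions \<Omega> \<Longrightarrow> (\<lambda>x. c * \<phi> x) \<in> test_functions \<Omega>"
  by (rule test_functionsI[where \<phi>=\<phi>]) (auto intro: C_k_cmult test_functions_C_k)

lemma test_functions_compose:
  assumes "\<phi> \<in> test_functions \<Omega>" "\<And>k. C_k k P" "P 0 = 0"
  shows "(\<lambda>x. P (\<phi> x)) \<in> test_functions \<Omega>"
  by (rule test_functionsI[OF C_k_compose[OF assms(2) test_functions_C_k[OF assms(1)]] assms(1)]) (simp add: assms(3))

lemma test_functions_add: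
  assumes "\<phi> \<in> test_functions \<Omega>" "\<eta> \<in> test_functions \<Omega>"
  shows "(\<lambda>x. \<phi> x + \<eta> x) \<in> test_functions \<Omega>"
proof -
  let ?A = "closure {x. \<phi> x \<noteq> 0}" and ?B = "closure {x. \<eta> x \<noteq> 0}"
  have sub: "closure {x. \<phi> x + \<eta> x \<noteq> 0} \<subseteq> ?A \<union> ?B"
    unfolding closure_Un[symmetric] by (intro closure_mono) auto
  moreover have "compact (?A \<union> ?B)"
    using test_functions_compact(1)[OF assms(1)] test_functions_compact(1)[OF assms(2)] by (rule compact_Un)
  ultimately have "compact (closure {x. \<phi> x + \<eta> x \<noteq> 0})"
    by (rule compact_subset_closed[OF _ closed_closure, rotated])
  moreover have "closure {x. \<phi> x + \<eta> x \<noteq> 0} \<subseteq> \<Omega>"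
    by (rule order_trans[OF sub Un_least[OF test_functions_compact(2)[OF assms(1)] test_functions_compact(2)[OF assms(2)]]])
  moreover have "C_k k (\<lambda>x. \<phi> x + \<eta> x)" for k
    by (rule C_k_add[OF test_functions_C_k[OF assms(1)] test_functions_C_k[OF assms(2)]])
  ultimately show ?thesis
    unfolding test_functions_def by simp
qed

lemma test_functions_grad_eq_0:
  assumes "\<phi> \<in> test_functions \<Omega>" "x \<notin> \<Omega>"
  shows "grad \<phi> x = 0"
proof (rule grad_eqI)
  have d0: "((\<lambda>_. 0) has_derivative (\<lambda>v. 0 \<bullet> v)) (at x)" by simp
  show "(\<phi> has_derivative (\<lambda>v. 0 \<bullet> v)) (at x)"
  proof (rule has_derivative_transform_within_open[OF d0])
    show "open (- closure {x. \<phi> x \<noteq> 0})" by (rule open_Compl[OF closed_closure])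
    show "x \<in> - closure {x. \<phi> x \<noteq> 0}" using test_functions_compact(2)[OF assms(1)] assms(2) by auto
    show "0 = \<phi> y" if "y \<in> - closure {x. \<phi> x \<noteq> 0}" for y
      using that closure_subset[of "{x. \<phi> x \<noteq> 0}"] by auto
  qed
qed

lemma test_functions_bounded:
  assumes "\<phi> \<in> test_functions \<Omega>"
  obtains B where "B > 0" "\<And>x. \<bar>\<phi> x\<bar> \<le> B" "\<And>x. norm (grad \<phi> x) \<le> B"
proof -
  note C = C1_compact_test[OF assms]
  obtain R where R: "R > 0" "\<And>x. norm x > R \<Longrightarrow> \<phi> x = 0 \<and> grad \<phi> x = 0"
    using C1_compact_vanishing[OF C] by blast
  obtain B1 where "B1 > 0" "\<And>x. norm (\<phi> x) \<le> B1"
    using continuous_bounded_support(2)[OF C1_compact_cont[OF C], of R] R by auto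
  moreover obtain B2 where "B2 > 0" "\<And>x. norm (grad \<phi> x) \<le> B2"
    using continuous_bounded_support(2)[OF C1_compact_cont_grad[OF C], of R] R by auto
  ultimately show ?thesis
    by (intro that[of "max B1 B2"]) (auto simp: le_max_iff_disj)
qed

lemma borel_measurable_lebesgue_on_borel:
  assumes "f \<in> borel_measurable borel"
  shows "f \<in> borel_measurable (lebesgue_on \<Omega>)"
  using assms by (intro measurable_restrict_space1 measurable_completion) simp

lemma nn_integral_lebesgue_on_eq_lborel:
  fixes g :: "'a::euclidean_space \<Rightarrow> ennreal"
  assumes \<Omega>: "open \<Omega>" and g: "g \<in> borel_measurable borel" and 0: "\<And>x. x \<notin> \<Omega> \<Longrightarrow> g x = 0"
  shows "(\<integral>\<^sup>+x. g x \<partial>lebesgue_on \<Omega>) = (\<integral>\<^sup>+x. g x \<partial>lborel)"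
proof -
  have "(\<integral>\<^sup>+x. g x \<partial>lebesgue_on \<Omega>) = (\<integral>\<^sup>+x. g x * indicator \<Omega> x \<partial>lebesgue)"
    using \<Omega> by (intro nn_integral_restrict_space) auto
  also have "\<dots> = (\<integral>\<^sup>+x. g x \<partial>lebesgue)"
    using 0 by (intro nn_integral_cong) (auto simp: indicator_def)
  also have "\<dots> = (\<integral>\<^sup>+x. g x \<partial>lborel)"
    by (rule nn_integral_completion)
  finally show ?thesis .
qed

lemma integral_lebesgue_on_eq_lborel:
  fixes g :: "'a::euclidean_space \<Rightarrow> real"
  assumes \<Omega>: "open \<Omega>" and g: "g \<in> borel_measurable borel" and 0: "\<And>x. x \<notin> \<Omega> \<Longrightarrow> g x = 0"
  shows "(LINT x|lebesgue_on \<Omega>. g x) = (LINT x|lborel. g x)"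
proof -
  have "(LINT x|lebesgue_on \<Omega>. g x) = (LINT x|lebesgue. indicator \<Omega> x *\<^sub>R g x)"
    using \<Omega> by (intro integral_restrict_space) auto
  also have "\<dots> = (LINT x|lebesgue. g x)"
    using 0 by (intro Bochner_Integration.integral_cong) (auto simp: indicator_def)
  also have "\<dots> = (LINT x|lborel. g x)"
    using g by (intro integral_completion) simp
  finally show ?thesis .
qed

lemma powr_integral_tendsto_0_add:
  fixes F G :: "nat \<Rightarrow> 'x \<Rightarrow> 'b::euclidean_space"
  assumes "\<And>n. F n \<in> borel_measurable M" "\<And>n. G n \<in> borel_measurable M" "r \<ge> 0"
    "(\<lambda>n. powr_integral M r (F n)) \<longlonglongrightarrow> 0" "(\<lambda>n. powr_integral M r (G n)) \<longlonglongrightarrow> 0"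
  shows "(\<lambda>n. powr_integral M r (\<lambda>x. F n x + G n x)) \<longlonglongrightarrow> 0"
proof -
  have "(\<lambda>n. ennreal (2 powr r) * (powr_integral M r (F n) + powr_integral M r (G n))) \<longlonglongrightarrow> ennreal (2 powr r) * (0 + 0)"
    by (intro ennreal_tendsto_cmult tendsto_add assms) simp
  then have "(\<lambda>n. ennreal (2 powr r) * (powr_integral M r (F n) + powr_integral M r (G n))) \<longlonglongrightarrow> 0" by simp
  then show ?thesis
    by (rule tendsto_sandwich[OF _ _ tendsto_const, rotated 2])
      (intro always_eventually allI zero_le powr_integral_add_le assms)+
qed

lemma ennreal_cmult_add_less_top: "a < \<infinity> \<Longrightarrow> b < 1 \<Longrightarrow> ennreal c * (a + b) < \<infinity>"
  using less_trans[OF _ ennreal_one_less_top, of b] by (simp add: ennreal_mult_less_top)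

section \<open>Functions with zero boundary values on a bounded open set\<close>

locale bounded_open =
  fixes \<Omega> :: "'a::euclidean_space set"
  assumes open_dom: "open \<Omega>" and bounded_dom: "bounded \<Omega>"
begin

abbreviation "M \<equiv> lebesgue_on \<Omega>"

lemma finite_M: "finite_measure M"
proof
  obtain R where "\<forall>x\<in>\<Omega>. norm x \<le> R" using bounded_dom unfolding bounded_iff by blast
  then have "\<Omega> \<subseteq> cball 0 R" by auto
  then have "emeasure lborel \<Omega> \<le> emeasure lborel (cball (0::'a) R)" by (intro emeasure_mono) auto
  also have "\<dots> < \<infinity>" by (rule emeasure_lborel_cball_finite)
  finally have "emeasure lborel \<Omega> < \<infinity>" .
  then have "emeasure lebesgue \<Omega> < \<infinity>" using open_dom by (subst emeasure_completion) auto
  then have "emeasure M \<Omega> < \<infinity>" using open_dom by (subst emeasure_restrict_space) auto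
  then show "emeasure M (space M) \<noteq> \<infinity>" by (simp add: space_restrict_space)
qed

sublocale finite_measure M by (rule finite_M)

lemma test_measurable:
  assumes "\<phi> \<in> test_functions \<Omega>"
  shows "\<phi> \<in> borel_measurable M" "grad \<phi> \<in> borel_measurable M"
  using C1_compact_borel[OF C1_compact_test[OF assms]] by (auto intro: borel_measurable_lebesgue_on_borel)

text \<open>\<open>weak0 r u U\<close> says that \<open>u\<close> lies in \<open>W\<^sub>0\<^bsup>1,r\<^esup>(\<Omega>)\<close> and has the weak gradient \<open>U\<close>.\<close>

definition weak0 :: "real \<Rightarrow> ('a \<Rightarrow> real) \<Rightarrow> ('a \<Rightarrow> 'a) \<Rightarrow> bool" where
  "weak0 r u U \<longleftrightarrow> u \<in> borel_measurable M \<and> U \<in> borel_measurable M \<and>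
     (\<exists>\<phi>. (\<forall>n. \<phi> n \<in> test_functions \<Omega>) \<and>
       (\<lambda>n. powr_integral M r (\<lambda>x. \<phi> n x - u x)) \<longlonglongrightarrow> 0 \<and>
       (\<lambda>n. powr_integral M r (\<lambda>x. grad (\<phi> n) x - U x)) \<longlonglongrightarrow> 0)"

lemma weak0_measurable: "weak0 r u U \<Longrightarrow> u \<in> borel_measurable M" "weak0 r u U \<Longrightarrow> U \<in> borel_measurable M"
  by (simp_all add: weak0_def)

lemma weak0_test: "\<phi> \<in> test_functions \<Omega> \<Longrightarrow> weak0 r \<phi> (grad \<phi>)"
  unfolding weak0_def by (intro conjI exI[of _ "\<lambda>_. \<phi>"] test_measurable) (simp_all add: powr_integral_def)

text \<open>A diagonal argument: for each n take a test function within 1/(n+1) of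
  \<open>u n\<close>, gradients included. Every limit function below enters the closure of the test
  functions in this way.\<close>

lemma weak0_closed:
  assumes r: "r \<ge> 0" and w: "\<And>n. weak0 r (u n) (U n)" and m: "v \<in> borel_measurable M" "V \<in> borel_measurable M"
    and lim: "(\<lambda>n. powr_integral M r (\<lambda>x. u n x - v x)) \<longlonglongrightarrow> 0" "(\<lambda>n. powr_integral M r (\<lambda>x. U n x - V x)) \<longlonglongrightarrow> 0"
  shows "weak0 r v V"
proof -
  have "\<exists>\<phi>. \<phi> \<in> test_functions \<Omega> \<and> powr_integral M r (\<lambda>x. \<phi> x - u n x) < ennreal (1 / real (Suc n)) \<and>
     powr_integral M r (\<lambda>x. grad \<phi> x - U n x) < ennreal (1 / real (Suc n))" for n
  proof -
    obtain \<phi> where \<phi>: "\<And>n. \<phi> n \<in> test_functions \<Omega>"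
      "(\<lambda>k. powr_integral M r (\<lambda>x. \<phi> k x - u n x)) \<longlonglongrightarrow> 0" "(\<lambda>k. powr_integral M r (\<lambda>x. grad (\<phi> k) x - U n x)) \<longlonglongrightarrow> 0"
      using w[of n] unfolding weak0_def by blast
    have "(0::ennreal) < ennreal (1 / real (Suc n))" by simp
    from eventually_conj[OF order_tendstoD(2)[OF \<phi>(2) this] order_tendstoD(2)[OF \<phi>(3) this]]
    obtain k where "powr_integral M r (\<lambda>x. \<phi> k x - u n x) < ennreal (1 / real (Suc n))"
      "powr_integral M r (\<lambda>x. grad (\<phi> k) x - U n x) < ennreal (1 / real (Suc n))"
      unfolding eventually_sequentially by blast
    with \<phi>(1) show ?thesis by blast
  qed
  then obtain \<phi> where \<phi>: "\<And>n. \<phi> n \<in> test_functions \<Omega>"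
    "\<And>n. powr_integral M r (\<lambda>x. \<phi> n x - u n x) < ennreal (1 / real (Suc n))"
    "\<And>n. powr_integral M r (\<lambda>x. grad (\<phi> n) x - U n x) < ennreal (1 / real (Suc n))"
    by metis
  have z: "(\<lambda>n. ennreal (1 / real (Suc n))) \<longlonglongrightarrow> 0"
    using tendsto_ennrealI[OF LIMSEQ_Suc[OF lim_1_over_n]] by simp
  have 1: "(\<lambda>n. powr_integral M r (\<lambda>x. \<phi> n x - u n x)) \<longlonglongrightarrow> 0"
    by (rule tendsto_sandwich[OF _ _ tendsto_const z]) (intro always_eventually allI zero_le less_imp_le \<phi>)+
  have 2: "(\<lambda>n. powr_integral M r (\<lambda>x. grad (\<phi> n) x - U n x)) \<longlonglongrightarrow> 0"
    by (rule tendsto_sandwich[OF _ _ tendsto_const z]) (intro always_eventually allI zero_le less_imp_le \<phi>)+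
  note [measurable] = m test_measurable[OF \<phi>(1)] weak0_measurable[OF w]
  have "(\<lambda>n. powr_integral M r (\<lambda>x. (\<phi> n x - u n x) + (u n x - v x))) \<longlonglongrightarrow> 0"
    by (rule powr_integral_tendsto_0_add[OF _ _ r 1 lim(1)]) measurable
  moreover have "(\<lambda>n. powr_integral M r (\<lambda>x. (grad (\<phi> n) x - U n x) + (U n x - V x))) \<longlonglongrightarrow> 0"
    by (rule powr_integral_tendsto_0_add[OF _ _ r 2 lim(2)]) measurable
  ultimately have lim': "(\<lambda>n. powr_integral M r (\<lambda>x. \<phi> n x - v x)) \<longlonglongrightarrow> 0"
    "(\<lambda>n. powr_integral M r (\<lambda>x. grad (\<phi> n) x - V x)) \<longlonglongrightarrow> 0"
    by (simp_all only: diff_add_cancel add_diff_eq)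
  show ?thesis
    unfolding weak0_def by (intro conjI exI[of _ \<phi>] m allI \<phi>(1) lim')
qed

lemma weak0_add:
  assumes r: "r \<ge> 0" and w: "weak0 r u U" "weak0 r v V"
  shows "weak0 r (\<lambda>x. u x + v x) (\<lambda>x. U x + V x)"
proof -
  obtain \<phi> where \<phi>: "\<And>n. \<phi> n \<in> test_functions \<Omega>"
      "(\<lambda>k. powr_integral M r (\<lambda>x. \<phi> k x - u x)) \<longlonglongrightarrow> 0" "(\<lambda>k. powr_integral M r (\<lambda>x. grad (\<phi> k) x - U x)) \<longlonglongrightarrow> 0"
    using w(1) unfolding weak0_def by blast
  obtain \<eta> where \<eta>: "\<And>n. \<eta> n \<in> test_functions \<Omega>"
      "(\<lambda>k. powr_integral M r (\<lambda>x. \<eta> k x - v x)) \<longlonglongrightarrow> 0" "(\<lambda>k. powr_integral M r (\<lambda>x. grad (\<eta> k) x - V x)) \<longlonglongrightarrow> 0"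
    using w(2) unfolding weak0_def by blast
  note [measurable] = weak0_measurable[OF w(1)] weak0_measurable[OF w(2)] test_measurable[OF \<phi>(1)] test_measurable[OF \<eta>(1)]
  have g: "grad (\<lambda>x. \<phi> n x + \<eta> n x) x = grad (\<phi> n) x + grad (\<eta> n) x" for n x
    by (intro grad_add test_functions_differentiable[OF \<phi>(1)] test_functions_differentiable[OF \<eta>(1)])
  have "(\<lambda>n. powr_integral M r (\<lambda>x. (\<phi> n x - u x) + (\<eta> n x - v x))) \<longlonglongrightarrow> 0"
    by (rule powr_integral_tendsto_0_add[OF _ _ r \<phi>(2) \<eta>(2)]) measurable
  moreover have "(\<lambda>n. powr_integral M r (\<lambda>x. (grad (\<phi> n) x - U x) + (grad (\<eta> n) x - V x))) \<longlonglongrightarrow> 0"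
    by (rule powr_integral_tendsto_0_add[OF _ _ r \<phi>(3) \<eta>(3)]) measurable
  moreover have "(\<lambda>x. (\<phi> n x - u x) + (\<eta> n x - v x)) = (\<lambda>x. \<phi> n x + \<eta> n x - (u x + v x))"
    "(\<lambda>x. (grad (\<phi> n) x - U x) + (grad (\<eta> n) x - V x)) = (\<lambda>x. grad (\<lambda>x. \<phi> n x + \<eta> n x) x - (U x + V x))" for n
    unfolding g by (simp_all add: fun_eq_iff)
  ultimately have lim: "(\<lambda>n. powr_integral M r (\<lambda>x. \<phi> n x + \<eta> n x - (u x + v x))) \<longlonglongrightarrow> 0"
    "(\<lambda>n. powr_integral M r (\<lambda>x. grad (\<lambda>x. \<phi> n x + \<eta> n x) x - (U x + V x))) \<longlonglongrightarrow> 0"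
    by (simp_all only:)
  show ?thesis
    unfolding weak0_def
    by (intro conjI exI[of _ "\<lambda>n x. \<phi> n x + \<eta> n x"] allI test_functions_add \<phi>(1) \<eta>(1) lim) measurable
qed

lemma weak0_cmult:
  assumes w: "weak0 r u U"
  shows "weak0 r (\<lambda>x. c * u x) (\<lambda>x. c *\<^sub>R U x)"
proof -
  obtain \<phi> where \<phi>: "\<And>n. \<phi> n \<in> test_functions \<Omega>"
      "(\<lambda>k. powr_integral M r (\<lambda>x. \<phi> k x - u x)) \<longlonglongrightarrow> 0" "(\<lambda>k. powr_integral M r (\<lambda>x. grad (\<phi> k) x - U x)) \<longlonglongrightarrow> 0"
    using w(1) unfolding weak0_def by blast
  note [measurable] = weak0_measurable[OF w(1)] test_measurable[OF \<phi>(1)]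
  have g: "grad (\<lambda>x. c * \<phi> n x) x = c *\<^sub>R grad (\<phi> n) x" for n x
    by (intro grad_cmult test_functions_differentiable[OF \<phi>(1)])
  have "(\<lambda>n. powr_integral M r (\<lambda>x. c *\<^sub>R (\<phi> n x - u x))) \<longlonglongrightarrow> ennreal (\<bar>c\<bar> powr r) * 0"
  proof -
    have "powr_integral M r (\<lambda>x. c *\<^sub>R (\<phi> n x - u x)) = ennreal (\<bar>c\<bar> powr r) * powr_integral M r (\<lambda>x. \<phi> n x - u x)" for n
      by (rule powr_integral_scaleR) measurable
    then show ?thesis by (simp only:) (rule ennreal_tendsto_cmult[OF _ \<phi>(2)], simp)
  qed
  moreover have "(\<lambda>n. powr_integral M r (\<lambda>x. c *\<^sub>R (grad (\<phi> n) x - U x))) \<longlonglongrightarrow> ennreal (\<bar>c\<bar> powr r) * 0"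
  proof -
    have "powr_integral M r (\<lambda>x. c *\<^sub>R (grad (\<phi> n) x - U x)) = ennreal (\<bar>c\<bar> powr r) * powr_integral M r (\<lambda>x. grad (\<phi> n) x - U x)" for n
      by (rule powr_integral_scaleR) measurable
    then show ?thesis by (simp only:) (rule ennreal_tendsto_cmult[OF _ \<phi>(3)], simp)
  qed
  moreover have "(\<lambda>x. c *\<^sub>R (\<phi> n x - u x)) = (\<lambda>x. c * \<phi> n x - c * u x)"
    "(\<lambda>x. c *\<^sub>R (grad (\<phi> n) x - U x)) = (\<lambda>x. grad (\<lambda>x. c * \<phi> n x) x - c *\<^sub>R U x)" for n
    unfolding g by (simp_all add: fun_eq_iff right_diff_distrib scaleR_diff_right)
  ultimately have lim: "(\<lambda>n. powr_integral M r (\<lambda>x. c * \<phi> n x - c * u x)) \<longlonglongrightarrow> 0"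
    "(\<lambda>n. powr_integral M r (\<lambda>x. grad (\<lambda>x. c * \<phi> n x) x - c *\<^sub>R U x)) \<longlonglongrightarrow> 0"
    by (simp_all only: mult_zero_right)
  show ?thesis
    unfolding weak0_def
    by (intro conjI exI[of _ "\<lambda>n x. c * \<phi> n x"] allI test_functions_cmult \<phi>(1) lim) measurable
qed

lemma weak0_diff:
  assumes "r \<ge> 0" "weak0 r u U" "weak0 r v V"
  shows "weak0 r (\<lambda>x. u x - v x) (\<lambda>x. U x - V x)"
  using weak0_add[OF assms(1,2) weak0_cmult[OF assms(3), of "-1"]] by simp

lemma weak0_lower_exponent:
  assumes "weak0 p u U" "0 < r" "r \<le> p"
  shows "weak0 r u U"
proof -
  obtain \<phi> where \<phi>: "\<And>n. \<phi> n \<in> test_functions \<Omega>"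
      "(\<lambda>k. powr_integral M p (\<lambda>x. \<phi> k x - u x)) \<longlonglongrightarrow> 0" "(\<lambda>k. powr_integral M p (\<lambda>x. grad (\<phi> k) x - U x)) \<longlonglongrightarrow> 0"
    using assms(1) unfolding weak0_def by blast
  note [measurable] = weak0_measurable[OF assms(1)] test_measurable[OF \<phi>(1)]
  show ?thesis
    unfolding weak0_def using \<phi>(1)
    by (intro conjI exI[of _ \<phi>] powr_integral_tendsto_lower_exponent[OF finite_M _ assms(2,3) \<phi>(2)]
       powr_integral_tendsto_lower_exponent[OF finite_M _ assms(2,3) \<phi>(3)]) auto
qed

lemma powr_integral_bounded:
  assumes "\<And>x. x \<in> \<Omega> \<Longrightarrow> norm (g x) \<le> B" "r \<ge> 0"
  shows "powr_integral M r g < \<infinity>"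
proof -
  have "powr_integral M r g \<le> (\<integral>\<^sup>+x. ennreal (B powr r) \<partial>M)"
    unfolding powr_integral_def using assms
    by (intro nn_integral_mono ennreal_leI powr_mono2) (auto simp: space_restrict_space)
  also have "\<dots> < \<infinity>"
    using emeasure_finite[of "space M"] by (simp add: ennreal_mult_less_top less_top[symmetric] ennreal_mult_eq_top_iff)
  finally show ?thesis .
qed

text \<open>Some approximating test function is at distance less than 1, and it has bounded values
  and gradient on a set of finite measure.\<close>

lemma weak0_finite:
  assumes w: "weak0 r u U" and r: "r \<ge> 0"
  shows "powr_integral M r u < \<infinity>" "powr_integral M r U < \<infinity>"
proof -
  obtain \<phi> where \<phi>: "\<And>n. \<phi> n \<in> test_functions \<Omega>"
      "(\<lambda>k. powr_integral M r (\<lambda>x. \<phi> k x - u x)) \<longlonglongrightarrow> 0" "(\<lambda>k. powr_integral M r (\<lambda>x. grad (\<phi> k) x - U x)) \<longlonglongrightarrow> 0"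
    using w(1) unfolding weak0_def by blast
  note [measurable] = weak0_measurable[OF w] test_measurable[OF \<phi>(1)]
  have "(0::ennreal) < 1" by simp
  from eventually_conj[OF order_tendstoD(2)[OF \<phi>(2) this] order_tendstoD(2)[OF \<phi>(3) this]]
  obtain k where k: "powr_integral M r (\<lambda>x. \<phi> k x - u x) < 1" "powr_integral M r (\<lambda>x. grad (\<phi> k) x - U x) < 1"
    unfolding eventually_sequentially by blast
  obtain B where B: "B > 0" "\<And>x. \<bar>\<phi> k x\<bar> \<le> B" "\<And>x. norm (grad (\<phi> k) x) \<le> B"
    using test_functions_bounded[OF \<phi>(1)[of k]] by blast
  have f: "powr_integral M r (\<phi> k) < \<infinity>" "powr_integral M r (grad (\<phi> k)) < \<infinity>"
    by (rule powr_integral_bounded[where B=B]; use B r in simp)+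
  have "powr_integral M r (\<lambda>x. \<phi> k x - (\<phi> k x - u x)) \<le> ennreal (2 powr r) * (powr_integral M r (\<phi> k) + powr_integral M r (\<lambda>x. \<phi> k x - u x))"
    by (rule powr_integral_diff_le[OF _ _ r]) measurable
  also have "\<dots> < \<infinity>" using f(1) k(1) by (rule ennreal_cmult_add_less_top)
  finally show "powr_integral M r u < \<infinity>" by simp
  have "powr_integral M r (\<lambda>x. grad (\<phi> k) x - (grad (\<phi> k) x - U x)) \<le> ennreal (2 powr r) * (powr_integral M r (grad (\<phi> k)) + powr_integral M r (\<lambda>x. grad (\<phi> k) x - U x))"
    by (rule powr_integral_diff_le[OF _ _ r]) measurable
  also have "\<dots> < \<infinity>" using f(2) k(2) by (rule ennreal_cmult_add_less_top)
  finally show "powr_integral M r U < \<infinity>" by simp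
qed

lemma weak0_AE_approx:
  assumes w: "weak0 r u U" and r: "r > 0"
  obtains \<phi> where "\<And>n. \<phi> n \<in> test_functions \<Omega>"
    "(\<lambda>k. powr_integral M r (\<lambda>x. \<phi> k x - u x)) \<longlonglongrightarrow> 0" "(\<lambda>k. powr_integral M r (\<lambda>x. grad (\<phi> k) x - U x)) \<longlonglongrightarrow> 0"
    "AE x in M. (\<lambda>n. \<phi> n x) \<longlonglongrightarrow> u x" "AE x in M. (\<lambda>n. grad (\<phi> n) x) \<longlonglongrightarrow> U x"
proof -
  obtain \<phi> where \<phi>: "\<And>n. \<phi> n \<in> test_functions \<Omega>"
      "(\<lambda>k. powr_integral M r (\<lambda>x. \<phi> k x - u x)) \<longlonglongrightarrow> 0" "(\<lambda>k. powr_integral M r (\<lambda>x. grad (\<phi> k) x - U x)) \<longlonglongrightarrow> 0"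
    using w(1) unfolding weak0_def by blast
  note [measurable] = weak0_measurable[OF w] test_measurable[OF \<phi>(1)]
  have m1: "(\<lambda>x. \<phi> n x - u x) \<in> borel_measurable M" for n by measurable
  obtain s where s: "strict_mono (s::nat\<Rightarrow>nat)" "AE x in M. (\<lambda>n. \<phi> (s n) x - u x) \<longlonglongrightarrow> 0"
    by (rule powr_integral_AE_subseq[OF m1 r \<phi>(2)])
  have l: "(\<lambda>k. powr_integral M r (\<lambda>x. grad (\<phi> (s k)) x - U x)) \<longlonglongrightarrow> 0"
    using LIMSEQ_subseq_LIMSEQ[OF \<phi>(3) s(1)] by (simp add: o_def)
  have m2: "(\<lambda>x. grad (\<phi> (s n)) x - U x) \<in> borel_measurable M" for n by measurable
  obtain t where t: "strict_mono (t::nat\<Rightarrow>nat)" "AE x in M. (\<lambda>n. grad (\<phi> (s (t n))) x - U x) \<longlonglongrightarrow> 0"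
    by (rule powr_integral_AE_subseq[OF m2 r l])
  have st: "strict_mono (s \<circ> t)" using s(1) t(1) by (rule strict_mono_o)
  show ?thesis
  proof (rule that[of "\<lambda>n. \<phi> (s (t n))"])
    show "(\<lambda>k. powr_integral M r (\<lambda>x. \<phi> (s (t k)) x - u x)) \<longlonglongrightarrow> 0"
      using LIMSEQ_subseq_LIMSEQ[OF \<phi>(2) st] by (simp add: o_def)
    show "(\<lambda>k. powr_integral M r (\<lambda>x. grad (\<phi> (s (t k))) x - U x)) \<longlonglongrightarrow> 0"
      using LIMSEQ_subseq_LIMSEQ[OF \<phi>(3) st] by (simp add: o_def)
    show "AE x in M. (\<lambda>n. \<phi> (s (t n)) x) \<longlonglongrightarrow> u x"
      using s(2)
    proof eventually_elim
      case (elim x)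
      then have "(\<lambda>n. \<phi> (s n) x) \<longlonglongrightarrow> u x" by (rule LIM_zero_cancel)
      from LIMSEQ_subseq_LIMSEQ[OF this t(1)] show ?case by (simp add: o_def)
    qed
    show "AE x in M. (\<lambda>n. grad (\<phi> (s (t n))) x) \<longlonglongrightarrow> U x"
      using t(2) by eventually_elim (rule LIM_zero_cancel)
  qed (rule \<phi>(1))
qed

end

text \<open>Convexity at the point a + b = (1 - t) (a / (1 - t)) + t (b / t), obtained by adding two
  tangent inequalities at that point. As t tends to 0 the coefficient of a^p tends to 1, which the
  crude factor 2^p of \<open>powr_add_le\<close> cannot achieve.\<close>

lemma powr_convex_ineq:
  assumes "a \<ge> 0" "b \<ge> 0" "p > (1::real)" "0 < t" "t < 1"
  shows "(a + b) powr p \<le> (1 - t) powr (1 - p) * a powr p + t powr (1 - p) * b powr p"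
proof -
  define x y where "x = a / (1 - t)" and "y = b / t"
  define z where "z = a + b"
  have xy: "x \<ge> 0" "y \<ge> 0" "z \<ge> 0" "z = (1 - t) * x + t * y" using assms by (auto simp: x_def y_def z_def)
  have "p * z powr (p - 1) * x \<le> (p - 1) * z powr p + x powr p" "p * z powr (p - 1) * y \<le> (p - 1) * z powr p + y powr p"
    using xy assms by (auto intro: Young_powr)
  then have "(1 - t) * (p * z powr (p - 1) * x) + t * (p * z powr (p - 1) * y) \<le> (1 - t) * ((p - 1) * z powr p + x powr p) + t * ((p - 1) * z powr p + y powr p)"
    using assms by (intro add_mono mult_left_mono) auto
  also have "(1 - t) * (p * z powr (p - 1) * x) + t * (p * z powr (p - 1) * y) = p * (z powr (p - 1) * z)"
    unfolding xy(4) by (simp add: algebra_simps)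
  also have "z powr (p - 1) * z = z powr p"
    using xy assms by (cases "z = 0") (auto simp: powr_diff)
  also have "(1 - t) * ((p - 1) * z powr p + x powr p) + t * ((p - 1) * z powr p + y powr p) = (p - 1) * z powr p + (1 - t) * x powr p + t * y powr p"
    by (simp add: algebra_simps)
  finally have "z powr p \<le> (1 - t) * x powr p + t * y powr p" by (simp add: algebra_simps)
  also have "(1 - t) * x powr p = (1 - t) powr (1 - p) * a powr p"
    using assms by (simp add: x_def powr_divide powr_diff)
  also have "t * y powr p = t powr (1 - p) * b powr p"
    using assms by (simp add: y_def powr_divide powr_diff)
  finally show ?thesis by (simp add: z_def)
qed

text \<open>Hardy's inequality has to reach the closure of the test functions with its sharp
  constant, so no factor may be lost here. For fixed t the convexity inequality loses only (1 -
  t)^(1-p) in the limit, and then t tends to 0.\<close>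

lemma powr_integral_liminf_le:
  fixes F :: "nat \<Rightarrow> 'x \<Rightarrow> 'b::euclidean_space"
  assumes [measurable]: "\<And>n. F n \<in> borel_measurable M" "g \<in> borel_measurable M" and p: "p > 1"
    and lim: "(\<lambda>n. powr_integral M p (\<lambda>x. F n x - g x)) \<longlonglongrightarrow> 0"
  shows "liminf (\<lambda>n. powr_integral M p (F n)) \<le> powr_integral M p g"
proof (cases "powr_integral M p g")
  case (real A)
  define L where "L = liminf (\<lambda>n. powr_integral M p (F n))"
  have bound: "L \<le> ennreal ((1 - t) powr (1 - p) * A)" if t: "0 < t" "t < 1" for t
  proof -
    have "powr_integral M p (F n) \<le> ennreal ((1 - t) powr (1 - p) * A) + ennreal (t powr (1 - p)) * powr_integral M p (\<lambda>x. F n x - g x)" for n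
    proof -
      have "powr_integral M p (F n) \<le> (\<integral>\<^sup>+x. ennreal ((1 - t) powr (1 - p)) * ennreal (norm (g x) powr p) + ennreal (t powr (1 - p)) * ennreal (norm (F n x - g x) powr p) \<partial>M)"
        unfolding powr_integral_def
      proof (rule nn_integral_mono)
        fix x
        have "norm (F n x) powr p \<le> (norm (g x) + norm (F n x - g x)) powr p"
          using p norm_triangle_ineq[of "g x" "F n x - g x"] by (intro powr_mono2) auto
        also have "\<dots> \<le> (1 - t) powr (1 - p) * norm (g x) powr p + t powr (1 - p) * norm (F n x - g x) powr p"
          by (rule powr_convex_ineq) (use p t in auto)
        finally have "ennreal (norm (F n x) powr p) \<le> ennreal ((1 - t) powr (1 - p) * norm (g x) powr p + t powr (1 - p) * norm (F n x - g x) powr p)"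
          by (rule ennreal_leI)
        then show "ennreal (norm (F n x) powr p) \<le> ennreal ((1 - t) powr (1 - p)) * ennreal (norm (g x) powr p) + ennreal (t powr (1 - p)) * ennreal (norm (F n x - g x) powr p)"
          by (simp add: ennreal_mult)
      qed
      also have "\<dots> = ennreal ((1 - t) powr (1 - p)) * powr_integral M p g + ennreal (t powr (1 - p)) * powr_integral M p (\<lambda>x. F n x - g x)"
        unfolding powr_integral_def by (simp add: nn_integral_add nn_integral_cmult)
      also have "ennreal ((1 - t) powr (1 - p)) * powr_integral M p g = ennreal ((1 - t) powr (1 - p) * A)"
        using real by (simp add: ennreal_mult)
      finally show ?thesis .
    qed
    then have "L \<le> liminf (\<lambda>n. ennreal ((1 - t) powr (1 - p) * A) + ennreal (t powr (1 - p)) * powr_integral M p (\<lambda>x. F n x - g x))"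
      unfolding L_def by (intro Liminf_mono always_eventually allI)
    also have "(\<lambda>n. ennreal ((1 - t) powr (1 - p) * A) + ennreal (t powr (1 - p)) * powr_integral M p (\<lambda>x. F n x - g x)) \<longlonglongrightarrow> ennreal ((1 - t) powr (1 - p) * A) + ennreal (t powr (1 - p)) * 0"
      by (intro tendsto_add tendsto_const ennreal_tendsto_cmult lim) simp
    then have "liminf (\<lambda>n. ennreal ((1 - t) powr (1 - p) * A) + ennreal (t powr (1 - p)) * powr_integral M p (\<lambda>x. F n x - g x)) = ennreal ((1 - t) powr (1 - p) * A) + ennreal (t powr (1 - p)) * 0"
      by (intro lim_imp_Liminf) auto
    finally show ?thesis by simp
  qed
  define t where "t n = 1 / real (Suc (Suc n))" for n
  have t0: "t \<longlonglongrightarrow> 0" unfolding t_def by (intro LIMSEQ_Suc lim_1_over_n)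
  have "(\<lambda>n. (1 - t n) powr (1 - p) * A) \<longlonglongrightarrow> (1 - 0) powr (1 - p) * A"
    by (intro tendsto_intros t0) auto
  then have "(\<lambda>n. ennreal ((1 - t n) powr (1 - p) * A)) \<longlonglongrightarrow> ennreal A"
    by (intro tendsto_ennrealI) simp
  then have "L \<le> ennreal A"
    by (rule LIMSEQ_le_const) (intro exI[of _ 0] allI impI bound, auto simp: t_def)
  then show ?thesis using real by (simp add: L_def)
qed simp

section \<open>Chain rule and functional inequalities on the closure of the test functions\<close>

context bounded_open
begin

lemma powr_integral_tendsto_0_le:
  fixes F :: "nat \<Rightarrow> 'x \<Rightarrow> 'b::euclidean_space" and G :: "nat \<Rightarrow> 'x \<Rightarrow> 'c::euclidean_space" and m :: "'x measure"
  assumes "\<And>n. powr_integral m r (F n) \<le> powr_integral m r (G n)" "(\<lambda>n. powr_integral m r (G n)) \<longlonglongrightarrow> 0"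
  shows "(\<lambda>n. powr_integral m r (F n)) \<longlonglongrightarrow> 0"
  by (rule tendsto_sandwich[OF _ _ tendsto_const assms(2)]) (intro always_eventually allI zero_le assms(1))+

lemma powr_integral_tendsto_0_scale:
  fixes F :: "nat \<Rightarrow> 'x \<Rightarrow> 'b::euclidean_space" and m :: "'x measure"
  assumes "\<And>n. F n \<in> borel_measurable m" "(\<lambda>n. powr_integral m r (F n)) \<longlonglongrightarrow> 0"
  shows "(\<lambda>n. powr_integral m r (\<lambda>x. c *\<^sub>R F n x)) \<longlonglongrightarrow> 0"
proof -
  have "(\<lambda>n. ennreal (\<bar>c\<bar> powr r) * powr_integral m r (F n)) \<longlonglongrightarrow> ennreal (\<bar>c\<bar> powr r) * 0"
    by (rule ennreal_tendsto_cmult[OF _ assms(2)]) simp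
  then show ?thesis unfolding powr_integral_scaleR[OF assms(1)] by simp
qed

text \<open>Since P is smooth and P 0 = 0, composing the approximants with P gives test functions
  again; this is why smooth functions such as \<open>arctan\<close> serve as truncations instead of
  minima. The error in the gradient splits into P'(\<phi> n) (grad (\<phi> n) - U), which is
  controlled by the bound on P', and (P'(\<phi> n) - P'(u)) U, which is dominated by a multiple of U
  and tends to 0 almost everywhere.\<close>

lemma weak0_compose:
  assumes w: "weak0 r u U" and r: "r > 0" and P: "\<And>k. C_k k P" "P 0 = 0" "\<And>t. (P has_real_derivative P' t) (at t)"
    "continuous_on UNIV P'" "\<And>t. \<bar>P' t\<bar> \<le> B"
  shows "weak0 r (\<lambda>x. P (u x)) (\<lambda>x. P' (u x) *\<^sub>R U x)"
proof -
  obtain \<phi> where \<phi>: "\<And>n. \<phi> n \<in> test_functions \<Omega>"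
    "(\<lambda>k. powr_integral M r (\<lambda>x. \<phi> k x - u x)) \<longlonglongrightarrow> 0" "(\<lambda>k. powr_integral M r (\<lambda>x. grad (\<phi> k) x - U x)) \<longlonglongrightarrow> 0"
    "AE x in M. (\<lambda>n. \<phi> n x) \<longlonglongrightarrow> u x" "AE x in M. (\<lambda>n. grad (\<phi> n) x) \<longlonglongrightarrow> U x"
    using weak0_AE_approx[OF w r] by blast
  note [measurable] = weak0_measurable[OF w] test_measurable[OF \<phi>(1)]
  have B: "B \<ge> 0" using P(5)[of 0] by linarith
  have [measurable]: "P' \<in> borel_measurable borel" using P(4) borel_measurable_continuous_onI by blast
  have "continuous_on UNIV P" using P(1)[of 0] by simp
  then have [measurable]: "P \<in> borel_measurable borel" using borel_measurable_continuous_onI by blast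
  have lip: "\<bar>P a - P b\<bar> \<le> B * \<bar>a - b\<bar>" for a b
    using field_differentiable_bound[of UNIV P P' B a b] P(3,5) by auto
  have g: "grad (\<lambda>x. P (\<phi> n x)) x = P' (\<phi> n x) *\<^sub>R grad (\<phi> n) x" for n x
    by (rule grad_compose[OF P(3) test_functions_differentiable[OF \<phi>(1)]])
  have "(\<lambda>n. powr_integral M r (\<lambda>x. P (\<phi> n x) - P (u x))) \<longlonglongrightarrow> 0"
  proof (rule powr_integral_tendsto_0_le)
    show "(\<lambda>n. powr_integral M r (\<lambda>x. B *\<^sub>R (\<phi> n x - u x))) \<longlonglongrightarrow> 0"
      by (rule powr_integral_tendsto_0_scale[OF _ \<phi>(2)]) measurable
    show "powr_integral M r (\<lambda>x. P (\<phi> n x) - P (u x)) \<le> powr_integral M r (\<lambda>x. B *\<^sub>R (\<phi> n x - u x))" for n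
      using lip B r by (intro powr_integral_mono) (auto simp: abs_mult)
  qed
  moreover have "(\<lambda>n. powr_integral M r (\<lambda>x. grad (\<lambda>x. P (\<phi> n x)) x - P' (u x) *\<^sub>R U x)) \<longlonglongrightarrow> 0"
  proof -
    have 1: "(\<lambda>n. powr_integral M r (\<lambda>x. P' (\<phi> n x) *\<^sub>R (grad (\<phi> n) x - U x))) \<longlonglongrightarrow> 0"
    proof (rule powr_integral_tendsto_0_le)
      show "(\<lambda>n. powr_integral M r (\<lambda>x. B *\<^sub>R (grad (\<phi> n) x - U x))) \<longlonglongrightarrow> 0"
        by (rule powr_integral_tendsto_0_scale[OF _ \<phi>(3)]) measurable
      show "powr_integral M r (\<lambda>x. P' (\<phi> n x) *\<^sub>R (grad (\<phi> n) x - U x)) \<le> powr_integral M r (\<lambda>x. B *\<^sub>R (grad (\<phi> n) x - U x))" for n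
        using P(5) B r by (intro powr_integral_mono) (auto intro: mult_right_mono)
    qed
    have 2: "(\<lambda>n. powr_integral M r (\<lambda>x. (P' (\<phi> n x) - P' (u x)) *\<^sub>R U x)) \<longlonglongrightarrow> 0"
    proof -
      have "(\<lambda>n. powr_integral M r (\<lambda>x. (P' (\<phi> n x) - P' (u x)) *\<^sub>R U x)) \<longlonglongrightarrow> (\<integral>\<^sup>+x. 0 \<partial>M)"
        unfolding powr_integral_def
      proof (rule nn_integral_dominated_convergence)
        show "(\<integral>\<^sup>+x. ennreal ((2 * B) powr r) * ennreal (norm (U x) powr r) \<partial>M) < \<infinity>"
          using weak0_finite(2)[OF w] r by (subst nn_integral_cmult) (auto simp: powr_integral_def ennreal_mult_less_top)
        have "norm ((P' (\<phi> n x) - P' (u x)) *\<^sub>R U x) \<le> 2 * B * norm (U x)" for n x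
          using P(5)[of "\<phi> n x"] P(5)[of "u x"] by (auto intro!: mult_right_mono)
        then have "norm ((P' (\<phi> n x) - P' (u x)) *\<^sub>R U x) powr r \<le> (2 * B * norm (U x)) powr r" for n x
          using r by (intro powr_mono2) auto
        then show "AE x in M. ennreal (norm ((P' (\<phi> n x) - P' (u x)) *\<^sub>R U x) powr r) \<le> ennreal ((2 * B) powr r) * ennreal (norm (U x) powr r)" for n
          using B by (simp add: powr_mult ennreal_mult[symmetric] ennreal_leI)
        show "AE x in M. (\<lambda>n. ennreal (norm ((P' (\<phi> n x) - P' (u x)) *\<^sub>R U x) powr r)) \<longlonglongrightarrow> 0"
          using \<phi>(4)
        proof eventually_elim
          case (elim x)
          have "isCont P' (u x)" using P(4) by (simp add: continuous_on_eq_continuous_at)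
          then have "(\<lambda>n. P' (\<phi> n x)) \<longlonglongrightarrow> P' (u x)" using elim by (rule isCont_tendsto_compose)
          then have "(\<lambda>n. norm ((P' (\<phi> n x) - P' (u x)) *\<^sub>R U x)) \<longlonglongrightarrow> norm ((P' (u x) - P' (u x)) *\<^sub>R U x)"
            by (intro tendsto_intros)
          then have "(\<lambda>n. norm ((P' (\<phi> n x) - P' (u x)) *\<^sub>R U x) powr r) \<longlonglongrightarrow> 0 powr r"
            using r by (intro tendsto_powr' tendsto_const) auto
          then have "(\<lambda>n. ennreal (norm ((P' (\<phi> n x) - P' (u x)) *\<^sub>R U x) powr r)) \<longlonglongrightarrow> ennreal 0"
            using r by (intro tendsto_ennrealI) simp
          then show ?case by simp
        qed
      qed measurable
      then show ?thesis by simp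
    qed
    have "(\<lambda>n. powr_integral M r (\<lambda>x. P' (\<phi> n x) *\<^sub>R (grad (\<phi> n) x - U x) + (P' (\<phi> n x) - P' (u x)) *\<^sub>R U x)) \<longlonglongrightarrow> 0"
        by (rule powr_integral_tendsto_0_add[OF _ _ less_imp_le[OF r] 1 2]) measurable
    moreover have "(\<lambda>x. P' (\<phi> n x) *\<^sub>R (grad (\<phi> n) x - U x) + (P' (\<phi> n x) - P' (u x)) *\<^sub>R U x) = (\<lambda>x. grad (\<lambda>x. P (\<phi> n x)) x - P' (u x) *\<^sub>R U x)" for n
      unfolding g by (simp add: fun_eq_iff scaleR_diff_right scaleR_diff_left)
    ultimately show ?thesis by (simp only:)
  qed
  ultimately show ?thesis
    unfolding weak0_def
    by (intro conjI exI[of _ "\<lambda>n x. P (\<phi> n x)"] allI test_functions_compose[OF \<phi>(1) P(1,2)]) measurable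
qed

lemma powr_integral_test_eq_lborel:
  assumes "\<phi> \<in> test_functions \<Omega>" "r > 0"
  shows "powr_integral M r \<phi> = (\<integral>\<^sup>+x. ennreal (\<bar>\<phi> x\<bar> powr r) \<partial>lborel)"
    "powr_integral M r (grad \<phi>) = (\<integral>\<^sup>+x. ennreal (norm (grad \<phi> x) powr r) \<partial>lborel)"
proof -
  note [measurable] = C1_compact_borel[OF C1_compact_test[OF assms(1)]]
  show "powr_integral M r \<phi> = (\<integral>\<^sup>+x. ennreal (\<bar>\<phi> x\<bar> powr r) \<partial>lborel)"
    unfolding powr_integral_def real_norm_def
    by (rule nn_integral_lebesgue_on_eq_lborel[OF open_dom]) (use assms test_functions_eq_0 in auto)
  show "powr_integral M r (grad \<phi>) = (\<integral>\<^sup>+x. ennreal (norm (grad \<phi> x) powr r) \<partial>lborel)"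
    unfolding powr_integral_def
    by (rule nn_integral_lebesgue_on_eq_lborel[OF open_dom]) (use assms test_functions_grad_eq_0 in auto)
qed

lemma hardy_test:
  assumes \<phi>: "\<phi> \<in> test_functions \<Omega>" and p: "1 < p" "p < real DIM('a)"
  shows "ennreal (((real DIM('a) - p) / p) powr p) * (\<integral>\<^sup>+x. ennreal (\<bar>\<phi> x\<bar> powr p / norm x powr p) \<partial>M) \<le> powr_integral M p (grad \<phi>)"
proof -
  note [measurable] = C1_compact_borel[OF C1_compact_test[OF \<phi>]]
  have "(\<integral>\<^sup>+x. ennreal (\<bar>\<phi> x\<bar> powr p / norm x powr p) \<partial>M) = (\<integral>\<^sup>+x. ennreal (\<bar>\<phi> x\<bar> powr p / norm x powr p) \<partial>lborel)"
    by (rule nn_integral_lebesgue_on_eq_lborel[OF open_dom]) (use test_functions_eq_0[OF \<phi>] in auto)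
  then show ?thesis
    using hardy_inequality[OF C1_compact_test[OF \<phi>] p] powr_integral_test_eq_lborel(2)[OF \<phi>] p by simp
qed

lemma borel_norm_measurable [measurable]: "(\<lambda>x. norm x powr a) \<in> borel_measurable M"
  by (rule borel_measurable_lebesgue_on_borel) measurable

text \<open>Fatou's lemma handles the left side along an almost everywhere convergent approximation,
  and \<open>powr_integral_liminf_le\<close> the right side, so that the sharp constant
  survives.\<close>

lemma hardy_weak0:
  assumes w: "weak0 p u U" and p: "1 < p" "p < real DIM('a)"
  shows "ennreal (((real DIM('a) - p) / p) powr p) * (\<integral>\<^sup>+x. ennreal (\<bar>u x\<bar> powr p / norm x powr p) \<partial>M) \<le> powr_integral M p U"
proof -
  let ?H = "((real DIM('a) - p) / p) powr p"
  have p0: "p > 0" using p by simp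
  obtain \<phi> where \<phi>: "\<And>n. \<phi> n \<in> test_functions \<Omega>"
    "(\<lambda>k. powr_integral M p (\<lambda>x. \<phi> k x - u x)) \<longlonglongrightarrow> 0" "(\<lambda>k. powr_integral M p (\<lambda>x. grad (\<phi> k) x - U x)) \<longlonglongrightarrow> 0"
    "AE x in M. (\<lambda>n. \<phi> n x) \<longlonglongrightarrow> u x" "AE x in M. (\<lambda>n. grad (\<phi> n) x) \<longlonglongrightarrow> U x"
    using weak0_AE_approx[OF w p0] by blast
  note [measurable] = weak0_measurable[OF w] test_measurable[OF \<phi>(1)]
  have "ennreal ?H * (\<integral>\<^sup>+x. ennreal (\<bar>u x\<bar> powr p / norm x powr p) \<partial>M) = (\<integral>\<^sup>+x. ennreal (?H * (\<bar>u x\<bar> powr p / norm x powr p)) \<partial>M)"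
    by (rule nn_integral_ennreal_cmult[symmetric]) auto
  also have "\<dots> = (\<integral>\<^sup>+x. liminf (\<lambda>n. ennreal (?H * (\<bar>\<phi> n x\<bar> powr p / norm x powr p))) \<partial>M)"
  proof (rule nn_integral_cong_AE, use \<phi>(4) in eventually_elim)
    case (elim x)
    have "(\<lambda>n. \<bar>\<phi> n x\<bar> powr p) \<longlonglongrightarrow> \<bar>u x\<bar> powr p"
      using p0 by (intro tendsto_powr' tendsto_intros elim) auto
    then have "(\<lambda>n. ?H * (\<bar>\<phi> n x\<bar> powr p * (1 / norm x powr p))) \<longlonglongrightarrow> ?H * (\<bar>u x\<bar> powr p * (1 / norm x powr p))"
      by (intro tendsto_mult tendsto_const)
    then have "(\<lambda>n. ennreal (?H * (\<bar>\<phi> n x\<bar> powr p / norm x powr p))) \<longlonglongrightarrow> ennreal (?H * (\<bar>u x\<bar> powr p / norm x powr p))"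
      by (intro tendsto_ennrealI) simp
    then show ?case by (intro lim_imp_Liminf[symmetric]) auto
  qed
  also have "\<dots> \<le> liminf (\<lambda>n. (\<integral>\<^sup>+x. ennreal (?H * (\<bar>\<phi> n x\<bar> powr p / norm x powr p)) \<partial>M))"
    by (rule nn_integral_liminf) measurable
  also have "\<dots> \<le> liminf (\<lambda>n. powr_integral M p (grad (\<phi> n)))"
  proof (intro Liminf_mono always_eventually allI)
    fix n
    have "(\<integral>\<^sup>+x. ennreal (?H * (\<bar>\<phi> n x\<bar> powr p / norm x powr p)) \<partial>M) = ennreal ?H * (\<integral>\<^sup>+x. ennreal (\<bar>\<phi> n x\<bar> powr p / norm x powr p) \<partial>M)"
      by (rule nn_integral_ennreal_cmult) auto
    then show "(\<integral>\<^sup>+x. ennreal (?H * (\<bar>\<phi> n x\<bar> powr p / norm x powr p)) \<partial>M) \<le> powr_integral M p (grad (\<phi> n))"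
      using hardy_test[OF \<phi>(1) p] by simp
  qed
  also have "\<dots> \<le> powr_integral M p U"
    by (rule powr_integral_liminf_le[OF _ _ p(1) \<phi>(3)]) measurable
  finally show ?thesis .
qed

lemma sobolev_test:
  assumes \<phi>: "\<phi> \<in> test_functions \<Omega>" and p: "1 < p" "p < N" and N: "N = real DIM('a)"
    and Y: "powr_integral M p (grad \<phi>) \<le> ennreal Y" "Y \<ge> 0"
  shows "powr_integral M (p * N / (N - p)) \<phi> \<le> ennreal (((p * (N - 1) / (N - p)) powr p * Y) powr (N / (N - p)))"
proof -
  note C = C1_compact_test[OF \<phi>]
  obtain R where R: "R > 0" "\<And>x. norm x > R \<Longrightarrow> \<phi> x = 0 \<and> grad \<phi> x = 0"
    using C1_compact_vanishing[OF C] by blast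
  define s where "s = p * N / (N - p)"
  have s: "s > 0" using p by (simp add: s_def)
  have i1: "integrable lborel (\<lambda>x. \<bar>\<phi> x\<bar> powr s)"
    by (rule continuous_bounded_support(1)[where R=R]) (use C1_compact_cont[OF C] R s in \<open>auto intro!: continuous_intros\<close>)
  have i2: "integrable lborel (\<lambda>x. norm (grad \<phi> x) powr p)"
    by (rule continuous_bounded_support(1)[where R=R])
      (use C1_compact_cont_grad[OF C] R p in \<open>auto intro!: continuous_intros continuous_on_powr'\<close>)
  have "powr_integral M p (grad \<phi>) = ennreal (LINT x|lborel. norm (grad \<phi> x) powr p)"
    using powr_integral_test_eq_lborel(2)[OF \<phi>, of p] p nn_integral_eq_integral[OF i2] by simp
  then have Y': "(LINT x|lborel. norm (grad \<phi> x) powr p) \<le> Y" using Y by simp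
  have "powr_integral M s \<phi> = ennreal (LINT x|lborel. \<bar>\<phi> x\<bar> powr s)"
    using powr_integral_test_eq_lborel(1)[OF \<phi> s] nn_integral_eq_integral[OF i1] by simp
  also have "\<dots> \<le> ennreal (((p * (N - 1) / (N - p)) powr p * (LINT x|lborel. norm (grad \<phi> x) powr p)) powr (N / (N - p)))"
    unfolding s_def by (intro ennreal_leI sobolev_inequality[OF C p N])
  also have "\<dots> \<le> ennreal (((p * (N - 1) / (N - p)) powr p * Y) powr (N / (N - p)))"
    using Y' p by (intro ennreal_leI powr_mono2 mult_left_mono) auto
  finally show ?thesis unfolding s_def .
qed

text \<open>The factor 2^p and the summand 1 come from comparing U with an approximating gradient at
  distance less than 1. A sharp constant is not the aim here: only the power of the energy on the
  right matters later.\<close>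

lemma sobolev_weak0:
  assumes w: "weak0 p u U" and p: "1 < p" "p < N" and N: "N = real DIM('a)"
    and Y: "powr_integral M p U \<le> ennreal Y" "Y \<ge> 0"
  shows "powr_integral M (p * N / (N - p)) u \<le> ennreal (((p * (N - 1) / (N - p)) powr p * (2 powr p * (Y + 1))) powr (N / (N - p)))"
proof -
  have p0: "p > 0" using p by simp
  obtain \<phi> where \<phi>: "\<And>n. \<phi> n \<in> test_functions \<Omega>"
    "(\<lambda>k. powr_integral M p (\<lambda>x. \<phi> k x - u x)) \<longlonglongrightarrow> 0" "(\<lambda>k. powr_integral M p (\<lambda>x. grad (\<phi> k) x - U x)) \<longlonglongrightarrow> 0"
    "AE x in M. (\<lambda>n. \<phi> n x) \<longlonglongrightarrow> u x" "AE x in M. (\<lambda>n. grad (\<phi> n) x) \<longlonglongrightarrow> U x"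
    using weak0_AE_approx[OF w p0] by blast
  note [measurable] = weak0_measurable[OF w] test_measurable[OF \<phi>(1)]
  have "(0::ennreal) < 1" by simp
  from order_tendstoD(2)[OF \<phi>(3) this]
  have ev: "\<forall>\<^sub>F n in sequentially. powr_integral M (p * N / (N - p)) (\<phi> n) \<le> ennreal (((p * (N - 1) / (N - p)) powr p * (2 powr p * (Y + 1))) powr (N / (N - p)))"
  proof eventually_elim
    case (elim n)
    have "powr_integral M p (\<lambda>x. (grad (\<phi> n) x - U x) + U x) \<le> ennreal (2 powr p) * (powr_integral M p (\<lambda>x. grad (\<phi> n) x - U x) + powr_integral M p U)"
      by (rule powr_integral_add_le[OF _ _ less_imp_le[OF p0]]) measurable
    also have "\<dots> \<le> ennreal (2 powr p) * (1 + ennreal Y)"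
      using elim Y by (intro mult_left_mono add_mono) auto
    also have "\<dots> = ennreal (2 powr p * (Y + 1))"
      using Y by (simp add: ennreal_mult add.commute)
    finally have "powr_integral M p (grad (\<phi> n)) \<le> ennreal (2 powr p * (Y + 1))" by simp
    then show ?case by (rule sobolev_test[OF \<phi>(1) p N]) (use Y in simp)
  qed
  show ?thesis
    by (rule powr_integral_Fatou[OF _ _ \<phi>(4) ev]) (use p in auto)
qed

text \<open>At the origin \<open>1 / norm x powr p\<close> evaluates to 0, so pointwise comparisons
  with the potential have to exclude this point.\<close>

lemma AE_neq_0: "AE x in M. x \<noteq> 0"
proof -
  have "AE x in lborel. x \<noteq> (0::'a)" by (rule AE_lborel_singleton)
  then have "AE x in lebesgue. x \<noteq> (0::'a)" by (rule AE_completion)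
  then have "AE x in lebesgue. x \<in> \<Omega> \<longrightarrow> x \<noteq> (0::'a)" by eventually_elim simp
  then show ?thesis using open_dom by (subst AE_restrict_space_iff) auto
qed

text \<open>A consequence of Hardy's inequality: on a bounded domain the potential |x|^(-p) is
  bounded below by a positive constant.\<close>

lemma poincare_test:
  assumes p: "1 < p" "p < real DIM('a)"
  obtains C where "C > 0" "\<And>\<phi>. \<phi> \<in> test_functions \<Omega> \<Longrightarrow> powr_integral M p \<phi> \<le> ennreal C * powr_integral M p (grad \<phi>)"
proof -
  let ?H = "((real DIM('a) - p) / p) powr p"
  have H: "?H > 0" using p by simp
  obtain R where R: "\<forall>x\<in>\<Omega>. norm x \<le> R" using bounded_dom unfolding bounded_iff by blast
  define R' where "R' = max R 1"
  have R': "R' > 0" "\<And>x. x \<in> \<Omega> \<Longrightarrow> norm x \<le> R'" using R by (auto simp: R'_def le_max_iff_disj)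
  show ?thesis
  proof (rule that[of "R' powr p / ?H"])
    show "R' powr p / ?H > 0" using R' H by simp
    fix \<phi> assume \<phi>: "\<phi> \<in> test_functions \<Omega>"
    note [measurable] = test_measurable[OF \<phi>]
    have "powr_integral M p \<phi> \<le> (\<integral>\<^sup>+x. ennreal (R' powr p * (\<bar>\<phi> x\<bar> powr p / norm x powr p)) \<partial>M)"
      unfolding powr_integral_def
    proof (rule nn_integral_mono_AE, use AE_neq_0 AE_space in eventually_elim)
      case (elim x)
      then have "x \<in> \<Omega>" by (simp add: space_restrict_space)
      then have "norm x powr p \<le> R' powr p" using R'(2) p by (intro powr_mono2) auto
      then have "\<bar>\<phi> x\<bar> powr p * norm x powr p \<le> \<bar>\<phi> x\<bar> powr p * R' powr p" by (intro mult_left_mono) auto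
      then have "\<bar>\<phi> x\<bar> powr p \<le> R' powr p * (\<bar>\<phi> x\<bar> powr p / norm x powr p)"
        using elim(1) by (simp add: pos_le_divide_eq mult.commute)
      then show ?case by (auto intro: ennreal_leI)
    qed
    also have "\<dots> = ennreal (R' powr p) * (\<integral>\<^sup>+x. ennreal (\<bar>\<phi> x\<bar> powr p / norm x powr p) \<partial>M)"
      by (rule nn_integral_ennreal_cmult) auto
    also have "\<dots> = ennreal (R' powr p / ?H) * (ennreal ?H * (\<integral>\<^sup>+x. ennreal (\<bar>\<phi> x\<bar> powr p / norm x powr p) \<partial>M))"
    proof -
      have "R' powr p / ?H * ?H = R' powr p" using H by (metis less_irrefl nonzero_eq_divide_eq)
      moreover have "ennreal (R' powr p / ?H * ?H) = ennreal (R' powr p / ?H) * ennreal ?H"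
        by (rule ennreal_mult) auto
      ultimately show ?thesis by (simp only: mult.assoc[symmetric])
    qed
    also have "\<dots> \<le> ennreal (R' powr p / ?H) * powr_integral M p (grad \<phi>)"
      by (intro mult_left_mono hardy_test[OF \<phi> p]) auto
    finally show "powr_integral M p \<phi> \<le> ennreal (R' powr p / ?H) * powr_integral M p (grad \<phi>)" .
  qed
qed

lemma weak0_approx:
  assumes "weak0 r u U" "e > 0"
  shows "\<exists>\<phi>. \<phi> \<in> test_functions \<Omega> \<and> powr_integral M r (\<lambda>x. \<phi> x - u x) < e \<and> powr_integral M r (\<lambda>x. grad \<phi> x - U x) < e"
proof -
  obtain \<phi> where \<phi>: "\<And>n. \<phi> n \<in> test_functions \<Omega>"
    "(\<lambda>k. powr_integral M r (\<lambda>x. \<phi> k x - u x)) \<longlonglongrightarrow> 0" "(\<lambda>k. powr_integral M r (\<lambda>x. grad (\<phi> k) x - U x)) \<longlonglongrightarrow> 0"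
    using assms(1) unfolding weak0_def by blast
  from eventually_conj[OF order_tendstoD(2)[OF \<phi>(2) assms(2)] order_tendstoD(2)[OF \<phi>(3) assms(2)]]
  obtain k where "powr_integral M r (\<lambda>x. \<phi> k x - u x) < e" "powr_integral M r (\<lambda>x. grad (\<phi> k) x - U x) < e"
    unfolding eventually_sequentially by blast
  with \<phi>(1) show ?thesis by blast
qed

lemma rellich_test:
  assumes \<phi>: "\<And>n. \<phi> n \<in> test_functions \<Omega>" and C: "\<And>n. powr_integral M 1 (\<phi> n) \<le> ennreal C"
    "\<And>n. powr_integral M 1 (grad (\<phi> n)) \<le> ennreal C" "C > 0"
  obtains r where "strict_mono (r::nat \<Rightarrow> nat)"
    "\<And>e. e > 0 \<Longrightarrow> \<exists>n0. \<forall>i\<ge>n0. \<forall>j\<ge>n0. powr_integral M 1 (\<lambda>x. \<phi> (r i) x - \<phi> (r j) x) \<le> ennreal e"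
proof -
  obtain R where R: "\<forall>x\<in>\<Omega>. norm x \<le> R" using bounded_dom unfolding bounded_iff by blast
  have z: "\<phi> j x = 0" if "norm x > R" for j x
    using R that test_functions_eq_0[OF \<phi>] by force
  have c1: "(\<integral>\<^sup>+x. ennreal \<bar>\<phi> j x\<bar> \<partial>lborel) \<le> ennreal C" for j
    using C(1)[of j] powr_integral_test_eq_lborel(1)[OF \<phi>, of 1 j] by simp
  have c2: "(\<integral>\<^sup>+x. ennreal (norm (grad (\<phi> j) x)) \<partial>lborel) \<le> ennreal C" for j
    using C(2)[of j] powr_integral_test_eq_lborel(2)[OF \<phi>, of 1 j] by simp
  have cc: "powr_integral M 1 (\<lambda>x. \<phi> i x - \<phi> j x) = (\<integral>\<^sup>+x. ennreal \<bar>\<phi> i x - \<phi> j x\<bar> \<partial>lborel)" for i j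
  proof -
    note [measurable] = C1_compact_borel[OF C1_compact_test[OF \<phi>]]
    show ?thesis
      unfolding powr_integral_def by (subst nn_integral_lebesgue_on_eq_lborel[OF open_dom]) (auto simp: test_functions_eq_0[OF \<phi>])
  qed
  show ?thesis
    by (rule rellich_L1[of \<phi> "\<lambda>j. grad (\<phi> j)" R C, OF C1_compact_test[OF \<phi>] z c1 c2 C(3)]) (auto simp: cc[symmetric] intro: that)
qed

lemma powr_integral_triangle3:
  fixes f g h :: "'a \<Rightarrow> 'b::euclidean_space"
  assumes [measurable]: "f \<in> borel_measurable M" "g \<in> borel_measurable M" "h \<in> borel_measurable M"
  shows "powr_integral M 1 (\<lambda>x. f x + g x + h x) \<le> powr_integral M 1 f + powr_integral M 1 g + powr_integral M 1 h"
proof -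
  have "powr_integral M 1 (\<lambda>x. f x + g x + h x) \<le> (\<integral>\<^sup>+x. ennreal (norm (f x)) + ennreal (norm (g x)) + ennreal (norm (h x)) \<partial>M)"
    unfolding powr_integral_def
  proof (rule nn_integral_mono)
    fix x
    have "norm (f x + g x + h x) \<le> norm (f x) + norm (g x) + norm (h x)"
      using norm_triangle_ineq[of "f x + g x" "h x"] norm_triangle_ineq[of "f x" "g x"] by linarith
    then show "ennreal (norm (f x + g x + h x) powr 1) \<le> ennreal (norm (f x)) + ennreal (norm (g x)) + ennreal (norm (h x))"
      by (simp add: ennreal_plus[symmetric] ennreal_leI del: ennreal_plus)
  qed
  also have "\<dots> = powr_integral M 1 f + powr_integral M 1 g + powr_integral M 1 h"
    unfolding powr_integral_def by (simp add: nn_integral_add)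
  finally show ?thesis .
qed

text \<open>Replace each function by a test function at distance less than 1/(n+1), gradients
  included. The L^1 bounds grow by at most 1, and the Cauchy property returns through the exact
  triangle inequality.\<close>

lemma rellich_weak0:
  assumes w: "\<And>n. weak0 1 (u n) (U n)" and C: "\<And>n. powr_integral M 1 (u n) \<le> ennreal C"
    "\<And>n. powr_integral M 1 (U n) \<le> ennreal C" "C > 0"
  obtains r where "strict_mono (r::nat \<Rightarrow> nat)"
    "\<And>e. e > 0 \<Longrightarrow> \<exists>n0. \<forall>i\<ge>n0. \<forall>j\<ge>n0. powr_integral M 1 (\<lambda>x. u (r i) x - u (r j) x) \<le> ennreal e"
proof -
  have "\<exists>\<phi>. \<phi> \<in> test_functions \<Omega> \<and> powr_integral M 1 (\<lambda>x. \<phi> x - u n x) < ennreal (1 / real (Suc n)) \<and>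
     powr_integral M 1 (\<lambda>x. grad \<phi> x - U n x) < ennreal (1 / real (Suc n))" for n
    by (rule weak0_approx[OF w]) simp
  then obtain \<phi> where \<phi>: "\<And>n. \<phi> n \<in> test_functions \<Omega>"
    "\<And>n. powr_integral M 1 (\<lambda>x. \<phi> n x - u n x) < ennreal (1 / real (Suc n))"
    "\<And>n. powr_integral M 1 (\<lambda>x. grad (\<phi> n) x - U n x) < ennreal (1 / real (Suc n))"
    by metis
  note [measurable] = weak0_measurable[OF w] test_measurable[OF \<phi>(1)]
  have le1: "ennreal (1 / real (Suc n)) \<le> ennreal 1" for n by (intro ennreal_leI) simp
  have b: "ennreal 1 + ennreal C + 0 \<le> ennreal (C + 1)" using C(3) by (simp add: add.commute)
  have z: "powr_integral M 1 (\<lambda>x. 0::real) = 0" "powr_integral M 1 (\<lambda>x. 0::'a) = 0"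
    by (simp_all add: powr_integral_def)
  have c1: "powr_integral M 1 (\<phi> n) \<le> ennreal (C + 1)" for n
  proof -
    have "powr_integral M 1 (\<lambda>x. (\<phi> n x - u n x) + u n x + 0) \<le> powr_integral M 1 (\<lambda>x. \<phi> n x - u n x) + powr_integral M 1 (u n) + powr_integral M 1 (\<lambda>x. 0::real)"
      by (rule powr_integral_triangle3) measurable
    also have "\<dots> \<le> ennreal 1 + ennreal C + 0"
      unfolding z using order_trans[OF less_imp_le[OF \<phi>(2)] le1] C(1) by (intro add_mono) auto
    finally show ?thesis using b by simp
  qed
  have c2: "powr_integral M 1 (grad (\<phi> n)) \<le> ennreal (C + 1)" for n
  proof -
    have "powr_integral M 1 (\<lambda>x. (grad (\<phi> n) x - U n x) + U n x + 0) \<le> powr_integral M 1 (\<lambda>x. grad (\<phi> n) x - U n x) + powr_integral M 1 (U n) + powr_integral M 1 (\<lambda>x. 0::'a)"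
      by (rule powr_integral_triangle3) measurable
    also have "\<dots> \<le> ennreal 1 + ennreal C + 0"
      unfolding z using order_trans[OF less_imp_le[OF \<phi>(3)] le1] C(2) by (intro add_mono) auto
    finally show ?thesis using b by simp
  qed
  have c3: "C + 1 > 0" using C(3) by simp
  obtain r where r: "strict_mono (r::nat \<Rightarrow> nat)"
    "\<And>e. e > 0 \<Longrightarrow> \<exists>n0. \<forall>i\<ge>n0. \<forall>j\<ge>n0. powr_integral M 1 (\<lambda>x. \<phi> (r i) x - \<phi> (r j) x) \<le> ennreal e"
    using rellich_test[of \<phi>, OF \<phi>(1) c1 c2 c3] by blast
  show ?thesis
  proof (rule that[OF r(1)])
    fix e :: real assume e: "e > 0"
    then obtain n0 where n0: "\<And>i j. i \<ge> n0 \<Longrightarrow> j \<ge> n0 \<Longrightarrow> powr_integral M 1 (\<lambda>x. \<phi> (r i) x - \<phi> (r j) x) \<le> ennreal (e / 3)"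
      using r(2)[of "e / 3"] by auto
    obtain n1 where n1: "1 / real (Suc n1) < e / 3"
      using reals_Archimedean[of "e / 3"] e by (auto simp: inverse_eq_divide)
    have s: "powr_integral M 1 (\<lambda>x. \<phi> (r i) x - u (r i) x) \<le> ennreal (e / 3)" if "i \<ge> n1" for i
    proof -
      have "r i \<ge> n1" using seq_suble[OF r(1), of i] that by simp
      then have "1 / real (Suc (r i)) \<le> 1 / real (Suc n1)" by (intro divide_left_mono) auto
      then have "1 / real (Suc (r i)) \<le> e / 3" using n1 by linarith
      then show ?thesis using order_trans[OF less_imp_le[OF \<phi>(2)] ennreal_leI] by blast
    qed
    have "powr_integral M 1 (\<lambda>x. u (r i) x - u (r j) x) \<le> ennreal e" if ij: "i \<ge> max n0 n1" "j \<ge> max n0 n1" for i j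
    proof -
      have "powr_integral M 1 (\<lambda>x. - (\<phi> (r i) x - u (r i) x) + (\<phi> (r i) x - \<phi> (r j) x) + (\<phi> (r j) x - u (r j) x)) \<le>
        powr_integral M 1 (\<lambda>x. - (\<phi> (r i) x - u (r i) x)) + powr_integral M 1 (\<lambda>x. \<phi> (r i) x - \<phi> (r j) x) + powr_integral M 1 (\<lambda>x. \<phi> (r j) x - u (r j) x)"
        by (rule powr_integral_triangle3) measurable
      also have "\<dots> \<le> ennreal (e / 3) + ennreal (e / 3) + ennreal (e / 3)"
        unfolding powr_integral_minus using ij by (intro add_mono s n0) auto
      also have "\<dots> = ennreal e" using e by (simp add: ennreal_plus[symmetric] del: ennreal_plus)
      finally show ?thesis by simp
    qed
    then show "\<exists>n0. \<forall>i\<ge>n0. \<forall>j\<ge>n0. powr_integral M 1 (\<lambda>x. u (r i) x - u (r j) x) \<le> ennreal e"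
      by blast
  qed
qed

section \<open>Comparison with the definitions of weak gradient and Sobolev space\<close>

lemma integrable_subset_dom:
  fixes g :: "'a \<Rightarrow> 'b::euclidean_space"
  assumes "integrable M g" "compact K" "K \<subseteq> \<Omega>"
  shows "integrable (lebesgue_on K) g"
proof -
  have K: "K \<in> sets lebesgue" using lmeasurable_compact[OF assms(2)] by (rule fmeasurableD)
  have "integrable lebesgue (\<lambda>x. indicator \<Omega> x *\<^sub>R g x)"
    using assms(1) open_dom by (subst (asm) integrable_restrict_space) auto
  then have "integrable lebesgue (\<lambda>x. indicator K x *\<^sub>R (indicator \<Omega> x *\<^sub>R g x))"
    by (rule integrable_mult_indicator[OF K])
  moreover have "(\<lambda>x. indicator K x *\<^sub>R (indicator \<Omega> x *\<^sub>R g x)) = (\<lambda>x. indicator K x *\<^sub>R g x)"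
    using assms(3) by (auto simp: indicator_def fun_eq_iff)
  ultimately show ?thesis
    using K by (subst integrable_restrict_space) auto
qed

lemma locally_integrableI:
  fixes g :: "'a \<Rightarrow> 'b::euclidean_space"
  shows "integrable M g \<Longrightarrow> locally_integrable \<Omega> g"
  unfolding locally_integrable_def using integrable_subset_dom by blast

lemma integrable_mult_bounded:
  fixes g :: "'a \<Rightarrow> real"
  assumes "integrable M g" "h \<in> borel_measurable M" "\<And>x. \<bar>h x\<bar> \<le> B"
  shows "integrable M (\<lambda>x. g x * h x)"
proof (rule Bochner_Integration.integrable_bound)
  show "integrable M (\<lambda>x. B * g x)" using assms(1) by simp
  show "AE x in M. norm (g x * h x) \<le> norm (B * g x)"
  proof (rule AE_I2)
    fix x
    have "\<bar>h x\<bar> * \<bar>g x\<bar> \<le> \<bar>B\<bar> * \<bar>g x\<bar>" using assms(3)[of x] by (intro mult_right_mono) auto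
    then show "norm (g x * h x) \<le> norm (B * g x)" by (simp add: abs_mult mult.commute)
  qed
qed (use assms in auto)

text \<open>The product of two test functions is admissible in
  \<open>integral_C1_compact_grad_eq_0\<close>, and the integral of its derivative vanishes.\<close>

lemma integral_by_parts_test:
  assumes \<phi>: "\<phi> \<in> test_functions \<Omega>" and \<eta>: "\<eta> \<in> test_functions \<Omega>"
  shows "(LINT x|M. \<phi> x * (grad \<eta> x \<bullet> b)) = - (LINT x|M. (grad \<phi> x \<bullet> b) * \<eta> x)"
proof -
  note C1 = C1_compact_test[OF \<phi>] and C2 = C1_compact_test[OF \<eta>]
  note [measurable] = C1_compact_borel[OF C1] C1_compact_borel[OF C2]
  have C: "C1_compact (\<lambda>x. \<phi> x * \<eta> x) (\<lambda>x. \<phi> x *\<^sub>R grad \<eta> x + \<eta> x *\<^sub>R grad \<phi> x)"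
    unfolding C1_compact_def
  proof (intro conjI allI)
    show "((\<lambda>x. \<phi> x * \<eta> x) has_derivative (\<lambda>v. (\<phi> x *\<^sub>R grad \<eta> x + \<eta> x *\<^sub>R grad \<phi> x) \<bullet> v)) (at x)" for x
      by (rule has_derivative_eq_rhs[OF has_derivative_mult[OF C1_compact_deriv[OF C1] C1_compact_deriv[OF C2]]])
        (simp add: fun_eq_iff inner_add_left)
    show "continuous_on UNIV (\<lambda>x. \<phi> x *\<^sub>R grad \<eta> x + \<eta> x *\<^sub>R grad \<phi> x)"
      by (intro continuous_on_add continuous_on_scaleR C1_compact_cont[OF C1] C1_compact_cont[OF C2]
          C1_compact_cont_grad[OF C1] C1_compact_cont_grad[OF C2])
    obtain R where "\<And>x. norm x > R \<Longrightarrow> \<phi> x = 0" using C1 C1_compact_def by blast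
    then show "\<exists>R. \<forall>x. norm x > R \<longrightarrow> \<phi> x * \<eta> x = 0" by (intro exI[of _ R]) simp
  qed
  obtain R where R: "R > 0" "\<And>x. norm x > R \<Longrightarrow> \<phi> x = 0 \<and> grad \<phi> x = 0"
    using C1_compact_vanishing[OF C1] by blast
  have i1: "integrable lborel (\<lambda>x. \<phi> x * (grad \<eta> x \<bullet> b))"
    by (rule continuous_bounded_support(1)[where R=R])
      (use R in \<open>auto intro!: continuous_on_mult continuous_on_inner continuous_on_const C1_compact_cont[OF C1] C1_compact_cont_grad[OF C2]\<close>)
  have i2: "integrable lborel (\<lambda>x. (grad \<phi> x \<bullet> b) * \<eta> x)"
    by (rule continuous_bounded_support(1)[where R=R])
      (use R in \<open>auto intro!: continuous_on_mult continuous_on_inner continuous_on_const C1_compact_cont[OF C2] C1_compact_cont_grad[OF C1]\<close>)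
  have "0 = (LINT x|lborel. \<phi> x * (grad \<eta> x \<bullet> b) + (grad \<phi> x \<bullet> b) * \<eta> x)"
    using integral_C1_compact_grad_eq_0(2)[OF C, of b] by (simp add: inner_add_left mult.commute)
  also have "\<dots> = (LINT x|lborel. \<phi> x * (grad \<eta> x \<bullet> b)) + (LINT x|lborel. (grad \<phi> x \<bullet> b) * \<eta> x)"
    using i1 i2 by simp
  also have "(LINT x|lborel. \<phi> x * (grad \<eta> x \<bullet> b)) = (LINT x|M. \<phi> x * (grad \<eta> x \<bullet> b))"
    by (rule integral_lebesgue_on_eq_lborel[OF open_dom, symmetric]) (auto simp: test_functions_eq_0[OF \<phi>])
  also have "(LINT x|lborel. (grad \<phi> x \<bullet> b) * \<eta> x) = (LINT x|M. (grad \<phi> x \<bullet> b) * \<eta> x)"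
    by (rule integral_lebesgue_on_eq_lborel[OF open_dom, symmetric]) (auto simp: test_functions_eq_0[OF \<eta>])
  finally show ?thesis by linarith
qed

lemma weak0_integrable:
  assumes "weak0 1 u U"
  shows "integrable M u" "integrable M U"
  using integrable_of_powr_integral[OF finite_M weak0_measurable(1)[OF assms], of 1]
    integrable_of_powr_integral[OF finite_M weak0_measurable(2)[OF assms], of 1] weak0_finite[OF assms] by auto

text \<open>A test function and its gradient are bounded, so both sides of the integration by parts
  are continuous under L^1 convergence. Hence exponent 1 suffices, whatever exponent is meant
  later.\<close>

lemma weak0_has_weak_gradient:
  assumes w: "weak0 1 u U"
  shows "has_weak_gradient \<Omega> u U"
  unfolding has_weak_gradient_def
proof (intro conjI locally_integrableI weak0_integrable[OF w] ballI)
  fix \<eta> b assume \<eta>: "\<eta> \<in> test_functions \<Omega>" and b: "(b::'a) \<in> Basis"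
  obtain B where B: "B > 0" "\<And>x. \<bar>\<eta> x\<bar> \<le> B" "\<And>x. norm (grad \<eta> x) \<le> B"
    using test_functions_bounded[OF \<eta>] by blast
  obtain \<phi> where \<phi>: "\<And>n. \<phi> n \<in> test_functions \<Omega>"
    "(\<lambda>k. powr_integral M 1 (\<lambda>x. \<phi> k x - u x)) \<longlonglongrightarrow> 0" "(\<lambda>k. powr_integral M 1 (\<lambda>x. grad (\<phi> k) x - U x)) \<longlonglongrightarrow> 0"
    using w unfolding weak0_def by blast
  note [measurable] = weak0_measurable[OF w] test_measurable[OF \<phi>(1)] test_measurable[OF \<eta>]
  have ub: "\<bar>v \<bullet> b\<bar> \<le> norm v" for v :: 'a using b by (rule Basis_le_norm)
  have gb: "\<bar>grad \<eta> x \<bullet> b\<bar> \<le> B" for x using ub[of "grad \<eta> x"] B(3)[of x] by linarith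
  have i\<phi>: "integrable M (\<phi> n)" "integrable M (grad (\<phi> n))" for n
    using weak0_integrable[OF weak0_test[OF \<phi>(1)]] by auto
  have l1: "(\<lambda>n. LINT x|M. \<phi> n x * (grad \<eta> x \<bullet> b)) \<longlonglongrightarrow> (LINT x|M. u x * (grad \<eta> x \<bullet> b))"
  proof (rule powr_integral_1_tendsto_integral)
    show "integrable M (\<lambda>x. \<phi> n x * (grad \<eta> x \<bullet> b))" for n
      by (rule integrable_mult_bounded[OF i\<phi>(1) _ gb]) measurable
    show "integrable M (\<lambda>x. u x * (grad \<eta> x \<bullet> b))"
      by (rule integrable_mult_bounded[OF weak0_integrable(1)[OF w] _ gb]) measurable
    show "(\<lambda>n. powr_integral M 1 (\<lambda>x. \<phi> n x * (grad \<eta> x \<bullet> b) - u x * (grad \<eta> x \<bullet> b))) \<longlonglongrightarrow> 0"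
    proof (rule powr_integral_tendsto_0_le)
      show "(\<lambda>n. powr_integral M 1 (\<lambda>x. B *\<^sub>R (\<phi> n x - u x))) \<longlonglongrightarrow> 0"
        by (rule powr_integral_tendsto_0_scale[OF _ \<phi>(2)]) measurable
      show "powr_integral M 1 (\<lambda>x. \<phi> n x * (grad \<eta> x \<bullet> b) - u x * (grad \<eta> x \<bullet> b)) \<le> powr_integral M 1 (\<lambda>x. B *\<^sub>R (\<phi> n x - u x))" for n
        using gb B(1) by (intro powr_integral_mono) (auto simp: left_diff_distrib[symmetric] abs_mult mult.commute intro: mult_right_mono)
    qed
  qed
  have l2: "(\<lambda>n. LINT x|M. (grad (\<phi> n) x \<bullet> b) * \<eta> x) \<longlonglongrightarrow> (LINT x|M. (U x \<bullet> b) * \<eta> x)"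
  proof (rule powr_integral_1_tendsto_integral)
    show "integrable M (\<lambda>x. (grad (\<phi> n) x \<bullet> b) * \<eta> x)" for n
      by (rule integrable_mult_bounded[OF integrable_inner_left[OF i\<phi>(2)] _ B(2)]) measurable
    show "integrable M (\<lambda>x. (U x \<bullet> b) * \<eta> x)"
      by (rule integrable_mult_bounded[OF integrable_inner_left[OF weak0_integrable(2)[OF w]] _ B(2)]) measurable
    show "(\<lambda>n. powr_integral M 1 (\<lambda>x. (grad (\<phi> n) x \<bullet> b) * \<eta> x - (U x \<bullet> b) * \<eta> x)) \<longlonglongrightarrow> 0"
    proof (rule powr_integral_tendsto_0_le)
      show "(\<lambda>n. powr_integral M 1 (\<lambda>x. B *\<^sub>R (grad (\<phi> n) x - U x))) \<longlonglongrightarrow> 0"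
        by (rule powr_integral_tendsto_0_scale[OF _ \<phi>(3)]) measurable
      show "powr_integral M 1 (\<lambda>x. (grad (\<phi> n) x \<bullet> b) * \<eta> x - (U x \<bullet> b) * \<eta> x) \<le> powr_integral M 1 (\<lambda>x. B *\<^sub>R (grad (\<phi> n) x - U x))" for n
      proof (intro powr_integral_mono)
        fix x
        have "\<bar>(grad (\<phi> n) x - U x) \<bullet> b\<bar> * \<bar>\<eta> x\<bar> \<le> norm (grad (\<phi> n) x - U x) * B"
          using ub B(2) by (intro mult_mono) auto
        moreover have "(grad (\<phi> n) x \<bullet> b) * \<eta> x - (U x \<bullet> b) * \<eta> x = ((grad (\<phi> n) x - U x) \<bullet> b) * \<eta> x"
          by (simp add: left_diff_distrib inner_diff_left)
        ultimately show "norm ((grad (\<phi> n) x \<bullet> b) * \<eta> x - (U x \<bullet> b) * \<eta> x) \<le> norm (B *\<^sub>R (grad (\<phi> n) x - U x))"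
          using B(1) by (simp only: real_norm_def abs_mult norm_scaleR abs_of_pos mult.commute)
      qed simp
    qed
  qed
  have "(\<lambda>n. LINT x|M. \<phi> n x * (grad \<eta> x \<bullet> b)) \<longlonglongrightarrow> - (LINT x|M. (U x \<bullet> b) * \<eta> x)"
    unfolding integral_by_parts_test[OF \<phi>(1) \<eta>] by (rule tendsto_minus[OF l2])
  from LIMSEQ_unique[OF l1 this]
  show "(LINT x|M. u x * partial_deriv b \<eta> x) = - (LINT x|M. U x \<bullet> b * \<eta> x)"
    unfolding partial_deriv_eq_grad_inner[OF test_functions_differentiable[OF \<eta>]] .
qed

lemma Lp_spaceI:
  fixes g :: "'a \<Rightarrow> 'b::euclidean_space"
  assumes "g \<in> borel_measurable M" "powr_integral M r g < \<infinity>"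
  shows "g \<in> Lp_space r \<Omega>"
  unfolding Lp_space_def using assms by (auto simp: powr_integral_def intro!: integrableI_nonneg)

lemma powr_integral_eq_LINT:
  fixes g :: "'a \<Rightarrow> 'b::euclidean_space"
  assumes "g \<in> borel_measurable M" "powr_integral M r g < \<infinity>"
  shows "powr_integral M r g = ennreal (LINT x|M. norm (g x) powr r)"
  using Lp_spaceI[OF assms] unfolding Lp_space_def powr_integral_def
  by (intro nn_integral_eq_integral) auto

lemma weak0_sobolev0_space:
  assumes w: "weak0 r u U" and r: "r \<ge> 1"
  shows "u \<in> sobolev0_space r \<Omega>"
proof -
  have w1: "weak0 1 u U" by (rule weak0_lower_exponent[OF w]) (use r in auto)
  have f: "powr_integral M r u < \<infinity>" "powr_integral M r U < \<infinity>"
    using weak0_finite[OF w] r by auto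
  note m = weak0_measurable[OF w]
  have "in_sobolev r \<Omega> u U"
    unfolding in_sobolev_def by (intro conjI Lp_spaceI m f weak0_has_weak_gradient w1)
  moreover have "\<exists>\<phi>\<in>test_functions \<Omega>. sobolev_norm r \<Omega> (\<lambda>x. u x - \<phi> x) (\<lambda>x. U x - grad \<phi> x) < e" if e: "e > 0" for e
  proof -
    have "0 < ennreal (e powr r / 2)" using e by simp
    from weak0_approx[OF w this]
    obtain \<phi> where \<phi>: "\<phi> \<in> test_functions \<Omega>" "powr_integral M r (\<lambda>x. \<phi> x - u x) < ennreal (e powr r / 2)"
      "powr_integral M r (\<lambda>x. grad \<phi> x - U x) < ennreal (e powr r / 2)" by blast
    note [measurable] = m test_measurable[OF \<phi>(1)]
    have "powr_integral M r (\<lambda>x. \<phi> x - u x) = ennreal (LINT x|M. norm (\<phi> x - u x) powr r)"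
      by (rule powr_integral_eq_LINT) (use less_trans[OF \<phi>(2) ennreal_less_top] in auto)
    then have 1: "(LINT x|M. \<bar>u x - \<phi> x\<bar> powr r) < e powr r / 2"
      using \<phi>(2) by (simp add: ennreal_less_iff abs_minus_commute)
    have "powr_integral M r (\<lambda>x. grad \<phi> x - U x) = ennreal (LINT x|M. norm (grad \<phi> x - U x) powr r)"
      by (rule powr_integral_eq_LINT) (use less_trans[OF \<phi>(3) ennreal_less_top] in auto)
    then have 2: "(LINT x|M. norm (U x - grad \<phi> x) powr r) < e powr r / 2"
      using \<phi>(3) by (simp add: ennreal_less_iff norm_minus_commute)
    have "sobolev_norm r \<Omega> (\<lambda>x. u x - \<phi> x) (\<lambda>x. U x - grad \<phi> x) < (e powr r) powr (1 / r)"
      unfolding sobolev_norm_def using 1 2 r by (intro powr_less_mono2) (auto intro!: add_nonneg_nonneg)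
    also have "\<dots> = e" using e r by (simp add: powr_powr)
    finally show ?thesis using \<phi>(1) by blast
  qed
  ultimately show ?thesis unfolding sobolev0_space_def by blast
qed

end

subsection \<open>The flux and bounded data\<close>

definition pflux :: "real \<Rightarrow> 'a::euclidean_space \<Rightarrow> 'a" where
  "pflux p \<xi> = norm \<xi> powr (p - 2) *\<^sub>R \<xi>"

lemma norm_pflux: "norm (pflux p \<xi>) = norm \<xi> powr (p - 1)"
proof (cases "\<xi> = 0")
  case False
  then have "norm \<xi> powr (p - 2) * norm \<xi> = norm \<xi> powr (p - 2 + 1)" by (subst powr_add) simp
  then show ?thesis by (simp add: pflux_def)
qed (simp add: pflux_def)

lemma pflux_inner_self: "p > 0 \<Longrightarrow> pflux p \<xi> \<bullet> \<xi> = norm \<xi> powr p"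
proof (cases "\<xi> = 0")
  case False
  then have "norm \<xi> powr (p - 2) * (norm \<xi> powr 2) = norm \<xi> powr (p - 2 + 2)" by (subst powr_add) simp
  then show ?thesis using False by (simp add: pflux_def dot_square_norm powr_numeral)
qed (simp add: pflux_def)

lemma continuous_pflux:
  assumes "p \<ge> 2"
  shows "continuous_on UNIV (pflux p :: 'a::euclidean_space \<Rightarrow> 'a)"
proof (rule continuous_at_imp_continuous_on, rule ballI)
  fix \<xi> :: 'a
  show "isCont (pflux p) \<xi>"
  proof (cases "\<xi> = 0")
    case True
    have "(\<lambda>\<eta>::'a. norm \<eta> powr (p - 1)) \<midarrow>0\<rightarrow> norm (0::'a) powr (p - 1)"
      using assms by (intro tendsto_powr' tendsto_intros) auto
    then have "(\<lambda>\<eta>::'a. norm (pflux p \<eta>)) \<midarrow>0\<rightarrow> 0" unfolding norm_pflux by simp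
    then have "pflux p \<midarrow>(0::'a)\<rightarrow> 0" by (rule tendsto_norm_zero_cancel)
    then show ?thesis using True by (simp add: isCont_def pflux_def)
  next
    case False
    then show ?thesis unfolding pflux_def[abs_def] by (intro continuous_intros) auto
  qed
qed

lemma pflux_borel: "p \<ge> 2 \<Longrightarrow> pflux p \<in> borel_measurable borel"
  by (rule borel_measurable_continuous_onI[OF continuous_pflux])

lemma pflux_tendsto:
  fixes \<xi> :: "'a::euclidean_space"
  assumes "p \<ge> 2" "(X \<longlonglongrightarrow> \<xi>)"
  shows "(\<lambda>n. pflux p (X n)) \<longlonglongrightarrow> pflux p \<xi>"
proof -
  have "isCont (pflux p) \<xi>"
    using continuous_pflux[OF assms(1), where 'a='a] by (simp add: continuous_on_eq_continuous_at)
  then show ?thesis using assms(2) by (rule isCont_tendsto_compose)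
qed

text \<open>Cauchy-Schwarz reduces the tangent inequality of |\<xi>|^p to the scalar one in
  \<open>Young_powr\<close>.\<close>

lemma pflux_convex:
  assumes "p > 1"
  shows "norm (c::'a::euclidean_space) powr p + p * (pflux p c \<bullet> (a - c)) \<le> norm a powr p"
proof -
  have "p * (pflux p c \<bullet> a) \<le> p * (norm c powr (p - 1) * norm a)"
    using norm_cauchy_schwarz[of "pflux p c" a] assms unfolding norm_pflux by (intro mult_left_mono) auto
  also have "\<dots> \<le> (p - 1) * norm c powr p + norm a powr p"
    using Young_powr[of "norm c" "norm a" p] assms by (simp add: mult.assoc)
  finally have "p * (pflux p c \<bullet> a) \<le> (p - 1) * norm c powr p + norm a powr p" .
  moreover have "pflux p c \<bullet> (a - c) = pflux p c \<bullet> a - norm c powr p"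
    using assms by (simp add: inner_diff_right pflux_inner_self)
  ultimately show ?thesis by (simp add: algebra_simps)
qed

text \<open>The pairing is the mean of the two weights times |a - b|^2, plus a product of two
  differences that have the same sign because the weight |\<xi>|^(p-2) grows with |\<xi>|. The
  larger of the two norms is at least |a - b| / 2, so the first term is at least (|a - b| / 2)^(p-2)
  |a - b|^2 / 2, which explains the constant.\<close>

lemma pflux_monotone:
  fixes a b :: "'a::euclidean_space"
  assumes "p \<ge> 2"
  shows "2 powr (1 - p) * norm (a - b) powr p \<le> (pflux p a - pflux p b) \<bullet> (a - b)"
proof (cases "p = 2")
  case True
  have e: "pflux p c = c" for c :: 'a using True by (cases "c = 0") (auto simp: pflux_def)
  have "2 powr (1 - p) * norm (a - b) powr p \<le> 1 * norm (a - b) powr p"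
    using True by (intro mult_right_mono) (auto simp: powr_minus)
  also have "\<dots> = (a - b) \<bullet> (a - b)"
    using True by (cases "a = b") (auto simp: dot_square_norm powr_numeral)
  finally show ?thesis by (simp only: e)
next
  case False
  then have p: "p > 2" using assms by simp
  define \<alpha> \<beta> where "\<alpha> = norm a powr (p - 2)" and "\<beta> = norm b powr (p - 2)"
  have id: "(pflux p a - pflux p b) \<bullet> (a - b) = (\<alpha> + \<beta>) / 2 * (norm (a - b))\<^sup>2 + (\<alpha> - \<beta>) * ((norm a)\<^sup>2 - (norm b)\<^sup>2) / 2"
    unfolding pflux_def \<alpha>_def[symmetric] \<beta>_def[symmetric] power2_norm_eq_inner
    by (simp add: inner_diff_left inner_diff_right inner_commute field_simps)
  have "(\<alpha> - \<beta>) * ((norm a)\<^sup>2 - (norm b)\<^sup>2) \<ge> 0"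
  proof (cases "norm a \<le> norm b")
    case True
    then have "\<alpha> \<le> \<beta>" unfolding \<alpha>_def \<beta>_def using p by (intro powr_mono2) auto
    moreover have "(norm a)\<^sup>2 \<le> (norm b)\<^sup>2" using True by (intro power_mono) auto
    ultimately show ?thesis by (intro mult_nonpos_nonpos) auto
  next
    case False
    then have "\<beta> \<le> \<alpha>" unfolding \<alpha>_def \<beta>_def using p by (intro powr_mono2) auto
    moreover have "(norm b)\<^sup>2 \<le> (norm a)\<^sup>2" using False by (intro power_mono) auto
    ultimately show ?thesis by (intro mult_nonneg_nonneg) auto
  qed
  moreover have "2 powr (1 - p) * norm (a - b) powr p \<le> (\<alpha> + \<beta>) / 2 * (norm (a - b))\<^sup>2"
  proof (cases "a = b")
    case False
    define m where "m = max (norm a) (norm b)"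
    have "norm (a - b) \<le> 2 * m" unfolding m_def using norm_triangle_ineq4[of a b] by linarith
    then have "(norm (a - b) / 2) powr (p - 2) \<le> m powr (p - 2)" using p by (intro powr_mono2) auto
    also have "\<dots> \<le> \<alpha> + \<beta>" unfolding m_def \<alpha>_def \<beta>_def by (auto simp: max_def)
    finally have "(norm (a - b) / 2) powr (p - 2) / 2 * (norm (a - b))\<^sup>2 \<le> (\<alpha> + \<beta>) / 2 * (norm (a - b))\<^sup>2"
      by (intro mult_right_mono) auto
    also have "(norm (a - b) / 2) powr (p - 2) / 2 * (norm (a - b))\<^sup>2 = 2 powr (1 - p) * norm (a - b) powr p"
    proof -
      have "(norm (a - b))\<^sup>2 = norm (a - b) powr 2" using False by (simp add: powr_numeral)
      then show ?thesis using False by (simp add: powr_divide powr_diff)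
    qed
    finally show ?thesis .
  qed (use p in simp)
  ultimately show ?thesis unfolding id by linarith
qed

section \<open>Uniform convexity and continuity of the flux pairing\<close>

lemma powr_superadditive:
  assumes "a \<ge> 0" "b \<ge> 0" "q \<ge> (1::real)"
  shows "a powr q + b powr q \<le> (a + b) powr q"
proof (cases "a + b = 0")
  case False
  then have ab: "a + b > 0" using assms by simp
  have s: "c powr q \<le> c * (a + b) powr (q - 1)" if "0 \<le> c" "c \<le> a + b" for c
  proof (cases "c = 0")
    case False
    then have "c powr q = c * c powr (q - 1)" using that by (simp add: powr_diff)
    also have "\<dots> \<le> c * (a + b) powr (q - 1)" using that assms by (intro mult_left_mono powr_mono2) auto
    finally show ?thesis .
  qed (use that in simp)
  have "a powr q + b powr q \<le> a * (a + b) powr (q - 1) + b * (a + b) powr (q - 1)"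
    using assms by (intro add_mono s) auto
  also have "\<dots> = (a + b) * (a + b) powr (q - 1)" by (simp add: algebra_simps)
  also have "\<dots> = (a + b) powr q" using ab by (simp add: powr_diff)
  finally show ?thesis .
next
  case True
  then have "a = 0" "b = 0" using assms by linarith+
  then show ?thesis by simp
qed

text \<open>With q = p / 2 >= 1, superadditivity of the power q brings the left side under the
  parallelogram law, and convexity of the same power separates the two terms on the right. This
  replaces weak compactness in the minimisation.\<close>

lemma clarkson:
  fixes a b :: "'a::euclidean_space"
  assumes p: "p \<ge> 2"
  shows "norm ((1/2) *\<^sub>R (a + b)) powr p + norm ((1/2) *\<^sub>R (a - b)) powr p \<le> (norm a powr p + norm b powr p) / 2"
proof -
  define q where "q = p / 2"
  have q: "q \<ge> 1" using p by (simp add: q_def)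
  have sq: "norm c powr p = ((norm c)\<^sup>2) powr q" for c :: 'a
    by (cases "c = 0") (auto simp: q_def powr_powr simp flip: powr_numeral)
  have "norm ((1/2) *\<^sub>R (a + b)) powr p + norm ((1/2) *\<^sub>R (a - b)) powr p \<le> ((norm ((1/2) *\<^sub>R (a + b)))\<^sup>2 + (norm ((1/2) *\<^sub>R (a - b)))\<^sup>2) powr q"
    unfolding sq by (intro powr_superadditive q) auto
  also have "(norm ((1/2) *\<^sub>R (a + b)))\<^sup>2 + (norm ((1/2) *\<^sub>R (a - b)))\<^sup>2 = (norm a)\<^sup>2 / 2 + (norm b)\<^sup>2 / 2"
    unfolding power2_norm_eq_inner by (simp add: inner_add_left inner_add_right inner_diff_left inner_diff_right inner_commute field_simps)
  also have "((norm a)\<^sup>2 / 2 + (norm b)\<^sup>2 / 2) powr q \<le> (norm a powr p + norm b powr p) / 2"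
  proof (cases "q = 1")
    case True
    then show ?thesis unfolding sq by simp
  next
    case False
    then have q1: "q > 1" using q by simp
    have "((norm a)\<^sup>2 / 2 + (norm b)\<^sup>2 / 2) powr q \<le> (1 - 1/2) powr (1 - q) * ((norm a)\<^sup>2 / 2) powr q + (1/2) powr (1 - q) * ((norm b)\<^sup>2 / 2) powr q"
      by (rule powr_convex_ineq) (use q1 in auto)
    also have "\<dots> = (norm a powr p + norm b powr p) / 2"
    proof -
      have h: "(1/2::real) powr (1 - q) * (x / 2) powr q = x powr q / 2" if "x \<ge> 0" for x
      proof -
        have "(1/2::real) powr (1 - q) * (x / 2) powr q = x powr q * ((1/2) powr (1 - q) * (1/2) powr q)"
          using that by (simp add: powr_divide)
        also have "(1/2::real) powr (1 - q) * (1/2) powr q = 1 / 2" by (simp add: powr_add[symmetric])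
        finally show ?thesis by simp
      qed
      have "(1 - 1/2::real) = 1/2" by simp
      then show ?thesis unfolding sq by (simp only: h[OF zero_le_power2] add_divide_distrib)
    qed
    finally show ?thesis .
  qed
  finally show ?thesis .
qed

text \<open>Young's inequality with a free parameter k and unoptimised constants, which come from
  distinguishing b <= k a and a <= b / k.\<close>

lemma powr_mult_le_add:
  assumes "a \<ge> 0" "b \<ge> 0" "k > (0::real)" "p > 1"
  shows "a powr (p - 1) * b \<le> k * a powr p + k powr (1 - p) * b powr p"
proof (cases "b \<le> k * a")
  case True
  then have "a powr (p - 1) * b \<le> a powr (p - 1) * (k * a)" by (intro mult_left_mono) auto
  also have "\<dots> = k * a powr p" using assms by (cases "a = 0") (auto simp: powr_diff)
  finally show ?thesis by (simp add: add_increasing2)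
next
  case False
  then have "a \<le> b / k" using assms by (simp add: field_simps)
  then have "a powr (p - 1) * b \<le> (b / k) powr (p - 1) * b" using assms by (intro mult_right_mono powr_mono2) auto
  also have "\<dots> = k powr (1 - p) * b powr p"
    using assms by (cases "b = 0") (auto simp: powr_divide powr_diff field_simps)
  finally show ?thesis using assms by (simp add: add_increasing)
qed

lemma powr_integral_flux_le:
  fixes U V :: "'x \<Rightarrow> 'b::euclidean_space"
  assumes [measurable]: "U \<in> borel_measurable m" "V \<in> borel_measurable m" and k: "k > 0" "p > 1"
  shows "powr_integral m 1 (\<lambda>x. pflux p (U x) \<bullet> V x) \<le> ennreal k * powr_integral m p U + ennreal (k powr (1 - p)) * powr_integral m p V"
proof -
  have "powr_integral m 1 (\<lambda>x. pflux p (U x) \<bullet> V x) \<le> (\<integral>\<^sup>+x. ennreal k * ennreal (norm (U x) powr p) + ennreal (k powr (1 - p)) * ennreal (norm (V x) powr p) \<partial>m)"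
    unfolding powr_integral_def
  proof (rule nn_integral_mono)
    fix x
    have "norm (pflux p (U x) \<bullet> V x) \<le> norm (U x) powr (p - 1) * norm (V x)"
      using Cauchy_Schwarz_ineq2[of "pflux p (U x)" "V x"] by (simp add: norm_pflux)
    also have "\<dots> \<le> k * norm (U x) powr p + k powr (1 - p) * norm (V x) powr p"
      by (rule powr_mult_le_add) (use k in auto)
    finally have "norm (pflux p (U x) \<bullet> V x) \<le> k * norm (U x) powr p + k powr (1 - p) * norm (V x) powr p" .
    then have "ennreal (norm (pflux p (U x) \<bullet> V x)) \<le> ennreal (k * norm (U x) powr p + k powr (1 - p) * norm (V x) powr p)"
      by (rule ennreal_leI)
    then show "ennreal (norm (pflux p (U x) \<bullet> V x) powr 1) \<le> ennreal k * ennreal (norm (U x) powr p) + ennreal (k powr (1 - p)) * ennreal (norm (V x) powr p)"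
      using k by (simp add: ennreal_mult)
  qed
  also have "\<dots> = ennreal k * powr_integral m p U + ennreal (k powr (1 - p)) * powr_integral m p V"
    unfolding powr_integral_def by (simp add: nn_integral_add nn_integral_cmult)
  finally show ?thesis .
qed

lemma integrable_flux:
  fixes U V :: "'x \<Rightarrow> 'b::euclidean_space"
  assumes [measurable]: "U \<in> borel_measurable m" "V \<in> borel_measurable m" and p: "p \<ge> 2"
    and f: "powr_integral m p U < \<infinity>" "powr_integral m p V < \<infinity>"
  shows "integrable m (\<lambda>x. pflux p (U x) \<bullet> V x)"
proof (rule integrableI_bounded)
  have [measurable]: "pflux p \<in> borel_measurable (borel::'b measure)" by (rule pflux_borel[OF p])
  show "(\<lambda>x. pflux p (U x) \<bullet> V x) \<in> borel_measurable m" by measurable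
  have "powr_integral m 1 (\<lambda>x. pflux p (U x) \<bullet> V x) \<le> ennreal 1 * powr_integral m p U + ennreal (1 powr (1 - p)) * powr_integral m p V"
    by (rule powr_integral_flux_le) (use p in auto)
  also have "\<dots> < \<infinity>" using f by simp
  finally show "(\<integral>\<^sup>+x. ennreal (norm (pflux p (U x) \<bullet> V x)) \<partial>m) < \<infinity>" by (simp add: powr_integral_def)
qed

text \<open>Take k small so that the fixed energy of U contributes little, and then n large. This
  extends the weak equation from test functions to all of their closure in exponent p.\<close>

lemma flux_integral_tendsto:
  fixes U :: "'x \<Rightarrow> 'b::euclidean_space"
  assumes [measurable]: "U \<in> borel_measurable m" "V \<in> borel_measurable m" "\<And>n. F n \<in> borel_measurable m" and p: "p \<ge> 2"
    and f: "powr_integral m p U < \<infinity>" "powr_integral m p V < \<infinity>" "\<And>n. powr_integral m p (F n) < \<infinity>"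
    and lim: "(\<lambda>n. powr_integral m p (\<lambda>x. F n x - V x)) \<longlonglongrightarrow> 0"
  shows "(\<lambda>n. LINT x|m. pflux p (U x) \<bullet> F n x) \<longlonglongrightarrow> (LINT x|m. pflux p (U x) \<bullet> V x)"
proof (rule powr_integral_1_tendsto_integral)
  show "integrable m (\<lambda>x. pflux p (U x) \<bullet> F n x)" for n by (rule integrable_flux[OF _ _ p f(1) f(3)]) measurable
  show "integrable m (\<lambda>x. pflux p (U x) \<bullet> V x)" by (rule integrable_flux[OF _ _ p f(1,2)]) measurable
  show "(\<lambda>n. powr_integral m 1 (\<lambda>x. pflux p (U x) \<bullet> F n x - pflux p (U x) \<bullet> V x)) \<longlonglongrightarrow> 0"
  proof (rule order_tendstoI)
    fix e :: ennreal assume "0 < e"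
    then obtain e' where e': "ennreal e' < e" "e' > 0" using ennreal_pos_dense_real by blast
    obtain A where A: "powr_integral m p U = ennreal A" "A \<ge> 0" using f(1) by (cases "powr_integral m p U") auto
    define k where "k = e' / (2 * (A + 1))"
    have k: "k > 0" using A e' by (simp add: k_def)
    have kA: "k * A \<le> e' / 2"
    proof -
      have "k * A = (e' / 2) * (A / (A + 1))" by (simp add: k_def)
      also have "\<dots> \<le> (e' / 2) * 1" using A e' by (intro mult_left_mono) auto
      finally show ?thesis by simp
    qed
    have "(\<lambda>n. ennreal (k powr (1 - p)) * powr_integral m p (\<lambda>x. F n x - V x)) \<longlonglongrightarrow> ennreal (k powr (1 - p)) * 0"
      by (rule ennreal_tendsto_cmult[OF _ lim]) simp
    then have "(\<lambda>n. ennreal (k powr (1 - p)) * powr_integral m p (\<lambda>x. F n x - V x)) \<longlonglongrightarrow> 0" by simp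
    then have "\<forall>\<^sub>F n in sequentially. ennreal (k powr (1 - p)) * powr_integral m p (\<lambda>x. F n x - V x) < ennreal (e' / 2)"
      by (rule order_tendstoD(2)) (use e' in simp)
    then show "\<forall>\<^sub>F n in sequentially. powr_integral m 1 (\<lambda>x. pflux p (U x) \<bullet> F n x - pflux p (U x) \<bullet> V x) < e"
    proof eventually_elim
      case (elim n)
      have "powr_integral m 1 (\<lambda>x. pflux p (U x) \<bullet> F n x - pflux p (U x) \<bullet> V x) = powr_integral m 1 (\<lambda>x. pflux p (U x) \<bullet> (F n x - V x))"
        by (simp add: inner_diff_right)
      also have "\<dots> \<le> ennreal k * powr_integral m p U + ennreal (k powr (1 - p)) * powr_integral m p (\<lambda>x. F n x - V x)"
        by (rule powr_integral_flux_le) (use k p in auto)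
      also have "\<dots> \<le> ennreal (e' / 2) + ennreal (e' / 2)"
        using elim kA k A by (intro add_mono) (auto simp: ennreal_mult[symmetric] intro!: ennreal_leI)
      also have "\<dots> = ennreal e'" using e' by (simp add: ennreal_plus[symmetric] del: ennreal_plus)
      finally show ?case using e' by simp
    qed
  qed simp
qed

section \<open>Existence for bounded data by minimisation\<close>

context bounded_open
begin

lemma integrable_bounded_dom:
  fixes g :: "'a \<Rightarrow> 'b::euclidean_space"
  assumes "g \<in> borel_measurable M" "\<And>x. norm (g x) \<le> B"
  shows "integrable M g"
  by (rule integrable_const_bound[where B=B]) (use assms in auto)

lemma powr_integral_lebesgue:
  fixes g :: "'a \<Rightarrow> 'b::euclidean_space"
  assumes "g \<in> borel_measurable M" "\<And>x. norm (g x) \<le> B" "r \<ge> 0"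
  shows "integrable M (\<lambda>x. norm (g x) powr r)" "powr_integral M r g = ennreal (LINT x|M. norm (g x) powr r)"
proof -
  show i: "integrable M (\<lambda>x. norm (g x) powr r)"
    by (rule integrable_bounded_dom[where B="B powr r"]) (use assms in \<open>auto intro!: powr_mono2\<close>)
  show "powr_integral M r g = ennreal (LINT x|M. norm (g x) powr r)"
    unfolding powr_integral_def by (rule nn_integral_eq_integral[OF i]) simp
qed

lemma powr_integral_dom_le_energy:
  fixes g :: "'a \<Rightarrow> 'b::euclidean_space"
  assumes g: "g \<in> borel_measurable M" "\<And>x. norm (g x) \<le> B" and p: "p > 1" and K: "K > 0"
  shows "(LINT x|M. norm (g x)) \<le> K * measure M (space M) + K powr (1 - p) * (LINT x|M. norm (g x) powr p)"
proof -
  have "ennreal (LINT x|M. norm (g x)) = powr_integral M 1 g"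
    using powr_integral_lebesgue(2)[OF g, of 1] by simp
  also have "\<dots> \<le> ennreal (K powr 1) * emeasure M (space M) + ennreal (K powr (1 - p)) * powr_integral M p g"
    by (rule powr_integral_le_lower_exponent) (use g K p in auto)
  also have "\<dots> = ennreal (K * measure M (space M) + K powr (1 - p) * (LINT x|M. norm (g x) powr p))"
    using powr_integral_lebesgue(2)[OF g, of p] p K
    by (simp add: emeasure_eq_measure ennreal_mult)
  finally show ?thesis using K by (subst (asm) ennreal_le_iff) (auto intro!: add_nonneg_nonneg)
qed

text \<open>The energy is \<open>\<integral> |D\<phi>|\<^sup>p / p - \<integral> (W K(\<phi>) + F \<phi>)\<close> with \<open>K' = h\<close>. It is not convex, but its lower order part is
  Lipschitz in \<open>L\<^sup>1\<close>. Hence along a minimising sequence of test functions, first made Cauchy in \<open>L\<^sup>1\<close> by compactness,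
  Clarkson's inequality makes the gradients Cauchy in \<open>L\<^sup>p\<close>. Choosing the sequence optimal up to
  \<open>1 / n\<^sup>2\<close> yields the equation in the limit by variations of size \<open>1 / n\<close>.\<close>

lemma exists_bounded_data_solution:
  assumes p: "2 \<le> p" "p < real DIM('a)"
    and h: "continuous_on UNIV h" "mono h" "\<And>t. \<bar>h t\<bar> \<le> B"
    and W: "W \<in> borel_measurable M" "\<And>x. 0 \<le> W x" "\<And>x. W x \<le> B"
    and F: "F \<in> borel_measurable M" "\<And>x. \<bar>F x\<bar> \<le> B"
  obtains u U where "weak0 p u U"
    "\<And>v V. weak0 p v V \<Longrightarrow> (LINT x|M. pflux p (U x) \<bullet> V x) = (LINT x|M. (W x * h (u x) + F x) * v x)"
proof -
  have p1: "p > 1" "p \<ge> 1" "p > 0" using p by auto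
  have B: "B \<ge> 0" using h(3)[of 0] by linarith
  note [measurable] = W(1) F(1)
  have [measurable]: "h \<in> borel_measurable borel" by (rule borel_measurable_continuous_onI[OF h(1)])
  have [measurable]: "pflux p \<in> borel_measurable (borel::'a measure)" by (rule pflux_borel[OF p(1)])
  obtain H where H: "\<And>t. (H has_real_derivative h t) (at t)" "H 0 = 0"
    using continuous_antiderivative[OF h(1)] by blast
  have "continuous_on UNIV H"
    using DERIV_isCont[OF H(1)] by (simp add: continuous_on_eq_continuous_at)
  then have [measurable]: "H \<in> borel_measurable borel" by (rule borel_measurable_continuous_onI)
  have Hlip: "\<bar>H a - H b\<bar> \<le> B * \<bar>a - b\<bar>" for a b
    using field_differentiable_bound[of UNIV H h B a b] H(1) h(3) by auto
  \<comment> \<open>Monotonicity of h makes its primitive convex; this is the tangent inequality at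
    a, obtained from the mean value theorem.\<close>
  have Hconv: "h a * (b - a) \<le> H b - H a" for a b
  proof -
    consider "a < b" | "b < a" | "a = b" by linarith
    then show ?thesis
    proof cases
      case 1
      then obtain z where z: "a < z" "z < b" "H b - H a = (b - a) * h z"
        using MVT2[of a b H h] H(1) by blast
      then have "h a \<le> h z" using h(2) by (simp add: monoD)
      then show ?thesis using z 1 by (simp add: mult.commute mult_left_mono)
    next
      case 2
      then obtain z where z: "b < z" "z < a" "H a - H b = (a - b) * h z"
        using MVT2[of b a H h] H(1) by blast
      then have "h z \<le> h a" using h(2) by (simp add: monoD)
      then have "(a - b) * h z \<le> (a - b) * h a" using 2 by (intro mult_left_mono) auto
      then show ?thesis using z(3) by (simp add: algebra_simps)
    qed simp
  qed
  \<comment> \<open>A common bound for the derivative k of the lower order integrand Kp and for its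
    Lipschitz constant; the summand 1 only makes it positive.\<close>
  define L where "L = B * B + B + 1"
  have L: "L > 0" using B by (simp add: L_def add_nonneg_pos)
  define k where "k x t = W x * h t + F x" for x t
  define Kp where "Kp x t = W x * H t + F x * t" for x t
  have kb: "\<bar>k x t\<bar> \<le> L" for x t
  proof -
    have "\<bar>k x t\<bar> \<le> \<bar>W x\<bar> * \<bar>h t\<bar> + \<bar>F x\<bar>" unfolding k_def using abs_triangle_ineq abs_mult by metis
    also have "\<dots> \<le> B * B + B" using W(2,3)[of x] h(3)[of t] F(2)[of x] B by (intro add_mono mult_mono) auto
    finally show ?thesis by (simp add: L_def)
  qed
  have Klip: "\<bar>Kp x a - Kp x b\<bar> \<le> L * \<bar>a - b\<bar>" for x a b
  proof -
    have "Kp x a - Kp x b = W x * (H a - H b) + F x * (a - b)" by (simp add: Kp_def algebra_simps)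
    then have "\<bar>Kp x a - Kp x b\<bar> \<le> \<bar>W x\<bar> * \<bar>H a - H b\<bar> + \<bar>F x\<bar> * \<bar>a - b\<bar>" using abs_triangle_ineq abs_mult by metis
    also have "\<dots> \<le> B * (B * \<bar>a - b\<bar>) + B * \<bar>a - b\<bar>"
      using W(2,3)[of x] Hlip[of a b] F(2)[of x] B by (intro add_mono mult_mono) auto
    also have "\<dots> \<le> L * \<bar>a - b\<bar>" by (simp add: L_def algebra_simps)
    finally show ?thesis .
  qed
  have Kconv: "k x a * (b - a) \<le> Kp x b - Kp x a" for x a b
  proof -
    have "W x * (h a * (b - a)) \<le> W x * (H b - H a)" using Hconv W(2) by (intro mult_left_mono) auto
    then show ?thesis by (simp add: Kp_def k_def algebra_simps)
  qed
  have K0: "Kp x 0 = 0" for x by (simp add: Kp_def H(2))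
  have km: "(\<lambda>x. k x (v x)) \<in> borel_measurable M" "(\<lambda>x. Kp x (v x)) \<in> borel_measurable M" if [measurable]: "v \<in> borel_measurable M" for v
    unfolding k_def Kp_def by measurable
  let ?T = "test_functions \<Omega>"
  define E where "E \<phi> = (LINT x|M. norm (grad \<phi> x) powr p)" for \<phi> :: "'a \<Rightarrow> real"
  define S where "S \<phi> = (LINT x|M. Kp x (\<phi> x))" for \<phi> :: "'a \<Rightarrow> real"
  define J where "J \<phi> = E \<phi> / p - S \<phi>" for \<phi> :: "'a \<Rightarrow> real"
  have E0: "E \<phi> \<ge> 0" for \<phi> unfolding E_def by simp
  have iE: "integrable M (\<lambda>x. norm (grad \<phi> x) powr p)" and eE: "powr_integral M p (grad \<phi>) = ennreal (E \<phi>)"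
    and iA: "integrable M (\<lambda>x. \<bar>\<phi> x\<bar>)" and eA: "powr_integral M 1 \<phi> = ennreal (LINT x|M. \<bar>\<phi> x\<bar>)"
    and iK: "integrable M (\<lambda>x. Kp x (\<phi> x))"
    if \<phi>: "\<phi> \<in> ?T" for \<phi>
  proof -
    obtain b where b: "b > 0" "\<And>x. \<bar>\<phi> x\<bar> \<le> b" "\<And>x. norm (grad \<phi> x) \<le> b"
      using test_functions_bounded[OF \<phi>] by blast
    show "integrable M (\<lambda>x. norm (grad \<phi> x) powr p)" "powr_integral M p (grad \<phi>) = ennreal (E \<phi>)"
      using powr_integral_lebesgue[OF test_measurable(2)[OF \<phi>] b(3), of p] p unfolding E_def by auto
    show "integrable M (\<lambda>x. \<bar>\<phi> x\<bar>)" "powr_integral M 1 \<phi> = ennreal (LINT x|M. \<bar>\<phi> x\<bar>)"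
      using powr_integral_lebesgue[OF test_measurable(1)[OF \<phi>], of b 1] b(2) by auto
    show "integrable M (\<lambda>x. Kp x (\<phi> x))"
    proof (rule integrable_bounded_dom[where B="L * b"])
      show "norm (Kp x (\<phi> x)) \<le> L * b" for x
        using Klip[of x "\<phi> x" 0] K0[of x] mult_left_mono[OF b(2)[of x] less_imp_le[OF L]] by simp
    qed (rule km[OF test_measurable(1)[OF \<phi>]])
  qed
  obtain C where C: "C > 0" "\<And>\<phi>. \<phi> \<in> ?T \<Longrightarrow> powr_integral M p \<phi> \<le> ennreal C * powr_integral M p (grad \<phi>)"
    using poincare_test[OF p1(1) p(2)] by blast
  define m where "m = measure M (space M)"
  have m0: "m \<ge> 0" by (simp add: m_def)
  \<comment> \<open>With this q, and K defined by K^(1-p) = q, the lower order term consumes exactly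
    E / (2 p), half of the principal part E / p. The rest is the constant D, and the energy is
    bounded below.\<close>
  define q where "q = 1 / (2 * p * L * C)"
  have q: "q > 0" "L * (q * C) = 1 / (2 * p)" using p L C by (auto simp: q_def)
  define K where "K = q powr (1 / (1 - p))"
  have "K powr (1 - p) = q powr 1" unfolding K_def powr_powr using p by simp
  then have K: "K > 0" "L * (K powr (1 - p) * C) = 1 / (2 * p)" using q by (auto simp: K_def)
  define D where "D = L * (K * m)"
  have Jlow: "J \<phi> \<ge> E \<phi> / (2 * p) - D" if \<phi>: "\<phi> \<in> ?T" for \<phi>
  proof -
    obtain b where b: "b > 0" "\<And>x. \<bar>\<phi> x\<bar> \<le> b" "\<And>x. norm (grad \<phi> x) \<le> b"
      using test_functions_bounded[OF \<phi>] by blast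
    have b': "\<And>x. norm (\<phi> x) \<le> b" using b(2) by simp
    have "ennreal (LINT x|M. norm (\<phi> x) powr p) \<le> ennreal C * ennreal (E \<phi>)"
      using C(2)[OF \<phi>] powr_integral_lebesgue(2)[OF test_measurable(1)[OF \<phi>] b', of p] p eE[OF \<phi>] by simp
    then have P: "(LINT x|M. norm (\<phi> x) powr p) \<le> C * E \<phi>"
      using C(1) E0[of \<phi>] by (simp add: ennreal_mult[symmetric])
    have "S \<phi> \<le> (LINT x|M. L * \<bar>\<phi> x\<bar>)"
      unfolding S_def
    proof (rule integral_mono[OF iK[OF \<phi>]])
      show "Kp x (\<phi> x) \<le> L * \<bar>\<phi> x\<bar>" for x using Klip[of x "\<phi> x" 0] K0[of x] by simp
    qed (use iA[OF \<phi>] in simp)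
    also have "\<dots> = L * (LINT x|M. norm (\<phi> x))" by simp
    also have "\<dots> \<le> L * (K * m + K powr (1 - p) * (LINT x|M. norm (\<phi> x) powr p))"
      unfolding m_def using powr_integral_dom_le_energy[OF test_measurable(1)[OF \<phi>] b' p1(1) K(1)] L by (intro mult_left_mono) auto
    also have "\<dots> \<le> L * (K * m + K powr (1 - p) * (C * E \<phi>))"
      using P L by (intro mult_left_mono add_left_mono) auto
    also have "\<dots> = D + (L * (K powr (1 - p) * C)) * E \<phi>" by (simp add: D_def algebra_simps)
    also have "\<dots> = D + E \<phi> / (2 * p)" unfolding K(2) by simp
    finally have "S \<phi> \<le> D + E \<phi> / (2 * p)" .
    moreover have "E \<phi> / p = E \<phi> / (2 * p) + E \<phi> / (2 * p)" using p by (simp add: field_simps)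
    ultimately show ?thesis unfolding J_def by linarith
  qed
  define I where "I = Inf (J ` ?T)"
  have bdd: "bdd_below (J ` ?T)"
  proof (rule bdd_belowI2)
    show "- D \<le> J \<phi>" if "\<phi> \<in> ?T" for \<phi>
      using Jlow[OF that] E0[of \<phi>] p divide_nonneg_nonneg[of "E \<phi>" "2 * p"] by linarith
  qed
  have I: "I \<le> J \<phi>" if "\<phi> \<in> ?T" for \<phi> unfolding I_def by (rule cINF_lower[OF bdd that])
  have "\<exists>\<phi>. \<phi> \<in> ?T \<and> J \<phi> < I + (1 / real (Suc n))\<^sup>2" for n
  proof -
    have "Inf (J ` ?T) < I + (1 / real (Suc n))\<^sup>2" unfolding I_def by simp
    then show ?thesis
      using cInf_lessD[of "J ` ?T" "I + (1 / real (Suc n))\<^sup>2"] test_functions_zero by blast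
  qed
  then obtain \<phi> where \<phi>: "\<And>n. \<phi> n \<in> ?T" "\<And>n. J (\<phi> n) < I + (1 / real (Suc n))\<^sup>2" by metis
  define E1 where "E1 = 2 * p * (I + 1 + D)"
  have EE: "E (\<phi> n) \<le> E1" for n
  proof -
    have "(1 / real (Suc n))\<^sup>2 \<le> 1\<^sup>2" by (intro power_mono) auto
    then have "E (\<phi> n) / (2 * p) \<le> I + 1 + D" using \<phi>(2)[of n] Jlow[OF \<phi>(1), of n] by simp
    then show ?thesis using p by (simp add: E1_def divide_le_eq mult.commute)
  qed
  have E10: "E1 \<ge> 0" using EE[of 0] E0[of "\<phi> 0"] by linarith
  note [measurable] = test_measurable[OF \<phi>(1)]
  define C1 where "C1 = m + max 1 C * E1 + 1"
  have C1: "C1 > 0" using m0 E10 by (simp add: C1_def add_nonneg_pos)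
  have "powr_integral M 1 (\<phi> n) \<le> ennreal C1" for n
  proof -
    have "powr_integral M 1 (\<phi> n) \<le> ennreal (1 powr 1) * emeasure M (space M) + ennreal (1 powr (1 - p)) * powr_integral M p (\<phi> n)"
      by (rule powr_integral_le_lower_exponent) (use p in auto)
    also have "\<dots> \<le> ennreal m + ennreal C * ennreal E1"
      using order_trans[OF C(2)[OF \<phi>(1)[of n]] mult_left_mono] EE[of n] eE[OF \<phi>(1)[of n]]
      by (intro add_mono) (auto simp: m_def emeasure_eq_measure ennreal_leI)
    also have "\<dots> = ennreal (m + C * E1)" using m0 C E10 by (simp add: ennreal_mult)
    also have "\<dots> \<le> ennreal C1"
      unfolding C1_def using mult_right_mono[OF max.cobounded2[of C 1] E10] by (intro ennreal_leI) simp
    finally show ?thesis .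
  qed
  moreover have "powr_integral M 1 (grad (\<phi> n)) \<le> ennreal C1" for n
  proof -
    have "powr_integral M 1 (grad (\<phi> n)) \<le> ennreal (1 powr 1) * emeasure M (space M) + ennreal (1 powr (1 - p)) * powr_integral M p (grad (\<phi> n))"
      by (rule powr_integral_le_lower_exponent) (use p in auto)
    also have "\<dots> \<le> ennreal m + ennreal E1"
      using EE[of n] eE[OF \<phi>(1)[of n]]
      by (intro add_mono) (auto simp: m_def emeasure_eq_measure ennreal_leI)
    also have "\<dots> = ennreal (m + 1 * E1)" using m0 E10 by simp
    also have "\<dots> \<le> ennreal C1"
      unfolding C1_def using mult_right_mono[OF max.cobounded1[of 1 C] E10] by (intro ennreal_leI) simp
    finally show ?thesis .
  qed
  ultimately obtain r where r: "strict_mono (r::nat \<Rightarrow> nat)"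
    "\<And>e. e > 0 \<Longrightarrow> \<exists>n0. \<forall>i\<ge>n0. \<forall>j\<ge>n0. powr_integral M 1 (\<lambda>x. \<phi> (r i) x - \<phi> (r j) x) \<le> ennreal e"
    using rellich_test[of \<phi> C1, OF \<phi>(1) _ _ C1] by blast
  \<comment> \<open>The midpoint of \<phi> i and \<phi> j is a competitor, so its energy is at least
    I. Clarkson's inequality bounds the principal part of its energy by the mean minus the energy of
    half the difference, whereas the lower order part moves by at most L / 2 times the L^1 distance.
    What the midpoint gains must be covered by the two defects and that distance.\<close>
  have half: "E (\<lambda>x. \<phi> i x + -1 * \<phi> j x) \<le> 2 powr p * p * ((1 / real (Suc i))\<^sup>2 + (1 / real (Suc j))\<^sup>2 + L * (LINT x|M. \<bar>\<phi> i x - \<phi> j x\<bar>))" for i j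
  proof -
    let ?a = "\<lambda>x. (1/2) * (\<phi> i x + \<phi> j x)"
    let ?d = "\<lambda>x. \<phi> i x + -1 * \<phi> j x"
    have aT: "?a \<in> ?T" by (intro test_functions_cmult test_functions_add \<phi>)
    have dT: "?d \<in> ?T" by (intro test_functions_cmult test_functions_add \<phi>)
    have diff: "\<phi> n differentiable (at x)" for n x by (rule test_functions_differentiable[OF \<phi>(1)])
    have ga: "grad ?a x = (1/2) *\<^sub>R (grad (\<phi> i) x + grad (\<phi> j) x)" for x
      using diff by (simp only: grad_cmult[OF differentiable_add[OF diff diff]] grad_add[OF diff diff])
    have gd: "grad ?d x = grad (\<phi> i) x - grad (\<phi> j) x" for x
    proof -
      have "grad ?d x = grad (\<phi> i) x + grad (\<lambda>x. -1 * \<phi> j x) x"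
        by (rule grad_add[OF diff differentiable_mult[OF differentiable_const diff]])
      also have "grad (\<lambda>x. -1 * \<phi> j x) x = -1 *\<^sub>R grad (\<phi> j) x" by (rule grad_cmult[OF diff])
      finally show ?thesis by simp
    qed
    have "norm (grad ?a x) powr p + (1/2) powr p * norm (grad ?d x) powr p \<le> (norm (grad (\<phi> i) x) powr p + norm (grad (\<phi> j) x) powr p) / 2" for x
      unfolding ga gd using clarkson[OF p(1), of "grad (\<phi> i) x" "grad (\<phi> j) x"] by (simp add: powr_mult powr_divide)
    then have "(LINT x|M. norm (grad ?a x) powr p + (1/2) powr p * norm (grad ?d x) powr p) \<le> (LINT x|M. (norm (grad (\<phi> i) x) powr p + norm (grad (\<phi> j) x) powr p) / 2)"
      using iE[OF aT] iE[OF dT] iE[OF \<phi>(1)] by (intro integral_mono) auto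
    then have c: "E ?a + (1/2) powr p * E ?d \<le> (E (\<phi> i) + E (\<phi> j)) / 2"
      unfolding E_def using iE[OF aT] iE[OF dT] iE[OF \<phi>(1)] by simp
    have iabs: "integrable M (\<lambda>x. \<bar>\<phi> i x - \<phi> j x\<bar>)" using iA[OF dT] by simp
    have sS: "S (\<phi> n) \<le> S ?a + L / 2 * (LINT x|M. \<bar>\<phi> i x - \<phi> j x\<bar>)" if n: "n = i \<or> n = j" for n
    proof -
      have "S (\<phi> n) \<le> (LINT x|M. Kp x (?a x) + L / 2 * \<bar>\<phi> i x - \<phi> j x\<bar>)"
        unfolding S_def
      proof (rule integral_mono[OF iK[OF \<phi>(1)]])
        show "integrable M (\<lambda>x. Kp x (?a x) + L / 2 * \<bar>\<phi> i x - \<phi> j x\<bar>)" using iK[OF aT] iabs by simp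
        fix x
        have "\<bar>\<phi> n x - ?a x\<bar> = \<bar>\<phi> i x - \<phi> j x\<bar> / 2" using n by (auto simp: field_simps)
        then have "L * \<bar>\<phi> n x - ?a x\<bar> = L / 2 * \<bar>\<phi> i x - \<phi> j x\<bar>" by (simp only:)
        then show "Kp x (\<phi> n x) \<le> Kp x (?a x) + L / 2 * \<bar>\<phi> i x - \<phi> j x\<bar>"
          using Klip[of x "\<phi> n x" "?a x"] by linarith
      qed
      also have "\<dots> = S ?a + L / 2 * (LINT x|M. \<bar>\<phi> i x - \<phi> j x\<bar>)"
        unfolding S_def using iK[OF aT] iabs by simp
      finally show ?thesis .
    qed
    \<comment> \<open>The comparison is linear once energies and integrals are replaced by
      variables, with Z standing for L z. The exact bound would be half of the stated one.\<close>
    have lin: "X \<le> a + b + Z" if "I \<le> Ea - Sa" "Ea + X \<le> (Ei + Ej) / 2" "Ei - Si < I + a" "Ej - Sj < I + b"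
      "Si \<le> Sa + L / 2 * z" "Sj \<le> Sa + L / 2 * z" "L * z = Z" "0 \<le> a" "0 \<le> b" "0 \<le> Z" for X a b Z Ea Sa Ei Ej Si Sj z
    proof -
      have e: "L / 2 * z = Z / 2" using that(7) by simp
      show ?thesis using that(1-4,8-10) that(5,6)[unfolded e] by (simp add: field_simps)
    qed
    have "(1/2) powr p * E ?d / p \<le> (1 / real (Suc i))\<^sup>2 + (1 / real (Suc j))\<^sup>2 + L * (LINT x|M. \<bar>\<phi> i x - \<phi> j x\<bar>)"
    proof (rule lin)
      show "I \<le> E ?a / p - S ?a" using I[OF aT] by (simp add: J_def)
      show "E ?a / p + (1/2) powr p * E ?d / p \<le> (E (\<phi> i) / p + E (\<phi> j) / p) / 2"
        using divide_right_mono[OF c, of p] p by (simp add: add_divide_distrib)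
      show "E (\<phi> i) / p - S (\<phi> i) < I + (1 / real (Suc i))\<^sup>2" "E (\<phi> j) / p - S (\<phi> j) < I + (1 / real (Suc j))\<^sup>2"
        using \<phi>(2)[of i] \<phi>(2)[of j] by (simp_all only: J_def)
      show "S (\<phi> i) \<le> S ?a + L / 2 * (LINT x|M. \<bar>\<phi> i x - \<phi> j x\<bar>)" "S (\<phi> j) \<le> S ?a + L / 2 * (LINT x|M. \<bar>\<phi> i x - \<phi> j x\<bar>)"
        using sS by blast+
    qed (use L in auto)
    then have "2 powr p * p * ((1/2) powr p * E ?d / p) \<le> 2 powr p * p * ((1 / real (Suc i))\<^sup>2 + (1 / real (Suc j))\<^sup>2 + L * (LINT x|M. \<bar>\<phi> i x - \<phi> j x\<bar>))"
      using p by (intro mult_left_mono) auto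
    moreover have "2 powr p * p * ((1/2) powr p * E ?d / p) = E ?d" using p by (simp add: powr_divide)
    ultimately show ?thesis by simp
  qed
  define \<Phi> where "\<Phi> n = \<phi> (r n)" for n
  have \<Phi>T: "\<Phi> n \<in> ?T" for n unfolding \<Phi>_def by (rule \<phi>(1))
  note [measurable] = test_measurable[OF \<Phi>T]
  have dT: "(\<lambda>x. \<Phi> i x + -1 * \<Phi> j x) \<in> ?T" for i j by (intro test_functions_cmult test_functions_add \<Phi>T)
  have gd: "grad (\<lambda>x. \<Phi> i x + -1 * \<Phi> j x) x = grad (\<Phi> i) x - grad (\<Phi> j) x" for i j x
  proof -
    have diff: "\<Phi> n differentiable (at x)" for n x by (rule test_functions_differentiable[OF \<Phi>T])
    have "grad (\<lambda>x. \<Phi> i x + -1 * \<Phi> j x) x = grad (\<Phi> i) x + grad (\<lambda>x. -1 * \<Phi> j x) x"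
      by (rule grad_add[OF diff differentiable_mult[OF differentiable_const diff]])
    also have "grad (\<lambda>x. -1 * \<Phi> j x) x = -1 *\<^sub>R grad (\<Phi> j) x" by (rule grad_cmult[OF diff])
    finally show ?thesis by simp
  qed
  have cE: "\<exists>n0. \<forall>i\<ge>n0. \<forall>j\<ge>n0. E (\<lambda>x. \<Phi> i x + -1 * \<Phi> j x) \<le> e" if e: "e > 0" for e
  proof -
    define e' where "e' = e / (2 powr p * p)"
    have e': "e' > 0" using e p by (simp add: e'_def)
    obtain n1 where n1: "1 / real (Suc n1) < e' / 3"
      using reals_Archimedean[of "e' / 3"] e' by (auto simp: inverse_eq_divide)
    obtain n2 where n2: "\<And>i j. i \<ge> n2 \<Longrightarrow> j \<ge> n2 \<Longrightarrow> powr_integral M 1 (\<lambda>x. \<phi> (r i) x - \<phi> (r j) x) \<le> ennreal (e' / (3 * L))"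
      using r(2)[of "e' / (3 * L)"] e' L by auto
    have sq: "(1 / real (Suc (r i)))\<^sup>2 \<le> e' / 3" if "i \<ge> n1" for i
    proof -
      have "(1 / real (Suc (r i)))\<^sup>2 \<le> 1 / real (Suc (r i))"
        using power_decreasing[of 1 2 "1 / real (Suc (r i))"] by simp
      also have "r i \<ge> n1" using seq_suble[OF r(1), of i] that by simp
      then have "1 / real (Suc (r i)) \<le> 1 / real (Suc n1)" by (intro divide_left_mono) auto
      finally show ?thesis using n1 by linarith
    qed
    have "E (\<lambda>x. \<Phi> i x + -1 * \<Phi> j x) \<le> e" if ij: "i \<ge> max n1 n2" "j \<ge> max n1 n2" for i j
    proof -
      have "powr_integral M 1 (\<lambda>x. \<Phi> i x + -1 * \<Phi> j x) \<le> ennreal (e' / (3 * L))" using n2[of i j] ij by (simp add: \<Phi>_def)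
      then have "(LINT x|M. \<bar>\<Phi> i x + -1 * \<Phi> j x\<bar>) \<le> e' / (3 * L)"
        using e' L unfolding eA[OF dT] by (simp add: ennreal_le_iff)
      then have "L * (LINT x|M. \<bar>\<Phi> i x - \<Phi> j x\<bar>) \<le> L * (e' / (3 * L))" using L by (intro mult_left_mono) auto
      then have "L * (LINT x|M. \<bar>\<Phi> i x - \<Phi> j x\<bar>) \<le> e' / 3" using L by simp
      then have "(1 / real (Suc (r i)))\<^sup>2 + (1 / real (Suc (r j)))\<^sup>2 + L * (LINT x|M. \<bar>\<phi> (r i) x - \<phi> (r j) x\<bar>) \<le> e'"
        using sq[of i] sq[of j] ij unfolding \<Phi>_def by simp
      then have "2 powr p * p * ((1 / real (Suc (r i)))\<^sup>2 + (1 / real (Suc (r j)))\<^sup>2 + L * (LINT x|M. \<bar>\<phi> (r i) x - \<phi> (r j) x\<bar>)) \<le> 2 powr p * p * e'"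
        using p by (intro mult_left_mono) auto
      also have "\<dots> = e" using p by (simp add: e'_def)
      finally show ?thesis using half[of "r i" "r j"] unfolding \<Phi>_def by linarith
    qed
    then show ?thesis by blast
  qed
  have cG: "\<exists>n0. \<forall>i\<ge>n0. \<forall>j\<ge>n0. powr_integral M p (\<lambda>x. grad (\<Phi> i) x - grad (\<Phi> j) x) \<le> ennreal e" if e: "e > 0" for e
  proof -
    obtain n0 where n0: "\<And>i j. i \<ge> n0 \<Longrightarrow> j \<ge> n0 \<Longrightarrow> E (\<lambda>x. \<Phi> i x + -1 * \<Phi> j x) \<le> e"
      using cE[OF e] by blast
    show ?thesis
      using ennreal_leI[OF n0] unfolding eE[OF dT, symmetric] gd by blast
  qed
  have c\<Phi>: "\<exists>n0. \<forall>i\<ge>n0. \<forall>j\<ge>n0. powr_integral M p (\<lambda>x. \<Phi> i x - \<Phi> j x) \<le> ennreal e" if e: "e > 0" for e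
  proof -
    obtain n0 where n0: "\<And>i j. i \<ge> n0 \<Longrightarrow> j \<ge> n0 \<Longrightarrow> E (\<lambda>x. \<Phi> i x + -1 * \<Phi> j x) \<le> e / C"
      using cE[of "e / C"] e C by auto
    have "powr_integral M p (\<lambda>x. \<Phi> i x - \<Phi> j x) \<le> ennreal e" if "i \<ge> n0" "j \<ge> n0" for i j
    proof -
      have "powr_integral M p (\<lambda>x. \<Phi> i x + -1 * \<Phi> j x) \<le> ennreal C * ennreal (E (\<lambda>x. \<Phi> i x + -1 * \<Phi> j x))"
        using C(2)[OF dT] eE[OF dT] by simp
      also have "\<dots> \<le> ennreal C * ennreal (e / C)" using n0[OF that] by (intro mult_left_mono ennreal_leI) auto
      also have "\<dots> = ennreal e" using C e by (simp add: ennreal_mult[symmetric])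
      finally show ?thesis by simp
    qed
    then show ?thesis by blast
  qed
  have i\<Phi>: "integrable M (\<Phi> n)" and iG: "integrable M (grad (\<Phi> n))" for n
    using weak0_integrable[OF weak0_test[OF \<Phi>T]] by auto
  obtain u s where u: "u \<in> borel_measurable M" "strict_mono (s::nat\<Rightarrow>nat)" "AE x in M. (\<lambda>n. \<Phi> (s n) x) \<longlonglongrightarrow> u x"
    "(\<lambda>n. powr_integral M p (\<lambda>x. \<Phi> n x - u x)) \<longlonglongrightarrow> 0"
    using powr_integral_complete[of M \<Phi> p, OF finite_M i\<Phi> p1(2) c\<Phi>] by blast
  obtain U s' where U: "U \<in> borel_measurable M" "strict_mono (s'::nat\<Rightarrow>nat)" "AE x in M. (\<lambda>n. grad (\<Phi> (s' n)) x) \<longlonglongrightarrow> U x"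
    "(\<lambda>n. powr_integral M p (\<lambda>x. grad (\<Phi> n) x - U x)) \<longlonglongrightarrow> 0"
    using powr_integral_complete[of M "\<lambda>n. grad (\<Phi> n)" p, OF finite_M iG p1(2) cG] by blast
  note [measurable] = u(1) U(1)
  have w: "weak0 p u U" unfolding weak0_def using u(1,4) U(1,4) \<Phi>T by (intro conjI exI[of _ \<Phi>]) auto
  have l: "(\<lambda>n. powr_integral M p (\<lambda>x. grad (\<Phi> (s n)) x - U x)) \<longlonglongrightarrow> 0"
    using LIMSEQ_subseq_LIMSEQ[OF U(4) u(2)] by (simp add: o_def)
  have lm: "(\<lambda>x. grad (\<Phi> (s n)) x - U x) \<in> borel_measurable M" for n by measurable
  obtain t where t: "strict_mono (t::nat\<Rightarrow>nat)" "AE x in M. (\<lambda>n. grad (\<Phi> (s (t n))) x - U x) \<longlonglongrightarrow> 0"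
    by (rule powr_integral_AE_subseq[OF lm p1(3) l])
  \<comment> \<open>The position in the original near-minimising sequence, which governs the defect
    of \<psi> n after three subsequences have been taken.\<close>
  define idx where "idx n = r (s (t n))" for n
  have idx: "idx n \<ge> n" for n
    unfolding idx_def using seq_suble[OF r(1), of "s (t n)"] seq_suble[OF u(2), of "t n"] seq_suble[OF t(1), of n] by linarith
  define \<psi> where "\<psi> n = \<phi> (idx n)" for n
  have \<psi>T: "\<psi> n \<in> ?T" for n unfolding \<psi>_def by (rule \<phi>(1))
  note [measurable] = test_measurable[OF \<psi>T]
  have ae1: "AE x in M. (\<lambda>n. \<psi> n x) \<longlonglongrightarrow> u x"
    using u(3)
  proof eventually_elim
    case (elim x)
    from LIMSEQ_subseq_LIMSEQ[OF this t(1)] show ?case by (simp add: o_def \<psi>_def idx_def \<Phi>_def)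
  qed
  have ae2: "AE x in M. (\<lambda>n. grad (\<psi> n) x) \<longlonglongrightarrow> U x"
    using t(2)
  proof eventually_elim
    case (elim x)
    from LIM_zero_cancel[OF this] show ?case by (simp add: \<psi>_def idx_def \<Phi>_def)
  qed
  \<comment> \<open>The step is the square root of the allowed defect in the energy, so the defect
    divided by the step still tends to 0.\<close>
  define \<tau> where "\<tau> n = 1 / real (Suc (idx n))" for n
  have \<tau>: "\<tau> n > 0" "\<tau> n \<le> 1" for n by (auto simp: \<tau>_def)
  have \<tau>0: "\<tau> \<longlonglongrightarrow> 0"
  proof (rule tendsto_sandwich[OF _ _ tendsto_const LIMSEQ_Suc[OF lim_1_over_n]])
    show "\<forall>\<^sub>F n in sequentially. 0 \<le> \<tau> n" using \<tau>(1) by (intro always_eventually allI less_imp_le)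
    show "\<forall>\<^sub>F n in sequentially. \<tau> n \<le> 1 / real (Suc n)"
      unfolding \<tau>_def using idx by (intro always_eventually allI divide_left_mono) auto
  qed
  \<comment> \<open>Minimality yields only an inequality for the direction \<eta>. The same
    statement for the negative of \<eta> turns it into an equation.\<close>
  have EL: "(LINT x|M. pflux p (U x) \<bullet> grad \<eta> x) \<ge> (LINT x|M. k x (u x) * \<eta> x)" if \<eta>: "\<eta> \<in> ?T" for \<eta>
  proof -
    note [measurable] = test_measurable[OF \<eta>]
    obtain b where b: "b > 0" "\<And>x. \<bar>\<eta> x\<bar> \<le> b" "\<And>x. norm (grad \<eta> x) \<le> b"
      using test_functions_bounded[OF \<eta>] by blast
    define \<psi>' where "\<psi>' n x = \<psi> n x + \<tau> n * \<eta> x" for n x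
    have \<psi>'T: "\<psi>' n \<in> ?T" for n unfolding \<psi>'_def by (intro test_functions_add test_functions_cmult \<psi>T \<eta>)
    note [measurable] = test_measurable[OF \<psi>'T]
    have g: "grad (\<psi>' n) x = grad (\<psi> n) x + \<tau> n *\<^sub>R grad \<eta> x" for n x
    proof -
      note d1 = test_functions_differentiable[OF \<psi>T] and d2 = test_functions_differentiable[OF \<eta>]
      have "grad (\<psi>' n) x = grad (\<psi> n) x + grad (\<lambda>x. \<tau> n * \<eta> x) x"
        unfolding \<psi>'_def by (rule grad_add[OF d1 differentiable_mult[OF differentiable_const d2]])
      also have "grad (\<lambda>x. \<tau> n * \<eta> x) x = \<tau> n *\<^sub>R grad \<eta> x" by (rule grad_cmult[OF d2])
      finally show ?thesis .
    qed
    have fE: "powr_integral M p (grad \<xi>) < \<infinity>" if "\<xi> \<in> ?T" for \<xi> using eE[OF that] by simp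
    have if1: "integrable M (\<lambda>x. pflux p (grad (\<psi>' n) x) \<bullet> grad \<eta> x)" for n
      by (rule integrable_flux[OF _ _ p(1) fE[OF \<psi>'T] fE[OF \<eta>]]) measurable
    have kbn: "norm (k x (v x) * \<eta> x) \<le> L * b" for v x
      using mult_mono[OF kb[of x "v x"] b(2)[of x]] L by (simp add: abs_mult)
    have if2: "integrable M (\<lambda>x. k x (\<psi> n x) * \<eta> x)" for n
      by (rule integrable_bounded_dom[OF _ kbn]) (intro borel_measurable_times km, measurable)
    \<comment> \<open>Convexity is used at opposite ends of the variation: the increase of the
      principal part is bounded above by its derivative at the perturbed gradient, the increase of
      the lower order part is bounded below by its derivative at \<psi> n. Thus no second order
      error appears, and dividing by \<tau> n leaves only - \<tau> n.\<close>
    have key: "(LINT x|M. pflux p (grad (\<psi>' n) x) \<bullet> grad \<eta> x) - (LINT x|M. k x (\<psi> n x) * \<eta> x) \<ge> - \<tau> n" for n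
    proof -
      have "E (\<psi>' n) - E (\<psi> n) = (LINT x|M. norm (grad (\<psi>' n) x) powr p - norm (grad (\<psi> n) x) powr p)"
        unfolding E_def using iE[OF \<psi>'T] iE[OF \<psi>T] by simp
      also have "\<dots> \<le> (LINT x|M. p * \<tau> n * (pflux p (grad (\<psi>' n) x) \<bullet> grad \<eta> x))"
      proof (rule integral_mono)
        show "norm (grad (\<psi>' n) x) powr p - norm (grad (\<psi> n) x) powr p \<le> p * \<tau> n * (pflux p (grad (\<psi>' n) x) \<bullet> grad \<eta> x)" for x
          using pflux_convex[OF p1(1), of "grad (\<psi>' n) x" "grad (\<psi> n) x"] unfolding g by (simp add: algebra_simps)
      qed (use iE[OF \<psi>'T] iE[OF \<psi>T] if1 in auto)
      also have "\<dots> = p * \<tau> n * (LINT x|M. pflux p (grad (\<psi>' n) x) \<bullet> grad \<eta> x)" by simp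
      finally have 1: "(E (\<psi>' n) - E (\<psi> n)) / p \<le> \<tau> n * (LINT x|M. pflux p (grad (\<psi>' n) x) \<bullet> grad \<eta> x)"
        using p by (simp add: divide_le_eq mult_ac)
      have "\<tau> n * (LINT x|M. k x (\<psi> n x) * \<eta> x) = (LINT x|M. \<tau> n * (k x (\<psi> n x) * \<eta> x))" by simp
      also have "\<dots> \<le> (LINT x|M. Kp x (\<psi>' n x) - Kp x (\<psi> n x))"
      proof (rule integral_mono)
        show "\<tau> n * (k x (\<psi> n x) * \<eta> x) \<le> Kp x (\<psi>' n x) - Kp x (\<psi> n x)" for x
          using Kconv[of x "\<psi> n x" "\<psi>' n x"] by (simp add: \<psi>'_def mult_ac)
      qed (use iK[OF \<psi>'T] iK[OF \<psi>T] if2 in auto)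
      also have "\<dots> = S (\<psi>' n) - S (\<psi> n)" unfolding S_def using iK[OF \<psi>'T] iK[OF \<psi>T] by simp
      finally have 2: "\<tau> n * (LINT x|M. k x (\<psi> n x) * \<eta> x) \<le> S (\<psi>' n) - S (\<psi> n)" .
      have 3: "J (\<psi> n) < I + \<tau> n * \<tau> n" using \<phi>(2)[of "idx n"] by (simp add: \<psi>_def \<tau>_def power2_eq_square)
      have 4: "I \<le> J (\<psi>' n)" by (rule I[OF \<psi>'T])
      have "- (\<tau> n * \<tau> n) \<le> (E (\<psi>' n) - E (\<psi> n)) / p - (S (\<psi>' n) - S (\<psi> n))"
        using 3 4 unfolding J_def diff_divide_distrib by linarith
      also have "\<dots> \<le> \<tau> n * (LINT x|M. pflux p (grad (\<psi>' n) x) \<bullet> grad \<eta> x) - \<tau> n * (LINT x|M. k x (\<psi> n x) * \<eta> x)"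
        using 1 2 by linarith
      finally have "\<tau> n * (- \<tau> n) \<le> \<tau> n * ((LINT x|M. pflux p (grad (\<psi>' n) x) \<bullet> grad \<eta> x) - (LINT x|M. k x (\<psi> n x) * \<eta> x))"
        by (simp add: right_diff_distrib)
      then show ?thesis using \<tau>(1)[of n] by (simp only: mult_le_cancel_left_pos)
    qed
    \<comment> \<open>The fluxes of gradients bounded in L^p are bounded in L^a with the conjugate
      exponent a > 1, which supplies equi-integrability.\<close>
    define a where "a = p / (p - 1)"
    have a: "a > 1" "a * (p - 1) = p" using p by (auto simp: a_def)
    have l1: "(\<lambda>n. LINT x|M. pflux p (grad (\<psi>' n) x) \<bullet> grad \<eta> x) \<longlonglongrightarrow> (LINT x|M. pflux p (U x) \<bullet> grad \<eta> x)"
    proof (rule integral_vitali(2)[OF finite_M _ _ a(1)])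
      show "AE x in M. (\<lambda>n. pflux p (grad (\<psi>' n) x) \<bullet> grad \<eta> x) \<longlonglongrightarrow> pflux p (U x) \<bullet> grad \<eta> x"
        using ae2
      proof eventually_elim
        case (elim x)
        have "(\<lambda>n. grad (\<psi> n) x + \<tau> n *\<^sub>R grad \<eta> x) \<longlonglongrightarrow> U x + 0 *\<^sub>R grad \<eta> x"
          by (intro tendsto_add tendsto_scaleR tendsto_const elim \<tau>0)
        then have "(\<lambda>n. grad (\<psi>' n) x) \<longlonglongrightarrow> U x" unfolding g by simp
        then show ?case by (intro tendsto_inner tendsto_const pflux_tendsto[OF p(1)])
      qed
      show "powr_integral M a (\<lambda>x. pflux p (grad (\<psi>' n) x) \<bullet> grad \<eta> x) \<le> ennreal (b powr a * (2 powr p * (E1 + E \<eta>)))" for n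
      proof -
        have "powr_integral M a (\<lambda>x. pflux p (grad (\<psi>' n) x) \<bullet> grad \<eta> x) \<le> (\<integral>\<^sup>+x. ennreal (b powr a * norm (grad (\<psi>' n) x) powr p) \<partial>M)"
          unfolding powr_integral_def
        proof (intro nn_integral_mono ennreal_leI)
          fix x
          have "norm (pflux p (grad (\<psi>' n) x) \<bullet> grad \<eta> x) \<le> norm (grad (\<psi>' n) x) powr (p - 1) * b"
            using Cauchy_Schwarz_ineq2[of "pflux p (grad (\<psi>' n) x)" "grad \<eta> x"] mult_left_mono[OF b(3)[of x], of "norm (grad (\<psi>' n) x) powr (p - 1)"]
            unfolding norm_pflux by simp
          then have "norm (pflux p (grad (\<psi>' n) x) \<bullet> grad \<eta> x) powr a \<le> (norm (grad (\<psi>' n) x) powr (p - 1) * b) powr a"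
            using a by (intro powr_mono2) auto
          also have "\<dots> = b powr a * norm (grad (\<psi>' n) x) powr p"
            using a b by (simp add: powr_mult powr_powr mult.commute)
          finally show "norm (pflux p (grad (\<psi>' n) x) \<bullet> grad \<eta> x) powr a \<le> b powr a * norm (grad (\<psi>' n) x) powr p" .
        qed
        also have "\<dots> = ennreal (b powr a) * powr_integral M p (\<lambda>x. grad (\<psi> n) x + \<tau> n *\<^sub>R grad \<eta> x)"
          unfolding powr_integral_def g[symmetric] by (rule nn_integral_ennreal_cmult) auto
        also have "\<dots> \<le> ennreal (b powr a) * (ennreal (2 powr p) * (powr_integral M p (grad (\<psi> n)) + powr_integral M p (\<lambda>x. \<tau> n *\<^sub>R grad \<eta> x)))"
          using p1 by (intro mult_left_mono powr_integral_add_le) auto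
        also have "\<dots> \<le> ennreal (b powr a) * (ennreal (2 powr p) * (ennreal E1 + ennreal (E \<eta>)))"
        proof (intro mult_left_mono add_mono)
          show "powr_integral M p (grad (\<psi> n)) \<le> ennreal E1"
            unfolding eE[OF \<psi>T] unfolding \<psi>_def by (rule ennreal_leI[OF EE])
          have "powr_integral M p (\<lambda>x. \<tau> n *\<^sub>R grad \<eta> x) \<le> powr_integral M p (grad \<eta>)"
            using \<tau>[of n] p1 by (intro powr_integral_mono) (auto simp: mult_left_le_one_le)
          then show "powr_integral M p (\<lambda>x. \<tau> n *\<^sub>R grad \<eta> x) \<le> ennreal (E \<eta>)" unfolding eE[OF \<eta>] .
        qed auto
        also have "\<dots> = ennreal (b powr a * (2 powr p * (E1 + E \<eta>)))"
          using E10 E0 by (simp add: ennreal_mult)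
        finally show ?thesis .
      qed
    qed measurable
    have l2: "(\<lambda>n. LINT x|M. k x (\<psi> n x) * \<eta> x) \<longlonglongrightarrow> (LINT x|M. k x (u x) * \<eta> x)"
    proof (rule integral_dominated_convergence[where w="\<lambda>x. L * b"])
      show "AE x in M. (\<lambda>n. k x (\<psi> n x) * \<eta> x) \<longlonglongrightarrow> k x (u x) * \<eta> x"
        using ae1
      proof eventually_elim
        case (elim x)
        have "isCont h (u x)" using h(1) by (simp add: continuous_on_eq_continuous_at)
        then have "(\<lambda>n. h (\<psi> n x)) \<longlonglongrightarrow> h (u x)" using elim by (rule isCont_tendsto_compose)
        then show ?case unfolding k_def by (intro tendsto_intros)
      qed
      show "(\<lambda>x. k x (\<psi> n x) * \<eta> x) \<in> borel_measurable M" for n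
        by (intro borel_measurable_times km) measurable
      show "(\<lambda>x. k x (u x) * \<eta> x) \<in> borel_measurable M"
        by (intro borel_measurable_times km) measurable
    qed (use kbn in auto)
    have "(\<lambda>n. - \<tau> n) \<longlonglongrightarrow> - 0" by (intro tendsto_minus \<tau>0)
    moreover have "(\<lambda>n. (LINT x|M. pflux p (grad (\<psi>' n) x) \<bullet> grad \<eta> x) - (LINT x|M. k x (\<psi> n x) * \<eta> x)) \<longlonglongrightarrow> (LINT x|M. pflux p (U x) \<bullet> grad \<eta> x) - (LINT x|M. k x (u x) * \<eta> x)"
      by (intro tendsto_diff l1 l2)
    ultimately have "- 0 \<le> (LINT x|M. pflux p (U x) \<bullet> grad \<eta> x) - (LINT x|M. k x (u x) * \<eta> x)"
      by (rule LIMSEQ_le) (use key in auto)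
    then show ?thesis by simp
  qed
  have EQ: "(LINT x|M. pflux p (U x) \<bullet> grad \<eta> x) = (LINT x|M. k x (u x) * \<eta> x)" if \<eta>: "\<eta> \<in> ?T" for \<eta>
  proof -
    have gm: "grad (\<lambda>x. -1 * \<eta> x) x = -1 *\<^sub>R grad \<eta> x" for x
      by (rule grad_cmult[OF test_functions_differentiable[OF \<eta>]])
    have "(LINT x|M. pflux p (U x) \<bullet> grad (\<lambda>x. -1 * \<eta> x) x) \<ge> (LINT x|M. k x (u x) * (-1 * \<eta> x))"
      by (rule EL[OF test_functions_cmult[OF \<eta>]])
    then have "- (LINT x|M. pflux p (U x) \<bullet> grad \<eta> x) \<ge> - (LINT x|M. k x (u x) * \<eta> x)"
      unfolding gm by simp
    with EL[OF \<eta>] show ?thesis by linarith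
  qed
  show thesis
  proof (rule that[OF w])
    fix v V assume v: "weak0 p v V"
    obtain \<eta> where \<eta>: "\<And>n. \<eta> n \<in> ?T"
      "(\<lambda>n. powr_integral M p (\<lambda>x. \<eta> n x - v x)) \<longlonglongrightarrow> 0" "(\<lambda>n. powr_integral M p (\<lambda>x. grad (\<eta> n) x - V x)) \<longlonglongrightarrow> 0"
      using v unfolding weak0_def by blast
    note [measurable] = test_measurable[OF \<eta>(1)] weak0_measurable[OF v]
    have l1: "(\<lambda>n. LINT x|M. pflux p (U x) \<bullet> grad (\<eta> n) x) \<longlonglongrightarrow> (LINT x|M. pflux p (U x) \<bullet> V x)"
      by (rule flux_integral_tendsto[OF _ _ _ p(1) weak0_finite(2)[OF w] weak0_finite(2)[OF v] _ \<eta>(3)])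
        (use p eE[OF \<eta>(1)] in auto)
    have w1: "weak0 1 v V" by (rule weak0_lower_exponent[OF v]) (use p in auto)
    have kk: "(\<lambda>x. k x (u x)) \<in> borel_measurable M" by (rule km[OF u(1)])
    note [measurable] = kk
    have l2: "(\<lambda>n. LINT x|M. \<eta> n x * k x (u x)) \<longlonglongrightarrow> (LINT x|M. v x * k x (u x))"
    proof (rule powr_integral_1_tendsto_integral)
      show "integrable M (\<lambda>x. \<eta> n x * k x (u x))" for n
        by (rule integrable_mult_bounded[OF weak0_integrable(1)[OF weak0_test[OF \<eta>(1)]] kk kb])
      show "integrable M (\<lambda>x. v x * k x (u x))"
        by (rule integrable_mult_bounded[OF weak0_integrable(1)[OF w1] kk kb])
      have \<eta>1: "(\<lambda>n. powr_integral M 1 (\<lambda>x. \<eta> n x - v x)) \<longlonglongrightarrow> 0"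
        by (rule powr_integral_tendsto_lower_exponent[OF finite_M _ _ _ \<eta>(2)]) (use p in auto)
      show "(\<lambda>n. powr_integral M 1 (\<lambda>x. \<eta> n x * k x (u x) - v x * k x (u x))) \<longlonglongrightarrow> 0"
      proof (rule powr_integral_tendsto_0_le)
        show "(\<lambda>n. powr_integral M 1 (\<lambda>x. L *\<^sub>R (\<eta> n x - v x))) \<longlonglongrightarrow> 0"
          by (rule powr_integral_tendsto_0_scale[OF _ \<eta>1]) measurable
        show "powr_integral M 1 (\<lambda>x. \<eta> n x * k x (u x) - v x * k x (u x)) \<le> powr_integral M 1 (\<lambda>x. L *\<^sub>R (\<eta> n x - v x))" for n
          using kb L by (intro powr_integral_mono) (auto simp: left_diff_distrib[symmetric] abs_mult mult.commute intro: mult_right_mono)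
      qed
    qed
    have "(\<lambda>n. LINT x|M. pflux p (U x) \<bullet> grad (\<eta> n) x) \<longlonglongrightarrow> (LINT x|M. v x * k x (u x))"
      using l2 unfolding EQ[OF \<eta>(1)] by (simp add: mult.commute)
    from LIMSEQ_unique[OF l1 this]
    show "(LINT x|M. pflux p (U x) \<bullet> V x) = (LINT x|M. (W x * h (u x) + F x) * v x)"
      by (simp add: k_def mult.commute)
  qed
qed

end

subsection \<open>A priori estimates\<close>

lemma bracket_ge_1: "1 + t\<^sup>2 \<ge> (1::real)" "1 + t\<^sup>2 > (0::real)"
  using zero_le_power2[of t] by linarith+

lemma bracket_primitive_minus: "bracket_primitive a (- t) = - bracket_primitive a t"
proof -
  have d: "\<forall>t. ((\<lambda>t. bracket_primitive a t + bracket_primitive a (- t)) has_real_derivative 0) (at t)"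
  proof
    fix t :: real
    have "((\<lambda>t. bracket_primitive a (- t)) has_real_derivative (1 + (- t)\<^sup>2) powr a * (- 1)) (at t)"
      by (rule DERIV_chain2[OF bracket_primitive_deriv]) (auto intro!: derivative_eq_intros)
    from DERIV_add[OF bracket_primitive_deriv[of a t] this]
    show "((\<lambda>t. bracket_primitive a t + bracket_primitive a (- t)) has_real_derivative 0) (at t)" by simp
  qed
  show ?thesis using DERIV_isconst_all[OF d, of t 0] by simp
qed

lemma bracket_primitive_mono: "s \<le> t \<Longrightarrow> bracket_primitive a s \<le> bracket_primitive a t"
proof (rule DERIV_nonneg_imp_nondecreasing[of s t "bracket_primitive a"])
  show "\<exists>y. (bracket_primitive a has_real_derivative y) (at x) \<and> 0 \<le> y" for x
    using bracket_primitive_deriv[of a x] by (intro exI[of _ "(1 + x\<^sup>2) powr a"]) simp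
qed

lemma bracket_primitive_nonneg: "t \<ge> 0 \<Longrightarrow> bracket_primitive a t \<ge> 0"
  using bracket_primitive_mono[of 0 t a] by simp

lemma abs_bracket_primitive: "\<bar>bracket_primitive a t\<bar> = bracket_primitive a \<bar>t\<bar>"
proof (cases "t \<ge> 0")
  case False
  then show ?thesis
    using bracket_primitive_minus[of a t] bracket_primitive_nonneg[of "- t" a] by simp
qed (simp add: bracket_primitive_nonneg)

text \<open>For a <= 0 the derivative (1 + y^2)^a is at most y^(2a), so the difference D of the two
  sides increases. As y^(2a) may be singular at 0, monotonicity is shown on the positive half-line
  and D 0 is reached as a limit from the right; 1 + 2a > 0 makes that limit exist.\<close>

lemma bracket_primitive_le_powr:
  assumes a: "-1/2 < a" "a \<le> 0"
  shows "\<bar>bracket_primitive a t\<bar> \<le> \<bar>t\<bar> powr (1 + 2 * a) / (1 + 2 * a)"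
proof (cases "t = 0")
  case False
  define x where "x = \<bar>t\<bar>"
  have x: "x > 0" using False by (simp add: x_def)
  define D where "D y = y powr (1 + 2 * a) / (1 + 2 * a) - bracket_primitive a y" for y
  have der: "(D has_real_derivative (y powr (2 * a) - (1 + y\<^sup>2) powr a)) (at y)" if "y > 0" for y
  proof -
    have "((\<lambda>y. y powr (1 + 2 * a) / (1 + 2 * a)) has_real_derivative ((1 + 2 * a) * y powr (1 + 2 * a - 1)) / (1 + 2 * a)) (at y)"
      by (rule DERIV_cdivide[OF has_real_derivative_powr[OF that]])
    from DERIV_diff[OF this bracket_primitive_deriv] show ?thesis
      unfolding D_def using a by simp
  qed
  have nn: "y powr (2 * a) - (1 + y\<^sup>2) powr a \<ge> 0" if "y > 0" for y
  proof -
    have "(1 + y\<^sup>2) powr a \<le> (y\<^sup>2) powr a" using that a by (intro powr_mono2') auto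
    also have "\<dots> = y powr (2 * a)" using that by (simp add: powr_powr flip: powr_numeral)
    finally show ?thesis by simp
  qed
  have mono: "D y \<le> D x" if "0 < y" "y \<le> x" for y
  proof (rule DERIV_nonneg_imp_nondecreasing[OF that(2), of D])
    fix z assume "y \<le> z"
    then have "z > 0" using that by simp
    then show "\<exists>d. (D has_real_derivative d) (at z) \<and> 0 \<le> d" using der nn by blast
  qed
  have cont: "(D \<longlongrightarrow> D 0) (at_right 0)"
  proof -
    have "((\<lambda>y. y powr (1 + 2 * a)) \<longlongrightarrow> 0 powr (1 + 2 * a)) (at_right 0)"
      using a by (intro tendsto_powr' tendsto_intros) (auto intro!: eventually_mono[OF eventually_at_right_less])
    moreover have "(bracket_primitive a \<longlongrightarrow> bracket_primitive a 0) (at_right 0)"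
      using DERIV_isCont[OF bracket_primitive_deriv[of a 0]] unfolding isCont_def filterlim_at_split by simp
    ultimately show ?thesis unfolding D_def using a by (intro tendsto_diff tendsto_divide tendsto_const) auto
  qed
  have "D 0 \<le> D x"
  proof (rule tendsto_upperbound[OF cont])
    show "\<forall>\<^sub>F y in at_right 0. D y \<le> D x"
      unfolding eventually_at_right_field using x mono by (intro exI[of _ x]) auto
  qed simp
  then have "0 \<le> x powr (1 + 2 * a) / (1 + 2 * a) - bracket_primitive a x" using a by (simp add: D_def)
  then show ?thesis unfolding abs_bracket_primitive x_def by simp
qed simp

text \<open>A converse to \<open>bracket_primitive_le_powr\<close>: beyond a threshold T the
  derivative of k times the power is below (1 + y^2)^b, and up to T an additive constant suffices.
  Having k as close to 1 as desired preserves the threshold for \<open>lam\<close>.\<close>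

lemma powr_le_bracket_primitive:
  assumes b: "-1/2 < b" "b < 0" and k: "0 < k" "k < 1"
  obtains C where "C \<ge> 0" "\<And>t. k * \<bar>t\<bar> powr (1 + 2 * b) / (1 + 2 * b) \<le> \<bar>bracket_primitive b t\<bar> + C"
proof -
  \<comment> \<open>r solves (1 + r)^b = k, and T is chosen with T^(-2) = r. For y >= T this gives
    (1 + y^(-2))^b >= k, because b < 0.\<close>
  define r where "r = k powr (1 / b) - 1"
  have r: "r > 0"
  proof -
    have "k powr (1 / b) > 1" using k b by (simp add: powr_def divide_neg_neg)
    then show ?thesis by (simp add: r_def)
  qed
  define T where "T = r powr (-1/2)"
  have T: "T > 0" using r by (simp add: T_def)
  define e where "e = 1 + 2 * b"
  have e: "e > 0" using b by (simp add: e_def)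
  have pt: "k * y powr (2 * b) \<le> (1 + y\<^sup>2) powr b" if y: "y \<ge> T" for y
  proof -
    have y0: "y > 0" using T y by simp
    have "y powr (-2) \<le> T powr (-2)" using T y by (intro powr_mono2') auto
    also have "\<dots> = r" using r by (simp add: T_def powr_powr)
    finally have "1 + y powr (-2) \<le> k powr (1 / b)" by (simp add: r_def)
    then have "(k powr (1 / b)) powr b \<le> (1 + y powr (-2)) powr b"
      using b by (intro powr_mono2') (auto intro: add_pos_nonneg)
    then have "k \<le> (1 + y powr (-2)) powr b" using k b by (simp add: powr_powr)
    then have "k * (y\<^sup>2) powr b \<le> (1 + y powr (-2)) powr b * (y\<^sup>2) powr b" by (intro mult_right_mono) auto
    also have "\<dots> = ((1 + y powr (-2)) * y\<^sup>2) powr b" by (simp add: powr_mult)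
    also have "(1 + y powr (-2)) * y\<^sup>2 = 1 + y\<^sup>2"
    proof -
      have "y powr (-2) * y\<^sup>2 = 1" using y0 by (simp add: powr_minus powr_numeral)
      then show ?thesis by (simp add: algebra_simps)
    qed
    also have "(y\<^sup>2) powr b = y powr (2 * b)" using y0 by (simp add: powr_powr flip: powr_numeral)
    finally show ?thesis .
  qed
  define D where "D y = bracket_primitive b y - k * y powr e / e" for y
  have der: "(D has_real_derivative ((1 + y\<^sup>2) powr b - k * y powr (2 * b))) (at y)" if "y > 0" for y
  proof -
    have "((\<lambda>y. k * y powr e / e) has_real_derivative (k * (e * y powr (e - 1))) / e) (at y)"
      by (rule DERIV_cdivide[OF DERIV_cmult[OF has_real_derivative_powr[OF that]]])
    from DERIV_diff[OF bracket_primitive_deriv this] show ?thesis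
      unfolding D_def using e by (simp add: e_def)
  qed
  define C where "C = k * T powr e / e"
  have C: "C \<ge> 0" using k e by (simp add: C_def)
  show ?thesis
  proof (rule that[OF C])
    fix t :: real
    define x where "x = \<bar>t\<bar>"
    have x: "x \<ge> 0" by (simp add: x_def)
    have "k * x powr e / e \<le> bracket_primitive b x + C"
    proof (cases "x \<le> T")
      case True
      have "k * x powr e / e \<le> C"
        unfolding C_def using True x e k by (intro divide_right_mono mult_left_mono powr_mono2) auto
      then show ?thesis using bracket_primitive_nonneg[OF x, of b] by simp
    next
      case False
      have "D T \<le> D x"
      proof (rule DERIV_nonneg_imp_nondecreasing[of T x D])
        fix y assume y: "T \<le> y"
        then have "y > 0" using T by simp
        from der[OF this] pt[OF y] show "\<exists>d. (D has_real_derivative d) (at y) \<and> 0 \<le> d"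
          by (intro exI[of _ "(1 + y\<^sup>2) powr b - k * y powr (2 * b)"]) simp
      qed (use False in simp)
      then show ?thesis using bracket_primitive_nonneg[of T b] T by (simp add: D_def C_def)
    qed
    then show "k * \<bar>t\<bar> powr (1 + 2 * b) / (1 + 2 * b) \<le> \<bar>bracket_primitive b t\<bar> + C"
      by (simp add: x_def e_def abs_bracket_primitive)
  qed
qed

lemma has_real_derivative_max_0_square: "((\<lambda>t. (max 0 t)\<^sup>2) has_real_derivative 2 * max 0 t) (at (t::real))"
proof -
  consider "t > 0" | "t < 0" | "t = 0" by linarith
  then show ?thesis
  proof cases
    case 1
    have "((\<lambda>t. t\<^sup>2) has_real_derivative 2 * t) (at t)" by (auto intro!: derivative_eq_intros)
    then have "((\<lambda>t. (max 0 t)\<^sup>2) has_real_derivative 2 * t) (at t)"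
      by (rule has_field_derivative_transform_within_open[where S="{0<..}"]) (use 1 in auto)
    then show ?thesis using 1 by simp
  next
    case 2
    have "((\<lambda>t. 0) has_real_derivative 0) (at t)" by simp
    then have "((\<lambda>t. (max 0 t)\<^sup>2) has_real_derivative 0) (at t)"
      by (rule has_field_derivative_transform_within_open[where S="{..<0}"]) (use 2 in auto)
    then show ?thesis using 2 by simp
  next
    case 3
    have "((\<lambda>h::real. max 0 h) \<longlongrightarrow> max 0 0) (at 0)" by (intro tendsto_intros)
    then have "((\<lambda>h::real. max 0 h) \<longlongrightarrow> 0) (at 0)" by simp
    moreover have "(\<lambda>h::real. (max 0 h)\<^sup>2 / h) = (\<lambda>h. max 0 h)" by (auto simp: fun_eq_iff max_def power2_eq_square)
    ultimately show ?thesis unfolding 3 DERIV_def by simp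
  qed
qed

section \<open>Integrability of the potential\<close>

context bounded_open
begin

text \<open>Hardy's inequality for one bump function that is bounded below on the domain. This
  avoids polar coordinates.\<close>

lemma hardy_potential_integrable:
  assumes p: "1 < p" "p < real DIM('a)"
  shows "integrable M (\<lambda>x. 1 / norm x powr p)"
proof -
  obtain R where R: "\<forall>x\<in>\<Omega>. norm x \<le> R" using bounded_dom unfolding bounded_iff by blast
  define S where "S = (max R 1)\<^sup>2"
  have S: "S > 0" by (simp add: S_def)
  have xS: "x \<bullet> x \<le> S" if "x \<in> \<Omega>" for x
  proof -
    have "norm x \<le> max R 1" using R that by (auto simp: le_max_iff_disj)
    then have "(norm x)\<^sup>2 \<le> (max R 1)\<^sup>2" by (intro power_mono) auto
    then show ?thesis by (simp add: S_def power2_norm_eq_inner)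
  qed
  \<comment> \<open>The square of the positive part is continuously differentiable. On the domain
    |x|^2 <= S, hence \<phi> >= S^2 there.\<close>
  define \<phi> where "\<phi> x = (max 0 (2 * S - x \<bullet> x))\<^sup>2" for x :: 'a
  define G where "G x = (- 4 * max 0 (2 * S - x \<bullet> x)) *\<^sub>R x" for x :: 'a
  have C: "C1_compact \<phi> G"
    unfolding C1_compact_def
  proof (intro conjI allI)
    fix x :: 'a
    have "((\<lambda>x. 2 * S - x \<bullet> x) has_derivative (\<lambda>v. - (2 * (x \<bullet> v)))) (at x)"
      by (auto intro!: derivative_eq_intros simp: inner_commute)
    from has_derivative_compose[OF this has_real_derivative_max_0_square[unfolded has_field_derivative_def]]
    show "(\<phi> has_derivative (\<lambda>v. G x \<bullet> v)) (at x)"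
      unfolding \<phi>_def G_def by (rule has_derivative_eq_rhs) (simp add: fun_eq_iff)
  next
    show "continuous_on UNIV G" unfolding G_def by (intro continuous_intros)
    have "\<phi> x = 0" if "norm x > 2 * S + 1" for x :: 'a
    proof -
      have "norm x * 1 \<le> norm x * norm x" using that S by (intro mult_left_mono) auto
      then have "x \<bullet> x > 2 * S" using that by (simp add: power2_norm_eq_inner[symmetric] power2_eq_square)
      then show ?thesis by (simp add: \<phi>_def)
    qed
    then show "\<exists>R. \<forall>x. norm x > R \<longrightarrow> \<phi> x = 0" by blast
  qed
  let ?H = "((real DIM('a) - p) / p) powr p"
  have H: "?H > 0" using p by simp
  obtain R' where R': "\<And>x. norm x > R' \<Longrightarrow> \<phi> x = 0 \<and> G x = 0"
    using C1_compact_vanishing[OF C] by blast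
  have i: "integrable lborel (\<lambda>x. norm (G x) powr p)"
    by (rule continuous_bounded_support(1)[where R=R'])
      (use C1_compact_cont_grad[OF C] R' p in \<open>auto intro!: continuous_intros continuous_on_powr'\<close>)
  have "ennreal ?H * (\<integral>\<^sup>+x. ennreal (\<bar>\<phi> x\<bar> powr p / norm x powr p) \<partial>lborel) \<le> (\<integral>\<^sup>+x. ennreal (norm (G x) powr p) \<partial>lborel)"
    by (rule hardy_inequality[OF C p])
  also have "\<dots> < \<infinity>" using i by (simp add: nn_integral_eq_integral)
  finally have fin: "(\<integral>\<^sup>+x. ennreal (\<bar>\<phi> x\<bar> powr p / norm x powr p) \<partial>lborel) < \<infinity>"
    using H by (auto simp: ennreal_mult_less_top)
  have [measurable]: "\<phi> \<in> borel_measurable borel" by (rule C1_compact_borel(1)[OF C])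
  define c where "c = (S\<^sup>2) powr p"
  have c: "c > 0" using S by (simp add: c_def)
  have "(\<integral>\<^sup>+x. ennreal (c * (1 / norm x powr p)) \<partial>M) = (\<integral>\<^sup>+x. ennreal (c * (1 / norm x powr p)) * indicator \<Omega> x \<partial>lebesgue)"
    using open_dom by (intro nn_integral_restrict_space) auto
  also have "\<dots> \<le> (\<integral>\<^sup>+x. ennreal (\<bar>\<phi> x\<bar> powr p / norm x powr p) \<partial>lebesgue)"
  proof (rule nn_integral_mono)
    fix x
    have "c * (1 / norm x powr p) \<le> \<bar>\<phi> x\<bar> powr p / norm x powr p" if "x \<in> \<Omega>"
    proof -
      have "S \<le> max 0 (2 * S - x \<bullet> x)" using xS[OF that] by simp
      then have "S\<^sup>2 \<le> \<bar>\<phi> x\<bar>" unfolding \<phi>_def using S by (simp add: power_mono)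
      then have "c \<le> \<bar>\<phi> x\<bar> powr p" unfolding c_def using p by (intro powr_mono2) auto
      then show ?thesis by (simp add: divide_right_mono)
    qed
    then show "ennreal (c * (1 / norm x powr p)) * indicator \<Omega> x \<le> ennreal (\<bar>\<phi> x\<bar> powr p / norm x powr p)"
      by (auto simp: indicator_def intro!: ennreal_leI)
  qed
  also have "\<dots> = (\<integral>\<^sup>+x. ennreal (\<bar>\<phi> x\<bar> powr p / norm x powr p) \<partial>lborel)" by (rule nn_integral_completion)
  also have "\<dots> < \<infinity>" by (rule fin)
  finally have f: "(\<integral>\<^sup>+x. ennreal (c * (1 / norm x powr p)) \<partial>M) < \<infinity>" .
  have "integrable M (\<lambda>x. c * (1 / norm x powr p))"
    by (rule integrableI_nonneg) (use f c in auto)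
  from integrable_mult_right[OF this, of "1 / c"] show ?thesis using c by simp
qed

end

text \<open>For large |t| the left side grows like |t|^(p-1+s) / s and the p-th power on the right
  like (|t|^\<beta> / \<beta>)^p with \<beta> p = p - 1 + s, so \<beta>^p / s is the exact ratio.
  Any factor \<mu> > 1 then pays for the lower order terms up to a constant.\<close>

lemma bracket_primitive_power_bound:
  assumes p: "p \<ge> 2" and s: "0 < s" "s < 1" and \<mu>: "\<mu> > (1::real)"
  obtains C where "C \<ge> 0" "\<And>t. \<bar>t\<bar> powr (p - 1) * \<bar>bracket_primitive ((s - 1) / 2) t\<bar>
    \<le> \<mu> * (((p - 1 + s) / p) powr p / s) * \<bar>bracket_primitive ((s - 1) / (2 * p)) t\<bar> powr p + C"
proof -
  define a b \<beta> where "a = (s - 1) / 2" and "b = (s - 1) / (2 * p)" and "\<beta> = (p - 1 + s) / p"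
  have ab: "1 + 2 * a = s" "1 + 2 * b = \<beta>" using p by (auto simp: a_def b_def \<beta>_def field_simps)
  have b: "-1/2 < b" "b < 0" using s p by (auto simp: b_def field_simps)
  have a: "-1/2 < a" "a \<le> 0" using s by (auto simp: a_def)
  have \<beta>: "\<beta> > 0" "\<beta> * p = p - 1 + s" using p s by (auto simp: \<beta>_def)
  \<comment> \<open>The loss is a factor k^(-p) from passing from the power to the primitive and a
    factor k^(1-p) from separating the additive constant by convexity. Their product is
    \<mu>.\<close>
  define k where "k = \<mu> powr (1 / (1 - 2 * p))"
  have k: "0 < k" "k < 1"
    using \<mu> p by (auto simp: k_def powr_def divide_pos_neg)
  have k\<mu>: "k powr (1 - 2 * p) = \<mu>" using \<mu> p by (simp add: k_def powr_powr)
  obtain C0 where C0: "C0 \<ge> 0" "\<And>t. k * \<bar>t\<bar> powr (1 + 2 * b) / (1 + 2 * b) \<le> \<bar>bracket_primitive b t\<bar> + C0"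
    using powr_le_bracket_primitive[OF b k] by blast
  define C where "C = (\<beta> / k) powr p * ((1 - k) powr (1 - p) * C0 powr p) / s"
  have C: "C \<ge> 0" using s by (simp add: C_def)
  show ?thesis
  proof (rule that[OF C])
    fix t :: real
    define x where "x = \<bar>t\<bar> powr \<beta>"
    define y where "y = \<bar>bracket_primitive b t\<bar>"
    have xy: "x \<le> \<beta> / k * (y + C0)"
      using C0(2)[of t] k \<beta> unfolding ab x_def y_def by (simp add: field_simps)
    have "\<bar>t\<bar> powr (p - 1) * \<bar>bracket_primitive a t\<bar> \<le> \<bar>t\<bar> powr (p - 1) * (\<bar>t\<bar> powr s / s)"
      using bracket_primitive_le_powr[OF a, of t] unfolding ab by (intro mult_left_mono) auto
    also have "\<dots> = x powr p / s"
    proof -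
      have "x powr p = \<bar>t\<bar> powr ((p - 1) + s)" unfolding x_def powr_powr \<beta>(2) ..
      then show ?thesis by (simp only: powr_add) simp
    qed
    also have "\<dots> \<le> (\<beta> / k * (y + C0)) powr p / s"
      using xy p s by (intro divide_right_mono powr_mono2) (auto simp: x_def)
    also have "(\<beta> / k * (y + C0)) powr p = (\<beta> / k) powr p * (y + C0) powr p" by (rule powr_mult)
    also have "(\<beta> / k) powr p * (y + C0) powr p / s \<le> (\<beta> / k) powr p * (k powr (1 - p) * y powr p + (1 - k) powr (1 - p) * C0 powr p) / s"
      using powr_convex_ineq[of y C0 p "1 - k"] C0(1) p k s by (intro divide_right_mono mult_left_mono) (auto simp: y_def)
    also have "\<dots> = (\<beta> powr p / s) * (k powr (- p) * k powr (1 - p)) * y powr p + C"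
    proof -
      have kp: "(\<beta> / k) powr p = \<beta> powr p * k powr (- p)" using k \<beta> by (simp add: powr_divide powr_minus_divide)
      show ?thesis unfolding C_def kp by (simp add: distrib_left add_divide_distrib mult_ac)
    qed
    also have "k powr (- p) * k powr (1 - p) = \<mu>" unfolding powr_add[symmetric] k\<mu>[symmetric] by simp
    finally show "\<bar>t\<bar> powr (p - 1) * \<bar>bracket_primitive ((s - 1) / 2) t\<bar>
      \<le> \<mu> * (((p - 1 + s) / p) powr p / s) * \<bar>bracket_primitive ((s - 1) / (2 * p)) t\<bar> powr p + C"
      unfolding a_def[symmetric] b_def[symmetric] \<beta>_def[symmetric] y_def by (simp add: mult_ac)
  qed
qed

text \<open>By \<open>powr_le_split\<close>, the sublinear term lies below a constant plus a line. K
  is tuned so that the slope of this line, after multiplication by B, is at most d / 2.\<close>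

lemma sublinear_bound:
  fixes A B d \<theta> :: real
  assumes "d > 0" "0 < \<theta>" "\<theta> < 1" "A \<ge> 0" "B \<ge> 0"
  obtains C where "C \<ge> 0" "\<And>x. x \<ge> 0 \<Longrightarrow> d * x \<le> A + B * (x + 1) powr \<theta> \<Longrightarrow> x \<le> C"
proof -
  define e where "e = d / (2 * (B + 1))"
  have e: "e > 0" "B * e \<le> d / 2" using assms by (auto simp: e_def field_simps)
  define K where "K = e powr (1 / (\<theta> - 1))"
  have K: "K > 0" "K powr (\<theta> - 1) = e" using e assms by (auto simp: K_def powr_powr)
  define C where "C = 2 / d * (A + B * (K powr \<theta> + e))"
  have "C \<ge> 0" using assms e by (auto simp: C_def)
  moreover have "x \<le> C" if x: "x \<ge> 0" "d * x \<le> A + B * (x + 1) powr \<theta>" for x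
  proof -
    have "(x + 1) powr \<theta> \<le> min (x + 1) K powr \<theta> + K powr (\<theta> - 1) * (x + 1) powr 1"
      by (rule powr_le_split) (use assms x K in auto)
    also have "min (x + 1) K powr \<theta> \<le> K powr \<theta>" using x K assms by (intro powr_mono2) auto
    finally have "(x + 1) powr \<theta> \<le> K powr \<theta> + e * (x + 1)" using x K by simp
    then have "B * (x + 1) powr \<theta> \<le> B * (K powr \<theta> + e * (x + 1))" using assms by (intro mult_left_mono) auto
    also have "\<dots> = B * (K powr \<theta> + e) + B * e * x" by (simp add: algebra_simps)
    also have "\<dots> \<le> B * (K powr \<theta> + e) + d / 2 * x" using e x by (intro add_left_mono mult_right_mono) auto
    finally have "d / 2 * x \<le> A + B * (K powr \<theta> + e)" using x(2) by (simp add: field_simps)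
    then show ?thesis using assms by (simp add: C_def field_simps)
  qed
  ultimately show ?thesis using that by blast
qed

section \<open>The energy estimate\<close>

context bounded_open
begin

lemma weak0_bracket_primitive:
  assumes w: "weak0 p u U" and p: "p > 0" and c: "c \<le> 0"
  shows "weak0 p (\<lambda>x. bracket_primitive c (u x)) (\<lambda>x. (1 + (u x)\<^sup>2) powr c *\<^sub>R U x)"
proof (rule weak0_compose[where B=1, OF w p C_k_bracket_primitive bracket_primitive_0 bracket_primitive_deriv])
  show "continuous_on UNIV (\<lambda>t::real. (1 + t\<^sup>2) powr c)" using C_k_japanese[of 0 c] by simp
  show "\<bar>(1 + t\<^sup>2) powr c\<bar> \<le> 1" for t :: real
    using powr_mono[of c 0 "1 + t\<^sup>2"] c bracket_ge_1[of t] by simp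
qed

text \<open>The test function is the bracket primitive with a = (s - 1) / 2. Since b p = a for b =
  (s - 1) / (2 p), the flux term becomes the energy Q of the bracket primitive of u with exponent b.
  Hardy's inequality and \<open>bracket_primitive_power_bound\<close> turn the potential term into a
  fraction of Q below 1; Hoelder's and Sobolev's inequalities bound the source by a power of Q + 1
  below 1. W, h and F are arbitrary within their growth bounds, so the constant does not depend on a
  truncation height.\<close>

lemma energy_estimate:
  fixes N p m lam s :: real and f :: "'a \<Rightarrow> real"
  assumes N: "N = real DIM('a)" and p: "2 \<le> p" "p < N" and m: "1 < m" "m * p < N"
    and s_def: "s = (p - 1) * N * (m - 1) / (N - m * p)" and s: "0 < s" "s < 1"
    and lam: "0 < lam" "lam < s * (N - p) powr p / (p - 1 + s) powr p"
    and f: "f \<in> borel_measurable M" "integrable M (\<lambda>x. \<bar>f x\<bar> powr m)"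
  obtains C where "C \<ge> 0"
    "\<And>u U W h F. weak0 p u U \<Longrightarrow>
      \<forall>v V. weak0 p v V \<longrightarrow> (LINT x|M. pflux p (U x) \<bullet> V x) = (LINT x|M. (W x * h (u x) + F x) * v x) \<Longrightarrow>
      W \<in> borel_measurable M \<Longrightarrow> h \<in> borel_measurable borel \<Longrightarrow> F \<in> borel_measurable M \<Longrightarrow>
      \<forall>x. 0 \<le> W x \<and> W x \<le> lam / norm x powr p \<Longrightarrow> \<forall>t. \<bar>h t\<bar> \<le> \<bar>t\<bar> powr (p - 1) \<Longrightarrow> \<forall>x. \<bar>F x\<bar> \<le> \<bar>f x\<bar> \<Longrightarrow>
      powr_integral M p (\<lambda>x. (1 + (u x)\<^sup>2) powr ((s - 1) / (2 * p)) *\<^sub>R U x) \<le> ennreal C"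
proof -
  have p': "1 < p" "p < real DIM('a)" "p > 0" using p N by auto
  define a b \<beta> where "a = (s - 1) / 2" and "b = (s - 1) / (2 * p)" and "\<beta> = (p - 1 + s) / p"
  have ab: "1 + 2 * a = s" "1 + 2 * b = \<beta>" "b * p = a" using p by (auto simp: a_def b_def \<beta>_def field_simps)
  have b: "-1/2 < b" "b < 0" using s p by (auto simp: b_def field_simps)
  have a: "-1/2 < a" "a \<le> 0" using s by (auto simp: a_def)
  have \<beta>: "\<beta> > 0" "\<beta> * p = p - 1 + s" using p s by (auto simp: \<beta>_def)
  define H where "H = ((N - p) / p) powr p"
  have H: "H > 0" using p by (simp add: H_def)
  define A where "A = \<beta> powr p / s"
  have A: "A > 0" using \<beta> s by (simp add: A_def)
  have lamA: "lam * A < H"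
  proof -
    have pp: "p powr p > 0" "(p - 1 + s) powr p > 0" using p s by auto
    have "A * (s * p powr p) = (p - 1 + s) powr p" using p s by (simp add: A_def \<beta>_def powr_divide)
    moreover have "H * (s * p powr p) = s * (N - p) powr p" using p by (simp add: H_def powr_divide)
    moreover have "lam * (p - 1 + s) powr p < s * (N - p) powr p"
      using lam(2) pp(2) by (simp only: pos_less_divide_eq)
    ultimately have "lam * A * (s * p powr p) < H * (s * p powr p)" by (simp only: mult.assoc)
    then show ?thesis using pp(1) s by (simp only: mult_less_cancel_right_pos mult_pos_pos)
  qed
  \<comment> \<open>Chosen so that \<open>lam * (\<mu> * A)\<close> is the midpoint of
    \<open>lam * A\<close> and H: \<mu> exceeds 1 and the potential is still absorbed.\<close>
  define \<mu> where "\<mu> = (1 + H / (lam * A)) / 2"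
  have \<mu>: "\<mu> > 1" "lam * (\<mu> * A) < H"
  proof -
    have "H / (lam * A) > 1" using lamA lam A by simp
    then show "\<mu> > 1" by (simp add: \<mu>_def)
    have "lam * (\<mu> * A) = (lam * A + H) / 2" using lam A by (simp add: \<mu>_def field_simps)
    then show "lam * (\<mu> * A) < H" using lamA by simp
  qed
  obtain C1 where C1: "C1 \<ge> 0" "\<And>t. \<bar>t\<bar> powr (p - 1) * \<bar>bracket_primitive a t\<bar> \<le> \<mu> * A * \<bar>bracket_primitive b t\<bar> powr p + C1"
    using bracket_primitive_power_bound[OF p(1) s \<mu>(1)] unfolding a_def[symmetric] b_def[symmetric] \<beta>_def[symmetric] A_def[symmetric] by blast
  have half: "(0::real) < 1/2" "(1/2::real) < 1" by auto
  obtain C0 where C0: "C0 \<ge> 0" "\<And>t. (1/2) * \<bar>t\<bar> powr (1 + 2 * b) / (1 + 2 * b) \<le> \<bar>bracket_primitive b t\<bar> + C0"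
    using powr_le_bracket_primitive[OF b half] by blast
  define m' where "m' = m / (m - 1)"
  have m': "m' > 1" "1 / m + 1 / m' = 1" using m by (auto simp: m'_def field_simps)
  define ps where "ps = p * N / (N - p)"
  have ps: "ps > 0" using p by (simp add: ps_def)
  \<comment> \<open>This is the equation that determines s: the conjugate exponent m' of the source,
    applied to |u|^s, produces the same power of |u| as the Sobolev exponent applied to
    |u|^\<beta>.\<close>
  have expo: "s * m' = \<beta> * ps"
  proof -
    have n: "N - m * p \<noteq> 0" "N - p \<noteq> 0" "p \<noteq> 0" "m - 1 \<noteq> 0" using m p by auto
    have e: "s * (N - m * p) = (p - 1) * N * (m - 1)" using n by (simp add: s_def)
    then have "(p - 1 + s) * (N - m * p) = (p - 1) * m * (N - p)" by algebra
    with e have "(p - 1 + s) * N * (m - 1) * (N - m * p) = s * m * (N - p) * (N - m * p)" by algebra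
    then have "(p - 1 + s) * N * (m - 1) = s * m * (N - p)" using n(1) by simp
    then have "(p - 1 + s) * N / (N - p) = s * m / (m - 1)" using n by (simp add: frac_eq_eq)
    then show ?thesis using n(3) by (simp add: \<beta>_def ps_def m'_def)
  qed
  define D1 where "D1 = (1 / s) powr m' * ((2 * \<beta>) powr ps * 2 powr ps)"
  define D2 where "D2 = D1 * C0 powr ps"
  have D: "D1 \<ge> 0" "D2 \<ge> 0" by (auto simp: D1_def D2_def)
  have Pa: "\<bar>bracket_primitive a t\<bar> powr m' \<le> D1 * \<bar>bracket_primitive b t\<bar> powr ps + D2" for t
  proof -
    let ?y = "\<bar>bracket_primitive b t\<bar>"
    have t\<beta>: "\<bar>t\<bar> powr \<beta> \<le> 2 * \<beta> * (?y + C0)" using C0(2)[of t] \<beta> unfolding ab by (simp add: field_simps)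
    have "\<bar>bracket_primitive a t\<bar> powr m' \<le> (\<bar>t\<bar> powr s / s) powr m'"
      using bracket_primitive_le_powr[OF a, of t] m' unfolding ab by (intro powr_mono2) auto
    also have "\<dots> = (1 / s) powr m' * (\<bar>t\<bar> powr \<beta>) powr ps"
      using s expo by (simp add: powr_divide powr_powr)
    also have "\<dots> \<le> (1 / s) powr m' * (2 * \<beta> * (?y + C0)) powr ps"
      using t\<beta> ps by (intro mult_left_mono powr_mono2) auto
    also have "(2 * \<beta> * (?y + C0)) powr ps = (2 * \<beta>) powr ps * (?y + C0) powr ps" by (rule powr_mult)
    also have "(1 / s) powr m' * ((2 * \<beta>) powr ps * (?y + C0) powr ps) \<le> (1 / s) powr m' * ((2 * \<beta>) powr ps * (2 powr ps * (?y powr ps + C0 powr ps)))"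
      using C0 ps by (intro mult_left_mono powr_add_le) auto
    also have "\<dots> = D1 * ?y powr ps + D2" by (simp add: D1_def D2_def algebra_simps)
    finally show ?thesis .
  qed
  define \<sigma> where "\<sigma> = N / (N - p)"
  have \<sigma>: "\<sigma> > 0" using p by (simp add: \<sigma>_def)
  define K0 where "K0 = (p * (N - 1) / (N - p)) powr p * 2 powr p"
  have K0: "K0 \<ge> 0" by (simp add: K0_def)
  define D3 where "D3 = D1 * K0 powr \<sigma> + D2 * measure M (space M)"
  have D3: "D3 \<ge> 0" using D by (simp add: D3_def)
  \<comment> \<open>The power of the energy that the source term contributes: \<sigma> from
    Sobolev's inequality, 1 / m' from Hoelder's. It is below 1 exactly because m p < N.\<close>
  define \<theta> where "\<theta> = \<sigma> / m'"
  have \<theta>: "0 < \<theta>" "\<theta> < 1"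
  proof -
    show "0 < \<theta>" using \<sigma> m' by (simp add: \<theta>_def)
    have "N * (m - 1) < (N - p) * m" using m p by (simp add: algebra_simps)
    then have "\<sigma> < m'" unfolding \<sigma>_def m'_def using m p by (simp add: field_simps)
    then show "\<theta> < 1" unfolding \<theta>_def using m' by simp
  qed
  define V0 where "V0 = (LINT x|M. 1 / norm x powr p)"
  have V0: "V0 \<ge> 0" by (simp add: V0_def)
  have iV: "integrable M (\<lambda>x. 1 / norm x powr p)" by (rule hardy_potential_integrable[OF p'(1,2)])
  define Fm where "Fm = (LINT x|M. \<bar>f x\<bar> powr m) powr (1 / m)"
  have d: "1 - lam * (\<mu> * A) / H > 0" using \<mu>(2) H by simp
  have AA: "lam * C1 * V0 \<ge> 0" using lam C1 V0 by simp
  have BB: "Fm * D3 powr (1 / m') \<ge> 0" by (simp add: Fm_def)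
  obtain C where C: "C \<ge> 0" "\<And>x. x \<ge> 0 \<Longrightarrow> (1 - lam * (\<mu> * A) / H) * x \<le> lam * C1 * V0 + Fm * D3 powr (1 / m') * (x + 1) powr \<theta> \<Longrightarrow> x \<le> C"
    using sublinear_bound[OF d \<theta> AA BB] by blast
  show ?thesis
  proof (rule that[OF C(1)])
    fix u U W h F
    assume w: "weak0 p u U"
      and eq: "\<forall>v V. weak0 p v V \<longrightarrow> (LINT x|M. pflux p (U x) \<bullet> V x) = (LINT x|M. (W x * h (u x) + F x) * v x)"
      and mm: "W \<in> borel_measurable M" "h \<in> borel_measurable borel" "F \<in> borel_measurable M"
      and bounds: "\<forall>x. 0 \<le> W x \<and> W x \<le> lam / norm x powr p" "\<forall>t. \<bar>h t\<bar> \<le> \<bar>t\<bar> powr (p - 1)" "\<forall>x. \<bar>F x\<bar> \<le> \<bar>f x\<bar>"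
    note W = bounds(1)[rule_format] and h = bounds(2)[rule_format] and F = bounds(3)[rule_format]
    note [measurable] = mm f(1) weak0_measurable[OF w]
    have wa: "weak0 p (\<lambda>x. bracket_primitive a (u x)) (\<lambda>x. (1 + (u x)\<^sup>2) powr a *\<^sub>R U x)"
      by (rule weak0_bracket_primitive[OF w p'(3) a(2)])
    have wb: "weak0 p (\<lambda>x. bracket_primitive b (u x)) (\<lambda>x. (1 + (u x)\<^sup>2) powr b *\<^sub>R U x)"
      by (rule weak0_bracket_primitive[OF w p'(3)]) (use b in simp)
    note [measurable] = weak0_measurable[OF wa] weak0_measurable[OF wb]
    have p0: "p \<ge> 0" using p by simp
    \<comment> \<open>Q is finite because u belongs to the closure in exponent p. Only therefore may
      multiples of Q be absorbed into the left side.\<close>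
    define Q where "Q = (LINT x|M. norm ((1 + (u x)\<^sup>2) powr b *\<^sub>R U x) powr p)"
    have Q0: "Q \<ge> 0" by (simp add: Q_def)
    have eQ: "powr_integral M p (\<lambda>x. (1 + (u x)\<^sup>2) powr b *\<^sub>R U x) = ennreal Q"
      unfolding Q_def by (rule powr_integral_eq_LINT[OF weak0_measurable(2)[OF wb] weak0_finite(2)[OF wb p0]])
    have ptQ: "norm ((1 + (u x)\<^sup>2) powr b *\<^sub>R U x) powr p = pflux p (U x) \<bullet> ((1 + (u x)\<^sup>2) powr a *\<^sub>R U x)" for x
      using p by (simp add: powr_mult powr_powr ab(3) pflux_inner_self)
    have QE: "Q = (LINT x|M. (W x * h (u x) + F x) * bracket_primitive a (u x))"
      unfolding Q_def ptQ by (rule eq[rule_format, OF wa])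
    define Y where "Y = (LINT x|M. \<bar>bracket_primitive b (u x)\<bar> powr p / norm x powr p)"
    have hY: "ennreal H * (\<integral>\<^sup>+x. ennreal (\<bar>bracket_primitive b (u x)\<bar> powr p / norm x powr p) \<partial>M) \<le> ennreal Q"
      using hardy_weak0[OF wb p'(1,2)] unfolding eQ H_def N .
    then have "ennreal H * (\<integral>\<^sup>+x. ennreal (\<bar>bracket_primitive b (u x)\<bar> powr p / norm x powr p) \<partial>M) < \<infinity>"
      using le_less_trans[OF _ ennreal_less_top] by simp
    then have fY: "(\<integral>\<^sup>+x. ennreal (\<bar>bracket_primitive b (u x)\<bar> powr p / norm x powr p) \<partial>M) < \<infinity>"
      using H by (auto simp: ennreal_mult_less_top)
    have iY: "integrable M (\<lambda>x. \<bar>bracket_primitive b (u x)\<bar> powr p / norm x powr p)"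
      by (rule integrableI_nonneg) (use fY in auto)
    have HY: "H * Y \<le> Q"
    proof -
      have "(\<integral>\<^sup>+x. ennreal (\<bar>bracket_primitive b (u x)\<bar> powr p / norm x powr p) \<partial>M) = ennreal Y"
        unfolding Y_def by (rule nn_integral_eq_integral[OF iY]) auto
      then have "ennreal (H * Y) \<le> ennreal Q" using hY H by (simp add: ennreal_mult')
      then show ?thesis using Q0 by (simp add: ennreal_le_iff)
    qed
    have "powr_integral M p (\<lambda>x. (1 + (u x)\<^sup>2) powr b *\<^sub>R U x) \<le> ennreal Q" unfolding eQ ..
    from sobolev_weak0[OF wb p'(1) p(2) N this Q0]
    have X: "powr_integral M ps (\<lambda>x. bracket_primitive b (u x)) \<le> ennreal ((K0 * (Q + 1)) powr \<sigma>)"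
      unfolding ps_def K0_def \<sigma>_def by (simp add: mult.assoc)
    have fX: "powr_integral M ps (\<lambda>x. bracket_primitive b (u x)) < \<infinity>"
      using le_less_trans[OF X ennreal_less_top] by simp
    have iX: "integrable M (\<lambda>x. \<bar>bracket_primitive b (u x)\<bar> powr ps)"
      using fX unfolding powr_integral_def real_norm_def by (intro integrableI_nonneg) auto
    have X': "(LINT x|M. \<bar>bracket_primitive b (u x)\<bar> powr ps) \<le> K0 powr \<sigma> * (Q + 1) powr \<sigma>"
    proof -
      have "ennreal (LINT x|M. \<bar>bracket_primitive b (u x)\<bar> powr ps) \<le> ennreal ((K0 * (Q + 1)) powr \<sigma>)"
        using X powr_integral_eq_LINT[OF weak0_measurable(1)[OF wb] fX] by simp
      then show ?thesis by (simp add: ennreal_le_iff powr_mult)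
    qed
    have iPa: "integrable M (\<lambda>x. \<bar>bracket_primitive a (u x)\<bar> powr m')"
    proof (rule Bochner_Integration.integrable_bound)
      show "integrable M (\<lambda>x. D1 * \<bar>bracket_primitive b (u x)\<bar> powr ps + D2)" using iX by simp
      show "AE x in M. norm (\<bar>bracket_primitive a (u x)\<bar> powr m') \<le> norm (D1 * \<bar>bracket_primitive b (u x)\<bar> powr ps + D2)"
        using Pa by (intro AE_I2) (smt (verit) powr_ge_zero real_norm_def)
    qed measurable
    have bPa: "(LINT x|M. \<bar>bracket_primitive a (u x)\<bar> powr m') \<le> D3 * (Q + 1) powr \<sigma>"
    proof -
      have "(LINT x|M. \<bar>bracket_primitive a (u x)\<bar> powr m') \<le> (LINT x|M. D1 * \<bar>bracket_primitive b (u x)\<bar> powr ps + D2)"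
        using iX iPa Pa by (intro integral_mono) auto
      also have "\<dots> = D1 * (LINT x|M. \<bar>bracket_primitive b (u x)\<bar> powr ps) + D2 * measure M (space M)"
        using iX by simp
      also have "\<dots> \<le> D1 * (K0 powr \<sigma> * (Q + 1) powr \<sigma>) + D2 * measure M (space M) * (Q + 1) powr \<sigma>"
      proof (intro add_mono mult_left_mono X')
        have "1 \<le> (Q + 1) powr \<sigma>" using Q0 \<sigma> by (intro ge_one_powr_ge_zero) auto
        then show "D2 * measure M (space M) \<le> D2 * measure M (space M) * (Q + 1) powr \<sigma>"
          using mult_left_mono[of 1 "(Q + 1) powr \<sigma>" "D2 * measure M (space M)"] D by simp
      qed (use D in auto)
      also have "\<dots> = D3 * (Q + 1) powr \<sigma>" by (simp add: D3_def algebra_simps)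
      finally show ?thesis .
    qed
    have fP: "integrable M (\<lambda>x. \<bar>f x\<bar> * \<bar>bracket_primitive a (u x)\<bar>)"
      "(LINT x|M. \<bar>f x\<bar> * \<bar>bracket_primitive a (u x)\<bar>) \<le> Fm * (LINT x|M. \<bar>bracket_primitive a (u x)\<bar> powr m') powr (1 / m')"
      unfolding Fm_def by (rule integral_Hoelder[OF m(1) m' f(1) weak0_measurable(1)[OF wa] f(2) iPa])+
    have "(LINT x|M. \<bar>bracket_primitive a (u x)\<bar> powr m') powr (1 / m') \<le> (D3 * (Q + 1) powr \<sigma>) powr (1 / m')"
      using bPa m' by (intro powr_mono2) auto
    also have "\<dots> = D3 powr (1 / m') * (Q + 1) powr \<theta>"
      by (simp add: powr_mult powr_powr \<theta>_def)
    finally have "Fm * (LINT x|M. \<bar>bracket_primitive a (u x)\<bar> powr m') powr (1 / m') \<le> Fm * (D3 powr (1 / m') * (Q + 1) powr \<theta>)"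
      by (intro mult_left_mono) (auto simp: Fm_def)
    with fP(2) have bf: "(LINT x|M. \<bar>f x\<bar> * \<bar>bracket_primitive a (u x)\<bar>) \<le> Fm * D3 powr (1 / m') * (Q + 1) powr \<theta>" by (simp add: mult.assoc)
    \<comment> \<open>R collects the pointwise majorants: the part controlled by Hardy's inequality,
      the part coming from the additive constant C1, and the source.\<close>
    define R where "R x = lam * (\<mu> * A) * (\<bar>bracket_primitive b (u x)\<bar> powr p / norm x powr p) + lam * C1 * (1 / norm x powr p) + \<bar>f x\<bar> * \<bar>bracket_primitive a (u x)\<bar>" for x
    have iR: "integrable M R"
      unfolding R_def by (intro Bochner_Integration.integrable_add integrable_mult_right iY iV fP(1))
    have R: "\<bar>(W x * h (u x) + F x) * bracket_primitive a (u x)\<bar> \<le> R x" for x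
    proof -
      have "\<bar>(W x * h (u x) + F x) * bracket_primitive a (u x)\<bar> \<le> (\<bar>W x * h (u x)\<bar> + \<bar>F x\<bar>) * \<bar>bracket_primitive a (u x)\<bar>"
        unfolding abs_mult by (intro mult_right_mono order_trans[OF abs_triangle_ineq]) (auto simp: abs_mult)
      also have "\<dots> \<le> (lam / norm x powr p * \<bar>u x\<bar> powr (p - 1) + \<bar>f x\<bar>) * \<bar>bracket_primitive a (u x)\<bar>"
        unfolding abs_mult using W[of x] h[of "u x"] F[of x] lam by (intro mult_right_mono add_mono mult_mono) auto
      also have "\<dots> = lam / norm x powr p * (\<bar>u x\<bar> powr (p - 1) * \<bar>bracket_primitive a (u x)\<bar>) + \<bar>f x\<bar> * \<bar>bracket_primitive a (u x)\<bar>"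
        by (simp add: algebra_simps)
      also have "\<dots> \<le> lam / norm x powr p * (\<mu> * A * \<bar>bracket_primitive b (u x)\<bar> powr p + C1) + \<bar>f x\<bar> * \<bar>bracket_primitive a (u x)\<bar>"
        using C1(2)[of "u x"] lam by (intro add_right_mono mult_left_mono) auto
      also have "\<dots> = R x" by (simp add: R_def algebra_simps add_divide_distrib)
      finally show ?thesis .
    qed
    have "Q \<le> (LINT x|M. R x)"
      unfolding QE
    proof (rule integral_mono[OF _ iR])
      show "integrable M (\<lambda>x. (W x * h (u x) + F x) * bracket_primitive a (u x))"
        by (rule Bochner_Integration.integrable_bound[OF iR]) (use R in \<open>auto intro!: AE_I2 order_trans[OF R abs_ge_self]\<close>)
      show "(W x * h (u x) + F x) * bracket_primitive a (u x) \<le> R x" for x using R[of x] by linarith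
    qed
    also have "\<dots> = lam * (\<mu> * A) * Y + lam * C1 * V0 + (LINT x|M. \<bar>f x\<bar> * \<bar>bracket_primitive a (u x)\<bar>)"
    proof -
      have i1: "integrable M (\<lambda>x. lam * (\<mu> * A) * (\<bar>bracket_primitive b (u x)\<bar> powr p / norm x powr p))" by (rule integrable_mult_right[OF iY])
      have i2: "integrable M (\<lambda>x. lam * C1 * (1 / norm x powr p))" by (rule integrable_mult_right[OF iV])
      show ?thesis
        unfolding R_def Y_def V0_def
        by (simp only: Bochner_Integration.integral_add[OF Bochner_Integration.integrable_add[OF i1 i2] fP(1)]
            Bochner_Integration.integral_add[OF i1 i2] integral_mult_right_zero)
    qed
    also have "\<dots> \<le> lam * (\<mu> * A) * (Q / H) + lam * C1 * V0 + Fm * D3 powr (1 / m') * (Q + 1) powr \<theta>"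
    proof -
      have "Y \<le> Q / H" using HY H by (simp add: pos_le_divide_eq mult.commute)
      then have "lam * (\<mu> * A) * Y \<le> lam * (\<mu> * A) * (Q / H)" using lam \<mu> A by (intro mult_left_mono) auto
      with bf show ?thesis by linarith
    qed
    finally have "(1 - lam * (\<mu> * A) / H) * Q \<le> lam * C1 * V0 + Fm * D3 powr (1 / m') * (Q + 1) powr \<theta>"
      by (simp add: left_diff_distrib)
    then have "Q \<le> C" by (rule C(2)[OF Q0])
    then show "powr_integral M p (\<lambda>x. (1 + (u x)\<^sup>2) powr ((s - 1) / (2 * p)) *\<^sub>R U x) \<le> ennreal C"
      using eQ unfolding b_def by (simp add: ennreal_leI)
  qed
qed

end

lemma powr_integral_tendsto_dominated:
  fixes F :: "nat \<Rightarrow> 'x \<Rightarrow> 'b::euclidean_space"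
  assumes [measurable]: "\<And>n. F n \<in> borel_measurable m" "g \<in> borel_measurable m" and r: "r > 0"
    and lim: "AE x in m. (\<lambda>n. F n x) \<longlonglongrightarrow> g x" and le: "\<And>n x. norm (F n x) \<le> norm (g x)"
    and fin: "powr_integral m r g < \<infinity>"
  shows "(\<lambda>n. powr_integral m r (\<lambda>x. F n x - g x)) \<longlonglongrightarrow> 0"
proof -
  have "(\<lambda>n. powr_integral m r (\<lambda>x. F n x - g x)) \<longlonglongrightarrow> (\<integral>\<^sup>+x. 0 \<partial>m)"
    unfolding powr_integral_def
  proof (rule nn_integral_dominated_convergence)
    show "(\<integral>\<^sup>+x. ennreal (2 powr r) * ennreal (norm (g x) powr r) \<partial>m) < \<infinity>"
      using fin by (subst nn_integral_cmult) (auto simp: powr_integral_def ennreal_mult_less_top)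
    have "norm (F n x - g x) powr r \<le> (2 * norm (g x)) powr r" for n x
      using norm_triangle_ineq4[of "F n x" "g x"] le[of n x] r by (intro powr_mono2) auto
    then show "AE x in m. ennreal (norm (F n x - g x) powr r) \<le> ennreal (2 powr r) * ennreal (norm (g x) powr r)" for n
      by (intro AE_I2) (simp add: powr_mult ennreal_mult[symmetric] ennreal_leI)
    show "AE x in m. (\<lambda>n. ennreal (norm (F n x - g x) powr r)) \<longlonglongrightarrow> 0"
      using lim
    proof eventually_elim
      case (elim x)
      have "(\<lambda>n. norm (F n x - g x)) \<longlonglongrightarrow> 0" by (rule tendsto_norm_zero[OF LIM_zero[OF elim]])
      then have "(\<lambda>n. norm (F n x - g x) powr r) \<longlonglongrightarrow> 0 powr r"
        using r by (intro tendsto_powr' tendsto_const) auto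
      then have "(\<lambda>n. ennreal (norm (F n x - g x) powr r)) \<longlonglongrightarrow> ennreal 0"
        using r by (intro tendsto_ennrealI) simp
      then show ?case by simp
    qed
  qed measurable
  then show ?thesis by simp
qed

lemma abs_arctan_le: "\<bar>arctan x\<bar> \<le> pi / 2"
  using arctan_lbound[of x] arctan_ubound[of x] by (simp add: abs_le_iff)

text \<open>Young's inequality for the conjugate exponents p / q and p / (p - q).\<close>

lemma powr_product_le:
  assumes xy: "x \<ge> 0" "y \<ge> 0" and q: "0 < q" "q < (p::real)"
  shows "(x * y) powr q \<le> x powr p + y powr (q * p / (p - q))"
proof -
  have "x powr q * y powr q \<le> (x powr q) powr (p / q) / (p / q) + (y powr q) powr (p / (p - q)) / (p / (p - q))"
    by (rule Youngs_inequality) (use q in \<open>auto simp: field_simps\<close>)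
  also have "(x powr q) powr (p / q) = x powr p" using q by (simp add: powr_powr)
  also have "(y powr q) powr (p / (p - q)) = y powr (q * p / (p - q))" by (simp add: powr_powr)
  also have "x powr p / (p / q) \<le> x powr p"
    using q mult_left_mono[of q p "x powr p"] by (simp add: pos_divide_le_eq)
  also have "y powr (q * p / (p - q)) / (p / (p - q)) \<le> y powr (q * p / (p - q))"
  proof -
    have "p / (p - q) \<ge> 1" using q by simp
    then have "y powr (q * p / (p - q)) * 1 \<le> y powr (q * p / (p - q)) * (p / (p - q))" by (intro mult_left_mono) auto
    then show ?thesis using q by (subst pos_divide_le_eq) (auto simp only: mult_1_right zero_less_divide_iff diff_gt_0_iff_gt)
  qed
  finally show ?thesis by (simp add: powr_mult)
qed

section \<open>Consequences of the energy bound and convergence of gradients\<close>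

context bounded_open
begin

text \<open>Sobolev's and Hardy's inequalities are applied to the bracket primitive, and
  \<open>powr_le_bracket_primitive\<close> converts them into statements about powers of u. For the
  gradient, U is the weighted gradient times (1 + u^2)^(-b), where -b > 0; the first factor is
  bounded in L^p and the second through the integrability of u.\<close>

lemma derived_estimates:
  fixes N p s C :: real
  assumes N: "N = real DIM('a)" and p: "2 \<le> p" "p < N" and s: "0 < s" "s < 1" and C: "C \<ge> 0"
  obtains D where "D \<ge> 0" "\<And>u U. weak0 p u U \<Longrightarrow>
      powr_integral M p (\<lambda>x. (1 + (u x)\<^sup>2) powr ((s - 1) / (2 * p)) *\<^sub>R U x) \<le> ennreal C \<Longrightarrow>
      powr_integral M (N * (p - 1 + s) / (N - p)) u \<le> ennreal D \<and>
      (\<integral>\<^sup>+x. ennreal (\<bar>u x\<bar> powr (p - 1 + s) / norm x powr p) \<partial>M) \<le> ennreal D \<and>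
      powr_integral M (N * (p - 1 + s) / (N - 1 + s)) U \<le> ennreal D"
proof -
  have p': "1 < p" "p < real DIM('a)" "p > 0" using p N by auto
  define b \<beta> where "b = (s - 1) / (2 * p)" and "\<beta> = (p - 1 + s) / p"
  have ab: "1 + 2 * b = \<beta>" using p by (auto simp: b_def \<beta>_def field_simps)
  have b: "-1/2 < b" "b < 0" using s p by (auto simp: b_def field_simps)
  have \<beta>: "\<beta> > 0" "\<beta> * p = p - 1 + s" using p s by (auto simp: \<beta>_def)
  define H where "H = ((N - p) / p) powr p"
  have H: "H > 0" using p by (simp add: H_def)
  have half: "(0::real) < 1/2" "(1/2::real) < 1" by auto
  obtain C0 where C0: "C0 \<ge> 0" "\<And>t. (1/2) * \<bar>t\<bar> powr (1 + 2 * b) / (1 + 2 * b) \<le> \<bar>bracket_primitive b t\<bar> + C0"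
    using powr_le_bracket_primitive[OF b half] by blast
  have t\<beta>: "\<bar>t\<bar> powr \<beta> \<le> 2 * \<beta> * (\<bar>bracket_primitive b t\<bar> + C0)" for t
    using C0(2)[of t] \<beta> unfolding ab by (simp add: field_simps)
  have pw: "\<bar>t\<bar> powr (\<beta> * r) \<le> (2 * \<beta>) powr r * 2 powr r * (\<bar>bracket_primitive b t\<bar> powr r + C0 powr r)" if r: "r \<ge> 0" for t r
  proof -
    have "\<bar>t\<bar> powr (\<beta> * r) = (\<bar>t\<bar> powr \<beta>) powr r" by (simp add: powr_powr)
    also have "\<dots> \<le> (2 * \<beta> * (\<bar>bracket_primitive b t\<bar> + C0)) powr r" using t\<beta> r by (intro powr_mono2) auto
    also have "\<dots> = (2 * \<beta>) powr r * (\<bar>bracket_primitive b t\<bar> + C0) powr r" by (rule powr_mult)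
    also have "\<dots> \<le> (2 * \<beta>) powr r * (2 powr r * (\<bar>bracket_primitive b t\<bar> powr r + C0 powr r))"
      using C0 r by (intro mult_left_mono powr_add_le) auto
    finally show ?thesis by (simp add: mult.assoc)
  qed
  define ps where "ps = p * N / (N - p)"
  have ps: "ps > 0" using p by (simp add: ps_def)
  define e2 where "e2 = N * (p - 1 + s) / (N - p)"
  have e2: "\<beta> * ps = e2" "e2 > 0" using p s by (auto simp: \<beta>_def ps_def e2_def)
  define q0 where "q0 = N * (p - 1 + s) / (N - 1 + s)"
  have nz: "N - 1 + s > 0" "N - p > 0" "1 - s > 0" using p s by auto
  have pq: "p - q0 = (1 - s) * (N - p) / (N - 1 + s)"
    unfolding q0_def using nz by (simp add: field_simps)
  have q0: "0 < q0" "q0 < p"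
  proof -
    show "0 < q0" unfolding q0_def using p s by simp
    have "(1 - s) * (N - p) / (N - 1 + s) > 0" using nz by simp
    then show "q0 < p" using pq by linarith
  qed
  \<comment> \<open>This identity fixes the exponent of the gradient: for \<open>q0\<close>, Young's
    inequality with exponent p for the weighted gradient asks for exactly the integrability
    \<open>e2\<close> of u that Sobolev's inequality provides.\<close>
  have er: "- b * (q0 * p / (p - q0)) = e2 / 2"
  proof -
    have "e2 * (p - q0) = N * (p - 1 + s) / (N - p) * ((1 - s) * (N - p) / (N - 1 + s))" by (simp only: pq e2_def)
    also have "\<dots> = (1 - s) * (N * (p - 1 + s) / (N - 1 + s))" using nz(1,2) by (simp add: divide_simps)
    finally have "(1 - s) * q0 = e2 * (p - q0)" by (simp only: q0_def)
    then have "(1 - s) * q0 / (p - q0) = e2" using q0 by simp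
    moreover have "- b * (q0 * p / (p - q0)) = (1 - s) * q0 / (p - q0) / 2" unfolding b_def using p q0 by (simp add: field_simps)
    ultimately show ?thesis by simp
  qed
  define mm where "mm = measure M (space M)"
  have em: "emeasure M (space M) = ennreal mm" "mm \<ge> 0" by (auto simp: mm_def emeasure_eq_measure)
  define V0 where "V0 = (LINT x|M. 1 / norm x powr p)"
  have V0: "V0 \<ge> 0" by (simp add: V0_def)
  have iV: "integrable M (\<lambda>x. 1 / norm x powr p)" by (rule hardy_potential_integrable[OF p'(1,2)])
  have eV: "(\<integral>\<^sup>+x. ennreal (1 / norm x powr p) \<partial>M) = ennreal V0"
    unfolding V0_def by (rule nn_integral_eq_integral[OF iV]) auto
  define X where "X = ((p * (N - 1) / (N - p)) powr p * (2 powr p * (C + 1))) powr (N / (N - p))"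
  have X: "X \<ge> 0" by (simp add: X_def)
  define c2 where "c2 = (2 * \<beta>) powr ps * 2 powr ps"
  define D2 where "D2 = c2 * (X + C0 powr ps * mm)"
  have D2: "D2 \<ge> 0" using X em by (simp add: D2_def c2_def)
  define c3 where "c3 = (2 * \<beta>) powr p * 2 powr p"
  define D3 where "D3 = c3 * (C / H + C0 powr p * V0)"
  have D3: "D3 \<ge> 0" using C H V0 by (simp add: D3_def c3_def)
  define D4 where "D4 = C + 2 powr (e2 / 2) * (mm + D2)"
  have D4: "D4 \<ge> 0" using C em D2 by (simp add: D4_def)
  show ?thesis
  proof (rule that[of "D2 + D3 + D4"])
    show "D2 + D3 + D4 \<ge> 0" using D2 D3 D4 by simp
    fix u U assume w: "weak0 p u U" and bd: "powr_integral M p (\<lambda>x. (1 + (u x)\<^sup>2) powr ((s - 1) / (2 * p)) *\<^sub>R U x) \<le> ennreal C"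
    note [measurable] = weak0_measurable[OF w]
    have wb: "weak0 p (\<lambda>x. bracket_primitive b (u x)) (\<lambda>x. (1 + (u x)\<^sup>2) powr b *\<^sub>R U x)"
      by (rule weak0_bracket_primitive[OF w p'(3)]) (use b in simp)
    note [measurable] = weak0_measurable[OF wb]
    have bd': "powr_integral M p (\<lambda>x. (1 + (u x)\<^sup>2) powr b *\<^sub>R U x) \<le> ennreal C" using bd by (simp only: b_def)
    have bX: "powr_integral M ps (\<lambda>x. bracket_primitive b (u x)) \<le> ennreal X"
      unfolding ps_def X_def by (rule sobolev_weak0[OF wb p'(1) p(2) N bd' C])
    have 2: "powr_integral M e2 u \<le> ennreal D2"
    proof -
      have "powr_integral M e2 u \<le> (\<integral>\<^sup>+x. ennreal c2 * (ennreal (norm (bracket_primitive b (u x)) powr ps) + ennreal (C0 powr ps)) \<partial>M)"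
        unfolding powr_integral_def
      proof (rule nn_integral_mono)
        fix x
        have "norm (u x) powr e2 \<le> c2 * (norm (bracket_primitive b (u x)) powr ps + C0 powr ps)"
          using pw[of ps "u x"] ps unfolding e2(1) c2_def by simp
        then have "ennreal (norm (u x) powr e2) \<le> ennreal (c2 * (norm (bracket_primitive b (u x)) powr ps + C0 powr ps))" by (rule ennreal_leI)
        also have "\<dots> = ennreal c2 * (ennreal (norm (bracket_primitive b (u x)) powr ps) + ennreal (C0 powr ps))"
          by (simp add: ennreal_mult c2_def)
        finally show "ennreal (norm (u x) powr e2) \<le> ennreal c2 * (ennreal (norm (bracket_primitive b (u x)) powr ps) + ennreal (C0 powr ps))" .
      qed
      also have "\<dots> = ennreal c2 * (powr_integral M ps (\<lambda>x. bracket_primitive b (u x)) + ennreal (C0 powr ps) * ennreal mm)"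
        unfolding powr_integral_def em(1)[symmetric] by (simp add: nn_integral_cmult nn_integral_add)
      also have "\<dots> \<le> ennreal c2 * (ennreal X + ennreal (C0 powr ps) * ennreal mm)"
        using bX by (intro mult_left_mono add_mono) auto
      also have "\<dots> = ennreal D2"
        using X em(2) by (simp add: D2_def c2_def ennreal_mult)
      finally show ?thesis .
    qed
    have 3: "(\<integral>\<^sup>+x. ennreal (\<bar>u x\<bar> powr (p - 1 + s) / norm x powr p) \<partial>M) \<le> ennreal D3"
    proof -
      have "(\<integral>\<^sup>+x. ennreal (\<bar>u x\<bar> powr (p - 1 + s) / norm x powr p) \<partial>M)
        \<le> (\<integral>\<^sup>+x. ennreal c3 * (ennreal (\<bar>bracket_primitive b (u x)\<bar> powr p / norm x powr p) + ennreal (C0 powr p) * ennreal (1 / norm x powr p)) \<partial>M)"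
      proof (rule nn_integral_mono)
        fix x
        have "\<bar>u x\<bar> powr (p - 1 + s) \<le> c3 * (\<bar>bracket_primitive b (u x)\<bar> powr p + C0 powr p)"
          using pw[of p "u x"] p unfolding \<beta>(2) c3_def by simp
        then have "\<bar>u x\<bar> powr (p - 1 + s) / norm x powr p \<le> c3 * (\<bar>bracket_primitive b (u x)\<bar> powr p + C0 powr p) / norm x powr p"
          by (intro divide_right_mono) auto
        also have "\<dots> = c3 * (\<bar>bracket_primitive b (u x)\<bar> powr p / norm x powr p + C0 powr p * (1 / norm x powr p))"
          by (simp add: add_divide_distrib distrib_left)
        finally have "ennreal (\<bar>u x\<bar> powr (p - 1 + s) / norm x powr p) \<le> ennreal (c3 * (\<bar>bracket_primitive b (u x)\<bar> powr p / norm x powr p + C0 powr p * (1 / norm x powr p)))"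
          by (rule ennreal_leI)
        also have "\<dots> = ennreal c3 * (ennreal (\<bar>bracket_primitive b (u x)\<bar> powr p / norm x powr p) + ennreal (C0 powr p) * ennreal (1 / norm x powr p))"
        proof -
          have "ennreal (c3 * (\<bar>bracket_primitive b (u x)\<bar> powr p / norm x powr p + C0 powr p * (1 / norm x powr p))) =
            ennreal c3 * ennreal (\<bar>bracket_primitive b (u x)\<bar> powr p / norm x powr p + C0 powr p * (1 / norm x powr p))"
            by (rule ennreal_mult) (auto simp: c3_def)
          also have "ennreal (\<bar>bracket_primitive b (u x)\<bar> powr p / norm x powr p + C0 powr p * (1 / norm x powr p)) =
            ennreal (\<bar>bracket_primitive b (u x)\<bar> powr p / norm x powr p) + ennreal (C0 powr p * (1 / norm x powr p))"
            by (rule ennreal_plus) auto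
          also have "ennreal (C0 powr p * (1 / norm x powr p)) = ennreal (C0 powr p) * ennreal (1 / norm x powr p)"
            by (rule ennreal_mult) auto
          finally show ?thesis .
        qed
        finally show "ennreal (\<bar>u x\<bar> powr (p - 1 + s) / norm x powr p) \<le> ennreal c3 * (ennreal (\<bar>bracket_primitive b (u x)\<bar> powr p / norm x powr p) + ennreal (C0 powr p) * ennreal (1 / norm x powr p))" .
      qed
      also have "\<dots> = ennreal c3 * ((\<integral>\<^sup>+x. ennreal (\<bar>bracket_primitive b (u x)\<bar> powr p / norm x powr p) \<partial>M) + ennreal (C0 powr p) * ennreal V0)"
        unfolding eV[symmetric] by (simp add: nn_integral_cmult nn_integral_add)
      also have "\<dots> \<le> ennreal c3 * (ennreal (C / H) + ennreal (C0 powr p) * ennreal V0)"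
      proof (intro mult_left_mono add_right_mono)
        have "ennreal H * (\<integral>\<^sup>+x. ennreal (\<bar>bracket_primitive b (u x)\<bar> powr p / norm x powr p) \<partial>M) \<le> ennreal C"
          using order_trans[OF hardy_weak0[OF wb p'(1,2)] bd'] unfolding H_def N .
        then have "ennreal (1 / H) * (ennreal H * (\<integral>\<^sup>+x. ennreal (\<bar>bracket_primitive b (u x)\<bar> powr p / norm x powr p) \<partial>M)) \<le> ennreal (1 / H) * ennreal C"
          by (intro mult_left_mono) auto
        moreover have "ennreal (1 / H) * ennreal H = 1" "ennreal (1 / H) * ennreal C = ennreal (C / H)"
          using H C by (simp_all add: ennreal_mult[symmetric])
        ultimately show "(\<integral>\<^sup>+x. ennreal (\<bar>bracket_primitive b (u x)\<bar> powr p / norm x powr p) \<partial>M) \<le> ennreal (C / H)"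
          by (simp add: mult.assoc[symmetric])
      qed auto
      also have "\<dots> = ennreal D3"
        using C H V0 by (simp add: D3_def c3_def ennreal_mult)
      finally show ?thesis .
    qed
    have 4: "powr_integral M q0 U \<le> ennreal D4"
    proof -
      have "powr_integral M q0 U \<le> (\<integral>\<^sup>+x. ennreal (norm ((1 + (u x)\<^sup>2) powr b *\<^sub>R U x) powr p) + ennreal (2 powr (e2 / 2)) * (1 + ennreal (norm (u x) powr e2)) \<partial>M)"
        unfolding powr_integral_def
      proof (rule nn_integral_mono)
        fix x
        let ?r = "1 + (u x)\<^sup>2"
        note r = bracket_ge_1[of "u x"]
        have "norm (U x) = norm (?r powr b *\<^sub>R U x) * ?r powr (- b)"
          using r by (simp add: powr_minus field_simps)
        then have "norm (U x) powr q0 = (norm (?r powr b *\<^sub>R U x) * ?r powr (- b)) powr q0" by (simp only:)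
        also have "\<dots> \<le> norm (?r powr b *\<^sub>R U x) powr p + (?r powr (- b)) powr (q0 * p / (p - q0))"
          by (rule powr_product_le) (use q0 in auto)
        also have "(?r powr (- b)) powr (q0 * p / (p - q0)) = ?r powr (e2 / 2)"
          unfolding powr_powr er ..
        also have "?r powr (e2 / 2) \<le> 2 powr (e2 / 2) * (1 powr (e2 / 2) + ((u x)\<^sup>2) powr (e2 / 2))"
          by (rule powr_add_le) (use e2 in auto)
        also have "((u x)\<^sup>2) powr (e2 / 2) = norm (u x) powr e2"
        proof (cases "u x = 0")
          case False
          then have "(u x)\<^sup>2 = \<bar>u x\<bar> powr 2" by (simp add: powr_numeral)
          then show ?thesis by (simp only: powr_powr) simp
        qed (use e2 in simp)
        finally have "norm (U x) powr q0 \<le> norm (?r powr b *\<^sub>R U x) powr p + 2 powr (e2 / 2) * (1 + norm (u x) powr e2)" by simp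
        then have "ennreal (norm (U x) powr q0) \<le> ennreal (norm (?r powr b *\<^sub>R U x) powr p + 2 powr (e2 / 2) * (1 + norm (u x) powr e2))"
          by (rule ennreal_leI)
        also have "\<dots> = ennreal (norm (?r powr b *\<^sub>R U x) powr p) + ennreal (2 powr (e2 / 2)) * (1 + ennreal (norm (u x) powr e2))"
          by (subst ennreal_plus) (auto simp: ennreal_mult)
        finally show "ennreal (norm (U x) powr q0) \<le> ennreal (norm (?r powr b *\<^sub>R U x) powr p) + ennreal (2 powr (e2 / 2)) * (1 + ennreal (norm (u x) powr e2))" .
      qed
      also have "\<dots> = powr_integral M p (\<lambda>x. (1 + (u x)\<^sup>2) powr b *\<^sub>R U x) + ennreal (2 powr (e2 / 2)) * (ennreal mm + powr_integral M e2 u)"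
        unfolding powr_integral_def em(1)[symmetric] by (simp add: nn_integral_cmult nn_integral_add)
      also have "\<dots> \<le> ennreal C + ennreal (2 powr (e2 / 2)) * (ennreal mm + ennreal D2)"
        by (intro add_mono mult_left_mono bd' 2) auto
      also have "\<dots> = ennreal D4" using C em(2) D2 by (simp add: D4_def ennreal_mult)
      finally show ?thesis .
    qed
    have le: "ennreal D2 \<le> ennreal (D2 + D3 + D4)" "ennreal D3 \<le> ennreal (D2 + D3 + D4)" "ennreal D4 \<le> ennreal (D2 + D3 + D4)"
      using D2 D3 D4 by (intro ennreal_leI; simp)+
    show "powr_integral M (N * (p - 1 + s) / (N - p)) u \<le> ennreal (D2 + D3 + D4) \<and>
      (\<integral>\<^sup>+x. ennreal (\<bar>u x\<bar> powr (p - 1 + s) / norm x powr p) \<partial>M) \<le> ennreal (D2 + D3 + D4) \<and>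
      powr_integral M (N * (p - 1 + s) / (N - 1 + s)) U \<le> ennreal (D2 + D3 + D4)"
      using order_trans[OF 2 le(1)] order_trans[OF 3 le(2)] order_trans[OF 4 le(3)] unfolding e2_def q0_def by blast
  qed
qed

text \<open>A smooth truncation at height d pi / 2: its derivative is at most 1 everywhere and
  equals 1 at 0, so it is close to the identity on values small compared with d.\<close>

lemma weak0_arctan:
  assumes w: "weak0 p u U" and p: "p > 0" and d: "d > 0"
  shows "weak0 p (\<lambda>x. d * arctan (u x / d)) (\<lambda>x. (1 / (1 + (u x / d)\<^sup>2)) *\<^sub>R U x)"
proof -
  have w1: "weak0 p (\<lambda>x. (1 / d) * u x) (\<lambda>x. (1 / d) *\<^sub>R U x)" by (rule weak0_cmult[OF w])
  have "weak0 p (\<lambda>x. arctan ((1 / d) * u x)) (\<lambda>x. inverse (1 + ((1 / d) * u x)\<^sup>2) *\<^sub>R ((1 / d) *\<^sub>R U x))"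
  proof (rule weak0_compose[where B=1 and P=arctan and P'="\<lambda>t. inverse (1 + t\<^sup>2)", OF w1 p C_k_arctan arctan_zero_zero DERIV_arctan])
    have "1 + t\<^sup>2 \<noteq> 0" for t :: real using bracket_ge_1(2)[of t] by linarith
    then show "continuous_on UNIV (\<lambda>t::real. inverse (1 + t\<^sup>2))" by (intro continuous_intros) auto
    show "\<bar>inverse (1 + t\<^sup>2)\<bar> \<le> 1" for t :: real
      using bracket_ge_1[of t] by (simp add: inverse_le_1_iff)
  qed
  note w2 = weak0_cmult[OF this, of d]
  have "d *\<^sub>R (inverse (1 + ((1 / d) * u x)\<^sup>2) *\<^sub>R ((1 / d) *\<^sub>R U x)) = (1 / (1 + (u x / d)\<^sup>2)) *\<^sub>R U x" for x
    using d by (simp add: inverse_eq_divide)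
  then show ?thesis using w2 by (simp only: mult_1_left times_divide_eq_left)
qed

text \<open>Where \<open>|u\<^sub>i - u\<^sub>j| \<le> d\<close>, monotonicity of the flux bounds \<open>|U\<^sub>i - U\<^sub>j|\<^sup>p\<close> in terms of the test function
  \<open>d arctan ((u\<^sub>i - u\<^sub>j) / d)\<close>, whose size is of order \<open>d\<close>; the remaining set is small in measure.\<close>

lemma gradient_cauchy:
  fixes u g :: "nat \<Rightarrow> 'a \<Rightarrow> real"
  assumes p: "p \<ge> 2" and w: "\<And>n. weak0 p (u n) (U n)"
    and eq: "\<And>n v V. weak0 p v V \<Longrightarrow> (LINT x|M. pflux p (U n x) \<bullet> V x) = (LINT x|M. g n x * v x)"
    and g: "\<And>n. integrable M (g n)" "\<And>n. (LINT x|M. \<bar>g n x\<bar>) \<le> G" and q: "q > 1" "\<And>n. powr_integral M q (U n) \<le> ennreal C"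
    and cauchy: "\<And>e. e > 0 \<Longrightarrow> \<exists>n0. \<forall>i\<ge>n0. \<forall>j\<ge>n0. powr_integral M 1 (\<lambda>x. u i x - u j x) \<le> ennreal e"
    and e: "e > 0"
  shows "\<exists>n0. \<forall>i\<ge>n0. \<forall>j\<ge>n0. powr_integral M 1 (\<lambda>x. U i x - U j x) \<le> ennreal e"
proof -
  note [measurable] = weak0_measurable[OF w]
  have [measurable]: "pflux p \<in> borel_measurable (borel::'a measure)" by (rule pflux_borel[OF p])
  have p0: "p > 0" "p \<ge> 0" "p > 1" using p by auto
  have G: "G \<ge> 0" using g(2)[of 0] by (smt (verit) integral_nonneg_AE AE_I2 abs_ge_zero)
  define C' where "C' = max C 0"
  have C': "ennreal C = ennreal C'" "C' \<ge> 0" by (auto simp: C'_def max_def ennreal_neg)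
  define mm where "mm = measure M (space M)"
  have em: "emeasure M (space M) = ennreal mm" "mm \<ge> 0" by (auto simp: mm_def emeasure_eq_measure)
  \<comment> \<open>Four errors of size e / 4 are prepared. \<eta> covers small gradient
    differences, and K covers large ones through the bound in exponent q. Then d is chosen depending
    on \<eta>, because the monotonicity estimate is proportional to d with a factor \<eta>^(1-p).
    Last comes n0, depending on d and K.\<close>
  define \<eta> where "\<eta> = e / (4 * (mm + 1))"
  have \<eta>: "\<eta> > 0" "\<eta> * mm \<le> e / 4"
  proof -
    show "\<eta> > 0" using e em by (simp add: \<eta>_def)
    have "\<eta> * mm = (e / 4) * (mm / (mm + 1))" by (simp add: \<eta>_def)
    also have "\<dots> \<le> (e / 4) * 1" using e em by (intro mult_left_mono) auto
    finally show "\<eta> * mm \<le> e / 4" by simp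
  qed
  define c where "c = 2 powr q * (2 * C')"
  have c: "c \<ge> 0" using C' by (simp add: c_def)
  define K where "K = (e / (4 * (c + 1))) powr (1 / (1 - q))"
  have K: "K > 0" "K powr (1 - q) * c \<le> e / 4"
  proof -
    have pos: "e / (4 * (c + 1)) > 0" using e c by simp
    then show "K > 0" unfolding K_def powr_gt_zero by (rule less_imp_neq[THEN not_sym])
    have "K powr (1 - q) = (e / (4 * (c + 1))) powr 1" unfolding K_def powr_powr using q by simp
    also have "\<dots> = e / (4 * (c + 1))" using pos by (simp only: powr_one)
    finally have "K powr (1 - q) * c = (e / 4) * (c / (c + 1))" by simp
    also have "\<dots> \<le> (e / 4) * 1" using e c by (intro mult_left_mono) auto
    finally show "K powr (1 - q) * c \<le> e / 4" by simp
  qed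
  define k where "k = 2 * \<eta> powr (1 - p) * 2 powr (p - 1) * (pi * G)"
  have k: "k \<ge> 0" using G by (simp add: k_def)
  define d where "d = e / (4 * (k + 1))"
  have d: "d > 0" "k * d \<le> e / 4"
  proof -
    show "d > 0" using e k by (simp add: d_def)
    have "k * d = (e / 4) * (k / (k + 1))" by (simp add: d_def)
    also have "\<dots> \<le> (e / 4) * 1" using e k by (intro mult_left_mono) auto
    finally show "k * d \<le> e / 4" by simp
  qed
  have "e * d / (4 * K) > 0" using e d K by simp
  then obtain n0 where n0: "\<And>i j. i \<ge> n0 \<Longrightarrow> j \<ge> n0 \<Longrightarrow> powr_integral M 1 (\<lambda>x. u i x - u j x) \<le> ennreal (e * d / (4 * K))"
    using cauchy by meson
  have "powr_integral M 1 (\<lambda>x. U i x - U j x) \<le> ennreal e" if ij: "i \<ge> n0" "j \<ge> n0" for i j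
  proof -
    define z where "z x = (u i x - u j x) / d" for x
    have [measurable]: "z \<in> borel_measurable M" unfolding z_def by measurable
    define D where "D x = U i x - U j x" for x
    have [measurable]: "D \<in> borel_measurable M" unfolding D_def by measurable
    have wd: "weak0 p (\<lambda>x. u i x - u j x) D"
      unfolding D_def by (rule weak0_diff[OF p0(2) w w])
    have wz: "weak0 p (\<lambda>x. d * arctan (z x)) (\<lambda>x. (1 / (1 + (z x)\<^sup>2)) *\<^sub>R D x)"
      unfolding z_def by (rule weak0_arctan[OF wd p0(1) d(1)])
    have ifl: "integrable M (\<lambda>x. pflux p (U n x) \<bullet> ((1 / (1 + (z x)\<^sup>2)) *\<^sub>R D x))" for n
      by (rule integrable_flux[OF weak0_measurable(2)[OF w] weak0_measurable(2)[OF wz] p weak0_finite(2)[OF w p0(2)] weak0_finite(2)[OF wz p0(2)]])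
    \<comment> \<open>The weight is the derivative of the truncated difference d arctan z, so
      monotonicity of the flux bounds the integral of E by the difference of the two right-hand
      sides tested with a function of size at most d pi / 2.\<close>
    define E where "E x = norm (D x) powr p / (1 + (z x)\<^sup>2)" for x
    have [measurable]: "E \<in> borel_measurable M" unfolding E_def by measurable
    have E0: "E x \<ge> 0" for x using bracket_ge_1[of "z x"] by (simp add: E_def)
    have ptE: "2 powr (1 - p) * E x \<le> (pflux p (U i x) - pflux p (U j x)) \<bullet> ((1 / (1 + (z x)\<^sup>2)) *\<^sub>R D x)" for x
    proof -
      have "(1 / (1 + (z x)\<^sup>2)) * (2 powr (1 - p) * norm (D x) powr p) \<le> (1 / (1 + (z x)\<^sup>2)) * ((pflux p (U i x) - pflux p (U j x)) \<bullet> D x)"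
        unfolding D_def using bracket_ge_1[of "z x"] by (intro mult_left_mono pflux_monotone[OF p]) auto
      then show ?thesis by (simp add: E_def mult.commute)
    qed
    have iE: "integrable M (\<lambda>x. 2 powr (1 - p) * E x)"
    proof (rule Bochner_Integration.integrable_bound)
      show "integrable M (\<lambda>x. pflux p (U i x) \<bullet> ((1 / (1 + (z x)\<^sup>2)) *\<^sub>R D x) - pflux p (U j x) \<bullet> ((1 / (1 + (z x)\<^sup>2)) *\<^sub>R D x))"
        by (rule Bochner_Integration.integrable_diff[OF ifl ifl])
      show "AE x in M. norm (2 powr (1 - p) * E x) \<le> norm (pflux p (U i x) \<bullet> ((1 / (1 + (z x)\<^sup>2)) *\<^sub>R D x) - pflux p (U j x) \<bullet> ((1 / (1 + (z x)\<^sup>2)) *\<^sub>R D x))"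
      proof (rule AE_I2)
        fix x
        have "0 \<le> 2 powr (1 - p) * E x" using E0[of x] by simp
        then show "norm (2 powr (1 - p) * E x) \<le> norm (pflux p (U i x) \<bullet> ((1 / (1 + (z x)\<^sup>2)) *\<^sub>R D x) - pflux p (U j x) \<bullet> ((1 / (1 + (z x)\<^sup>2)) *\<^sub>R D x))"
          using ptE[of x] unfolding inner_diff_left real_norm_def by linarith
      qed
    qed measurable
    have gi: "integrable M (\<lambda>x. g n x * (d * arctan (z x)))" for n
    proof (rule integrable_mult_bounded[OF g(1)])
      show "\<bar>d * arctan (z x)\<bar> \<le> d * (pi / 2)" for x
        using d(1) abs_arctan_le[of "z x"] by (simp add: abs_mult)
    qed measurable
    have gb: "\<bar>LINT x|M. g n x * (d * arctan (z x))\<bar> \<le> d * (pi / 2) * G" for n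
    proof -
      have "\<bar>LINT x|M. g n x * (d * arctan (z x))\<bar> \<le> (LINT x|M. \<bar>g n x * (d * arctan (z x))\<bar>)" by simp
      also have "\<dots> \<le> (LINT x|M. d * (pi / 2) * \<bar>g n x\<bar>)"
      proof (rule integral_mono)
        show "integrable M (\<lambda>x. \<bar>g n x * (d * arctan (z x))\<bar>)" using gi by simp
        show "integrable M (\<lambda>x. d * (pi / 2) * \<bar>g n x\<bar>)" using g(1) by (intro integrable_mult_right integrable_abs)
        fix x
        have "\<bar>g n x\<bar> * (d * \<bar>arctan (z x)\<bar>) \<le> \<bar>g n x\<bar> * (d * (pi / 2))"
          using d(1) abs_arctan_le[of "z x"] by (intro mult_left_mono) auto
        then show "\<bar>g n x * (d * arctan (z x))\<bar> \<le> d * (pi / 2) * \<bar>g n x\<bar>"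
          using d(1) by (simp add: abs_mult mult_ac)
      qed
      also have "\<dots> = d * (pi / 2) * (LINT x|M. \<bar>g n x\<bar>)" by (rule integral_mult_right_zero)
      also have "\<dots> \<le> d * (pi / 2) * G" using g(2)[of n] d(1) by (intro mult_left_mono) auto
      finally show ?thesis .
    qed
    have "2 powr (1 - p) * (LINT x|M. E x) = (LINT x|M. 2 powr (1 - p) * E x)" by simp
    also have "\<dots> \<le> (LINT x|M. pflux p (U i x) \<bullet> ((1 / (1 + (z x)\<^sup>2)) *\<^sub>R D x) - pflux p (U j x) \<bullet> ((1 / (1 + (z x)\<^sup>2)) *\<^sub>R D x))"
      using ptE by (intro integral_mono iE Bochner_Integration.integrable_diff[OF ifl ifl]) (simp only: inner_diff_left)
    also have "\<dots> = (LINT x|M. g i x * (d * arctan (z x))) - (LINT x|M. g j x * (d * arctan (z x)))"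
      unfolding Bochner_Integration.integral_diff[OF ifl ifl] eq[OF wz] ..
    also have "\<dots> \<le> d * (pi * G)" using gb[of i] gb[of j] by (simp add: abs_le_iff field_simps)
    finally have "2 powr (p - 1) * (2 powr (1 - p) * (LINT x|M. E x)) \<le> 2 powr (p - 1) * (d * (pi * G))" by (intro mult_left_mono) auto
    moreover have "2 powr (p - 1) * 2 powr (1 - p) = (1::real)" unfolding powr_add[symmetric] by simp
    ultimately have LE: "(LINT x|M. E x) \<le> 2 powr (p - 1) * (d * (pi * G))" by (simp add: mult.assoc[symmetric])
    have iE': "integrable M E" using iE by simp
    have nE: "(\<integral>\<^sup>+x. ennreal (E x) \<partial>M) \<le> ennreal (2 powr (p - 1) * (d * (pi * G)))"
      using nn_integral_eq_integral[OF iE'] E0 LE by (simp add: ennreal_leI)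
    \<comment> \<open>Where |z| <= 1 the weight in E is at least 1/2. Elsewhere K <= K |z|, which is
      Chebyshev's inequality in pointwise form and brings in the L^1 distance of the
      functions.\<close>
    have pt: "norm (D x) \<le> \<eta> + 2 * \<eta> powr (1 - p) * E x + K / d * \<bar>u i x - u j x\<bar> + K powr (1 - q) * norm (D x) powr q" for x
    proof (cases "\<bar>z x\<bar> \<le> 1")
      case True
      have "norm (D x) powr 1 \<le> min (norm (D x)) \<eta> powr 1 + \<eta> powr (1 - p) * norm (D x) powr p"
        by (rule powr_le_split) (use \<eta> p in auto)
      then have "norm (D x) \<le> \<eta> + \<eta> powr (1 - p) * norm (D x) powr p" using \<eta> by simp
      also have "norm (D x) powr p \<le> 2 * E x"
      proof -
        have "(z x)\<^sup>2 \<le> 1" using True by (simp add: abs_square_le_1)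
        then have "norm (D x) powr p * (1 + (z x)\<^sup>2) \<le> norm (D x) powr p * 2" by (intro mult_left_mono) auto
        then show ?thesis using bracket_ge_1[of "z x"] by (simp add: E_def field_simps)
      qed
      finally have "norm (D x) \<le> \<eta> + 2 * \<eta> powr (1 - p) * E x" by (simp add: mult_left_mono)
      then show ?thesis using K(1) d(1) by (simp add: add_increasing2)
    next
      case False
      have "norm (D x) powr 1 \<le> min (norm (D x)) K powr 1 + K powr (1 - q) * norm (D x) powr q"
        by (rule powr_le_split) (use K q in auto)
      then have 1: "norm (D x) \<le> K + K powr (1 - q) * norm (D x) powr q" using K by simp
      have "K * 1 \<le> K * \<bar>z x\<bar>" using False K by (intro mult_left_mono) auto
      also have "\<dots> = K / d * \<bar>u i x - u j x\<bar>" using d(1) by (simp add: z_def)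
      finally have "norm (D x) \<le> K / d * \<bar>u i x - u j x\<bar> + K powr (1 - q) * norm (D x) powr q" using 1 by simp
      moreover have "\<eta> + 2 * \<eta> powr (1 - p) * E x \<ge> 0" using \<eta> E0 by simp
      ultimately show ?thesis by linarith
    qed
    have "powr_integral M 1 D \<le> (\<integral>\<^sup>+x. ennreal \<eta> + ennreal (2 * \<eta> powr (1 - p)) * ennreal (E x) + ennreal (K / d) * ennreal \<bar>u i x - u j x\<bar> + ennreal (K powr (1 - q)) * ennreal (norm (D x) powr q) \<partial>M)"
      unfolding powr_integral_def
    proof (rule nn_integral_mono)
      fix x
      have "ennreal (norm (D x)) \<le> ennreal (\<eta> + 2 * \<eta> powr (1 - p) * E x + K / d * \<bar>u i x - u j x\<bar> + K powr (1 - q) * norm (D x) powr q)"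
        by (rule ennreal_leI[OF pt])
      also have "\<dots> = ennreal \<eta> + ennreal (2 * \<eta> powr (1 - p)) * ennreal (E x) + ennreal (K / d) * ennreal \<bar>u i x - u j x\<bar> + ennreal (K powr (1 - q)) * ennreal (norm (D x) powr q)"
        using \<eta> E0 K d by (simp add: ennreal_mult[symmetric] ennreal_plus[symmetric] del: ennreal_plus)
      finally show "ennreal (norm (D x) powr 1) \<le> ennreal \<eta> + ennreal (2 * \<eta> powr (1 - p)) * ennreal (E x) + ennreal (K / d) * ennreal \<bar>u i x - u j x\<bar> + ennreal (K powr (1 - q)) * ennreal (norm (D x) powr q)"
        by simp
    qed
    also have "\<dots> = ennreal \<eta> * ennreal mm + ennreal (2 * \<eta> powr (1 - p)) * (\<integral>\<^sup>+x. ennreal (E x) \<partial>M) + ennreal (K / d) * powr_integral M 1 (\<lambda>x. u i x - u j x) + ennreal (K powr (1 - q)) * powr_integral M q D"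
      unfolding powr_integral_def em(1)[symmetric] by (simp add: nn_integral_add nn_integral_cmult)
    also have "\<dots> \<le> ennreal (e / 4) + ennreal (e / 4) + ennreal (e / 4) + ennreal (e / 4)"
    proof (intro add_mono)
      show "ennreal \<eta> * ennreal mm \<le> ennreal (e / 4)" using \<eta> em by (simp add: ennreal_mult[symmetric] ennreal_leI)
      have "ennreal (2 * \<eta> powr (1 - p)) * (\<integral>\<^sup>+x. ennreal (E x) \<partial>M) \<le> ennreal (2 * \<eta> powr (1 - p)) * ennreal (2 powr (p - 1) * (d * (pi * G)))"
        using nE by (intro mult_left_mono) auto
      also have "\<dots> = ennreal (k * d)" using G d by (simp add: ennreal_mult[symmetric] k_def mult_ac)
      also have "\<dots> \<le> ennreal (e / 4)" using d by (intro ennreal_leI)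
      finally show "ennreal (2 * \<eta> powr (1 - p)) * (\<integral>\<^sup>+x. ennreal (E x) \<partial>M) \<le> ennreal (e / 4)" .
      have "ennreal (K / d) * powr_integral M 1 (\<lambda>x. u i x - u j x) \<le> ennreal (K / d) * ennreal (e * d / (4 * K))"
        using n0[OF ij] by (intro mult_left_mono) auto
      also have "\<dots> = ennreal (e / 4)" using K d e by (simp add: ennreal_mult[symmetric])
      finally show "ennreal (K / d) * powr_integral M 1 (\<lambda>x. u i x - u j x) \<le> ennreal (e / 4)" .
      have "powr_integral M q D \<le> ennreal (2 powr q) * (powr_integral M q (U i) + powr_integral M q (U j))"
        unfolding D_def by (rule powr_integral_diff_le) (use q in auto)
      also have "\<dots> \<le> ennreal (2 powr q) * (ennreal C' + ennreal C')"
        using q(2) C'(1) by (intro mult_left_mono add_mono) auto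
      also have "\<dots> = ennreal c" using C'(2) by (simp add: c_def ennreal_mult[symmetric] ennreal_plus[symmetric] del: ennreal_plus)
      finally have "ennreal (K powr (1 - q)) * powr_integral M q D \<le> ennreal (K powr (1 - q)) * ennreal c" by (intro mult_left_mono) auto
      also have "\<dots> \<le> ennreal (e / 4)" using K c by (simp add: ennreal_mult[symmetric] ennreal_leI)
      finally show "ennreal (K powr (1 - q)) * powr_integral M q D \<le> ennreal (e / 4)" .
    qed
    also have "\<dots> = ennreal e" using e by (simp add: ennreal_plus[symmetric] del: ennreal_plus)
    finally show ?thesis unfolding D_def .
  qed
  then show ?thesis by blast
qed

end

subsection \<open>Passage to the limit\<close>

text \<open>The bound on m says m d < p N for d = p N - N + p. This is equivalent to s < 1, and it
  implies m p < N because p^2 <= d. The factorisations (p - 1 + s) k = (p - 1) m (N - p) and (N - 1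
  + s) k = (N - p) (N - m), with k = N - m p, turn the condition on \<open>lam\<close> into the one
  for absorption and give q0 = (p - 1) m N / (N - m).\<close>

lemma exponent_identities:
  fixes N p m q lam :: real
  assumes p: "2 \<le> p" "p < N" and m: "1 < m" "m < hoelder_conjugate (sobolev_conjugate N p)"
    and lam: "lam < (m - 1) * N * (N - m * p) powr (p - 1) / ((p - 1) powr (p - 1) * m powr p)"
    and q: "q = p * m * N / (N * p - m * (N * (p - 2) + p))"
    and s: "s = (p - 1) * N * (m - 1) / (N - m * p)"
    and q0: "q0 = N * (p - 1 + s) / (N - 1 + s)"
  shows "m * p < N" "0 < s" "s < 1" "lam < s * (N - p) powr p / (p - 1 + s) powr p"
    "1 \<le> q" "q < p" "q \<le> q0" "p - 1 < q0" "q0 \<le> N * (p - 1 + s) / (N - p)"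
proof -
  define d where "d = p * N - N + p"
  have d: "d > 0"
  proof -
    have "p * N \<ge> 1 * N" using p by (intro mult_right_mono) auto
    then show ?thesis unfolding d_def using p by linarith
  qed
  have "hoelder_conjugate (sobolev_conjugate N p) = p * N / d"
    using p d by (simp add: hoelder_conjugate_def sobolev_conjugate_def d_def divide_simps)
  then have md: "m * d < p * N" using m(2) d by (simp add: pos_less_divide_eq)
  have "p * d \<le> N * d \<and> p * (p * N) \<le> N * d"
  proof
    show "p * d \<le> N * d" using p d by (intro mult_right_mono) auto
    have "(p - 1) * (N - p) \<ge> 0" using p by simp
    then have "p * p \<le> d" by (simp add: d_def algebra_simps)
    then have "N * (p * p) \<le> N * d" using p by (intro mult_left_mono) auto
    then show "p * (p * N) \<le> N * d" by (simp add: mult_ac)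
  qed
  moreover have "p * (m * d) < p * (p * N)" using md p by (intro mult_strict_left_mono) auto
  ultimately have "d * (m * p) < d * N" by (simp add: mult_ac)
  then show mp: "m * p < N" using d by (simp only: mult_less_cancel_left_pos)
  define k where "k = N - m * p"
  have k: "k > 0" using mp by (simp add: k_def)
  have sk: "s = (p - 1) * N * (m - 1) / k" by (simp add: s k_def)
  show s0: "0 < s" unfolding sk using p m k by simp
  show s1: "s < 1" unfolding sk using md k by (simp add: pos_divide_less_eq) (simp add: k_def d_def algebra_simps)
  have ps: "p - 1 + s = (p - 1) * m * (N - p) / k"
  proof -
    have "(p - 1 + s) * k = (p - 1) * k + (p - 1) * N * (m - 1)" using k by (simp add: sk field_simps)
    also have "\<dots> = (p - 1) * m * (N - p)" by (simp add: k_def algebra_simps)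
    finally show ?thesis using k by (simp add: field_simps)
  qed
  show "lam < s * (N - p) powr p / (p - 1 + s) powr p"
  proof -
    have P: "(p - 1) powr p = (p - 1) * (p - 1) powr (p - 1)" "k powr p = k * k powr (p - 1)"
      using p k powr_mult_base[of "p - 1" "p - 1"] powr_mult_base[of k "p - 1"] by auto
    have E: "(p - 1 + s) powr p = (p - 1) powr p * m powr p * (N - p) powr p / k powr p"
      unfolding ps using p m k by (simp add: powr_mult powr_divide)
    have "(p - 1) powr (p - 1) > 0" "m powr p > 0" "(N - p) powr p > 0" "k powr (p - 1) > 0"
      using p m k by auto
    then have "s * (N - p) powr p / (p - 1 + s) powr p = (m - 1) * N * k powr (p - 1) / ((p - 1) powr (p - 1) * m powr p)"
      unfolding E unfolding P sk using p k by (simp add: divide_simps)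
    then show ?thesis using lam by (simp add: k_def)
  qed
  have Nm: "N - m > 0"
  proof -
    have "m * 1 \<le> m * p" using p m by (intro mult_left_mono) auto
    then show ?thesis using mp by simp
  qed
  have q0': "q0 = (p - 1) * m * N / (N - m)"
  proof -
    have NS: "N - 1 + s = (N - p) * (N - m) / k"
    proof -
      have "(N - 1 + s) * k = (N - 1) * k + (p - 1) * N * (m - 1)" using k by (simp add: sk field_simps)
      also have "\<dots> = (N - p) * (N - m)" by (simp add: k_def algebra_simps)
      finally show ?thesis using k by (simp add: field_simps)
    qed
    show ?thesis unfolding q0 ps NS using p k Nm by (simp add: divide_simps)
  qed
  define D where "D = N * p - m * (N * (p - 2) + p)"
  have Dm: "m * N < D" using md by (simp add: D_def d_def algebra_simps)
  have mN: "m * N > 0" using m p by simp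
  have D: "D > 0" using Dm mN by simp
  have qD: "q = p * m * N / D" by (simp add: q D_def)
  have "p * (m * N) < p * D" using Dm p by (intro mult_strict_left_mono) auto
  then show "q < p" unfolding qD using D by (simp add: pos_divide_less_eq mult_ac)
  show "1 \<le> q"
  proof -
    have "m * (N * (p - 2) + p) \<ge> 0" using m p by (intro mult_nonneg_nonneg add_nonneg_nonneg) auto
    then have "D \<le> N * p * 1" by (simp add: D_def)
    also have "\<dots> \<le> N * p * m" using p m by (intro mult_left_mono) auto
    finally show ?thesis unfolding qD using D by (simp add: pos_le_divide_eq mult_ac)
  qed
  show "q \<le> q0"
  \<comment> \<open>The inequality q <= q0 amounts to (p - 2) (p N - m d) >= 0. For p = 2 it is an
    equality, and then no integrability is left to spare.\<close>
  proof -
    have "(p - 2) * (p * N - m * d) \<ge> 0" using md p by simp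
    then have "p * (N - m) \<le> (p - 1) * D" by (simp add: D_def d_def algebra_simps)
    then have "(m * N) * (p * (N - m)) \<le> (m * N) * ((p - 1) * D)" using mN by (intro mult_left_mono) auto
    then show ?thesis unfolding qD q0' using D Nm by (simp add: divide_simps mult_ac)
  qed
  show "p - 1 < q0"
  proof -
    have "(N - m) < m * N"
    proof -
      have "1 * N \<le> m * N" using m p by (intro mult_right_mono) auto
      then show ?thesis using m by simp
    qed
    then have "(p - 1) * (N - m) < (p - 1) * (m * N)" using p by (intro mult_strict_left_mono) auto
    then show ?thesis unfolding q0' using Nm by (simp add: pos_less_divide_eq mult_ac)
  qed
  show "q0 \<le> N * (p - 1 + s) / (N - p)"
    unfolding q0 using p s0 by (intro divide_left_mono) auto
qed

section \<open>Truncation and odd powers\<close>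

definition trunc :: "real \<Rightarrow> real \<Rightarrow> real" where
  "trunc c t = max (- c) (min c t)"

lemma abs_trunc_le: "c \<ge> 0 \<Longrightarrow> \<bar>trunc c t\<bar> \<le> c" "c \<ge> 0 \<Longrightarrow> \<bar>trunc c t\<bar> \<le> \<bar>t\<bar>"
  by (auto simp: trunc_def max_def min_def)

lemma mono_trunc: "mono (trunc c)"
  unfolding trunc_def by (intro monoI max.mono min.mono order_refl)

lemma continuous_on_trunc [continuous_intros]: "continuous_on S (trunc c)"
  unfolding trunc_def by (intro continuous_intros)

lemma borel_measurable_trunc [measurable]: "trunc c \<in> borel_measurable borel"
  by (rule borel_measurable_continuous_onI[OF continuous_on_trunc])

lemma tendsto_trunc:
  assumes c: "filterlim c at_top sequentially" and a: "a \<longlonglongrightarrow> (t::real)"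
  shows "(\<lambda>n. trunc (c n) (a n)) \<longlonglongrightarrow> t"
proof (rule Lim_transform_eventually[OF a])
  have "eventually (\<lambda>n. \<bar>a n\<bar> < \<bar>t\<bar> + 1) sequentially"
    using tendsto_rabs[OF a] by (rule order_tendstoD) simp
  moreover have "eventually (\<lambda>n. c n \<ge> \<bar>t\<bar> + 1) sequentially" using c by (simp add: filterlim_at_top)
  ultimately show "eventually (\<lambda>n. a n = trunc (c n) (a n)) sequentially"
    by eventually_elim (auto simp: trunc_def max_def min_def)
qed

text \<open>For a = p - 1 this is the nonlinearity |t|^(p-2) t, see \<open>signed_power_eq\<close>.
  Written with \<open>sgn\<close>, it is visibly monotone and continuous also at 0, and its absolute
  value is a plain power.\<close>

definition signed_power :: "real \<Rightarrow> real \<Rightarrow> real" where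
  "signed_power a t = \<bar>t\<bar> powr a * sgn t"

lemma abs_signed_power: "\<bar>signed_power a t\<bar> = \<bar>t\<bar> powr a"
  by (simp add: signed_power_def abs_mult abs_sgn_eq)

lemma signed_power_eq: "signed_power (p - 1) t = \<bar>t\<bar> powr (p - 2) * t"
proof (cases "t = 0")
  case False
  then have "\<bar>t\<bar> * \<bar>t\<bar> powr (p - 2) = \<bar>t\<bar> powr (p - 1)" using powr_mult_base[of "\<bar>t\<bar>" "p - 2"] by simp
  moreover have "t = \<bar>t\<bar> * sgn t" by (simp add: abs_mult_sgn)
  ultimately show ?thesis unfolding signed_power_def by (metis mult.assoc mult.commute)
qed (simp add: signed_power_def)

lemma continuous_on_signed_power: "a > 0 \<Longrightarrow> continuous_on S (signed_power a)"
  unfolding signed_power_def by (rule continuous_on_sgn_powr)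

lemma borel_measurable_signed_power [measurable]: "signed_power a \<in> borel_measurable borel"
  unfolding signed_power_def by measurable

lemma mono_signed_power:
  assumes "a \<ge> 0"
  shows "mono (signed_power a)"
proof (rule monoI)
  fix x y :: real assume xy: "x \<le> y"
  consider "0 \<le> x" | "x < 0" "0 \<le> y" | "y < 0" by linarith
  then show "signed_power a x \<le> signed_power a y"
  proof cases
    case 1
    then have "x powr a \<le> y powr a" using xy assms by (intro powr_mono2) auto
    then show ?thesis using 1 xy by (auto simp: signed_power_def sgn_if)
  next
    case 2
    then have "signed_power a x \<le> 0" "0 \<le> signed_power a y" by (auto simp: signed_power_def sgn_if)
    then show ?thesis by simp
  next
    case 3
    have "(- y) powr a \<le> (- x) powr a" using 3 xy assms by (intro powr_mono2) auto
    then show ?thesis using 3 xy by (auto simp: signed_power_def sgn_if)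
  qed
qed

lemma powr_integral_lower_exponent_le:
  fixes g :: "'x \<Rightarrow> 'b::euclidean_space"
  assumes "g \<in> borel_measurable m" "0 < b" "b \<le> a" "powr_integral m a g \<le> ennreal C" "C \<ge> 0"
    and "finite_measure m"
  shows "powr_integral m b g \<le> ennreal (measure m (space m) + C)"
proof -
  interpret finite_measure m by fact
  have "powr_integral m b g \<le> ennreal (1 powr b) * emeasure m (space m) + ennreal (1 powr (b - a)) * powr_integral m a g"
    using assms by (intro powr_integral_le_lower_exponent) auto
  also have "\<dots> \<le> ennreal (measure m (space m)) + ennreal C"
    using assms(4) by (simp add: emeasure_eq_measure add_left_mono)
  also have "\<dots> = ennreal (measure m (space m) + C)" using assms(5) by simp
  finally show ?thesis .
qed

lemma abs_arctan_le_abs: "\<bar>arctan x\<bar> \<le> \<bar>x\<bar>"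
proof -
  have pos: "arctan y \<le> y" if "y > 0" for y
  proof -
    have "\<exists>z>0. z < y \<and> arctan y - arctan 0 = (y - 0) * inverse (1 + z\<^sup>2)"
      by (rule MVT2[OF that]) (rule DERIV_arctan)
    then obtain z where "arctan y = y * inverse (1 + z\<^sup>2)" by auto
    also have "\<dots> \<le> y * 1" using bracket_ge_1[of z] that by (intro mult_left_mono) (auto simp: inverse_le_1_iff)
    finally show ?thesis by simp
  qed
  show ?thesis using pos[of x] pos[of "- x"] by (cases "x = 0") (auto simp: arctan_minus abs_if)
qed

section \<open>Compactness of approximate solutions and limits of the single terms\<close>

context bounded_open
begin

text \<open>Compactness in exponent 1 asks only for L^1 bounds of the gradients, so it is available
  although no bound in L^p exists. The Cauchy property of the functions passes to the gradients by
  \<open>gradient_cauchy\<close>. The convergence takes place in exponent 1, which suffices for the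
  weak gradient of the limit.\<close>

lemma solutions_compact:
  fixes u g :: "nat \<Rightarrow> 'a \<Rightarrow> real"
  assumes p: "p \<ge> 2" and w: "\<And>n. weak0 p (u n) (U n)"
    and eq: "\<And>n v V. weak0 p v V \<Longrightarrow> (LINT x|M. pflux p (U n x) \<bullet> V x) = (LINT x|M. g n x * v x)"
    and g: "\<And>n. integrable M (g n)" "\<And>n. (LINT x|M. \<bar>g n x\<bar>) \<le> G"
    and q: "q > 1" "\<And>n. powr_integral M q (U n) \<le> ennreal C" "\<And>n. powr_integral M q (u n) \<le> ennreal C" "C \<ge> 0"
  obtains \<rho> v V where "strict_mono (\<rho>::nat \<Rightarrow> nat)" "weak0 1 v V"
    "AE x in M. (\<lambda>n. u (\<rho> n) x) \<longlonglongrightarrow> v x" "AE x in M. (\<lambda>n. U (\<rho> n) x) \<longlonglongrightarrow> V x"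
proof -
  note [measurable] = weak0_measurable[OF w]
  have w1: "weak0 1 (u n) (U n)" for n by (rule weak0_lower_exponent[OF w]) (use p in auto)
  define c where "c = measure M (space M) + C + 1"
  have c: "measure M (space M) + C \<le> c" "c > 0" using q(4) measure_nonneg[of M "space M"] unfolding c_def by linarith+
  have bu: "powr_integral M 1 (u n) \<le> ennreal c" for n
    by (rule order_trans[OF powr_integral_lower_exponent_le[OF weak0_measurable(1)[OF w] _ _ q(3,4)] ennreal_leI[OF c(1)]])
       (use q finite_measure_axioms in auto)
  have bU: "powr_integral M 1 (U n) \<le> ennreal c" for n
    by (rule order_trans[OF powr_integral_lower_exponent_le[OF weak0_measurable(2)[OF w] _ _ q(2,4)] ennreal_leI[OF c(1)]])
       (use q finite_measure_axioms in auto)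
  obtain r where r: "strict_mono (r::nat \<Rightarrow> nat)"
    and cu: "\<And>e. e > 0 \<Longrightarrow> \<exists>n0. \<forall>i\<ge>n0. \<forall>j\<ge>n0. powr_integral M 1 (\<lambda>x. u (r i) x - u (r j) x) \<le> ennreal e"
    by (rule rellich_weak0[where u=u and U=U, OF w1 bu bU c(2)]) (rule that)
  have cU: "\<exists>n0. \<forall>i\<ge>n0. \<forall>j\<ge>n0. powr_integral M 1 (\<lambda>x. U (r i) x - U (r j) x) \<le> ennreal e" if "e > 0" for e
    by (rule gradient_cauchy[where u="\<lambda>n. u (r n)" and U="\<lambda>n. U (r n)" and g="\<lambda>n. g (r n)", OF p w eq g q(1,2) cu that])
  obtain v s where v: "v \<in> borel_measurable M" "(\<lambda>n. powr_integral M 1 (\<lambda>x. u (r n) x - v x)) \<longlonglongrightarrow> 0"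
    by (rule powr_integral_complete[where F="\<lambda>n. u (r n)", OF finite_measure_axioms weak0_integrable(1)[OF w1] order_refl cu])
  obtain V s where V: "V \<in> borel_measurable M" "strict_mono (s::nat \<Rightarrow> nat)" "AE x in M. (\<lambda>n. U (r (s n)) x) \<longlonglongrightarrow> V x"
      "(\<lambda>n. powr_integral M 1 (\<lambda>x. U (r n) x - V x)) \<longlonglongrightarrow> 0"
    by (rule powr_integral_complete[where F="\<lambda>n. U (r n)", OF finite_measure_axioms weak0_integrable(2)[OF w1] order_refl cU])
  note [measurable] = v(1) V(1)
  have "(\<lambda>n. powr_integral M 1 (\<lambda>x. u (r (s n)) x - v x)) \<longlonglongrightarrow> 0"
    using LIMSEQ_subseq_LIMSEQ[OF v(2) V(2)] by (simp add: o_def)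
  then obtain t where t: "strict_mono (t::nat \<Rightarrow> nat)" "AE x in M. (\<lambda>n. u (r (s (t n))) x - v x) \<longlonglongrightarrow> 0"
    by (rule powr_integral_AE_subseq[rotated 2]) auto
  show ?thesis
  proof (rule that[of "\<lambda>n. r (s (t n))" v V])
    show "strict_mono (\<lambda>n. r (s (t n)))" using strict_mono_o[OF r strict_mono_o[OF V(2) t(1)]] by (simp add: o_def)
    show "weak0 1 v V" by (rule weak0_closed[OF _ w1 v(1) V(1) v(2) V(4)]) simp
    show "AE x in M. (\<lambda>n. u (r (s (t n))) x) \<longlonglongrightarrow> v x" using t(2) by eventually_elim (rule LIM_zero_cancel)
    show "AE x in M. (\<lambda>n. U (r (s (t n))) x) \<longlonglongrightarrow> V x"
      using V(3)
    proof eventually_elim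
      case (elim x)
      then show ?case using LIMSEQ_subseq_LIMSEQ[OF elim t(1)] by (simp add: o_def)
    qed
  qed
qed

text \<open>For fixed k the truncated functions are bounded in exponent p together with their
  gradients, uniformly in n. Hence there is room between q and p for Vitali's theorem, even when the
  bound for \<open>U n\<close> itself leaves none.\<close>

lemma arctan_truncation_limit:
  assumes p: "q < p" "1 \<le> q" and b: "-1 \<le> b" and w: "\<And>n. weak0 p (u n) (U n)"
    and C: "\<And>n. powr_integral M p (\<lambda>x. (1 + (u n x)\<^sup>2) powr b *\<^sub>R U n x) \<le> ennreal C" "C \<ge> 0"
    and m: "v \<in> borel_measurable M" "V \<in> borel_measurable M"
    and lim: "AE x in M. (\<lambda>n. u n x) \<longlonglongrightarrow> v x" "AE x in M. (\<lambda>n. U n x) \<longlonglongrightarrow> V x"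
    and k: "k \<ge> 1"
  shows "weak0 q (\<lambda>x. k * arctan (v x / k)) (\<lambda>x. (1 / (1 + (v x / k)\<^sup>2)) *\<^sub>R V x)"
proof -
  note [measurable] = weak0_measurable[OF w] m
  have wk: "weak0 q (\<lambda>x. k * arctan (u n x / k)) (\<lambda>x. (1 / (1 + (u n x / k)\<^sup>2)) *\<^sub>R U n x)" for n
    by (rule weak0_lower_exponent[OF weak0_arctan[OF w]]) (use p k in auto)
  \<comment> \<open>The derivative of the truncation decays like t^(-2), and b >= -1 means that the
    weight of the energy estimate decays no faster. The factor k^2 is immaterial since k stays
    fixed.\<close>
  have k2: "1 / (1 + (t / k)\<^sup>2) \<le> k\<^sup>2 * (1 + t\<^sup>2) powr b" for t
  proof -
    have "1 + t\<^sup>2 \<le> k\<^sup>2 + t\<^sup>2" using k by simp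
    also have "\<dots> = k\<^sup>2 * (1 + (t / k)\<^sup>2)" using k by (simp add: power_divide field_simps)
    finally have "1 / (1 + (t / k)\<^sup>2) \<le> k\<^sup>2 * (1 / (1 + t\<^sup>2))"
      using bracket_ge_1[of t] bracket_ge_1[of "t / k"] by (simp add: divide_simps)
    also have "1 / (1 + t\<^sup>2) = (1 + t\<^sup>2) powr (-1)" using bracket_ge_1[of t] by (simp add: powr_minus_divide)
    also have "\<dots> \<le> (1 + t\<^sup>2) powr b" using bracket_ge_1[of t] b by (intro powr_mono) auto
    finally show ?thesis by (simp add: mult_left_mono)
  qed
  have b1: "powr_integral M p (\<lambda>x. k * arctan (u n x / k)) \<le> ennreal ((k * (pi / 2)) powr p * measure M (space M))" for n
  proof -
    have "powr_integral M p (\<lambda>x. k * arctan (u n x / k)) \<le> powr_integral M p (\<lambda>x. k * (pi / 2))"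
      using p k abs_arctan_le by (intro powr_integral_mono) (auto simp: abs_mult)
    also have "\<dots> = ennreal ((k * (pi / 2)) powr p * measure M (space M))"
      using k by (simp add: powr_integral_def emeasure_eq_measure ennreal_mult)
    finally show ?thesis .
  qed
  have b2: "powr_integral M p (\<lambda>x. (1 / (1 + (u n x / k)\<^sup>2)) *\<^sub>R U n x) \<le> ennreal ((k\<^sup>2) powr p * C)" for n
  proof -
    have "powr_integral M p (\<lambda>x. (1 / (1 + (u n x / k)\<^sup>2)) *\<^sub>R U n x) \<le> powr_integral M p (\<lambda>x. k\<^sup>2 *\<^sub>R ((1 + (u n x)\<^sup>2) powr b *\<^sub>R U n x))"
    proof (rule powr_integral_mono)
      fix x
      have "\<bar>1 / (1 + (u n x / k)\<^sup>2)\<bar> = 1 / (1 + (u n x / k)\<^sup>2)" using bracket_ge_1[of "u n x / k"] by simp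
      then show "norm ((1 / (1 + (u n x / k)\<^sup>2)) *\<^sub>R U n x) \<le> norm (k\<^sup>2 *\<^sub>R ((1 + (u n x)\<^sup>2) powr b *\<^sub>R U n x))"
        using mult_right_mono[OF k2[of "u n x"] norm_ge_zero[of "U n x"]] by (simp add: mult.assoc)
    qed (use p in simp)
    also have "\<dots> = ennreal ((k\<^sup>2) powr p) * powr_integral M p (\<lambda>x. (1 + (u n x)\<^sup>2) powr b *\<^sub>R U n x)"
      by (subst powr_integral_scaleR) auto
    also have "\<dots> \<le> ennreal ((k\<^sup>2) powr p) * ennreal C" by (intro mult_left_mono C) auto
    also have "\<dots> = ennreal ((k\<^sup>2) powr p * C)" using C by (simp add: ennreal_mult)
    finally show ?thesis .
  qed
  have nz: "1 + t\<^sup>2 \<noteq> 0" for t :: real using bracket_ge_1[of t] by linarith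
  show ?thesis
  proof (rule weak0_closed[OF _ wk])
    show "(\<lambda>n. powr_integral M q (\<lambda>x. k * arctan (u n x / k) - k * arctan (v x / k))) \<longlonglongrightarrow> 0"
    proof (rule powr_integral_vitali[OF finite_measure_axioms _ _ _ p(1) _ b1])
      show "AE x in M. (\<lambda>n. k * arctan (u n x / k)) \<longlonglongrightarrow> k * arctan (v x / k)"
        using lim(1)
      proof eventually_elim
        case (elim x)
        show ?case using k by (intro tendsto_intros elim) auto
      qed
    qed (use p in auto)
    show "(\<lambda>n. powr_integral M q (\<lambda>x. (1 / (1 + (u n x / k)\<^sup>2)) *\<^sub>R U n x - (1 / (1 + (v x / k)\<^sup>2)) *\<^sub>R V x)) \<longlonglongrightarrow> 0"
    proof (rule powr_integral_vitali[OF finite_measure_axioms _ _ _ p(1) _ b2])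
      show "AE x in M. (\<lambda>n. (1 / (1 + (u n x / k)\<^sup>2)) *\<^sub>R U n x) \<longlonglongrightarrow> (1 / (1 + (v x / k)\<^sup>2)) *\<^sub>R V x"
        using lim
      proof eventually_elim
        case (elim x)
        show ?case using k nz by (intro tendsto_intros elim) auto
      qed
    qed (use p in auto)
  qed (use p in auto)
qed

text \<open>As k runs to infinity, the truncations are dominated by |v| and their gradients by |V|.
  Finite integrals of the q-th powers are therefore enough, and these come from Fatou's
  lemma.\<close>

lemma weak0_of_arctan_truncations:
  assumes q: "1 \<le> q" and m: "v \<in> borel_measurable M" "V \<in> borel_measurable M"
    and w: "\<And>k. k \<ge> 1 \<Longrightarrow> weak0 q (\<lambda>x. k * arctan (v x / k)) (\<lambda>x. (1 / (1 + (v x / k)\<^sup>2)) *\<^sub>R V x)"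
    and fin: "powr_integral M q v < \<infinity>" "powr_integral M q V < \<infinity>"
  shows "weak0 q v V"
proof -
  note [measurable] = m
  let ?k = "\<lambda>j. real (Suc j)"
  have k: "(\<lambda>j. t / ?k j) \<longlonglongrightarrow> 0" for t using tendsto_mult[OF tendsto_const[of t] LIMSEQ_inverse_real_of_nat] by (simp add: divide_inverse)
  show ?thesis
  proof (rule weak0_closed[OF _ w m])
    show "(\<lambda>j. powr_integral M q (\<lambda>x. ?k j * arctan (v x / ?k j) - v x)) \<longlonglongrightarrow> 0"
    proof (rule powr_integral_tendsto_dominated[OF _ m(1) _ _ _ fin(1)])
      show "norm (?k j * arctan (v x / ?k j)) \<le> norm (v x)" for j x
        using mult_left_mono[OF abs_arctan_le_abs[of "v x / ?k j"], of "?k j"] by (simp add: abs_mult del: of_nat_Suc)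
      have "(\<lambda>j. ?k j * arctan (t / ?k j)) \<longlonglongrightarrow> t" for t
      proof (cases "t = 0")
        case False
        \<comment> \<open>The quotient arctan h / h tends to 1 because the derivative of
          \<open>arctan\<close> at 0 is 1.\<close>
        have d: "((\<lambda>h. arctan h / h) \<longlongrightarrow> 1) (at 0)"
          using DERIV_arctan[of 0] unfolding DERIV_def by simp
        have "filterlim (\<lambda>j. t / ?k j) (at 0) sequentially"
          using k False by (simp add: filterlim_at)
        from filterlim_compose[OF d this] have "(\<lambda>j. t * (arctan (t / ?k j) / (t / ?k j))) \<longlonglongrightarrow> t * 1"
          by (intro tendsto_intros)
        then show ?thesis using False by (simp add: mult.commute del: of_nat_Suc)
      qed simp
      then show "AE x in M. (\<lambda>j. ?k j * arctan (v x / ?k j)) \<longlonglongrightarrow> v x" by simp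
    qed (use q in auto)
    show "(\<lambda>j. powr_integral M q (\<lambda>x. (1 / (1 + (v x / ?k j)\<^sup>2)) *\<^sub>R V x - V x)) \<longlonglongrightarrow> 0"
    proof (rule powr_integral_tendsto_dominated[OF _ m(2) _ _ _ fin(2)])
      show "norm ((1 / (1 + (v x / ?k j)\<^sup>2)) *\<^sub>R V x) \<le> norm (V x)" for j x
      proof -
        have "\<bar>1 / (1 + (v x / ?k j)\<^sup>2)\<bar> \<le> 1" using bracket_ge_1[of "v x / ?k j"] by (simp add: divide_simps)
        from mult_right_mono[OF this norm_ge_zero[of "V x"]] show ?thesis by simp
      qed
      have "(\<lambda>j. (1 / (1 + (v x / ?k j)\<^sup>2)) *\<^sub>R V x) \<longlonglongrightarrow> (1 / (1 + 0\<^sup>2)) *\<^sub>R V x" for x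
        by (intro tendsto_intros k) simp
      then show "AE x in M. (\<lambda>j. (1 / (1 + (v x / ?k j)\<^sup>2)) *\<^sub>R V x) \<longlonglongrightarrow> V x" by simp
    qed (use q in auto)
  qed (use q in auto)
qed

text \<open>The flux is of order p - 1 in the gradient, so a bound in an exponent a > p - 1 bounds
  it in exponent a / (p - 1) > 1. Almost everywhere convergence then suffices.\<close>

lemma flux_limit:
  fixes U :: "nat \<Rightarrow> 'a \<Rightarrow> 'a"
  assumes p: "p \<ge> 2" and a: "p - 1 < a" and m: "\<And>n. U n \<in> borel_measurable M" "V \<in> borel_measurable M"
    and lim: "AE x in M. (\<lambda>n. U n x) \<longlonglongrightarrow> V x" and C: "\<And>n. powr_integral M a (U n) \<le> ennreal C"
    and \<Phi>: "\<Phi> \<in> borel_measurable M" "\<And>x. norm (\<Phi> x) \<le> B"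
  shows "(\<lambda>n. LINT x|M. pflux p (U n x) \<bullet> \<Phi> x) \<longlonglongrightarrow> (LINT x|M. pflux p (V x) \<bullet> \<Phi> x)"
    and "integrable M (\<lambda>x. norm (V x) powr (p - 1))"
proof -
  note [measurable] = m \<Phi>(1)
  have [measurable]: "pflux p \<in> borel_measurable (borel::'a measure)" by (rule pflux_borel[OF p])
  have a1: "a / (p - 1) > 1" using p a by simp
  have B: "B \<ge> 0" using order_trans[OF norm_ge_zero \<Phi>(2)] .
  have C0: "powr_integral M (a / (p - 1)) (\<lambda>x. norm (U n x) powr (p - 1)) \<le> ennreal C" for n
    using C[of n] p by (simp add: powr_integral_def powr_powr)
  show "(\<lambda>n. LINT x|M. pflux p (U n x) \<bullet> \<Phi> x) \<longlonglongrightarrow> (LINT x|M. pflux p (V x) \<bullet> \<Phi> x)"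
  proof (rule integral_vitali(2)[OF finite_measure_axioms _ _ a1])
    show "AE x in M. (\<lambda>n. pflux p (U n x) \<bullet> \<Phi> x) \<longlonglongrightarrow> pflux p (V x) \<bullet> \<Phi> x"
      using lim
    proof eventually_elim
      case (elim x)
      show ?case by (intro tendsto_intros pflux_tendsto[OF p] elim)
    qed
    show "powr_integral M (a / (p - 1)) (\<lambda>x. pflux p (U n x) \<bullet> \<Phi> x) \<le> ennreal (B powr (a / (p - 1)) * max C 0)" for n
    proof -
      have "powr_integral M (a / (p - 1)) (\<lambda>x. pflux p (U n x) \<bullet> \<Phi> x) \<le> powr_integral M (a / (p - 1)) (\<lambda>x. B *\<^sub>R (norm (U n x) powr (p - 1)))"
      proof (rule powr_integral_mono)
        fix x
        have "\<bar>pflux p (U n x) \<bullet> \<Phi> x\<bar> \<le> norm (pflux p (U n x)) * norm (\<Phi> x)" by (rule Cauchy_Schwarz_ineq2)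
        also have "\<dots> \<le> norm (U n x) powr (p - 1) * B" unfolding norm_pflux by (intro mult_left_mono \<Phi>) auto
        finally show "norm (pflux p (U n x) \<bullet> \<Phi> x) \<le> norm (B *\<^sub>R (norm (U n x) powr (p - 1)))"
          using B by (simp add: abs_mult mult.commute)
      qed (use a1 in simp)
      also have "\<dots> = ennreal (B powr (a / (p - 1))) * powr_integral M (a / (p - 1)) (\<lambda>x. norm (U n x) powr (p - 1))"
        using B by (simp add: powr_integral_scaleR del: real_scaleR_def)
      also have "\<dots> \<le> ennreal (B powr (a / (p - 1))) * ennreal (max C 0)"
        by (intro mult_left_mono order_trans[OF C0] ennreal_leI) auto
      finally show ?thesis by (simp add: ennreal_mult)
    qed
  qed measurable
  show "integrable M (\<lambda>x. norm (V x) powr (p - 1))"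
  proof (rule integral_vitali(1)[OF finite_measure_axioms _ _ a1 _ C0])
    show "AE x in M. (\<lambda>n. norm (U n x) powr (p - 1)) \<longlonglongrightarrow> norm (V x) powr (p - 1)"
      using lim
    proof eventually_elim
      case (elim x)
      show ?case using p by (intro tendsto_powr' tendsto_norm elim tendsto_const) auto
    qed
  qed auto
qed

text \<open>Equi-integrability is used with respect to the finite measure \<open>|x|\<^bsup>-p\<^esup> dx\<close>.\<close>

lemma potential_limit:
  fixes u :: "nat \<Rightarrow> 'a \<Rightarrow> real"
  assumes p: "2 \<le> p" "p < real DIM('a)" and \<sigma>: "p - 1 < \<sigma>" and l: "lam > 0"
    and m: "\<And>n. u n \<in> borel_measurable M" "v \<in> borel_measurable M"
    and lim: "AE x in M. (\<lambda>n. u n x) \<longlonglongrightarrow> v x"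
    and C: "\<And>n. (\<integral>\<^sup>+x. ennreal (\<bar>u n x\<bar> powr \<sigma> / norm x powr p) \<partial>M) \<le> ennreal C"
    and \<Phi>: "\<Phi> \<in> borel_measurable M" "\<And>x. \<bar>\<Phi> x\<bar> \<le> B"
    and c: "filterlim c at_top sequentially" "\<And>n. c n \<ge> 0"
  shows "(\<lambda>n. LINT x|M. min (lam / norm x powr p) (c n) * signed_power (p - 1) (trunc (c n) (u n x)) * \<Phi> x)
      \<longlonglongrightarrow> (LINT x|M. lam / norm x powr p * \<bar>v x\<bar> powr (p - 2) * v x * \<Phi> x)"
    and "integrable M (\<lambda>x. \<bar>v x\<bar> powr (p - 1) / norm x powr p)"
proof -
  note [measurable] = m \<Phi>(1)
  define w where "w x = 1 / norm x powr p" for x :: 'a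
  have [measurable]: "w \<in> borel_measurable M" unfolding w_def by measurable
  have w0: "w x \<ge> 0" for x by (simp add: w_def)
  define \<mu> where "\<mu> = density M (\<lambda>x. ennreal (w x))"
  have [measurable_cong]: "sets \<mu> = sets M" by (simp add: \<mu>_def)
  have iw: "integrable M w" unfolding w_def by (rule hardy_potential_integrable) (use p in auto)
  have fin: "finite_measure \<mu>"
  proof (rule finite_measureI)
    have "emeasure \<mu> (space \<mu>) = (\<integral>\<^sup>+x. ennreal (w x) \<partial>M)"
      unfolding \<mu>_def by (subst emeasure_density) (auto intro!: nn_integral_cong)
    also have "\<dots> = ennreal (LINT x|M. w x)" using w0 by (intro nn_integral_eq_integral iw) auto
    finally show "emeasure \<mu> (space \<mu>) \<noteq> \<infinity>" by simp
  qed
  have AE\<mu>: "AE x in \<mu>. P x" if "AE x in M. P x" for P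
    unfolding \<mu>_def by (subst AE_density) (use that in \<open>auto elim: eventually_mono\<close>)
  have a: "\<sigma> / (p - 1) > 1" using p \<sigma> by simp
  have C0: "powr_integral \<mu> (\<sigma> / (p - 1)) (\<lambda>x. \<bar>u n x\<bar> powr (p - 1)) \<le> ennreal C" for n
  proof -
    have "powr_integral \<mu> (\<sigma> / (p - 1)) (\<lambda>x. \<bar>u n x\<bar> powr (p - 1)) = (\<integral>\<^sup>+x. ennreal (w x) * ennreal (\<bar>u n x\<bar> powr \<sigma>) \<partial>M)"
      unfolding powr_integral_def \<mu>_def using p by (subst nn_integral_density) (simp_all add: powr_powr)
    also have "\<dots> = (\<integral>\<^sup>+x. ennreal (\<bar>u n x\<bar> powr \<sigma> / norm x powr p) \<partial>M)"
      by (intro nn_integral_cong) (simp add: ennreal_mult[symmetric] w_def)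
    finally show ?thesis using C[of n] by simp
  qed
  have "integrable \<mu> (\<lambda>x. \<bar>v x\<bar> powr (p - 1))"
  proof (rule integral_vitali(1)[OF fin _ _ a _ C0])
    show "AE x in \<mu>. (\<lambda>n. \<bar>u n x\<bar> powr (p - 1)) \<longlonglongrightarrow> \<bar>v x\<bar> powr (p - 1)"
    proof (rule AE\<mu>, use lim in eventually_elim)
      case (elim x)
      show ?case using p by (intro tendsto_powr' tendsto_rabs elim tendsto_const) auto
    qed
  qed measurable
  then have "integrable M (\<lambda>x. w x * \<bar>v x\<bar> powr (p - 1))"
    unfolding \<mu>_def using w0 by (subst (asm) integrable_real_density) auto
  then show "integrable M (\<lambda>x. \<bar>v x\<bar> powr (p - 1) / norm x powr p)" by (simp add: w_def)
  \<comment> \<open>The density 1 / |x|^p has been divided out of the truncated potential: it turns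
    min lam (c |x|^p) back into min (lam / |x|^p) c. At the origin both expressions are 0 because
    division by zero gives 0 and c >= 0.\<close>
  define F where "F n x = min lam (c n * norm x powr p) * signed_power (p - 1) (trunc (c n) (u n x)) * \<Phi> x" for n x
  define G where "G x = lam * signed_power (p - 1) (v x) * \<Phi> x" for x
  have [measurable]: "F n \<in> borel_measurable M" for n unfolding F_def by measurable
  have [measurable]: "G \<in> borel_measurable M" unfolding G_def by measurable
  have B: "B \<ge> 0" using order_trans[OF abs_ge_zero \<Phi>(2)] .
  have "(\<lambda>n. LINT x|\<mu>. F n x) \<longlonglongrightarrow> (LINT x|\<mu>. G x)"
  proof (rule integral_vitali(2)[OF fin _ _ a])
    show "AE x in \<mu>. (\<lambda>n. F n x) \<longlonglongrightarrow> G x"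
    proof (rule AE\<mu>, use lim AE_neq_0 in eventually_elim)
      case (elim x)
      have "eventually (\<lambda>n. c n \<ge> lam / norm x powr p) sequentially" using c(1) by (simp add: filterlim_at_top)
      then have "eventually (\<lambda>n. lam = min lam (c n * norm x powr p)) sequentially"
        by eventually_elim (use elim(2) in \<open>simp add: pos_divide_le_eq\<close>)
      then have 1: "(\<lambda>n. min lam (c n * norm x powr p)) \<longlonglongrightarrow> lam" by (rule Lim_transform_eventually[OF tendsto_const])
      have "isCont (signed_power (p - 1)) (v x)"
        using continuous_on_signed_power[of "p - 1" UNIV] p by (simp add: continuous_on_eq_continuous_at)
      then have 2: "(\<lambda>n. signed_power (p - 1) (trunc (c n) (u n x))) \<longlonglongrightarrow> signed_power (p - 1) (v x)"
        by (rule isCont_tendsto_compose) (rule tendsto_trunc[OF c(1) elim(1)])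
      show ?case unfolding F_def G_def by (intro tendsto_intros 1 2)
    qed
    show "powr_integral \<mu> (\<sigma> / (p - 1)) (F n) \<le> ennreal ((lam * B) powr (\<sigma> / (p - 1)) * max C 0)" for n
    proof -
      have "powr_integral \<mu> (\<sigma> / (p - 1)) (F n) \<le> powr_integral \<mu> (\<sigma> / (p - 1)) (\<lambda>x. (lam * B) *\<^sub>R (\<bar>u n x\<bar> powr (p - 1)))"
      proof (rule powr_integral_mono)
        fix x :: 'a
        have "0 \<le> c n * norm x powr p" using c(2) by simp
        then have ml: "\<bar>min lam (c n * norm x powr p)\<bar> \<le> lam" using l by (simp add: abs_le_iff)
        have "\<bar>trunc (c n) (u n x)\<bar> powr (p - 1) \<le> \<bar>u n x\<bar> powr (p - 1)"
          using abs_trunc_le(2)[OF c(2)] p by (intro powr_mono2) auto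
        then have "\<bar>min lam (c n * norm x powr p)\<bar> * \<bar>trunc (c n) (u n x)\<bar> powr (p - 1) * \<bar>\<Phi> x\<bar> \<le> lam * \<bar>u n x\<bar> powr (p - 1) * B"
          using l ml by (intro mult_mono \<Phi>) auto
        then show "norm (F n x) \<le> norm ((lam * B) *\<^sub>R (\<bar>u n x\<bar> powr (p - 1)))"
          using B l by (simp add: F_def abs_mult abs_signed_power mult_ac)
      qed (use a in simp)
      also have "\<dots> = ennreal ((lam * B) powr (\<sigma> / (p - 1))) * powr_integral \<mu> (\<sigma> / (p - 1)) (\<lambda>x. \<bar>u n x\<bar> powr (p - 1))"
        using B l by (subst powr_integral_scaleR) (auto simp: abs_mult)
      also have "\<dots> \<le> ennreal ((lam * B) powr (\<sigma> / (p - 1))) * ennreal (max C 0)"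
        by (intro mult_left_mono order_trans[OF C0] ennreal_leI) auto
      finally show ?thesis by (simp add: ennreal_mult)
    qed
  qed measurable
  moreover have "(LINT x|\<mu>. F n x) = (LINT x|M. min (lam / norm x powr p) (c n) * signed_power (p - 1) (trunc (c n) (u n x)) * \<Phi> x)" for n
  proof -
    have "w x * min lam (c n * norm x powr p) = min (lam / norm x powr p) (c n)" for x
    proof (cases "x = 0")
      case False
      then show ?thesis by (simp add: w_def min_def field_simps)
    qed (use c(2)[of n] in \<open>simp add: w_def\<close>)
    then have "w x * F n x = min (lam / norm x powr p) (c n) * signed_power (p - 1) (trunc (c n) (u n x)) * \<Phi> x" for x
      unfolding F_def by (simp add: mult.assoc[symmetric])
    then show ?thesis unfolding \<mu>_def using w0 by (subst integral_real_density) auto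
  qed
  moreover have "(LINT x|\<mu>. G x) = (LINT x|M. lam / norm x powr p * \<bar>v x\<bar> powr (p - 2) * v x * \<Phi> x)"
  proof -
    have "w x * G x = lam / norm x powr p * \<bar>v x\<bar> powr (p - 2) * v x * \<Phi> x" for x
      unfolding G_def signed_power_eq by (simp add: w_def)
    then show ?thesis unfolding \<mu>_def using w0 by (subst integral_real_density) auto
  qed
  ultimately show "(\<lambda>n. LINT x|M. min (lam / norm x powr p) (c n) * signed_power (p - 1) (trunc (c n) (u n x)) * \<Phi> x)
      \<longlonglongrightarrow> (LINT x|M. lam / norm x powr p * \<bar>v x\<bar> powr (p - 2) * v x * \<Phi> x)" by simp
qed

lemma source_limit:
  fixes f :: "'a \<Rightarrow> real"
  assumes f: "integrable M f" and \<Phi>: "\<Phi> \<in> borel_measurable M" "\<And>x. \<bar>\<Phi> x\<bar> \<le> B"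
    and c: "filterlim c at_top sequentially" "\<And>n. c n \<ge> 0"
  shows "(\<lambda>n. LINT x|M. trunc (c n) (f x) * \<Phi> x) \<longlonglongrightarrow> (LINT x|M. f x * \<Phi> x)"
proof (rule integral_dominated_convergence)
  have [measurable]: "f \<in> borel_measurable M" "\<Phi> \<in> borel_measurable M" using f \<Phi>(1) by auto
  show "(\<lambda>x. f x * \<Phi> x) \<in> borel_measurable M" "\<And>n. (\<lambda>x. trunc (c n) (f x) * \<Phi> x) \<in> borel_measurable M" by measurable
  show "integrable M (\<lambda>x. \<bar>f x\<bar> * B)" using f by (intro integrable_mult_left integrable_abs)
  show "AE x in M. (\<lambda>n. trunc (c n) (f x) * \<Phi> x) \<longlonglongrightarrow> f x * \<Phi> x"
    by (intro AE_I2 tendsto_intros tendsto_trunc[OF c(1)])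
  show "AE x in M. norm (trunc (c n) (f x) * \<Phi> x) \<le> \<bar>f x\<bar> * B" for n
    unfolding real_norm_def abs_mult
    by (intro AE_I2 mult_mono \<Phi> abs_trunc_le(2)[OF c(2)]) auto
qed

text \<open>The truncations of the potential, of the nonlinearity and of f only decrease absolute
  values. The growth conditions of \<open>energy_estimate\<close> thus hold with the original data,
  and all constants are independent of n.\<close>

lemma truncated_problems:
  fixes N p m lam s :: real and f :: "'a \<Rightarrow> real"
  assumes N: "N = real DIM('a)" and p: "2 \<le> p" "p < N" and m: "1 < m" "m * p < N"
    and s: "s = (p - 1) * N * (m - 1) / (N - m * p)" "0 < s" "s < 1"
    and lam: "0 < lam" "lam < s * (N - p) powr p / (p - 1 + s) powr p"
    and f: "f \<in> borel_measurable M" "integrable M (\<lambda>x. \<bar>f x\<bar> powr m)"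
  obtains u U C where "C \<ge> 0" "\<And>n. weak0 p (u n) (U n)"
    "\<And>n. \<forall>v V. weak0 p v V \<longrightarrow> (LINT x|M. pflux p (U n x) \<bullet> V x) =
      (LINT x|M. (min (lam / norm x powr p) (real n) * signed_power (p - 1) (trunc (real n) (u n x)) + trunc (real n) (f x)) * v x)"
    "\<And>n. powr_integral M p (\<lambda>x. (1 + (u n x)\<^sup>2) powr ((s - 1) / (2 * p)) *\<^sub>R U n x) \<le> ennreal C"
    "\<And>n. powr_integral M (N * (p - 1 + s) / (N - p)) (u n) \<le> ennreal C"
    "\<And>n. (\<integral>\<^sup>+x. ennreal (\<bar>u n x\<bar> powr (p - 1 + s) / norm x powr p) \<partial>M) \<le> ennreal C"
    "\<And>n. powr_integral M (N * (p - 1 + s) / (N - 1 + s)) (U n) \<le> ennreal C"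
proof -
  note [measurable] = f(1)
  define W where "W n x = min (lam / norm x powr p) (real n)" for n and x :: 'a
  define h where "h n t = signed_power (p - 1) (trunc (real n) t)" for n t
  define F where "F n x = trunc (real n) (f x)" for n x
  have [measurable]: "W n \<in> borel_measurable M" "h n \<in> borel_measurable borel" "F n \<in> borel_measurable M" for n
    unfolding W_def h_def F_def by measurable
  have W: "0 \<le> W n x" "W n x \<le> real n" "W n x \<le> lam / norm x powr p" for n x
    using lam(1) by (auto simp: W_def)
  have h: "\<bar>h n t\<bar> \<le> real n powr (p - 1)" "\<bar>h n t\<bar> \<le> \<bar>t\<bar> powr (p - 1)" for n t
    unfolding h_def abs_signed_power using p by (intro powr_mono2 abs_trunc_le; simp)+
  have hc: "continuous_on UNIV (h n)" for n
    unfolding h_def by (rule continuous_on_compose2[OF continuous_on_signed_power continuous_on_trunc]) (use p in auto)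
  have hm: "mono (h n)" for n
    unfolding h_def by (intro monoI monoD[OF mono_signed_power] monoD[OF mono_trunc]) (use p in auto)
  have F: "\<bar>F n x\<bar> \<le> real n" "\<bar>F n x\<bar> \<le> \<bar>f x\<bar>" for n x
    unfolding F_def by (intro abs_trunc_le; simp)+
  define P where "P n u U \<longleftrightarrow> weak0 p u U \<and> (\<forall>v V. weak0 p v V \<longrightarrow> (LINT x|M. pflux p (U x) \<bullet> V x) = (LINT x|M. (W n x * h n (u x) + F n x) * v x))" for n u U
  have ex: "\<exists>u U. P n u U" for n
  proof -
    \<comment> \<open>The existence lemma takes a single bound for the nonlinearity, the potential
      and the source, so the larger of the two truncation bounds is used.\<close>
    define B where "B = max (real n) (real n powr (p - 1))"
    have B: "real n \<le> B" "real n powr (p - 1) \<le> B" by (auto simp: B_def)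
    obtain u U where "weak0 p u U" "\<And>v V. weak0 p v V \<Longrightarrow> (LINT x|M. pflux p (U x) \<bullet> V x) = (LINT x|M. (W n x * h n (u x) + F n x) * v x)"
    proof (rule exists_bounded_data_solution[of p "h n" B "W n" "F n"])
      show "\<bar>h n t\<bar> \<le> B" for t by (rule order_trans[OF h(1) B(2)])
      show "W n x \<le> B" for x by (rule order_trans[OF W(2) B(1)])
      show "\<bar>F n x\<bar> \<le> B" for x by (rule order_trans[OF F(1) B(1)])
    qed (use p N hc hm W in auto)
    then have "P n u U" unfolding P_def by blast
    then show ?thesis by (intro exI)
  qed
  from choice[OF allI[OF ex]] obtain u where "\<forall>n. \<exists>U. P n (u n) U" by (rule exE)
  from choice[OF this] obtain U where PU: "\<forall>n. P n (u n) (U n)" by (rule exE)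
  have w: "\<And>n. weak0 p (u n) (U n)"
    and eq: "\<And>n v V. weak0 p v V \<Longrightarrow> (LINT x|M. pflux p (U n x) \<bullet> V x) = (LINT x|M. (W n x * h n (u n x) + F n x) * v x)"
    using PU unfolding P_def by blast+
  obtain C where C: "C \<ge> 0" and E: "\<And>u U W h F. weak0 p u U \<Longrightarrow>
      \<forall>v V. weak0 p v V \<longrightarrow> (LINT x|M. pflux p (U x) \<bullet> V x) = (LINT x|M. (W x * h (u x) + F x) * v x) \<Longrightarrow>
      W \<in> borel_measurable M \<Longrightarrow> h \<in> borel_measurable borel \<Longrightarrow> F \<in> borel_measurable M \<Longrightarrow>
      \<forall>x. 0 \<le> W x \<and> W x \<le> lam / norm x powr p \<Longrightarrow> \<forall>t. \<bar>h t\<bar> \<le> \<bar>t\<bar> powr (p - 1) \<Longrightarrow> \<forall>x. \<bar>F x\<bar> \<le> \<bar>f x\<bar> \<Longrightarrow>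
      powr_integral M p (\<lambda>x. (1 + (u x)\<^sup>2) powr ((s - 1) / (2 * p)) *\<^sub>R U x) \<le> ennreal C"
    by (rule energy_estimate[OF N p m s lam f]) (rule that)
  have E': "powr_integral M p (\<lambda>x. (1 + (u n x)\<^sup>2) powr ((s - 1) / (2 * p)) *\<^sub>R U n x) \<le> ennreal C" for n
  proof (rule E[where W="W n" and h="h n" and F="F n", OF w])
    show "\<forall>v V. weak0 p v V \<longrightarrow> (LINT x|M. pflux p (U n x) \<bullet> V x) = (LINT x|M. (W n x * h n (u n x) + F n x) * v x)"
      by (intro allI impI eq)
    show "\<forall>x. 0 \<le> W n x \<and> W n x \<le> lam / norm x powr p" "\<forall>t. \<bar>h n t\<bar> \<le> \<bar>t\<bar> powr (p - 1)" "\<forall>x. \<bar>F n x\<bar> \<le> \<bar>f x\<bar>"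
      by (intro allI conjI W h F)+
  qed measurable
  obtain D where D: "D \<ge> 0" and D': "\<And>u U. weak0 p u U \<Longrightarrow>
      powr_integral M p (\<lambda>x. (1 + (u x)\<^sup>2) powr ((s - 1) / (2 * p)) *\<^sub>R U x) \<le> ennreal C \<Longrightarrow>
      powr_integral M (N * (p - 1 + s) / (N - p)) u \<le> ennreal D \<and>
      (\<integral>\<^sup>+x. ennreal (\<bar>u x\<bar> powr (p - 1 + s) / norm x powr p) \<partial>M) \<le> ennreal D \<and>
      powr_integral M (N * (p - 1 + s) / (N - 1 + s)) U \<le> ennreal D"
    by (rule derived_estimates[OF N p s(2,3) C]) (rule that)
  have CD: "ennreal C \<le> ennreal (max C D)" "ennreal D \<le> ennreal (max C D)" by (intro ennreal_leI; simp)+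
  show ?thesis
  proof (rule that[of "max C D" u U])
    show "max C D \<ge> 0" using C by simp
    show "powr_integral M p (\<lambda>x. (1 + (u n x)\<^sup>2) powr ((s - 1) / (2 * p)) *\<^sub>R U n x) \<le> ennreal (max C D)" for n
      by (rule order_trans[OF E' CD(1)])
    show "powr_integral M (N * (p - 1 + s) / (N - p)) (u n) \<le> ennreal (max C D)"
      "(\<integral>\<^sup>+x. ennreal (\<bar>u n x\<bar> powr (p - 1 + s) / norm x powr p) \<partial>M) \<le> ennreal (max C D)"
      "powr_integral M (N * (p - 1 + s) / (N - 1 + s)) (U n) \<le> ennreal (max C D)" for n
      using D'[OF w E', of n] by (auto intro: order_trans[OF _ CD(2)])
  qed (fact w, (intro allI impI, fact eq[unfolded W_def h_def F_def]))
qed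

end

theorem theorem2:
  fixes \<Omega> :: "'a::euclidean_space set"
    and f :: "'a \<Rightarrow> real"
    and N p m q lam :: real
  assumes N: "N = real DIM('a)"
    and domain: "open \<Omega>" "connected \<Omega>" "\<Omega> \<noteq> {}" "bounded \<Omega>"
    and p: "2 \<le> p" "p < N"
    and m: "1 < m" "m < hoelder_conjugate (sobolev_conjugate N p)"
    and f: "f \<in> Lp_space m \<Omega>"
    and hardy: "0 < lam" "lam < ((N - p) / p) powr p"
    and lam: "lam < (m - 1) * N * (N - m * p) powr (p - 1) / ((p - 1) powr (p - 1) * m powr p)"
    and q: "q = p * m * N / (N * p - m * (N * (p - 2) + p))"
  shows "\<exists>u. u \<in> sobolev0_space q \<Omega> \<and> distributional_solution \<Omega> p lam f u"
proof -
  interpret bounded_open \<Omega> by unfold_locales (fact domain)+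
  define s where "s = (p - 1) * N * (m - 1) / (N - m * p)"
  define q0 where "q0 = N * (p - 1 + s) / (N - 1 + s)"
  define e where "e = N * (p - 1 + s) / (N - p)"
  note ids = exponent_identities[OF p m lam q s_def q0_def, folded e_def]
  have p': "p < real DIM('a)" "1 < p" using p N by auto
  have q1: "1 < q0" "p - 1 < p - 1 + s" using ids p by auto
  have [measurable]: "f \<in> borel_measurable M" and fm: "integrable M (\<lambda>x. \<bar>f x\<bar> powr m)"
    using f by (auto simp: Lp_space_def)
  have fi: "integrable M f"
  proof (rule integrable_of_powr_integral[OF finite_measure_axioms])
    show "powr_integral M m f < \<infinity>"
      using nn_integral_eq_integral[OF fm] by (simp add: powr_integral_def)
  qed (use m in auto)
  obtain u U C where C: "C \<ge> 0" and w: "\<And>n. weak0 p (u n) (U n)"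
    and eq: "\<And>n. \<forall>v V. weak0 p v V \<longrightarrow> (LINT x|M. pflux p (U n x) \<bullet> V x) =
      (LINT x|M. (min (lam / norm x powr p) (real n) * signed_power (p - 1) (trunc (real n) (u n x)) + trunc (real n) (f x)) * v x)"
    and E: "\<And>n. powr_integral M p (\<lambda>x. (1 + (u n x)\<^sup>2) powr ((s - 1) / (2 * p)) *\<^sub>R U n x) \<le> ennreal C"
    and ue: "\<And>n. powr_integral M e (u n) \<le> ennreal C"
    and pot: "\<And>n. (\<integral>\<^sup>+x. ennreal (\<bar>u n x\<bar> powr (p - 1 + s) / norm x powr p) \<partial>M) \<le> ennreal C"
    and Uq: "\<And>n. powr_integral M q0 (U n) \<le> ennreal C"
    by (rule truncated_problems[OF N p m(1) ids(1) s_def ids(2,3) hardy(1) ids(4) \<open>f \<in> borel_measurable M\<close> fm, folded e_def q0_def]) (rule that)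
  note [measurable] = weak0_measurable[OF w]
  define P where "P n x = min (lam / norm x powr p) (real n) * signed_power (p - 1) (trunc (real n) (u n x))" for n x
  have [measurable]: "P n \<in> borel_measurable M" for n unfolding P_def by measurable
  \<comment> \<open>Adding the measure of the domain allows every bound to be lowered to a smaller
    exponent with the same constant.\<close>
  define C' where "C' = measure M (space M) + C"
  have C': "C \<le> C'" "0 \<le> C'" using C measure_nonneg[of M "space M"] unfolding C'_def by linarith+
  have lower: "powr_integral M r g \<le> ennreal C'" if "g \<in> borel_measurable M" "0 < r" "r \<le> a" "powr_integral M a g \<le> ennreal C"
    for r a and g :: "'a \<Rightarrow> 'b::euclidean_space"
    unfolding C'_def by (rule powr_integral_lower_exponent_le[OF that C finite_measure_axioms])
  \<comment> \<open>A majorant of the right-hand sides whose integral is bounded uniformly in n. It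
    uses t^(p-1) <= 1 + t^(p-1+s) for t >= 0, so the potential term is controlled by the potential
    itself and by the weighted bound from Hardy's inequality.\<close>
  define Z where "Z n x = lam * (1 / norm x powr p + \<bar>u n x\<bar> powr (p - 1 + s) / norm x powr p) + \<bar>f x\<bar>" for n x
  have iV: "integrable M (\<lambda>x. 1 / norm x powr p)" by (rule hardy_potential_integrable[OF p'(2,1)])
  have iu: "integrable M (\<lambda>x. \<bar>u n x\<bar> powr (p - 1 + s) / norm x powr p)" for n
    by (rule integrableI_nonneg) (use pot[of n] in \<open>auto simp: le_less_trans\<close>)
  have Lu: "(LINT x|M. \<bar>u n x\<bar> powr (p - 1 + s) / norm x powr p) \<le> C" for n
    using pot[of n] nn_integral_eq_integral[OF iu[of n]] C by simp
  have iZ: "integrable M (Z n)" for n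
    unfolding Z_def by (intro Bochner_Integration.integrable_add integrable_mult_right integrable_abs iV iu fi)
  have PZ: "\<bar>P n x + trunc (real n) (f x)\<bar> \<le> Z n x" for n x
  proof -
    have "\<bar>P n x\<bar> \<le> lam / norm x powr p * (1 + \<bar>u n x\<bar> powr (p - 1 + s))"
      unfolding P_def abs_mult abs_signed_power
    proof (rule mult_mono)
      show "\<bar>min (lam / norm x powr p) (real n)\<bar> \<le> lam / norm x powr p" using hardy(1) by (simp add: abs_le_iff min_le_iff_disj)
      have "\<bar>trunc (real n) (u n x)\<bar> powr (p - 1) \<le> \<bar>u n x\<bar> powr (p - 1)"
        using p by (intro powr_mono2 abs_trunc_le) auto
      also have "\<dots> \<le> 1 + \<bar>u n x\<bar> powr (p - 1 + s)"
      proof (cases "\<bar>u n x\<bar> \<le> 1")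
        case True
        then have "\<bar>u n x\<bar> powr (p - 1) \<le> 1" using p by (intro powr_le1) auto
        then show ?thesis by (simp add: add_increasing2)
      next
        case False
        then have "\<bar>u n x\<bar> powr (p - 1) \<le> \<bar>u n x\<bar> powr (p - 1 + s)" using ids(2) by (intro powr_mono) auto
        then show ?thesis by simp
      qed
      finally show "\<bar>trunc (real n) (u n x)\<bar> powr (p - 1) \<le> 1 + \<bar>u n x\<bar> powr (p - 1 + s)" .
    qed (use hardy(1) in auto)
    moreover have "\<bar>trunc (real n) (f x)\<bar> \<le> \<bar>f x\<bar>" by (rule abs_trunc_le) simp
    moreover have "lam / norm x powr p * (1 + \<bar>u n x\<bar> powr (p - 1 + s)) = lam * (1 / norm x powr p + \<bar>u n x\<bar> powr (p - 1 + s) / norm x powr p)"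
      by (simp add: distrib_left)
    ultimately show ?thesis unfolding Z_def by linarith
  qed
  have ig: "integrable M (\<lambda>x. P n x + trunc (real n) (f x))" for n
    by (rule Bochner_Integration.integrable_bound[OF iZ[of n]]) (use PZ order_trans[OF PZ abs_ge_self] in auto)
  define G where "G = lam * ((LINT x|M. 1 / norm x powr p) + C) + (LINT x|M. \<bar>f x\<bar>)"
  have gG: "(LINT x|M. \<bar>P n x + trunc (real n) (f x)\<bar>) \<le> G" for n
  proof -
    have "(LINT x|M. \<bar>P n x + trunc (real n) (f x)\<bar>) \<le> (LINT x|M. Z n x)"
      by (intro integral_mono integrable_abs ig iZ PZ)
    also have "\<dots> = lam * ((LINT x|M. 1 / norm x powr p) + (LINT x|M. \<bar>u n x\<bar> powr (p - 1 + s) / norm x powr p)) + (LINT x|M. \<bar>f x\<bar>)"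
      unfolding Z_def using iV iu fi by (simp del: times_divide_eq_right)
    also have "\<dots> \<le> G" unfolding G_def using hardy(1) Lu[of n] by (intro add_right_mono mult_left_mono add_left_mono) auto
    finally show ?thesis .
  qed
  \<comment> \<open>The compactness lemma wants one exponent above 1 for functions and gradients
    alike; u is bounded in the exponent e >= q0.\<close>
  have uq0: "powr_integral M q0 (u n) \<le> ennreal C'" for n
    by (rule lower[OF weak0_measurable(1)[OF w] _ ids(9) ue]) (use q1 in simp)
  obtain \<rho> v V where \<rho>: "strict_mono (\<rho>::nat \<Rightarrow> nat)" and vV: "weak0 1 v V"
    and limu: "AE x in M. (\<lambda>n. u (\<rho> n) x) \<longlonglongrightarrow> v x" and limU: "AE x in M. (\<lambda>n. U (\<rho> n) x) \<longlonglongrightarrow> V x"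
    by (rule solutions_compact[where u=u and U=U and g="\<lambda>n x. P n x + trunc (real n) (f x)" and C=C', OF p(1) w eq[rule_format, folded P_def] ig gG q1(1) order_trans[OF Uq ennreal_leI[OF C'(1)]] uq0 C'(2)])
      (assumption | rule that)+
  note [measurable] = weak0_measurable[OF vV]
  \<comment> \<open>The limits inherit the bounds by Fatou's lemma, after the exponents e and q0
    have been lowered to q.\<close>
  have fin: "powr_integral M q v < \<infinity>" "powr_integral M q V < \<infinity>"
  proof -
    have "powr_integral M q v \<le> ennreal C'"
      by (rule powr_integral_Fatou[OF _ _ limu]) (use ids lower[OF weak0_measurable(1)[OF w] _ _ ue] in auto)
    then show "powr_integral M q v < \<infinity>" by (simp add: le_less_trans)
    have "powr_integral M q V \<le> ennreal C'"
      by (rule powr_integral_Fatou[OF _ _ limU]) (use ids lower[OF weak0_measurable(2)[OF w] _ _ Uq] in auto)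
    then show "powr_integral M q V < \<infinity>" by (simp add: le_less_trans)
  qed
  have b: "-1 \<le> (s - 1) / (2 * p)" using p ids(2) by (simp add: pos_le_divide_eq)
  have "weak0 q v V"
  proof (rule weak0_of_arctan_truncations[OF ids(5) weak0_measurable[OF vV] _ fin])
    fix k :: real assume k: "k \<ge> 1"
    show "weak0 q (\<lambda>x. k * arctan (v x / k)) (\<lambda>x. (1 / (1 + (v x / k)\<^sup>2)) *\<^sub>R V x)"
      by (rule arctan_truncation_limit[where u="\<lambda>n. u (\<rho> n)" and U="\<lambda>n. U (\<rho> n)", OF ids(6,5) b w E C weak0_measurable[OF vV] limu limU k])
  qed
  then have "v \<in> sobolev0_space q \<Omega>" by (rule weak0_sobolev0_space[OF _ ids(5)])
  moreover have "distributional_solution \<Omega> p lam f v"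
    unfolding distributional_solution_def
  proof (intro exI conjI ballI)
    \<comment> \<open>Along the subsequence the truncation heights still tend to infinity, because
      \<rho> is strictly increasing.\<close>
    have c: "filterlim (\<lambda>n. real (\<rho> n)) at_top sequentially"
      by (rule filterlim_compose[OF filterlim_real_sequentially filterlim_subseq[OF \<rho>]])
    have c0: "real (\<rho> n) \<ge> 0" for n by simp
    show "has_weak_gradient \<Omega> v V" by (rule weak0_has_weak_gradient[OF vV])
    \<comment> \<open>Integrability of the limits is read off from the limit lemmas with the test
      field taken to be 0.\<close>
    show "locally_integrable \<Omega> (\<lambda>x. norm (V x) powr (p - 1))"
      by (rule locally_integrableI[OF flux_limit(2)[where U="\<lambda>n. U (\<rho> n)" and \<Phi>="\<lambda>_. 0" and B=0, OF p(1) ids(8) weak0_measurable(2)[OF w] weak0_measurable(2)[OF vV] limU Uq]]) auto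
    show "locally_integrable \<Omega> (\<lambda>x. \<bar>v x\<bar> powr (p - 1) / norm x powr p)"
      by (rule locally_integrableI[OF potential_limit(2)[where u="\<lambda>n. u (\<rho> n)" and \<Phi>="\<lambda>_. 0" and B=0, OF p(1) p'(1) q1(2) hardy(1) weak0_measurable(1)[OF w] weak0_measurable(1)[OF vV] limu pot _ _ c c0]]) auto
    fix \<phi> assume \<phi>: "\<phi> \<in> test_functions \<Omega>"
    obtain B where B: "B > 0" "\<And>x. \<bar>\<phi> x\<bar> \<le> B" "\<And>x. norm (grad \<phi> x) \<le> B" by (rule test_functions_bounded[OF \<phi>]) (rule that)
    note [measurable] = test_measurable[OF \<phi>]
    have "(\<lambda>n. LINT x|M. pflux p (U (\<rho> n) x) \<bullet> grad \<phi> x) \<longlonglongrightarrow> (LINT x|M. pflux p (V x) \<bullet> grad \<phi> x)"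
      by (rule flux_limit(1)[where U="\<lambda>n. U (\<rho> n)", OF p(1) ids(8) weak0_measurable(2)[OF w] weak0_measurable(2)[OF vV] limU Uq test_measurable(2)[OF \<phi>] B(3)])
    moreover have "(LINT x|M. pflux p (U n x) \<bullet> grad \<phi> x) = (LINT x|M. P n x * \<phi> x) + (LINT x|M. trunc (real n) (f x) * \<phi> x)" for n
    proof -
      have "integrable M (\<lambda>x. (P n x + trunc (real n) (f x)) * \<phi> x)"
        by (rule integrable_mult_bounded[OF ig _ B(2)]) measurable
      \<comment> \<open>The truncated source times \<phi> is bounded, so it can be split off from
        the integrable sum and the two terms pass to the limit separately.\<close>
      moreover have "integrable M (\<lambda>x. trunc (real n) (f x) * \<phi> x)"
      proof (rule integrable_bounded_dom)
        show "norm (trunc (real n) (f x) * \<phi> x) \<le> real n * B" for x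
          unfolding real_norm_def abs_mult by (intro mult_mono abs_trunc_le B) auto
      qed measurable
      ultimately have "(LINT x|M. (P n x + trunc (real n) (f x)) * \<phi> x - trunc (real n) (f x) * \<phi> x) =
          (LINT x|M. (P n x + trunc (real n) (f x)) * \<phi> x) - (LINT x|M. trunc (real n) (f x) * \<phi> x)"
        by (rule Bochner_Integration.integral_diff)
      then show ?thesis using eq[rule_format, OF weak0_test[OF \<phi>], of n] by (simp add: P_def algebra_simps)
    qed
    moreover have "(\<lambda>n. (LINT x|M. P (\<rho> n) x * \<phi> x) + (LINT x|M. trunc (real (\<rho> n)) (f x) * \<phi> x)) \<longlonglongrightarrow>
        (LINT x|M. lam / norm x powr p * \<bar>v x\<bar> powr (p - 2) * v x * \<phi> x) + (LINT x|M. f x * \<phi> x)"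
      unfolding P_def
      by (intro tendsto_add potential_limit(1)[where u="\<lambda>n. u (\<rho> n)" and c="\<lambda>n. real (\<rho> n)", OF p(1) p'(1) q1(2) hardy(1) weak0_measurable(1)[OF w] weak0_measurable(1)[OF vV] limu pot test_measurable(1)[OF \<phi>] B(2) c c0]
          source_limit[OF fi test_measurable(1)[OF \<phi>] B(2) c c0])
    ultimately have "(LINT x|M. pflux p (V x) \<bullet> grad \<phi> x) =
        (LINT x|M. lam / norm x powr p * \<bar>v x\<bar> powr (p - 2) * v x * \<phi> x) + (LINT x|M. f x * \<phi> x)"
      using LIMSEQ_unique by simp
    then show "(LINT x|M. norm (V x) powr (p - 2) * inner (V x) (grad \<phi> x)) =
        (LINT x|M. lam / norm x powr p * \<bar>v x\<bar> powr (p - 2) * v x * \<phi> x) + (LINT x|M. f x * \<phi> x)"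
      by (simp add: pflux_def)
  qed
  ultimately show ?thesis by blast
qed

end
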